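(* Let $G$ be a countable discrete group, acting on its Stone-Čech compactification $\beta G$ by the extension of left multiplication. Then the following are equivalent: (1) The group $G$ is exact. (2) The Johnson class $[J]\in H^1_b(G,N_0(G,\beta G)^{**})$ is trivial. (3) $H^p_b(G,\mathcal{E}^* )=0$ for every $p\geq 1$ and every $\ell^1$-geometric $G$-$\ell^\infty(G)$-module $\mathcal{E}$.
   Context: Exactness of $G$ has its usual meaning (the reduced group $C^*$-algebra of $G$ is an exact $C^*$-algebra). Put $X=\beta G$. $C(X)$ is the Banach algebra of real-valued continuous functions on $X$ with the supremum norm, identified with real-valued $\ell^\infty(G)$; $1_X$ is the constant function $1$. $G$ acts on $C(X)$ by $(g\cdot t)(x)=t(g^{-1}x)$. All Banach spaces are real. For a function $f:G\to C(X)$ write $f_g\in C(X)$ for its value at $g\in G$, and set $\|f\|_{\infty,1}=\sup_{x\in X}\sum_{g\in G}|f_g(x)|$. $V$ denotes the Banach space of all $f:G\to C(X)$ with $\|f\|_{\infty,1}<\infty$. $G$ acts isometrically on $V$ by $(gf)_h(x)=f_{g^{-1}h}(g^{-1}x)$. $W_{00}(G,X)\subseteq V$ is the subspace of finitely supported $f:G\to C(X)$ such that $\sum_{g\in G}f_g=c\,1_X$ for some $c\in\mathbb{R}$ depending on $f$. $W_0(G,X)$ is its closure in $V$. The map $\pi:W_{00}(G,X)\to\mathbb{R}$ is defined by $\sum_{g\in G}f_g=\pi(f)1_X$ and is extended by continuity to $W_0(G,X)$. $N_0(G,X)=\ker(\pi:W_0(G,X)\to\mathbb{R})$, a $G$-invariant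 closed subspace. Modules: a $C(X)$-module is a Banach space $\mathcal{E}$ with a contractive unital representation of the Banach algebra $C(X)$ (so $\|tv\|\le\|t\|_\infty\|v\|$ and $1_Xv=v$). It is a $G$-$C(X)$-module (here also called a $G$-$\ell^\infty(G)$-module) if moreover $G$ acts on $\mathcal{E}$ by linear isometries and $g(tv)=(g\cdot t)(gv)$. Vectors $v_1,v_2\in\mathcal{E}$ are disjointly supported if there exist $f_1,f_2\in C(X)$ with disjoint (closed) supports such that $f_1v_1=v_1$ and $f_2v_2=v_2$. $\mathcal{E}$ is $\ell^1$-geometric if $\|v_1+v_2\|=\|v_1\|+\|v_2\|$ for all disjointly supported $v_1,v_2\in\mathcal{E}$. Bounded cohomology: if $G$ acts isometrically on a Banach space $\mathcal{E}$, it acts on the dual $\mathcal{E}^*$ by $\langle g\alpha,v\rangle=\langle\alpha,g^{-1}v\rangle$ (and likewise on the double dual). $C^m_b(G,\mathcal{E}^* )$ is the space of bounded $G$-equivariant functions $\phi:G^{m+1}\to\mathcal{E}^*$, i.e. $\phi(kg_0,\dots,kg_m)=k\,\phi(g_0,\dots,g_m)$, with differential $(d\phi)(g_0,\dots,g_{m+1})=\sum_{i=0}^{m+1}(-1)^i\phi(g_0,\dots,\widehat{g_i},\dots,g_{m+1})$. $H^*_b(G,\mathcal{E}^* )$ is the cohomology of this complex. Johnson class: for $g\in G$, $\delta_g\in W_{00}(G,X)$ is given by $(\delta_g)_h=1_X$ if $h=g$ and $0$ otherwise. The function $J(g_0,g_1)=\delta_{g_1}-\delta_{g_0}$ takes values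 in $N_0(G,X)\subseteq N_0(G,X)^{**}$ (canonical embedding); it is a bounded 1-cocycle, and its class in $H^1_b(G,N_0(G,X)^{**})$ (with coefficient module the dual of $N_0(G,X)^*$) is the Johnson class $[J]$. *)

theory Defs
  imports "HOL-Analysis.Analysis"
begin

section \<open>The Stone-Cech compactification and its continuous functions\<close>

text \<open>
  Groups are types of class \<^class>\<open>group_add\<close>: the (not necessarily commutative) group law is
  written additively, so that \<open>g\<inverse>h\<close> reads \<open>- g + h\<close>.
  For discrete \<open>G\<close>, the points of \<open>\<beta>G\<close> are the ultrafilters on \<open>G\<close>, and the sets of all
  ultrafilters containing a fixed set form a base of the topology.
\<close>

typedef 'g stone_cech =
  "{F :: 'g filter. F \<noteq> bot \<and> (\<forall>P. eventually P F \<or> eventually (\<lambda>x. \<not> P x) F)}"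
  morphisms ultrafilter Abs_stone_cech
proof
  show "principal {undefined} \<in> {F :: 'g filter. F \<noteq> bot \<and> (\<forall>P. eventually P F \<or> eventually (\<lambda>x. \<not> P x) F)}"
    by (auto simp: eventually_principal principal_eq_bot_iff)
qed

setup_lifting type_definition_stone_cech

instantiation stone_cech :: (type) topological_space
begin

definition open_stone_cech :: "'a stone_cech set \<Rightarrow> bool" where
  "open_stone_cech U \<longleftrightarrow> (\<forall>p\<in>U. \<exists>P. eventually P (ultrafilter p) \<and>
     {q. eventually P (ultrafilter q)} \<subseteq> U)"

instance
proof
  show "open (UNIV :: 'a stone_cech set)"
    by (auto simp: open_stone_cech_def intro: exI[of _ "\<lambda>_. True"])
next
  fix S T :: "'a stone_cech set" assume "open S" "open T"
  show "open (S \<inter> T)"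
    unfolding open_stone_cech_def
  proof
    fix p assume "p \<in> S \<inter> T"
    then obtain P Q where "eventually P (ultrafilter p)" "{q. eventually P (ultrafilter q)} \<subseteq> S"
      "eventually Q (ultrafilter p)" "{q. eventually Q (ultrafilter q)} \<subseteq> T"
      using \<open>open S\<close> \<open>open T\<close> unfolding open_stone_cech_def by blast
    then show "\<exists>P. eventually P (ultrafilter p) \<and> {q. eventually P (ultrafilter q)} \<subseteq> S \<inter> T"
      by (intro exI[of _ "\<lambda>x. P x \<and> Q x"]) (auto simp: eventually_conj_iff)
  qed
next
  fix K :: "'a stone_cech set set" assume "\<forall>S\<in>K. open S"
  then show "open (\<Union>K)" unfolding open_stone_cech_def by (meson Union_upper UnionE subset_trans)
qed

end

lemma open_stone_cech_basic: "open {q. eventually P (ultrafilter q)}"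
  unfolding open_stone_cech_def by blast

instance stone_cech :: (type) t2_space
proof
  fix p q :: "'a stone_cech" assume "p \<noteq> q"
  then have "ultrafilter p \<noteq> ultrafilter q" by (simp add: ultrafilter_inject)
  then obtain P where P: "eventually P (ultrafilter p) \<noteq> eventually P (ultrafilter q)"
    unfolding filter_eq_iff by blast
  have u: "eventually (\<lambda>x. \<not> P x) (ultrafilter r) \<longleftrightarrow> \<not> eventually P (ultrafilter r)" for P and r :: "'a stone_cech"
  proof -
    have nb: "ultrafilter r \<noteq> bot" and "eventually P (ultrafilter r) \<or> eventually (\<lambda>x. \<not> P x) (ultrafilter r)"
      using ultrafilter[of r] by auto
    moreover have False if "eventually P (ultrafilter r)" "eventually (\<lambda>x. \<not> P x) (ultrafilter r)"
      using eventually_conj[OF that] nb by (simp add: trivial_limit_def)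
    ultimately show ?thesis by blast
  qed
  have o: "open {r :: 'a stone_cech. \<not> eventually P (ultrafilter r)}"
    using open_stone_cech_basic[of "\<lambda>x. \<not> P x"] unfolding u .
  show "\<exists>U V. open U \<and> open V \<and> p \<in> U \<and> q \<in> V \<and> U \<inter> V = {}"
  proof (cases "eventually P (ultrafilter p)")
    case True
    show ?thesis
      by (rule exI[of _ "{r. eventually P (ultrafilter r)}"], rule exI[of _ "{r. eventually (\<lambda>x. \<not> P x) (ultrafilter r)}"])
         (use True P u[of P] o in \<open>simp add: open_stone_cech_basic disjoint_iff\<close>)
  next
    case False
    show ?thesis
      by (rule exI[of _ "{r. eventually (\<lambda>x. \<not> P x) (ultrafilter r)}"], rule exI[of _ "{r. eventually P (ultrafilter r)}"])
         (use False P u[of P] o in \<open>simp add: open_stone_cech_basic disjoint_iff\<close>)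
  qed
qed

lift_definition stone_cech_act :: "'g::group_add \<Rightarrow> 'g stone_cech \<Rightarrow> 'g stone_cech"
  is "\<lambda>g F. filtermap (\<lambda>h. g + h) F"
  by (auto simp: eventually_filtermap filtermap_bot_iff)

lemma continuous_stone_cech_act: "continuous_on UNIV (stone_cech_act g)"
proof -
  have "open (stone_cech_act g -` U)" if U: "open U" for U :: "'a stone_cech set"
    unfolding open_stone_cech_def
  proof
    fix p assume "p \<in> stone_cech_act g -` U"
    then obtain P where P: "eventually P (ultrafilter (stone_cech_act g p))"
      "{q. eventually P (ultrafilter q)} \<subseteq> U"
      using U unfolding open_stone_cech_def by blast
    then show "\<exists>P. eventually P (ultrafilter p) \<and> {q. eventually P (ultrafilter q)} \<subseteq> stone_cech_act g -` U"
      by (intro exI[of _ "\<lambda>h. P (g + h)"])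
        (auto simp: stone_cech_act.rep_eq eventually_filtermap dest!: subsetD)
  qed
  then show ?thesis by (auto simp: continuous_on_open_vimage)
qed

text \<open>\<open>\<beta>G\<close> is compact, so the bounded continuous functions below are all of \<open>C(\<beta>G)\<close>.\<close>

type_synonym 'g CX = "'g stone_cech \<Rightarrow>\<^sub>C real"

abbreviation one_CX :: "'g CX" where "one_CX \<equiv> const_bcontfun 1"

lemma CX_mult_bcontfun:
  fixes s t :: "'g stone_cech \<Rightarrow> real"
  assumes "s \<in> bcontfun" "t \<in> bcontfun"
  shows "(\<lambda>x. s x * t x) \<in> bcontfun"
proof -
  obtain A B where AB: "\<And>x. \<bar>s x\<bar> \<le> A" "\<And>x. \<bar>t x\<bar> \<le> B"
    using assms by (auto simp: bcontfun_def bounded_iff)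
  have "norm (s x * t x) \<le> A * B" for x
    using mult_mono[OF AB(1)[of x] AB(2)[of x]] order_trans[OF abs_ge_zero AB(1)[of x]]
    by (simp add: abs_mult)
  then show ?thesis
    using assms by (intro bcontfun_normI[of _ "A * B"]) (auto simp: bcontfun_def intro!: continuous_on_mult)
qed

lemma CX_act_bcontfun:
  fixes t :: "'g::group_add stone_cech \<Rightarrow> real"
  assumes "t \<in> bcontfun"
  shows "(\<lambda>x. t (stone_cech_act g x)) \<in> bcontfun"
proof -
  have "continuous_on UNIV (\<lambda>x. t (stone_cech_act g x))"
    by (rule continuous_on_compose2[OF _ continuous_stone_cech_act]) (use assms in \<open>auto simp: bcontfun_def\<close>)
  moreover have "bounded (range (\<lambda>x. t (stone_cech_act g x)))"
    by (rule bounded_subset[of "range t"]) (use assms in \<open>auto simp: bcontfun_def\<close>)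
  ultimately show ?thesis by (simp add: bcontfun_def)
qed

definition CX_mult :: "'g CX \<Rightarrow> 'g CX \<Rightarrow> 'g CX" where
  "CX_mult s t = Bcontfun (\<lambda>x. s x * t x)"

definition CX_act :: "'g::group_add \<Rightarrow> 'g CX \<Rightarrow> 'g CX" where
  "CX_act g t = Bcontfun (\<lambda>x. t (stone_cech_act (- g) x))"

lemma CX_mult_apply: "CX_mult s t x = s x * t x"
  unfolding CX_mult_def
  by (subst Bcontfun_inverse) (auto intro: CX_mult_bcontfun[OF apply_bcontfun apply_bcontfun])

lemma CX_act_apply: "CX_act g t x = t (stone_cech_act (- g) x)"
  unfolding CX_act_def
  by (subst Bcontfun_inverse) (auto intro: CX_act_bcontfun[OF apply_bcontfun])

section \<open>The spaces \<open>V\<close>, \<open>W\<^sub>0\<close> and \<open>N\<^sub>0\<close>\<close>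

typedef 'g V = "{f :: 'g \<Rightarrow> 'g CX. (\<forall>x. (\<lambda>g. \<bar>f g x\<bar>) summable_on UNIV) \<and>
    bdd_above (range (\<lambda>x. \<Sum>\<^sub>\<infinity>g. \<bar>f g x\<bar>))}"
  morphisms V_apply Abs_V
  by (rule exI[of _ "\<lambda>_. 0"]) auto

setup_lifting type_definition_V

lemma bdd_above_range_iff: "bdd_above (range (F :: 'x \<Rightarrow> real)) \<longleftrightarrow> (\<exists>A. \<forall>x. F x \<le> A)"
  by (auto simp: bdd_above_def)

lemma V_add: 
  fixes f g :: "'g \<Rightarrow> 'g CX"
  assumes "(\<forall>x. (\<lambda>h. \<bar>f h x\<bar>) summable_on UNIV) \<and> bdd_above (range (\<lambda>x. \<Sum>\<^sub>\<infinity>h. \<bar>f h x\<bar>))"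
    "(\<forall>x. (\<lambda>h. \<bar>g h x\<bar>) summable_on UNIV) \<and> bdd_above (range (\<lambda>x. \<Sum>\<^sub>\<infinity>h. \<bar>g h x\<bar>))"
  shows "(\<forall>x. (\<lambda>h. \<bar>(f h + g h) x\<bar>) summable_on UNIV) \<and>
     (\<forall>x. (\<Sum>\<^sub>\<infinity>h. \<bar>(f h + g h) x\<bar>) \<le> (\<Sum>\<^sub>\<infinity>h. \<bar>f h x\<bar>) + (\<Sum>\<^sub>\<infinity>h. \<bar>g h x\<bar>)) \<and>
     bdd_above (range (\<lambda>x. \<Sum>\<^sub>\<infinity>h. \<bar>(f h + g h) x\<bar>))"
proof -
  have s: "(\<lambda>h. \<bar>(f h + g h) x\<bar>) summable_on UNIV" for x
    by (rule summable_on_comparison_test[OF summable_on_add[of "\<lambda>h. \<bar>f h x\<bar>" UNIV "\<lambda>h. \<bar>g h x\<bar>"]])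
       (use assms in \<open>auto simp: abs_triangle_ineq\<close>)
  have le: "(\<Sum>\<^sub>\<infinity>h. \<bar>(f h + g h) x\<bar>) \<le> (\<Sum>\<^sub>\<infinity>h. \<bar>f h x\<bar>) + (\<Sum>\<^sub>\<infinity>h. \<bar>g h x\<bar>)" for x
  proof -
    have "(\<Sum>\<^sub>\<infinity>h. \<bar>(f h + g h) x\<bar>) \<le> (\<Sum>\<^sub>\<infinity>h. \<bar>f h x\<bar> + \<bar>g h x\<bar>)"
      by (rule infsum_mono) (use assms s in \<open>auto intro!: summable_on_add simp: abs_triangle_ineq\<close>)
    also have "\<dots> = (\<Sum>\<^sub>\<infinity>h. \<bar>f h x\<bar>) + (\<Sum>\<^sub>\<infinity>h. \<bar>g h x\<bar>)"
      by (rule infsum_add) (use assms in auto)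
    finally show ?thesis .
  qed
  obtain A where A: "\<forall>x. (\<Sum>\<^sub>\<infinity>h. \<bar>f h x\<bar>) \<le> A"
    using assms(1) unfolding bdd_above_range_iff by blast
  obtain B where B: "\<forall>x. (\<Sum>\<^sub>\<infinity>h. \<bar>g h x\<bar>) \<le> B"
    using assms(2) unfolding bdd_above_range_iff by blast
  have "bdd_above (range (\<lambda>x. \<Sum>\<^sub>\<infinity>h. \<bar>(f h + g h) x\<bar>))"
    using order_trans[OF le add_mono[OF A[rule_format] B[rule_format]]] unfolding bdd_above_range_iff by blast
  with s le show ?thesis by blast
qed

lemma V_add':
  fixes f g :: "'g \<Rightarrow> 'g CX"
  assumes "(\<forall>x. (\<lambda>h. \<bar>f h x\<bar>) summable_on UNIV) \<and> bdd_above (range (\<lambda>x. \<Sum>\<^sub>\<infinity>h. \<bar>f h x\<bar>))"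
    "(\<forall>x. (\<lambda>h. \<bar>g h x\<bar>) summable_on UNIV) \<and> bdd_above (range (\<lambda>x. \<Sum>\<^sub>\<infinity>h. \<bar>g h x\<bar>))"
  shows "(\<forall>x. (\<lambda>h. \<bar>(f h + g h) x\<bar>) summable_on UNIV) \<and>
     bdd_above (range (\<lambda>x. \<Sum>\<^sub>\<infinity>h. \<bar>(f h + g h) x\<bar>))"
  using V_add[OF assms] by argo

lemma V_scaleR: 
  fixes f :: "'g \<Rightarrow> 'g CX"
  assumes "(\<forall>x. (\<lambda>h. \<bar>f h x\<bar>) summable_on UNIV) \<and> bdd_above (range (\<lambda>x. \<Sum>\<^sub>\<infinity>h. \<bar>f h x\<bar>))"
  shows "(\<forall>x. (\<lambda>h. \<bar>(r *\<^sub>R f h) x\<bar>) summable_on UNIV) \<and>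
     bdd_above (range (\<lambda>x. \<Sum>\<^sub>\<infinity>h. \<bar>(r *\<^sub>R f h) x\<bar>))"
proof -
  obtain A where A: "\<forall>x. (\<Sum>\<^sub>\<infinity>h. \<bar>f h x\<bar>) \<le> A"
    using assms unfolding bdd_above_range_iff by blast
  have "(\<Sum>\<^sub>\<infinity>h. \<bar>(r *\<^sub>R f h) x\<bar>) \<le> \<bar>r\<bar> * A" for x
    using A assms by (simp add: abs_mult infsum_cmult_right mult_left_mono)
  then have "bdd_above (range (\<lambda>x. \<Sum>\<^sub>\<infinity>h. \<bar>(r *\<^sub>R f h) x\<bar>))"
    unfolding bdd_above_range_iff by blast
  moreover have "(\<lambda>h. \<bar>(r *\<^sub>R f h) x\<bar>) summable_on UNIV" for x
    using assms summable_on_cmult_right[of "\<lambda>h. \<bar>f h x\<bar>" UNIV "\<bar>r\<bar>"] by (simp add: abs_mult)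
  ultimately show ?thesis by blast
qed

instantiation V :: (type) real_vector
begin

lift_definition zero_V :: "'a V" is "\<lambda>_. 0" by simp
lift_definition plus_V :: "'a V \<Rightarrow> 'a V \<Rightarrow> 'a V" is "\<lambda>f g h. f h + g h"
  by (rule V_add')
lift_definition scaleR_V :: "real \<Rightarrow> 'a V \<Rightarrow> 'a V" is "\<lambda>r f h. r *\<^sub>R f h"
  by (rule V_scaleR)
lift_definition uminus_V :: "'a V \<Rightarrow> 'a V" is "\<lambda>f h. - f h"
  by simp
definition minus_V :: "'a V \<Rightarrow> 'a V \<Rightarrow> 'a V" where "minus_V f g = f + - g"
lemma V_eqI: "(\<And>h. V_apply f h = V_apply g h) \<Longrightarrow> f = g"
  by (simp add: V_apply_inject[symmetric] fun_eq_iff)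

instance
proof
  fix f g k :: "'a V" and r s :: real
  show "f + g + k = f + (g + k)" by (rule V_eqI) (simp add: zero_V.rep_eq plus_V.rep_eq scaleR_V.rep_eq uminus_V.rep_eq algebra_simps)
  show "f + g = g + f" by (rule V_eqI) (simp add: zero_V.rep_eq plus_V.rep_eq scaleR_V.rep_eq uminus_V.rep_eq algebra_simps)
  show "0 + f = f" by (rule V_eqI) (simp add: zero_V.rep_eq plus_V.rep_eq scaleR_V.rep_eq uminus_V.rep_eq algebra_simps)
  show "- f + f = 0" by (rule V_eqI) (simp add: zero_V.rep_eq plus_V.rep_eq scaleR_V.rep_eq uminus_V.rep_eq algebra_simps)
  show "f - g = f + - g" by (rule minus_V_def)
  show "r *\<^sub>R (f + g) = r *\<^sub>R f + r *\<^sub>R g" by (rule V_eqI) (simp add: zero_V.rep_eq plus_V.rep_eq scaleR_V.rep_eq uminus_V.rep_eq algebra_simps)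
  show "(r + s) *\<^sub>R f = r *\<^sub>R f + s *\<^sub>R f" by (rule V_eqI) (simp add: zero_V.rep_eq plus_V.rep_eq scaleR_V.rep_eq uminus_V.rep_eq algebra_simps)
  show "r *\<^sub>R s *\<^sub>R f = (r * s) *\<^sub>R f" by (rule V_eqI) (simp add: zero_V.rep_eq plus_V.rep_eq scaleR_V.rep_eq uminus_V.rep_eq algebra_simps)
  show "1 *\<^sub>R f = f" by (rule V_eqI) (simp add: zero_V.rep_eq plus_V.rep_eq scaleR_V.rep_eq uminus_V.rep_eq algebra_simps)
qed

end

instantiation V :: (type) real_normed_vector
begin

definition norm_V :: "'a V \<Rightarrow> real" where "norm_V f = (SUP x. \<Sum>\<^sub>\<infinity>h. \<bar>V_apply f h x\<bar>)"
definition sgn_V :: "'a V \<Rightarrow> 'a V" where "sgn_V f = f /\<^sub>R norm f"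
definition dist_V :: "'a V \<Rightarrow> 'a V \<Rightarrow> real" where "dist_V f g = norm (f - g)"
definition uniformity_V :: "('a V \<times> 'a V) filter"
  where "uniformity_V = (INF e\<in>{0 <..}. principal {(x, y). dist x y < e})"
definition open_V :: "'a V set \<Rightarrow> bool"
  where "open_V U = (\<forall>x\<in>U. \<forall>\<^sub>F (x', y) in uniformity. x' = x \<longrightarrow> y \<in> U)"

lemmas V_D = V_apply[unfolded mem_Collect_eq]

lemma V_mass_le_norm: "(\<Sum>\<^sub>\<infinity>h. \<bar>V_apply f h x\<bar>) \<le> norm f"
  unfolding norm_V_def by (rule cSUP_upper[OF UNIV_I V_D[THEN conjunct2]])

lemma V_norm_le: "(\<And>x. (\<Sum>\<^sub>\<infinity>h. \<bar>V_apply f h x\<bar>) \<le> b) \<Longrightarrow> norm f \<le> b"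
  unfolding norm_V_def by (rule cSUP_least[OF UNIV_not_empty])

lemma V_summable: "(\<lambda>h. \<bar>V_apply f h x\<bar>) summable_on UNIV"
  using V_D[of f] by blast

lemma V_apply_le_norm: "\<bar>V_apply f h x\<bar> \<le> norm (f :: 'a V)"
proof -
  have "(\<Sum>h\<in>{h}. \<bar>V_apply f h x\<bar>) \<le> (\<Sum>\<^sub>\<infinity>h. \<bar>V_apply f h x\<bar>)"
    by (rule finite_sum_le_infsum[OF V_summable]) simp_all
  then show ?thesis using V_mass_le_norm[of f x] by simp
qed

instance
proof
  fix f g k :: "'a V" and r s :: real
  show "dist f g = norm (f - g)" "sgn f = f /\<^sub>R norm f"
    "uniformity = (INF e\<in>{0 <..}. principal {(x, y :: 'a V). dist x y < e})"
    by (simp_all add: dist_V_def sgn_V_def uniformity_V_def)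
  show "open U \<longleftrightarrow> (\<forall>x\<in>U. \<forall>\<^sub>F (x', y) in uniformity. x' = x \<longrightarrow> y \<in> U)" for U :: "'a V set"
    by (simp add: open_V_def)
  show "norm f = 0 \<longleftrightarrow> f = 0"
  proof
    assume "norm f = 0"
    then have "V_apply f h x = 0" for h x using V_apply_le_norm[of f h x] by simp
    then have "V_apply f = V_apply 0" by (intro ext bcontfun_eqI) (simp add: zero_V.rep_eq)
    then show "f = 0" by (simp only: V_apply_inject)
  qed (simp add: norm_V_def zero_V.rep_eq)
  show "norm (f + g) \<le> norm f + norm g"
  proof (rule V_norm_le)
    fix x
    have "(\<Sum>\<^sub>\<infinity>h. \<bar>V_apply (f + g) h x\<bar>) \<le> (\<Sum>\<^sub>\<infinity>h. \<bar>V_apply f h x\<bar>) + (\<Sum>\<^sub>\<infinity>h. \<bar>V_apply g h x\<bar>)"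
      unfolding plus_V.rep_eq using V_add[OF V_D[of f] V_D[of g]] by blast
    also have "\<dots> \<le> norm f + norm g" by (intro add_mono V_mass_le_norm)
    finally show "(\<Sum>\<^sub>\<infinity>h. \<bar>V_apply (f + g) h x\<bar>) \<le> norm f + norm g" .
  qed
  have sc: "norm (r *\<^sub>R f) \<le> \<bar>r\<bar> * norm f" for r and f :: "'a V"
    by (rule V_norm_le)
       (simp add: scaleR_V.rep_eq abs_mult infsum_cmult_right V_summable mult_left_mono V_mass_le_norm)
  show "norm (r *\<^sub>R f) = \<bar>r\<bar> * norm f"
  proof (cases "r = 0")
    case True
    with True show ?thesis by (simp add: norm_V_def zero_V.rep_eq)
  next
    case False
    have "inverse r *\<^sub>R r *\<^sub>R f = f" using False by transfer simp
    then have "norm f \<le> \<bar>inverse r\<bar> * norm (r *\<^sub>R f)" using sc[of "inverse r" "r *\<^sub>R f"] by simp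
    then have "\<bar>r\<bar> * norm f \<le> norm (r *\<^sub>R f)" using False by (simp add: field_simps)
    with sc[of r f] show ?thesis by simp
  qed
qed

end

lemma stone_cech_act_add: "stone_cech_act (g + h) p = stone_cech_act g (stone_cech_act h p)"
  by transfer (simp add: filtermap_filtermap add.assoc, intro arg_cong2[where f = filtermap] refl ext, simp add: add.assoc)

lemma stone_cech_act_zero: "stone_cech_act 0 p = p"
  by transfer (simp add: filter_eq_iff eventually_filtermap)

lift_definition V_act :: "'g::group_add \<Rightarrow> 'g V \<Rightarrow> 'g V" is "\<lambda>g f h. CX_act g (f (- g + h))"
proof -
  fix g :: 'g and f :: "'g \<Rightarrow> 'g CX"
  assume f: "(\<forall>x. (\<lambda>g. \<bar>f g x\<bar>) summable_on UNIV) \<and> bdd_above (range (\<lambda>x. \<Sum>\<^sub>\<infinity>g. \<bar>f g x\<bar>))"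
  have bij: "bij ((+) (- g))" 
    by (rule bij_plus)
  have 1: "(\<lambda>h. \<bar>CX_act g (f (- g + h)) x\<bar>) summable_on UNIV" for x
    using summable_on_reindex_bij_betw[OF bij, of "\<lambda>h. \<bar>f h (stone_cech_act (- g) x)\<bar>"] f
    by (simp add: CX_act_apply)
  have 2: "(\<Sum>\<^sub>\<infinity>h. \<bar>CX_act g (f (- g + h)) x\<bar>) = (\<Sum>\<^sub>\<infinity>h. \<bar>f h (stone_cech_act (- g) x)\<bar>)" for x
    using infsum_reindex_bij_betw[OF bij, of "\<lambda>h. \<bar>f h (stone_cech_act (- g) x)\<bar>"]
    by (simp add: CX_act_apply)
  show "(\<forall>x. (\<lambda>h. \<bar>CX_act g (f (- g + h)) x\<bar>) summable_on UNIV) \<and>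
    bdd_above (range (\<lambda>x. \<Sum>\<^sub>\<infinity>h. \<bar>CX_act g (f (- g + h)) x\<bar>))"
    using f 1 unfolding 2 bdd_above_range_iff by blast
qed

definition W00 :: "'g V set" where
  "W00 = {f. finite {g. V_apply f g \<noteq> 0} \<and>
     (\<exists>c. (\<Sum>g | V_apply f g \<noteq> 0. V_apply f g) = c *\<^sub>R one_CX)}"

definition W0 :: "'g V set" where "W0 = closure W00"

definition pi00 :: "'g V \<Rightarrow> real" where
  "pi00 f = (THE c. (\<Sum>g | V_apply f g \<noteq> 0. V_apply f g) = c *\<^sub>R one_CX)"

text \<open>The extension of \<open>pi00\<close> by continuity (see \<open>pi0_tendsto\<close> below): the limit of \<open>pi00 w\<close>
  as \<open>w\<close> tends to \<open>f\<close> inside \<open>W00\<close>.\<close>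

definition pi0 :: "'g V \<Rightarrow> real" where
  "pi0 f = Lim (inf (nhds f) (principal W00)) pi00"

lemma scaleR_one_CX_inject: "c *\<^sub>R one_CX = d *\<^sub>R (one_CX :: 'a CX) \<longleftrightarrow> c = d"
proof
  assume "c *\<^sub>R one_CX = d *\<^sub>R (one_CX :: 'a CX)"
  from arg_cong[OF this, of "\<lambda>f. apply_bcontfun f undefined"]
  have "c * apply_bcontfun (one_CX :: 'a CX) undefined = d * apply_bcontfun (one_CX :: 'a CX) undefined"
    by (simp only: scaleR_bcontfun.rep_eq real_scaleR_def)
  then show "c = d" by simp
qed simp

lemma W00_sum:
  assumes "f \<in> W00"
  shows "(\<Sum>g | V_apply f g \<noteq> 0. V_apply f g) = pi00 f *\<^sub>R one_CX"
proof -
  obtain c where c: "(\<Sum>g | V_apply f g \<noteq> 0. V_apply f g) = c *\<^sub>R one_CX"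
    using assms by (auto simp: W00_def)
  then have "pi00 f = c"
    unfolding pi00_def c scaleR_one_CX_inject by simp
  with c show ?thesis by (simp only:)
qed

lemma W00_iff:
  assumes "finite A" "\<And>g. g \<notin> A \<Longrightarrow> V_apply f g = 0" "(\<Sum>g\<in>A. V_apply f g) = c *\<^sub>R one_CX"
  shows "f \<in> W00 \<and> pi00 f = c"
proof -
  have fin: "finite {g. V_apply f g \<noteq> 0}" using assms by (auto intro: finite_subset[OF _ assms(1)])
  have eq: "(\<Sum>g | V_apply f g \<noteq> 0. V_apply f g) = c *\<^sub>R one_CX"
    unfolding assms(3)[symmetric] by (rule sum.mono_neutral_left) (use assms in auto)
  have W: "f \<in> W00" using fin eq by (auto simp: W00_def)
  have "pi00 f *\<^sub>R one_CX = c *\<^sub>R (one_CX :: 'a CX)" using W00_sum[OF W] eq by (simp only:)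
  with W show ?thesis by (simp only: scaleR_one_CX_inject)
qed

lemma sum_bcontfun_apply: "(\<Sum>i\<in>A. f i) x = (\<Sum>i\<in>A. apply_bcontfun (f i) x)"
  for f :: "'i \<Rightarrow> 'a::topological_space \<Rightarrow>\<^sub>C real"
  by (induction A rule: infinite_finite_induct) auto

lemma W00_supp:
  assumes "f \<in> W00" "finite A" "{g. V_apply f g \<noteq> 0} \<subseteq> A"
  shows "(\<Sum>g\<in>A. V_apply f g) = pi00 f *\<^sub>R one_CX"
proof -
  have "(\<Sum>g | V_apply f g \<noteq> 0. V_apply f g) = (\<Sum>g\<in>A. V_apply f g)"
    by (rule sum.mono_neutral_left) (use assms in auto)
  then show ?thesis using W00_sum[OF assms(1)] by (simp only:)
qed

lemma W00_add: 
  assumes "f \<in> W00" "g \<in> W00"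
  shows "f + g \<in> W00 \<and> pi00 (f + g) = pi00 f + pi00 g"
proof (rule W00_iff)
  let ?A = "{h. V_apply f h \<noteq> 0} \<union> {h. V_apply g h \<noteq> 0}"
  show fin: "finite ?A" using assms by (auto simp: W00_def)
  show "(\<Sum>h\<in>?A. V_apply (f + g) h) = (pi00 f + pi00 g) *\<^sub>R one_CX"
    unfolding plus_V.rep_eq sum.distrib scaleR_add_left
    using W00_supp[OF assms(1) fin] W00_supp[OF assms(2) fin] by (simp only: Un_upper1 Un_upper2)
qed (auto simp: plus_V.rep_eq)

lemma W00_scaleR: 
  assumes "f \<in> W00"
  shows "r *\<^sub>R f \<in> W00 \<and> pi00 (r *\<^sub>R f) = r * pi00 f"
proof (rule W00_iff)
  let ?A = "{h. V_apply f h \<noteq> 0}"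
  show fin: "finite ?A" using assms by (auto simp: W00_def)
  show "(\<Sum>h\<in>?A. V_apply (r *\<^sub>R f) h) = (r * pi00 f) *\<^sub>R one_CX"
    unfolding scaleR_V.rep_eq scaleR_sum_right[symmetric]
    unfolding W00_sum[OF assms(1)] by (rule scaleR_scaleR)
qed (auto simp: scaleR_V.rep_eq)

lemma W00_zero: "(0 :: 'g V) \<in> W00 \<and> pi00 (0 :: 'g V) = 0"
  by (rule W00_iff[of "{}"]) (auto simp: zero_V.rep_eq)

lemma pi00_le_norm: 
  assumes "f \<in> W00" shows "\<bar>pi00 f\<bar> \<le> norm f"
proof -
  let ?A = "{h. V_apply f h \<noteq> 0}" and ?x = "undefined"
  have fin: "finite ?A" using assms by (auto simp: W00_def)
  have "\<bar>pi00 f\<bar> = \<bar>\<Sum>h\<in>?A. V_apply f h ?x\<bar>"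
    unfolding sum_bcontfun_apply[symmetric] W00_sum[OF assms] by simp
  also have "\<dots> \<le> (\<Sum>h\<in>?A. \<bar>V_apply f h ?x\<bar>)" by (rule sum_abs)
  also have "\<dots> \<le> (\<Sum>\<^sub>\<infinity>h. \<bar>V_apply f h ?x\<bar>)"
    by (rule finite_sum_le_infsum) (use fin V_summable in simp_all)
  also have "\<dots> \<le> norm f" by (rule V_mass_le_norm)
  finally show ?thesis .
qed

lemma W00_diff: 
  assumes "f \<in> W00" "g \<in> W00"
  shows "f - g \<in> W00 \<and> pi00 (f - g) = pi00 f - pi00 g"
proof -
  have eq: "f - g = f + (-1) *\<^sub>R g" by simp
  have g: "(-1) *\<^sub>R g \<in> W00" "pi00 ((-1) *\<^sub>R g) = - 1 * pi00 g"
    using W00_scaleR[OF assms(2)] by blast+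
  show ?thesis unfolding eq using W00_add[OF assms(1) g(1)] unfolding g(2) by simp
qed

lemma pi00_dist:
  assumes "f \<in> W00" "g \<in> W00" shows "\<bar>pi00 f - pi00 g\<bar> \<le> norm (f - g)"
  using W00_diff[OF assms] pi00_le_norm[of "f - g"] by simp

lemma pi0_tendsto:
  assumes "f \<in> W0"
  shows "(pi00 \<longlongrightarrow> pi0 f) (inf (nhds f) (principal W00))"
proof -
  have "uniformly_continuous_on W00 (pi00 :: 'a V \<Rightarrow> real)"
    unfolding uniformly_continuous_on_def dist_norm real_norm_def
    using le_less_trans[OF pi00_dist] by blast
  then obtain h where h: "uniformly_continuous_on (closure W00) h" "\<And>x :: 'a V. x \<in> W00 \<Longrightarrow> pi00 x = h x"
    by (rule uniformly_continuous_on_extension_on_closure) blast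
  have cont: "continuous_on W0 h"
    using uniformly_continuous_imp_continuous[OF h(1)] by (simp add: W0_def)
  have sub: "W00 \<subseteq> (W0 :: 'a V set)" by (simp add: W0_def closure_subset)
  have lim: "(pi00 \<longlongrightarrow> h f) (inf (nhds f) (principal W00))"
    unfolding tendsto_iff eventually_inf_principal eventually_nhds_metric
  proof (intro allI impI)
    fix e :: real assume "e > 0"
    then obtain d where d: "d > 0" "\<forall>x'\<in>W0. dist x' f < d \<longrightarrow> dist (h x') (h f) < e"
      using cont assms unfolding continuous_on_iff by blast
    show "\<exists>d>0. \<forall>x. dist x f < d \<longrightarrow> x \<in> W00 \<longrightarrow> dist (pi00 x) (h f) < e"
      using d sub h(2) by (intro exI[of _ d]) (auto simp: subset_iff)
  qed
  have "inf (nhds f) (principal W00) \<noteq> bot"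
  proof
    assume "inf (nhds f) (principal W00) = bot"
    then have "eventually (\<lambda>_. False) (inf (nhds f) (principal W00))" by simp
    then obtain d where "d > 0" "\<forall>x. dist x f < d \<longrightarrow> x \<notin> W00"
      unfolding eventually_inf_principal eventually_nhds_metric by auto
    moreover obtain x where "x \<in> W00" "dist x f < d"
      using assms \<open>d > 0\<close> unfolding W0_def closure_approachable by blast
    ultimately show False by blast
  qed
  from tendsto_Lim[OF this lim] lim show ?thesis unfolding pi0_def by simp
qed

lemma pi0_seq:
  assumes "\<And>n. w n \<in> W00" "w \<longlonglongrightarrow> f"
  shows "(\<lambda>n. pi00 (w n)) \<longlonglongrightarrow> pi0 f" "f \<in> W0"
proof -
  show "f \<in> W0" using assms unfolding W0_def closure_sequential by blast
  then have "(pi00 \<longlongrightarrow> pi0 f) (inf (nhds f) (principal W00))" by (rule pi0_tendsto)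
  moreover have "filterlim w (inf (nhds f) (principal W00)) sequentially"
    using assms by (simp add: filterlim_inf filterlim_principal)
  ultimately show "(\<lambda>n. pi00 (w n)) \<longlonglongrightarrow> pi0 f" by (rule filterlim_compose)
qed

lemma pi0_eqI:
  assumes "\<And>n. w n \<in> W00" "w \<longlonglongrightarrow> f" "(\<lambda>n. pi00 (w n)) \<longlonglongrightarrow> c"
  shows "f \<in> W0 \<and> pi0 f = c"
  using pi0_seq[OF assms(1,2)] assms(3) LIMSEQ_unique by blast

lemma W0_seq: "f \<in> W0 \<Longrightarrow> \<exists>w. (\<forall>n. w n \<in> W00) \<and> w \<longlonglongrightarrow> f"
  by (simp add: W0_def closure_sequential)

lemma pi0_W00: "f \<in> W00 \<Longrightarrow> f \<in> W0 \<and> pi0 f = pi00 f"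
  by (rule pi0_eqI[of "\<lambda>_. f"]) auto

lemma W0_add: 
  assumes "f \<in> W0" "g \<in> W0"
  shows "f + g \<in> W0 \<and> pi0 (f + g) = pi0 f + pi0 g"
proof -
  obtain v w where vw: "\<forall>n. v n \<in> W00" "v \<longlonglongrightarrow> f" "\<forall>n. w n \<in> W00" "w \<longlonglongrightarrow> g"
    using assms[THEN W0_seq] by blast
  show ?thesis
    by (rule pi0_eqI[of "\<lambda>n. v n + w n"])
       (use vw W00_add[of "v _" "w _"] pi0_seq(1)[of v f] pi0_seq(1)[of w g] in \<open>simp_all add: tendsto_add\<close>)
qed

lemma W0_scaleR: 
  assumes "f \<in> W0"
  shows "r *\<^sub>R f \<in> W0 \<and> pi0 (r *\<^sub>R f) = r * pi0 f"
proof -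
  obtain v where vw: "\<forall>n. v n \<in> W00" "v \<longlonglongrightarrow> f"
    using assms[THEN W0_seq] by blast
  show ?thesis
    by (rule pi0_eqI[of "\<lambda>n. r *\<^sub>R v n"])
       (use vw W00_scaleR[of "v _" r] pi0_seq(1)[of v f] in \<open>simp_all add: tendsto_intros\<close>)
qed

lemma W0_diff:
  assumes "f \<in> W0" "g \<in> W0"
  shows "f - g \<in> W0 \<and> pi0 (f - g) = pi0 f - pi0 g"
proof -
  have eq: "f - g = f + (-1) *\<^sub>R g" by simp
  have g: "(-1) *\<^sub>R g \<in> W0" "pi0 ((-1) *\<^sub>R g) = - 1 * pi0 g"
    using W0_scaleR[OF assms(2)] by blast+
  show ?thesis unfolding eq using W0_add[OF assms(1) g(1)] unfolding g(2) by simp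
qed

lemma W0_zero: "(0 :: 'g V) \<in> W0 \<and> pi0 (0 :: 'g V) = 0"
  using pi0_W00[of "0 :: 'g V"] W00_zero[where 'g = 'g] by simp

typedef 'g N0 = "{f :: 'g V. f \<in> W0 \<and> pi0 f = 0}"
  morphisms N0_V Abs_N0
proof
  show "0 \<in> {f :: 'g V. f \<in> W0 \<and> pi0 f = 0}"
    using W0_zero by simp
qed

setup_lifting type_definition_N0

instantiation N0 :: (type) real_vector
begin

lift_definition zero_N0 :: "'a N0" is 0 by (rule W0_zero)
lift_definition plus_N0 :: "'a N0 \<Rightarrow> 'a N0 \<Rightarrow> 'a N0" is "(+)" by (simp add: W0_add)
lift_definition scaleR_N0 :: "real \<Rightarrow> 'a N0 \<Rightarrow> 'a N0" is "(*\<^sub>R)" by (simp add: W0_scaleR)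
lift_definition uminus_N0 :: "'a N0 \<Rightarrow> 'a N0" is "uminus" using W0_scaleR[of _ "-1"] by fastforce
lift_definition minus_N0 :: "'a N0 \<Rightarrow> 'a N0 \<Rightarrow> 'a N0" is "(-)"
  by (simp add: W0_diff)
instance
proof
  fix f g k :: "'a N0" and r s :: real
  show "f + g + k = f + (g + k)" by transfer (simp add: algebra_simps)
  show "f + g = g + f" by transfer (simp add: algebra_simps)
  show "0 + f = f" by transfer (simp add: algebra_simps)
  show "- f + f = 0" by transfer (simp add: algebra_simps)
  show "f - g = f + - g" by transfer (simp add: algebra_simps)
  show "r *\<^sub>R (f + g) = r *\<^sub>R f + r *\<^sub>R g" by transfer (simp add: algebra_simps)
  show "(r + s) *\<^sub>R f = r *\<^sub>R f + s *\<^sub>R f" by transfer (simp add: algebra_simps)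
  show "r *\<^sub>R s *\<^sub>R f = (r * s) *\<^sub>R f" by transfer (simp add: algebra_simps)
  show "1 *\<^sub>R f = f" by transfer (simp add: algebra_simps)
qed

end

instantiation N0 :: (type) real_normed_vector
begin

lift_definition norm_N0 :: "'a N0 \<Rightarrow> real" is norm .
lift_definition dist_N0 :: "'a N0 \<Rightarrow> 'a N0 \<Rightarrow> real" is dist .
definition sgn_N0 :: "'a N0 \<Rightarrow> 'a N0" where "sgn_N0 f = f /\<^sub>R norm f"
definition uniformity_N0 :: "('a N0 \<times> 'a N0) filter"
  where "uniformity_N0 = (INF e\<in>{0 <..}. principal {(x, y). dist x y < e})"
definition open_N0 :: "'a N0 set \<Rightarrow> bool"
  where "open_N0 U = (\<forall>x\<in>U. \<forall>\<^sub>F (x', y) in uniformity. x' = x \<longrightarrow> y \<in> U)"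

instance
proof
  fix f g k :: "'a N0" and r s :: real
  show "dist f g = norm (f - g)" by transfer (simp add: dist_norm)
  show "sgn f = f /\<^sub>R norm f"
    "uniformity = (INF e\<in>{0 <..}. principal {(x, y :: 'a N0). dist x y < e})"
    by (simp_all add: sgn_N0_def uniformity_N0_def)
  show "open U \<longleftrightarrow> (\<forall>x\<in>U. \<forall>\<^sub>F (x', y) in uniformity. x' = x \<longrightarrow> y \<in> U)" for U :: "'a N0 set"
    by (simp add: open_N0_def)
  show "norm f = 0 \<longleftrightarrow> f = 0" by transfer simp
  show "norm (f + g) \<le> norm f + norm g" by transfer (rule norm_triangle_ineq)
  show "norm (r *\<^sub>R f) = \<bar>r\<bar> * norm f" by transfer simp
qed

end

lemma V_apply_act: "V_apply (V_act g f) h = CX_act g (V_apply f (- g + h))"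
  by (simp add: V_act.rep_eq)

lemma norm_V_act: "norm (V_act g f) \<le> norm f"
proof (rule V_norm_le)
  fix x
  have "(\<Sum>\<^sub>\<infinity>h. \<bar>V_apply (V_act g f) h x\<bar>) = (\<Sum>\<^sub>\<infinity>h. \<bar>V_apply f h (stone_cech_act (- g) x)\<bar>)"
    using infsum_reindex_bij_betw[OF bij_plus[of "- g"], of "\<lambda>h. \<bar>V_apply f h (stone_cech_act (- g) x)\<bar>"]
    by (simp add: CX_act_apply V_apply_act)
  then show "(\<Sum>\<^sub>\<infinity>h. \<bar>V_apply (V_act g f) h x\<bar>) \<le> norm f" using V_mass_le_norm[of f] by metis
qed

lemma CX_act_linear: "linear (CX_act g)"
  by (rule linearI) (auto intro!: bcontfun_eqI simp: CX_act_apply)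

lemma V_act_linear: "linear (V_act g)"
  by (rule linearI) (auto simp: V_apply_inject[symmetric] fun_eq_iff V_apply_act plus_V.rep_eq scaleR_V.rep_eq
    linear_add[OF CX_act_linear] linear_scale[OF CX_act_linear])

lemma V_act_add: "V_act (g + h) f = V_act g (V_act h f)"
  by (auto simp: V_apply_inject[symmetric] fun_eq_iff V_apply_act CX_act_apply minus_add stone_cech_act_add add.assoc
    simp del: add_uminus_conv_diff intro!: bcontfun_eqI)

lemma V_act_zero: "V_act 0 f = f"
  by (auto simp: V_apply_inject[symmetric] fun_eq_iff V_apply_act CX_act_apply stone_cech_act_zero
    intro!: bcontfun_eqI)

lemma V_act_norm: "norm (V_act g f) = norm f"
  using norm_V_act[of g f] norm_V_act[of "- g" "V_act g f"] by (simp flip: V_act_add add: V_act_zero)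

lemma W00_act: 
  assumes "f \<in> W00"
  shows "V_act g f \<in> W00 \<and> pi00 (V_act g f) = pi00 f"
proof (rule W00_iff)
  let ?A = "{h. V_apply f h \<noteq> 0}"
  show "finite ((+) g ` ?A)" using assms by (auto simp: W00_def)
  show "V_apply (V_act g f) h = 0" if "h \<notin> (+) g ` ?A" for h
  proof -
    have "V_apply f (- g + h) = 0"
      using that by (metis (mono_tags, lifting) add_minus_cancel image_eqI mem_Collect_eq)
    then show ?thesis by (simp add: V_apply_act linear_0[OF CX_act_linear])
  qed
  have "(\<Sum>h\<in>(+) g ` ?A. V_apply (V_act g f) h) = (\<Sum>h\<in>?A. CX_act g (V_apply f h))"
    by (subst sum.reindex) (auto simp: V_apply_act)
  also have "\<dots> = CX_act g (\<Sum>h\<in>?A. V_apply f h)"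
    by (simp add: linear_sum[OF CX_act_linear])
  also have "\<dots> = pi00 f *\<^sub>R one_CX"
    unfolding W00_sum[OF assms] by (auto intro!: bcontfun_eqI simp: CX_act_apply)
  finally show "(\<Sum>h\<in>(+) g ` ?A. V_apply (V_act g f) h) = pi00 f *\<^sub>R one_CX" .
qed

lemma bounded_linear_V_act: "bounded_linear (V_act g)"
  by (intro linear_conv_bounded_linear bounded_linear.intro bounded_linear_axioms.intro V_act_linear)
     (auto simp: V_act_norm intro!: exI[of _ 1])

lemma W0_act: 
  assumes "f \<in> W0"
  shows "V_act g f \<in> W0 \<and> pi0 (V_act g f) = pi0 f"
proof -
  obtain v where vw: "\<forall>n. v n \<in> W00" "v \<longlonglongrightarrow> f"
    using assms[THEN W0_seq] by blast
  show ?thesis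
    by (rule pi0_eqI[of "\<lambda>n. V_act g (v n)"])
       (use vw W00_act[of "v _" g] pi0_seq(1)[of v f] in \<open>simp_all add: bounded_linear.tendsto[OF bounded_linear_V_act]\<close>)
qed

lift_definition N0_act :: "'g::group_add \<Rightarrow> 'g N0 \<Rightarrow> 'g N0" is V_act
  by (simp add: W0_act)

lift_definition delta :: "'g \<Rightarrow> 'g V" is "\<lambda>g h. if h = g then one_CX else 0"
proof
  fix g :: 'g
  have eq: "(\<lambda>h. \<bar>(if h = g then one_CX else 0 :: 'g CX) x\<bar>) = (\<lambda>h. if h \<in> {g} then 1 else 0)" for x
    by auto
  have s: "((\<lambda>h. \<bar>(if h = g then one_CX else 0 :: 'g CX) x\<bar>) has_sum 1) UNIV" for x
  proof -
    have "((\<lambda>_. 1::real) has_sum (\<Sum>_\<in>{g}. 1)) {g}" by (rule has_sum_finite) simp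
    then have "((\<lambda>h. if h \<in> {g} then 1 else 0 :: real) has_sum (\<Sum>_\<in>{g}. 1)) UNIV"
      by (rule has_sum_cong_neutral[THEN iffD1, rotated -1]) simp_all
    then show ?thesis unfolding eq by simp
  qed
  show "\<forall>x. (\<lambda>h. \<bar>(if h = g then one_CX else 0 :: 'g CX) x\<bar>) summable_on UNIV"
    using s by (auto simp: summable_on_def)
  show "bdd_above (range (\<lambda>x. \<Sum>\<^sub>\<infinity>h. \<bar>(if h = g then one_CX else 0 :: 'g CX) x\<bar>))"
    using s[THEN infsumI] by auto
qed

lemma delta_W00: "delta g \<in> W00 \<and> pi00 (delta g) = 1"
  by (rule W00_iff[of "{g}"]) (auto simp: delta.rep_eq)

lift_definition johnson_diff :: "'g \<Rightarrow> 'g \<Rightarrow> 'g N0" is "\<lambda>g0 g1. delta g1 - delta g0"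
  using delta_W00 W00_diff pi0_W00 by (metis diff_self)

section \<open>Exactness\<close>

text \<open>
  Complex Hilbert spaces are taken in the form \<open>\<ell>\<^sup>2(I)\<close>, with operators as real-linear
  bounded maps (type \<open>'i op\<close>) that in addition commute with complex scalars.
\<close>

typedef 'i ell2 = "{f :: 'i \<Rightarrow> complex. (\<lambda>i. (cmod (f i))\<^sup>2) summable_on UNIV}"
  morphisms ell2_apply Abs_ell2
  by (rule exI[of _ "\<lambda>_. 0"]) simp

setup_lifting type_definition_ell2

lemma ell2_eqI: "(\<And>i. ell2_apply x i = ell2_apply y i) \<Longrightarrow> x = y"
  by (simp add: ell2_apply_inject[symmetric] fun_eq_iff)

lemma ell2_summable: "(\<lambda>i. (cmod (ell2_apply x i))\<^sup>2) summable_on UNIV"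
  using ell2_apply[of x] by simp

lemma ell2_mult_abs_summable:
  fixes f g :: "'i \<Rightarrow> complex"
  assumes "(\<lambda>i. (cmod (f i))\<^sup>2) summable_on UNIV" "(\<lambda>i. (cmod (g i))\<^sup>2) summable_on UNIV"
  shows "(\<lambda>i. norm (f i * g i)) summable_on UNIV"
  by (rule abs_summable_product) (use assms in \<open>simp_all add: norm_mult power2_eq_square\<close>)

lemma ell2_add:
  fixes f g :: "'i \<Rightarrow> complex"
  assumes "(\<lambda>i. (cmod (f i))\<^sup>2) summable_on UNIV" "(\<lambda>i. (cmod (g i))\<^sup>2) summable_on UNIV"
  shows "(\<lambda>i. (cmod (f i + g i))\<^sup>2) summable_on UNIV"
proof (rule summable_on_comparison_test)
  show "(\<lambda>i. 2 * (cmod (f i))\<^sup>2 + 2 * (cmod (g i))\<^sup>2) summable_on UNIV"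
    by (rule summable_on_add[OF summable_on_cmult_right[OF assms(1)] summable_on_cmult_right[OF assms(2)]])
  show "(cmod (f i + g i))\<^sup>2 \<le> 2 * (cmod (f i))\<^sup>2 + 2 * (cmod (g i))\<^sup>2" for i
  proof -
    have "(cmod (f i + g i))\<^sup>2 \<le> (cmod (f i) + cmod (g i))\<^sup>2"
      by (intro power_mono norm_triangle_ineq) simp
    also have "\<dots> \<le> 2 * (cmod (f i))\<^sup>2 + 2 * (cmod (g i))\<^sup>2"
      using zero_le_power2[of "cmod (f i) - cmod (g i)"] by (simp add: power2_sum power2_diff)
    finally show ?thesis .
  qed
qed simp

lemma ell2_cscale:
  fixes f :: "'i \<Rightarrow> complex"
  assumes "(\<lambda>i. (cmod (f i))\<^sup>2) summable_on UNIV"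
  shows "(\<lambda>i. (cmod (c * f i))\<^sup>2) summable_on UNIV"
  using summable_on_cmult_right[OF assms, of "(cmod c)\<^sup>2"] by (simp add: norm_mult power_mult_distrib)

lift_definition cscale :: "complex \<Rightarrow> 'i ell2 \<Rightarrow> 'i ell2" is "\<lambda>c x i. c * x i"
  by (rule ell2_cscale)

instantiation ell2 :: (type) real_vector
begin

lift_definition zero_ell2 :: "'a ell2" is "\<lambda>_. 0" by simp
lift_definition plus_ell2 :: "'a ell2 \<Rightarrow> 'a ell2 \<Rightarrow> 'a ell2" is "\<lambda>x y i. x i + y i"
  by (rule ell2_add)
lift_definition uminus_ell2 :: "'a ell2 \<Rightarrow> 'a ell2" is "\<lambda>x i. - x i" by simp
definition minus_ell2 :: "'a ell2 \<Rightarrow> 'a ell2 \<Rightarrow> 'a ell2" where "minus_ell2 x y = x + - y"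
definition scaleR_ell2 :: "real \<Rightarrow> 'a ell2 \<Rightarrow> 'a ell2" where "scaleR_ell2 r x = cscale (of_real r) x"

instance
proof
  fix x y z :: "'a ell2" and r s :: real
  show "x + y + z = x + (y + z)" by (rule ell2_eqI) (simp add: plus_ell2.rep_eq ac_simps)
  show "x + y = y + x" by (rule ell2_eqI) (simp add: plus_ell2.rep_eq ac_simps)
  show "0 + x = x" by (rule ell2_eqI) (simp add: plus_ell2.rep_eq zero_ell2.rep_eq)
  show "- x + x = 0" by (rule ell2_eqI) (simp add: plus_ell2.rep_eq zero_ell2.rep_eq uminus_ell2.rep_eq)
  show "x - y = x + - y" by (rule minus_ell2_def)
  show "r *\<^sub>R (x + y) = r *\<^sub>R x + r *\<^sub>R y"
    by (rule ell2_eqI) (simp add: scaleR_ell2_def cscale.rep_eq plus_ell2.rep_eq distrib_left distrib_right)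
  show "(r + s) *\<^sub>R x = r *\<^sub>R x + s *\<^sub>R x"
    by (rule ell2_eqI) (simp add: scaleR_ell2_def cscale.rep_eq plus_ell2.rep_eq distrib_left distrib_right)
  show "r *\<^sub>R s *\<^sub>R x = (r * s) *\<^sub>R x"
    by (rule ell2_eqI) (simp add: scaleR_ell2_def cscale.rep_eq)
  show "1 *\<^sub>R x = x"
    by (rule ell2_eqI) (simp add: scaleR_ell2_def cscale.rep_eq)
qed

end

definition cinner :: "'i ell2 \<Rightarrow> 'i ell2 \<Rightarrow> complex" where
  "cinner x y = (\<Sum>\<^sub>\<infinity>i. cnj (ell2_apply x i) * ell2_apply y i)"

lemma cinner_summable: "(\<lambda>i. cnj (ell2_apply x i) * ell2_apply y i) summable_on UNIV"
  by (rule abs_summable_summable, rule ell2_mult_abs_summable) (simp_all add: ell2_summable)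

lemma cinner_add_left: "cinner (x + y) z = cinner x z + cinner y z"
  unfolding cinner_def by (simp add: plus_ell2.rep_eq distrib_right infsum_add cinner_summable)

lemma cinner_commute: "cinner x y = cnj (cinner y x)"
  unfolding cinner_def infsum_cnj[symmetric] by (simp add: mult.commute)

lemma cinner_cscale_right: "cinner x (cscale c y) = c * cinner x y"
  unfolding cinner_def infsum_cmult_right'[symmetric] by (simp add: cscale.rep_eq mult_ac)

lemma cinner_cscale_left: "cinner (cscale c x) y = cnj c * cinner x y"
  unfolding cinner_def infsum_cmult_right'[symmetric] by (simp add: cscale.rep_eq mult_ac)

lemma cinner_self: "cinner x x = of_real (\<Sum>\<^sub>\<infinity>i. (cmod (ell2_apply x i))\<^sup>2)"
proof -
  have "cnj (ell2_apply x i) * ell2_apply x i = of_real ((cmod (ell2_apply x i))\<^sup>2)" for i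
    by (metis complex_norm_square mult.commute)
  moreover have "((\<lambda>i. of_real ((cmod (ell2_apply x i))\<^sup>2) :: complex) has_sum
      of_real (\<Sum>\<^sub>\<infinity>i. (cmod (ell2_apply x i))\<^sup>2)) UNIV"
    unfolding has_sum_of_real_iff by (rule has_sum_infsum[OF ell2_summable])
  ultimately show ?thesis unfolding cinner_def by (simp only: infsumI)
qed

instantiation ell2 :: (type) real_inner
begin

definition inner_ell2 :: "'a ell2 \<Rightarrow> 'a ell2 \<Rightarrow> real" where "inner_ell2 x y = Re (cinner x y)"
definition norm_ell2 :: "'a ell2 \<Rightarrow> real" where "norm_ell2 x = sqrt (inner x x)"
definition sgn_ell2 :: "'a ell2 \<Rightarrow> 'a ell2" where "sgn_ell2 x = x /\<^sub>R norm x"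
definition dist_ell2 :: "'a ell2 \<Rightarrow> 'a ell2 \<Rightarrow> real" where "dist_ell2 x y = norm (x - y)"
definition uniformity_ell2 :: "('a ell2 \<times> 'a ell2) filter"
  where "uniformity_ell2 = (INF e\<in>{0 <..}. principal {(x, y). dist x y < e})"
definition open_ell2 :: "'a ell2 set \<Rightarrow> bool"
  where "open_ell2 U = (\<forall>x\<in>U. \<forall>\<^sub>F (x', y) in uniformity. x' = x \<longrightarrow> y \<in> U)"

lemma inner_ell2_self: "inner x x = (\<Sum>\<^sub>\<infinity>i. (cmod (ell2_apply x i))\<^sup>2)"
  by (simp add: inner_ell2_def cinner_self)

instance
proof
  fix x y z :: "'a ell2" and r :: real
  show "dist x y = norm (x - y)" "sgn x = x /\<^sub>R norm x" "norm x = sqrt (inner x x)"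
    "uniformity = (INF e\<in>{0 <..}. principal {(x, y :: 'a ell2). dist x y < e})"
    by (simp_all add: dist_ell2_def sgn_ell2_def uniformity_ell2_def norm_ell2_def)
  show "open U \<longleftrightarrow> (\<forall>x\<in>U. \<forall>\<^sub>F (x', y) in uniformity. x' = x \<longrightarrow> y \<in> U)" for U :: "'a ell2 set"
    by (simp add: open_ell2_def)
  show "inner x y = inner y x"
    unfolding inner_ell2_def by (subst cinner_commute) simp
  show "inner (x + y) z = inner x z + inner y z"
    by (simp add: inner_ell2_def cinner_add_left)
  show "inner (r *\<^sub>R x) y = r * inner x y"
    by (simp add: inner_ell2_def scaleR_ell2_def cinner_cscale_left)
  show "0 \<le> inner x x"
    unfolding inner_ell2_self by (rule infsum_nonneg) simp
  show "inner x x = 0 \<longleftrightarrow> x = 0"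
  proof
    assume *: "inner x x = 0"
    have "ell2_apply x i = 0" for i
    proof -
      have "(\<Sum>i\<in>{i}. (cmod (ell2_apply x i))\<^sup>2) \<le> (\<Sum>\<^sub>\<infinity>i. (cmod (ell2_apply x i))\<^sup>2)"
        by (rule finite_sum_le_infsum[OF ell2_summable]) simp_all
      with * show ?thesis unfolding inner_ell2_self by simp
    qed
    then show "x = 0" by (intro ell2_eqI) (simp add: zero_ell2.rep_eq)
  qed (simp add: inner_ell2_self zero_ell2.rep_eq)
qed

end

lemma norm_ell2: "norm x = sqrt (\<Sum>\<^sub>\<infinity>i. (cmod (ell2_apply x i))\<^sup>2)"
  by (simp add: norm_ell2_def inner_ell2_self)

lemma norm_cscale: "norm (cscale c x) = cmod c * norm x"
  by (simp add: norm_ell2 cscale.rep_eq norm_mult power_mult_distrib infsum_cmult_right'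
      real_sqrt_mult)

lemma bounded_linear_cscale: "bounded_linear (cscale c)"
proof (rule bounded_linear_intro[of _ "cmod c"])
  fix x y :: "'a ell2" and r :: real
  show "cscale c (x + y) = cscale c x + cscale c y"
    by (rule ell2_eqI) (simp add: cscale.rep_eq plus_ell2.rep_eq algebra_simps)
  show "cscale c (r *\<^sub>R x) = r *\<^sub>R cscale c x"
    by (rule ell2_eqI) (simp add: scaleR_ell2_def cscale.rep_eq)
  show "norm (cscale c x) \<le> norm x * cmod c"
    by (simp add: norm_cscale)
qed

type_synonym 'i op = "'i ell2 \<Rightarrow>\<^sub>L 'i ell2"

definition cscale_op :: "complex \<Rightarrow> 'i op \<Rightarrow> 'i op" where
  "cscale_op c T = Blinfun (\<lambda>x. cscale c (blinfun_apply T x))"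

lemma cscale_op_apply: "cscale_op c T x = cscale c (T x)"
  unfolding cscale_op_def
  by (simp add: bounded_linear_Blinfun_apply bounded_linear_compose[OF bounded_linear_cscale blinfun.bounded_linear_right])

lift_definition left_shift :: "'g::group_add \<Rightarrow> 'g ell2 \<Rightarrow> 'g ell2" is "\<lambda>g x h. x (- g + h)"
proof -
  fix g :: 'g and x :: "'g \<Rightarrow> complex"
  assume "(\<lambda>i. (cmod (x i))\<^sup>2) summable_on UNIV"
  then show "(\<lambda>h. (cmod (x (- g + h)))\<^sup>2) summable_on UNIV"
    using summable_on_reindex_bij_betw[OF bij_plus[of "- g"], of "\<lambda>h. (cmod (x h))\<^sup>2"] by simp
qed

lemma norm_left_shift: "norm (left_shift g x) = norm x"
  using infsum_reindex_bij_betw[OF bij_plus[of "- g"], of "\<lambda>h. (cmod (ell2_apply x h))\<^sup>2"]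
  by (simp add: norm_ell2 left_shift.rep_eq)

lemma bounded_linear_left_shift: "bounded_linear (left_shift g)"
proof (rule bounded_linear_intro[of _ 1])
  fix x y :: "'a ell2" and r :: real
  show "left_shift g (x + y) = left_shift g x + left_shift g y"
    by (rule ell2_eqI) (simp add: left_shift.rep_eq plus_ell2.rep_eq)
  show "left_shift g (r *\<^sub>R x) = r *\<^sub>R left_shift g x"
    by (rule ell2_eqI) (simp add: left_shift.rep_eq scaleR_ell2_def cscale.rep_eq)
  show "norm (left_shift g x) \<le> norm x * 1" by (simp add: norm_left_shift)
qed

definition left_regular :: "'g::group_add \<Rightarrow> 'g op" where
  "left_regular g = Blinfun (left_shift g)"

lemma left_regular_apply: "left_regular g x = left_shift g x"
  by (simp add: left_regular_def bounded_linear_Blinfun_apply[OF bounded_linear_left_shift])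

lift_definition tensor_vec :: "'i ell2 \<Rightarrow> 'j ell2 \<Rightarrow> ('i \<times> 'j) ell2" is "\<lambda>x y (i, j). x i * y j"
proof -
  fix x :: "'i \<Rightarrow> complex" and y :: "'j \<Rightarrow> complex"
  assume x: "(\<lambda>i. (cmod (x i))\<^sup>2) summable_on UNIV" and y: "(\<lambda>i. (cmod (y i))\<^sup>2) summable_on UNIV"
  let ?f = "\<lambda>(i, j). (cmod (x i))\<^sup>2 * (cmod (y j))\<^sup>2"
  have "?f summable_on Sigma UNIV (\<lambda>_. UNIV)"
  proof (rule summable_on_SigmaI)
    show "((\<lambda>j. ?f (i, j)) has_sum (cmod (x i))\<^sup>2 * (\<Sum>\<^sub>\<infinity>j. (cmod (y j))\<^sup>2)) UNIV" for i
      using has_sum_cmult_right[OF has_sum_infsum[OF y]] by simp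
    show "(\<lambda>i. (cmod (x i))\<^sup>2 * (\<Sum>\<^sub>\<infinity>j. (cmod (y j))\<^sup>2)) summable_on UNIV"
      by (rule summable_on_cmult_left[OF x])
  qed simp
  then show "(\<lambda>p. (cmod ((\<lambda>(i, j). x i * y j) p))\<^sup>2) summable_on UNIV"
    by (simp add: norm_mult power_mult_distrib case_prod_unfold UNIV_Times_UNIV)
qed

definition is_adjoint :: "'i op \<Rightarrow> 'i op \<Rightarrow> bool" where
  "is_adjoint S T \<longleftrightarrow> (\<forall>x y. cinner (T x) y = cinner x (S y))"

definition concrete_cstar_algebra :: "'i op set \<Rightarrow> bool" where
  "concrete_cstar_algebra A \<longleftrightarrow>
     (\<forall>T\<in>A. \<forall>c x. T (cscale c x) = cscale c (T x)) \<and>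
     0 \<in> A \<and> (\<forall>S\<in>A. \<forall>T\<in>A. S + T \<in> A) \<and> (\<forall>c. \<forall>T\<in>A. cscale_op c T \<in> A) \<and>
     (\<forall>S\<in>A. \<forall>T\<in>A. S o\<^sub>L T \<in> A) \<and> (\<forall>T\<in>A. \<exists>S\<in>A. is_adjoint S T) \<and> closed A"

definition star_hom :: "'i op set \<Rightarrow> 'j op set \<Rightarrow> ('i op \<Rightarrow> 'j op) \<Rightarrow> bool" where
  "star_hom A B f \<longleftrightarrow> f ` A \<subseteq> B \<and>
     (\<forall>S\<in>A. \<forall>T\<in>A. f (S + T) = f S + f T) \<and> (\<forall>c. \<forall>T\<in>A. f (cscale_op c T) = cscale_op c (f T)) \<and>
     (\<forall>S\<in>A. \<forall>T\<in>A. f (S o\<^sub>L T) = f S o\<^sub>L f T) \<and>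
     (\<forall>S\<in>A. \<forall>T\<in>A. is_adjoint S T \<longrightarrow> is_adjoint (f S) (f T))"

text \<open>A bounded operator is determined by its values on elementary tensors.\<close>

definition tensor_op :: "'i op \<Rightarrow> 'j op \<Rightarrow> ('i \<times> 'j) op" where
  "tensor_op S T = (THE R :: ('i \<times> 'j) op. \<forall>x y. blinfun_apply R (tensor_vec x y) = tensor_vec (S x) (T y))"

text \<open>The minimal tensor product of concrete C*-algebras is the spatial one. The sets \<open>A\<close>, \<open>B\<close>
  are closed under complex scalars, so the real span is the algebraic tensor product.\<close>

definition min_tensor :: "'i op set \<Rightarrow> 'j op set \<Rightarrow> ('i \<times> 'j) op set" where
  "min_tensor A B = closure (span {tensor_op S T | S T. S \<in> A \<and> T \<in> B})"

text \<open>
  \<open>A\<close> is exact if tensoring an arbitrary short exact sequence \<open>0 \<rightarrow> J \<rightarrow> B \<rightarrow> C \<rightarrow> 0\<close> of C*-algebras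
  minimally with \<open>A\<close> gives a short exact sequence. Up to isomorphism \<open>J\<close> is the kernel of
  \<open>q : B \<rightarrow> C\<close>; then \<open>A \<otimes> J \<rightarrow> A \<otimes> B\<close> is an inclusion. \<open>Q\<close> is the induced map \<open>id \<otimes> q\<close>.
  HOL cannot quantify over types in a formula: \<open>B\<close> and \<open>C\<close> range over the C*-algebras that act on
  \<open>\<ell>\<^sup>2\<close> of the type parameter \<open>'u\<close>. Every pair of C*-algebras is of this form for some \<open>'u\<close>.
\<close>

definition exact_cstar_algebra :: "'u itself \<Rightarrow> 'i op set \<Rightarrow> bool" where
  "exact_cstar_algebra _ A \<longleftrightarrow>
     (\<forall>(B :: 'u op set) (C :: 'u op set) q.
        concrete_cstar_algebra B \<and> concrete_cstar_algebra C \<and> star_hom B C q \<and> q ` B = C \<longrightarrow>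
        (\<exists>Q. star_hom (min_tensor A B) (min_tensor A C) Q \<and>
             (\<forall>S\<in>A. \<forall>T\<in>B. Q (tensor_op S T) = tensor_op S (q T)) \<and>
             Q ` min_tensor A B = min_tensor A C \<and>
             {R \<in> min_tensor A B. Q R = 0} = min_tensor A {T \<in> B. q T = 0}))"

definition reduced_group_cstar_algebra :: "'g::group_add op set" where
  "reduced_group_cstar_algebra =
     closure {\<Sum>g\<in>F. cscale_op (c g) (left_regular g) | F c. finite F}"

definition exact_group :: "'u itself \<Rightarrow> 'g::group_add itself \<Rightarrow> bool" where
  "exact_group u _ \<longleftrightarrow> exact_cstar_algebra u (reduced_group_cstar_algebra :: 'g op set)"

section \<open>Bounded cohomology\<close>

definition isometric_action :: "('g::group_add \<Rightarrow> 'v::real_normed_vector \<Rightarrow> 'v) \<Rightarrow> bool" where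
  "isometric_action a \<longleftrightarrow> (\<forall>g. linear (a g)) \<and> (\<forall>g v. norm (a g v) = norm v) \<and>
     (\<forall>v. a 0 v = v) \<and> (\<forall>g h v. a (g + h) v = a g (a h v))"

definition dual_act :: "('g::group_add \<Rightarrow> 'v::real_normed_vector \<Rightarrow> 'v) \<Rightarrow>
    'g \<Rightarrow> ('v \<Rightarrow>\<^sub>L real) \<Rightarrow> ('v \<Rightarrow>\<^sub>L real)" where
  "dual_act a g \<alpha> = Blinfun (\<lambda>v. blinfun_apply \<alpha> (a (- g) v))"

text \<open>Functions on \<open>G\<^sup>m\<^sup>+\<^sup>1\<close> are functions on lists that vanish at all lists of length other
  than \<open>m + 1\<close>; the differential respects this convention.\<close>

definition bcochains :: "('g::group_add \<Rightarrow> 'v::real_normed_vector \<Rightarrow> 'v) \<Rightarrow> nat \<Rightarrow> ('g list \<Rightarrow> 'v) set" where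
  "bcochains a m = {\<phi>. (\<forall>gs. length gs \<noteq> m + 1 \<longrightarrow> \<phi> gs = 0) \<and> bounded (range \<phi>) \<and>
     (\<forall>k gs. length gs = m + 1 \<longrightarrow> \<phi> (map ((+) k) gs) = a k (\<phi> gs))}"

definition differential :: "('g list \<Rightarrow> 'v::real_vector) \<Rightarrow> 'g list \<Rightarrow> 'v" where
  "differential \<phi> gs = (\<Sum>i<length gs. (- 1) ^ i *\<^sub>R \<phi> (take i gs @ drop (Suc i) gs))"

definition bcocycles :: "('g::group_add \<Rightarrow> 'v::real_normed_vector \<Rightarrow> 'v) \<Rightarrow> nat \<Rightarrow> ('g list \<Rightarrow> 'v) set" where
  "bcocycles a m = {\<phi> \<in> bcochains a m. differential \<phi> = (\<lambda>_. 0)}"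

definition bcoboundaries :: "('g::group_add \<Rightarrow> 'v::real_normed_vector \<Rightarrow> 'v) \<Rightarrow> nat \<Rightarrow> ('g list \<Rightarrow> 'v) set" where
  "bcoboundaries a m = (case m of 0 \<Rightarrow> {\<lambda>_. 0} | Suc n \<Rightarrow> differential ` bcochains a n)"

definition bcohomologous :: "('g::group_add \<Rightarrow> 'v::real_normed_vector \<Rightarrow> 'v) \<Rightarrow> nat \<Rightarrow>
    (('g list \<Rightarrow> 'v) \<times> ('g list \<Rightarrow> 'v)) set" where
  "bcohomologous a m = {(\<phi>, \<psi>). \<phi> \<in> bcocycles a m \<and> \<psi> \<in> bcocycles a m \<and>
     (\<lambda>gs. \<phi> gs - \<psi> gs) \<in> bcoboundaries a m}"

definition bcohomology :: "('g::group_add \<Rightarrow> 'v::real_normed_vector \<Rightarrow> 'v) \<Rightarrow> nat \<Rightarrow> ('g list \<Rightarrow> 'v) set set" where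
  "bcohomology a m = bcocycles a m // bcohomologous a m"

definition bcohomology_class :: "('g::group_add \<Rightarrow> 'v::real_normed_vector \<Rightarrow> 'v) \<Rightarrow> nat \<Rightarrow>
    ('g list \<Rightarrow> 'v) \<Rightarrow> ('g list \<Rightarrow> 'v) set" where
  "bcohomology_class a m \<phi> = bcohomologous a m `` {\<phi>}"

section \<open>The Johnson class\<close>

definition bidual_embed :: "'v::real_normed_vector \<Rightarrow> ('v \<Rightarrow>\<^sub>L real) \<Rightarrow>\<^sub>L real" where
  "bidual_embed v = Blinfun (\<lambda>\<alpha>. blinfun_apply \<alpha> v)"

definition N0_bidual_act :: "'g::group_add \<Rightarrow> (('g N0 \<Rightarrow>\<^sub>L real) \<Rightarrow>\<^sub>L real) \<Rightarrow> (('g N0 \<Rightarrow>\<^sub>L real) \<Rightarrow>\<^sub>L real)" where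
  "N0_bidual_act = dual_act (dual_act N0_act)"

definition johnson_cocycle :: "'g list \<Rightarrow> (('g N0 \<Rightarrow>\<^sub>L real) \<Rightarrow>\<^sub>L real)" where
  "johnson_cocycle gs = (if length gs = 2 then bidual_embed (johnson_diff (gs ! 0) (gs ! 1)) else 0)"

definition johnson_class :: "('g::group_add list \<Rightarrow> (('g N0 \<Rightarrow>\<^sub>L real) \<Rightarrow>\<^sub>L real)) set" where
  "johnson_class = bcohomology_class N0_bidual_act 1 johnson_cocycle"

definition johnson_class_trivial :: "'g::group_add itself \<Rightarrow> bool" where
  "johnson_class_trivial _ \<longleftrightarrow>
     (johnson_class :: ('g list \<Rightarrow> _) set) = bcohomology_class N0_bidual_act 1 (\<lambda>_. 0)"

lemma isometric_action_N0: "isometric_action N0_act"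
  unfolding isometric_action_def
proof (intro conjI allI)
  fix g h :: 'a and v :: "'a N0"
  show "linear (N0_act g)"
    by (rule linearI; transfer) (simp_all add: linear_add[OF V_act_linear] linear_scale[OF V_act_linear])
  show "norm (N0_act g v) = norm v" by transfer (rule V_act_norm)
  show "N0_act 0 v = v" by transfer (rule V_act_zero)
  show "N0_act (g + h) v = N0_act g (N0_act h v)" by transfer (rule V_act_add)
qed

lemma isometric_action_bounded_linear:
  assumes "isometric_action a"
  shows "bounded_linear (a g)"
  using assms unfolding isometric_action_def
  by (intro bounded_linear_intro[of _ 1]) (simp_all add: linear_add linear_scale)

lemma dual_act_apply:
  assumes "isometric_action a"
  shows "dual_act a g \<alpha> v = \<alpha> (a (- g) v)"
  unfolding dual_act_def
  by (rule fun_cong[OF bounded_linear_Blinfun_apply])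
     (rule bounded_linear_compose[OF blinfun.bounded_linear_right isometric_action_bounded_linear[OF assms]])

lemma dual_act_norm_le:
  assumes "isometric_action a"
  shows "norm (dual_act a g \<alpha>) \<le> norm \<alpha>"
proof (rule norm_blinfun_bound)
  fix v
  have "norm (\<alpha> (a (- g) v)) \<le> norm \<alpha> * norm (a (- g) v)" by (rule norm_blinfun)
  also have "norm (a (- g) v) = norm v" using assms by (simp add: isometric_action_def)
  finally show "norm (dual_act a g \<alpha> v) \<le> norm \<alpha> * norm v" by (simp add: dual_act_apply[OF assms])
qed simp

lemma isometric_action_dual:
  assumes a: "isometric_action a"
  shows "isometric_action (dual_act a)"
proof -
  have z: "dual_act a 0 \<alpha> = \<alpha>" for \<alpha>
    using a by (intro blinfun_eqI) (simp add: dual_act_apply isometric_action_def)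
  have p: "dual_act a (g + h) \<alpha> = dual_act a g (dual_act a h \<alpha>)" for g h \<alpha>
    using a by (intro blinfun_eqI) (simp add: dual_act_apply isometric_action_def minus_add
        del: add_uminus_conv_diff)
  have l: "linear (dual_act a g)" for g
    by (rule linearI; rule blinfun_eqI) (simp_all add: dual_act_apply[OF a] blinfun.add_left blinfun.scaleR_left)
  have n: "norm (dual_act a g \<alpha>) = norm \<alpha>" for g \<alpha>
    using dual_act_norm_le[OF a, of g \<alpha>] dual_act_norm_le[OF a, of "- g" "dual_act a g \<alpha>"]
    by (simp add: p[symmetric] z)
  show ?thesis unfolding isometric_action_def using z p l n by blast
qed

lemma bidual_embed_apply: "bidual_embed v \<alpha> = \<alpha> v"
  unfolding bidual_embed_def
  by (rule fun_cong[OF bounded_linear_Blinfun_apply[OF blinfun.bounded_linear_left]])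

lemma norm_bidual_embed: "norm (bidual_embed v) \<le> norm v"
proof (rule norm_blinfun_bound)
  fix \<alpha> :: "'a \<Rightarrow>\<^sub>L real"
  show "norm (bidual_embed v \<alpha>) \<le> norm v * norm \<alpha>"
    using norm_blinfun[of \<alpha> v] by (simp add: bidual_embed_apply mult.commute)
qed simp

lemma V_act_delta: "V_act k (delta g) = delta (k + g)"
proof (rule V_eqI)
  fix h
  have "- k + h = g \<longleftrightarrow> h = k + g" by (metis add.assoc add.left_neutral left_minus right_minus)
  then show "V_apply (V_act k (delta g)) h = V_apply (delta (k + g)) h"
    by (auto simp: V_apply_act delta.rep_eq linear_0[OF CX_act_linear] CX_act_apply intro!: bcontfun_eqI)
qed

lemma norm_delta: "norm (delta (g :: 'g::group_add)) = norm (delta (0 :: 'g))"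
  using V_act_norm[of g "delta 0"] by (simp add: V_act_delta)

lemma johnson_cocycle_bcocycle: "johnson_cocycle \<in> bcocycles N0_bidual_act 1"
proof -
  have act: "N0_act k (johnson_diff g h) = johnson_diff (k + g) (k + h)" for k g h :: 'a
    by transfer (simp add: linear_diff[OF V_act_linear] V_act_delta)
  have bact: "N0_bidual_act k (bidual_embed v) = bidual_embed (N0_act k v)" for k :: 'a and v
    by (rule blinfun_eqI)
       (simp add: N0_bidual_act_def dual_act_apply isometric_action_N0 isometric_action_dual bidual_embed_apply)
  have "norm (johnson_cocycle gs) \<le> 2 * norm (delta (0::'a))" for gs :: "'a list"
  proof (cases "length gs = 2")
    case True
    have "norm (johnson_cocycle gs) \<le> norm (johnson_diff (gs ! 0) (gs ! 1))"
      using True by (simp add: johnson_cocycle_def norm_bidual_embed)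
    also have "\<dots> = norm (delta (gs ! 1) - delta (gs ! 0))" by transfer simp
    also have "\<dots> \<le> norm (delta (gs ! 1)) + norm (delta (gs ! 0))" by (rule norm_triangle_ineq4)
    finally show ?thesis unfolding norm_delta[of "gs ! 0"] norm_delta[of "gs ! 1"] by linarith
  qed (simp add: johnson_cocycle_def)
  then have "bounded (range (johnson_cocycle :: 'a list \<Rightarrow> _))" by (auto intro: boundedI)
  then have 1: "(johnson_cocycle :: 'a list \<Rightarrow> _) \<in> bcochains N0_bidual_act 1"
    by (auto simp: bcochains_def johnson_cocycle_def bact act)
  have "differential johnson_cocycle gs = 0" for gs :: "'a list"
  proof (cases "length gs = 3")
    case True
    then obtain x y z where gs: "gs = [x, y, z]" by (auto simp: numeral_3_eq_3 length_Suc_conv)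
    have "johnson_diff y z - johnson_diff x z + johnson_diff x y = 0" by transfer simp
    then have "bidual_embed (johnson_diff y z) - bidual_embed (johnson_diff x z) + bidual_embed (johnson_diff x y) = 0"
      by (intro blinfun_eqI) (simp add: bidual_embed_apply blinfun.add_left blinfun.diff_left flip: blinfun.diff_right blinfun.add_right)
    then show ?thesis by (simp add: gs differential_def johnson_cocycle_def numeral_3_eq_3)
  next
    case False
    have "johnson_cocycle (take i gs @ drop (Suc i) gs) = 0" if "i < length gs" for i
      using False that by (auto simp: johnson_cocycle_def)
    then show ?thesis by (simp add: differential_def)
  qed
  then show ?thesis using 1 by (auto simp: bcocycles_def)
qed

section \<open>Geometric modules\<close>

definition CX_module :: "('g CX \<Rightarrow> 'e::banach \<Rightarrow> 'e) \<Rightarrow> bool" where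
  "CX_module smul \<longleftrightarrow> (\<forall>t. linear (smul t)) \<and> (\<forall>v. linear (\<lambda>t. smul t v)) \<and>
     (\<forall>s t v. smul (CX_mult s t) v = smul s (smul t v)) \<and> (\<forall>v. smul one_CX v = v) \<and>
     (\<forall>t v. norm (smul t v) \<le> norm t * norm v)"

definition G_CX_module :: "('g::group_add \<Rightarrow> 'e::banach \<Rightarrow> 'e) \<Rightarrow> ('g CX \<Rightarrow> 'e \<Rightarrow> 'e) \<Rightarrow> bool" where
  "G_CX_module act smul \<longleftrightarrow> CX_module smul \<and> isometric_action act \<and>
     (\<forall>g t v. act g (smul t v) = smul (CX_act g t) (act g v))"

definition closed_support :: "'g CX \<Rightarrow> 'g stone_cech set" where
  "closed_support t = closure {x. t x \<noteq> 0}"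

definition disjointly_supported :: "('g CX \<Rightarrow> 'e::banach \<Rightarrow> 'e) \<Rightarrow> 'e \<Rightarrow> 'e \<Rightarrow> bool" where
  "disjointly_supported smul v w \<longleftrightarrow>
     (\<exists>s t. closed_support s \<inter> closed_support t = {} \<and> smul s v = v \<and> smul t w = w)"

definition l1_geometric :: "('g CX \<Rightarrow> 'e::banach \<Rightarrow> 'e) \<Rightarrow> bool" where
  "l1_geometric smul \<longleftrightarrow> (\<forall>v w. disjointly_supported smul v w \<longrightarrow> norm (v + w) = norm v + norm w)"

text \<open>
  The vanishing of \<open>H\<^sup>p\<^sub>b(G, E\<^sup>*)\<close> for all \<open>p \<ge> 1\<close> and all \<open>\<ell>\<^sup>1\<close>-geometric module structures on one
  Banach space \<open>E\<close>, given as a type. As \<open>E\<close> is a type it cannot be quantified in a formula.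
  Vanishing for all Banach spaces is expressed by a theorem in which \<open>'e\<close> is a free type
  variable. There, "for all \<open>'e\<close>: \<open>P\<close> holds iff vanishing holds for \<open>'e\<close> and for \<open>N\<^sub>0\<^sup>*\<close>" yields that \<open>P\<close>
  implies vanishing for every Banach space, and that \<open>P\<close> follows from vanishing for every Banach space
  (instantiate \<open>'e\<close> with \<open>N\<^sub>0\<^sup>*\<close>); without the second conjunct the converse would be false for small \<open>'e\<close>.
  In the same way \<^const>\<open>exact_group\<close> is to be used at \<open>'u + nat set\<close> with \<open>'u\<close> free:
  \<open>'u\<close> makes room for arbitrary C*-algebras, and \<open>nat set\<close> ensures that there are always enough of
  them to detect exactness.
\<close>

definition l1_geometric_vanishing :: "'g::group_add itself \<Rightarrow> 'e::banach itself \<Rightarrow> bool" where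
  "l1_geometric_vanishing _ _ \<longleftrightarrow>
     (\<forall>(act :: 'g \<Rightarrow> 'e \<Rightarrow> 'e) smul p. G_CX_module act smul \<and> l1_geometric smul \<and> p \<ge> 1 \<longrightarrow>
        bcohomology (dual_act act) p = {bcohomology_class (dual_act act) p (\<lambda>_. 0)})"

end

theory Submission
  imports Defs
begin

text \<open>
  All conditions are compared with Yu's property A, equivalently with the existence of a bounded
  sequence \<open>f\<^sub>n\<close> in \<open>W\<^sub>0\<^sub>0\<close> with \<open>\<pi> f\<^sub>n = 1\<close> and \<open>\<parallel>g f\<^sub>n - f\<^sub>n\<parallel> \<rightarrow> 0\<close>. Averaging cochains over \<open>f\<^sub>n\<close> and
  passing to an ultralimit contracts the bounded complex of a geometric module; the dual of \<open>N\<^sub>0\<close> is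
  geometric, so vanishing kills the Johnson class; and a primitive of the Johnson cocycle is
  approximated by elements of \<open>N\<^sub>0\<close> (Hahn-Banach), which gives back the sequence \<open>f\<^sub>n\<close>.

  Property A yields finitely supported positive definite kernels close to \<open>1\<close>; the corresponding Schur
  multipliers approximate the kernel of \<open>id \<otimes> q\<close> by elements of \<open>A \<otimes> J\<close>.

  Conversely, if property A fails, Hahn-Banach gives finite matrices \<open>a\<^sub>n\<close> of width \<open>F\<close> on finite sets
  \<open>S\<^sub>n\<close>, nonnegative on all positive definite kernels of width \<open>E\<^sub>n\<close>, with \<open>E\<^sub>n\<close> exhausting the group, but with
  \<open>\<Sum> a\<^sub>n \<le> - \<delta>\<close>. They assemble to an operator \<open>T = \<Sum> \<lambda>\<^sub>f \<otimes> b\<^sub>f\<close> in \<open>A \<otimes> B\<close> that is not almost positive, whereas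
  its image under \<open>id \<otimes> q\<close> is positive, where \<open>q\<close> sends an operator to its limits along the sequences
  of base points \<open>\<sigma>\<^sub>n\<close> in the group. If \<open>0 \<rightarrow> A \<otimes> J \<rightarrow> A \<otimes> B \<rightarrow> A \<otimes> C\<close> were exact, then \<open>T + \<epsilon>\<close> would be positive modulo
  \<open>A \<otimes> J\<close>, and the elements of \<open>A \<otimes> J\<close> vanish asymptotically on the vectors that witness \<open>\<Sum> a\<^sub>n \<le> - \<delta>\<close>.
\<close>

text \<open>Of the ingredients of exactness, the map id \<otimes> q, its surjectivity and the
  inclusion of A \<otimes> J in its kernel come for free; only the reverse inclusion depends on the
  group. When it is derived from property A, the obstacle is that the Schur multiple of a kernel
  element is a finite sum of D \<otimes> j with j in J, but with D outside A in general; an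
  approximate unit of J repairs this. In the converse, a single bounded operator has to violate
  exactness, so the separating matrices must be rescaled to uniformly bounded entries. The quotient
  of B has to act on the prescribed Hilbert space. Each sequence \<sigma> of base points contributes
  a block, a copy of l2(G), and every \<sigma> must be present, because only then does a vanishing
  limit mean decay that is uniform in the base point. There may be continuum many \<sigma>, which is
  what \<open>nat set\<close> in the index type has room for. Positivity is handled through two
  fixed point equations, for a square root and for a resolvent; they make sense without a unit and
  are preserved by homomorphisms.\<close>

notation tendsto (infixr "--->" 55)

abbreviation sequence_tendsto (infixr "---->" 60) where
  "X ----> L == (X ---> L) sequentially"

section \<open>Functional analysis\<close>

definition sublinear :: "('a::real_vector => real) => bool" where
  "sublinear q \<longleftrightarrow> (ALL x y. q (x + y) <= q x + q y) & (\<forall>c\<ge>0. ALL x. q (c *\<^sub>R x) <= c * q x)"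

text \<open>\<open>sublinear\<close> asks only for an inequality under scaling, which is what can be
  checked directly for the infima built below. Using it for c and for 1 / c gives equality.\<close>

lemma sublinear_scaleR:
  assumes "sublinear q" "c >= 0"
  shows "q (c *\<^sub>R x) = c * q x"
proof (cases "c = 0")
  case True
  have "q 0 <= 0" using assms(1)[unfolded sublinear_def, THEN conjunct2, rule_format, of 0 0] by simp
  moreover have "q (0 + 0) <= q 0 + q 0" using assms(1) unfolding sublinear_def by blast
  ultimately show ?thesis using True by simp
next
  case False
  have "q x <= inverse c * q (c *\<^sub>R x)"
    using assms(1)[unfolded sublinear_def, THEN conjunct2, rule_format, of "inverse c" "c *\<^sub>R x"] assms(2) False by simp
  then have "c * q x <= q (c *\<^sub>R x)" using assms(2) False by (simp add: field_simps)
  then show ?thesis using assms unfolding sublinear_def by (metis order_antisym)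
qed

lemma sublinear_lower:
  assumes "sublinear q"
  shows "- q (- x) <= q x"
proof -
  have "q (x + - x) <= q x + q (- x)" using assms unfolding sublinear_def by blast
  then show ?thesis using sublinear_scaleR[OF assms, of 0 0] by simp
qed

text \<open>A minimal sublinear functional m below p, supplied by Zorn, is already linear: for fixed
  y the infimum over t >= 0 of m (x + t y) - t m y is again sublinear and at most m, hence equal to
  m, and t = 1 gives m x <= m (x + y) - m y.\<close>

lemma hahn_banach_sublinear:
  fixes p :: "'a::real_vector => real"
  assumes p: "sublinear p"
  shows "\<exists>\<Lambda>. linear \<Lambda> & (ALL x. \<Lambda> x <= p x)"
proof -
  define A where "A = {q. sublinear q & (ALL x. q x <= p x)}"
  define P where "P = (%q r :: 'a => real. ALL x. r x <= q x)"
  have po: "partial_order_on A (relation_of P A)"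
    by (rule partial_order_on_relation_ofI) (auto simp: P_def fun_eq_iff intro: order_trans order_antisym)
  have ex: "\<exists>m\<in>A. \<forall>a\<in>A. P m a --> a = m"
  proof (rule predicate_Zorn[OF po])
    fix C assume C: "C \<in> Chains (relation_of P A)"
    have CA: "C \<subseteq> A" and ch: "!!q r. q \<in> C ==> r \<in> C ==> P q r \<or> P r q"
      using C unfolding Chains_def relation_of_def by auto
    show "\<exists>u\<in>A. \<forall>a\<in>C. P a u"
    proof (cases "C = {}")
      case True
      then show ?thesis using p by (auto simp: A_def)
    next
      case ne: False
      define u where "u x = (INF q\<in>C. q x)" for x
      have bdd: "bdd_below ((%q. q x) ` C)" for x
      proof (rule bdd_belowI2)
        fix q assume "q \<in> C"
        then have "sublinear q" "q (- x) <= p (- x)" using CA by (auto simp: A_def)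
        then show "- p (- x) <= q x" using sublinear_lower[of q x] by linarith
      qed
      have ule: "u x <= q x" if "q \<in> C" for q x
        unfolding u_def by (rule cINF_lower[OF bdd that])
      have uge: "b <= u x" if "!!q. q \<in> C ==> b <= q x" for b x
        unfolding u_def by (rule cINF_greatest[OF ne that])
      have subC: "sublinear q" if "q \<in> C" for q using that CA by (auto simp: A_def)
      have "sublinear u"
        unfolding sublinear_def
      proof (intro conjI allI impI)
        fix x y
        \<comment> \<open>Two members of a chain are comparable, so the smaller of q and r serves
          both summands.\<close>
        have "u (x + y) <= q x + r y" if qr: "q \<in> C" "r \<in> C" for q r
        proof -
          obtain s where s: "s \<in> C" "s x <= q x" "s y <= r y"
            using ch[OF qr] qr by (auto simp: P_def)
          have "u (x + y) <= s (x + y)" by (rule ule[OF s(1)])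
          also have "... <= s x + s y" using subC[OF s(1)] unfolding sublinear_def by blast
          finally show ?thesis using s by linarith
        qed
        note M = this
        have N: "u (x + y) - q x <= u y" if q: "q \<in> C" for q
        proof (rule uge)
          fix r assume "r \<in> C"
          then show "u (x + y) - q x <= r y" using M[OF q, of r] by linarith
        qed
        have "u (x + y) - u y <= u x"
        proof (rule uge)
          fix q assume "q \<in> C"
          then show "u (x + y) - u y <= q x" using N[of q] by linarith
        qed
        then show "u (x + y) <= u x + u y" by simp
      next
        fix c :: real and x assume c: "c >= 0"
        show "u (c *\<^sub>R x) <= c * u x"
        proof (cases "c = 0")
          case True
          obtain q where "q \<in> C" using ne by blast
          then show ?thesis using True ule[of q 0] sublinear_scaleR[OF subC, of q 0 0] by simp
        next
          case False
          have "u (c *\<^sub>R x) / c <= u x"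
          proof (rule uge)
            fix q assume "q \<in> C"
            then show "u (c *\<^sub>R x) / c <= q x"
              using ule[of q "c *\<^sub>R x"] sublinear_scaleR[OF subC, of q c x] c False by (simp add: field_simps)
          qed
          then show ?thesis using c False by (simp add: field_simps)
        qed
      qed
      moreover have "u x <= p x" for x
      proof -
        obtain q where "q \<in> C" using ne by blast
        then have "q x <= p x" using CA by (auto simp: A_def)
        then show ?thesis using ule[of q x] \<open>q \<in> C\<close> by linarith
      qed
      ultimately show ?thesis using ule by (auto simp: A_def P_def)
    qed
  qed
  obtain m where m: "sublinear m" "!!x. m x <= p x" 
    and min: "!!q. sublinear q ==> (!!x. q x <= m x) ==> q = m"
  proof -
    from ex obtain m where m: "m \<in> A" "\<forall>a\<in>A. P m a --> a = m" by blast
    show thesis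
    proof (rule that[of m])
      show "sublinear m" "m x <= p x" for x using m(1) by (auto simp: A_def)
      show "q = m" if "sublinear q" "!!x. q x <= m x" for q
      proof -
        have "q \<in> A" using that m(1) by (auto simp: A_def intro: order_trans)
        then show ?thesis using m(2) that by (auto simp: P_def)
      qed
    qed
  qed
  have add: "m (x + y) = m x + m y" for x y
  proof -
    define q where "q x = (INF t\<in>{0..}. m (x + t *\<^sub>R y) - t * m y)" for x
    have bdd: "bdd_below ((%t. m (x + t *\<^sub>R y) - t * m y) ` {0..})" for x
    proof (rule bdd_belowI2)
      fix t :: real assume "t \<in> {0..}"
      then have "m (t *\<^sub>R y) = t * m y" using sublinear_scaleR[OF m(1)] by simp
      moreover have "m ((x + t *\<^sub>R y) + (- x)) <= m (x + t *\<^sub>R y) + m (- x)"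
        using m(1) unfolding sublinear_def by blast
      ultimately show "- m (- x) <= m (x + t *\<^sub>R y) - t * m y" by simp
    qed
    have qle: "q x <= m (x + t *\<^sub>R y) - t * m y" if "t >= 0" for t x
      unfolding q_def by (rule cINF_lower[OF bdd]) (use that in simp)
    have qge: "b <= q x" if "!!t. t >= 0 ==> b <= m (x + t *\<^sub>R y) - t * m y" for b x
      unfolding q_def by (rule cINF_greatest) (use that in auto)
    have "sublinear q"
      unfolding sublinear_def
    proof (intro conjI allI impI)
      fix a b
      have *: "q (a + b) <= (m (a + t *\<^sub>R y) - t * m y) + (m (b + s *\<^sub>R y) - s * m y)"
        if "t >= 0" "s >= 0" for t s
      proof -
        have "q (a + b) <= m ((a + b) + (t + s) *\<^sub>R y) - (t + s) * m y"
          by (rule qle) (use that in simp)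
        also have "(a + b) + (t + s) *\<^sub>R y = (a + t *\<^sub>R y) + (b + s *\<^sub>R y)"
          by (simp add: algebra_simps)
        also have "m ... <= m (a + t *\<^sub>R y) + m (b + s *\<^sub>R y)"
          using m(1) unfolding sublinear_def by blast
        finally show ?thesis by (simp add: algebra_simps)
      qed
      have N: "q (a + b) - (m (a + t *\<^sub>R y) - t * m y) <= q b" if t: "t >= 0" for t
      proof (rule qge)
        fix s :: real assume "s >= 0"
        then show "q (a + b) - (m (a + t *\<^sub>R y) - t * m y) <= m (b + s *\<^sub>R y) - s * m y"
          using *[OF t, of s] by linarith
      qed
      have "q (a + b) - q b <= q a"
      proof (rule qge)
        fix t :: real assume "t >= 0"
        then show "q (a + b) - q b <= m (a + t *\<^sub>R y) - t * m y" using N[of t] by linarith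
      qed
      then show "q (a + b) <= q a + q b" by simp
    next
      fix c :: real and a assume c: "c >= 0"
      show "q (c *\<^sub>R a) <= c * q a"
      proof (cases "c = 0")
        case True
        then show ?thesis using qle[of 0 0] sublinear_scaleR[OF m(1), of 0 0] by simp
      next
        case False
        have "q (c *\<^sub>R a) / c <= q a"
        proof (rule qge)
          fix t :: real assume t: "t >= 0"
          have "q (c *\<^sub>R a) <= m (c *\<^sub>R a + (c * t) *\<^sub>R y) - (c * t) * m y"
            by (rule qle) (use c t in simp)
          also have "c *\<^sub>R a + (c * t) *\<^sub>R y = c *\<^sub>R (a + t *\<^sub>R y)" by (simp add: algebra_simps)
          finally show "q (c *\<^sub>R a) / c <= m (a + t *\<^sub>R y) - t * m y"
            using sublinear_scaleR[OF m(1) c, of "a + t *\<^sub>R y"] c False by (simp add: field_simps)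
        qed
        then show ?thesis using c False by (simp add: field_simps)
      qed
    qed
    moreover have "q x <= m x" for x using qle[of 0 x] by simp
    ultimately have "q = m" by (rule min)
    then have "m x <= m (x + y) - m y" using qle[of 1 x] by simp
    then show ?thesis using m(1)[unfolded sublinear_def, THEN conjunct1, rule_format, of x y] by linarith
  qed
  have neg: "m (- x) = - m x" for x
    using add[of x "- x"] sublinear_scaleR[OF m(1), of 0 0] by simp
  have "m (c *\<^sub>R x) = c * m x" for c x
  proof (cases "c >= 0")
    case False
    then have "m ((- c) *\<^sub>R x) = - c * m x" by (intro sublinear_scaleR[OF m(1)]) simp
    then show ?thesis using neg[of "c *\<^sub>R x"] by simp
  qed (rule sublinear_scaleR[OF m(1)])
  then have "linear m" using add by (intro linearI) simp_all
  with m(2) show ?thesis by blast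
qed

text \<open>Every linear functional below \<rho> has the required properties: t = 0 gives \<rho> <=
  norm, and t = 1 at x = - k gives \<rho> (- k) <= - \<epsilon>. The distance hypothesis keeps the
  infimum \<rho> finite. The bound 1 on the functional is used quantitatively later.\<close>

lemma hahn_banach_separation:
  fixes K :: "'a::real_normed_vector set"
  assumes K: "convex K" "K ~= {}" and far: "!!k. k \<in> K ==> \<epsilon> <= norm k"
  obtains \<Lambda> :: "'a => real" where "linear \<Lambda>" "!!x. \<bar>\<Lambda> x\<bar> <= norm x" "!!k. k \<in> K ==> \<epsilon> <= \<Lambda> k"
proof -
  define I :: "(real \<times> 'a) set" where "I = {0..} \<times> K"
  define g :: "'a => real \<times> 'a => real" where "g x = (%(t, k). norm (x + t *\<^sub>R k) - t * \<epsilon>)" for x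
  define \<rho> where "\<rho> x = (INF i\<in>I. g x i)" for x
  obtain k0 where k0: "k0 \<in> K" using K by blast
  have ne: "I ~= {}" using k0 by (auto simp: I_def)
  have bdd: "bdd_below (g x ` I)" for x
  proof (rule bdd_belowI2)
    fix i assume "i \<in> I"
    then obtain t k where i: "i = (t, k)" "t >= 0" "k \<in> K" by (auto simp: I_def)
    have "t * \<epsilon> <= t * norm k" by (intro mult_left_mono far i)
    also have "t * norm k = norm ((x + t *\<^sub>R k) - x)" using i by simp
    also have "... <= norm (x + t *\<^sub>R k) + norm x" by (rule norm_triangle_ineq4)
    finally show "- norm x <= g x i" by (simp add: g_def i)
  qed
  have le: "\<rho> x <= norm (x + t *\<^sub>R k) - t * \<epsilon>" if "t >= 0" "k \<in> K" for x t k
    using cINF_lower[OF bdd[of x], of "(t, k)"] that by (simp add: \<rho>_def g_def I_def)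
  have ge: "b <= \<rho> x" if "!!t k. t >= 0 ==> k \<in> K ==> b <= norm (x + t *\<^sub>R k) - t * \<epsilon>" for b x
    unfolding \<rho>_def by (rule cINF_greatest[OF ne]) (use that in \<open>auto simp: g_def I_def\<close>)
  have "sublinear \<rho>"
    unfolding sublinear_def
  proof (intro conjI allI impI)
    fix a b
    have *: "\<rho> (a + b) <= (norm (a + t *\<^sub>R k) - t * \<epsilon>) + (norm (b + s *\<^sub>R l) - s * \<epsilon>)"
      if "t >= 0" "s >= 0" "k \<in> K" "l \<in> K" for t s k l
    proof -
      \<comment> \<open>Convexity merges the pairs (t, k) and (s, l) into the single pair (t + s,
        j).\<close>
      have "\<exists>j\<in>K. (t + s) *\<^sub>R j = t *\<^sub>R k + s *\<^sub>R l"
      proof (cases "t + s = 0")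
        case True
        then have "t = 0" "s = 0" using that by auto
        then show ?thesis using k0 by auto
      next
        case False
        have "(t / (t + s)) *\<^sub>R k + (s / (t + s)) *\<^sub>R l \<in> K"
          by (rule convexD[OF K(1)]) (use that False in \<open>auto simp: add_divide_distrib[symmetric]\<close>)
        then show ?thesis
          by (rule rev_bexI) (use False in \<open>simp add: scaleR_add_right\<close>)
      qed
      then obtain j where j: "j \<in> K" "(t + s) *\<^sub>R j = t *\<^sub>R k + s *\<^sub>R l" by blast
      have "\<rho> (a + b) <= norm (a + b + (t + s) *\<^sub>R j) - (t + s) * \<epsilon>"
        by (rule le) (use that j in auto)
      also have "a + b + (t + s) *\<^sub>R j = (a + t *\<^sub>R k) + (b + s *\<^sub>R l)" by (simp add: j)
      also have "norm ... <= norm (a + t *\<^sub>R k) + norm (b + s *\<^sub>R l)" by (rule norm_triangle_ineq)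
      finally show ?thesis by (simp add: algebra_simps)
    qed
    have N: "\<rho> (a + b) - (norm (a + t *\<^sub>R k) - t * \<epsilon>) <= \<rho> b" if t: "t >= 0" "k \<in> K" for t k
    proof (rule ge)
      fix s :: real and l assume "s >= 0" "l \<in> K"
      then show "\<rho> (a + b) - (norm (a + t *\<^sub>R k) - t * \<epsilon>) <= norm (b + s *\<^sub>R l) - s * \<epsilon>"
        using *[OF t(1) _ t(2), of s l] by linarith
    qed
    have "\<rho> (a + b) - \<rho> b <= \<rho> a"
    proof (rule ge)
      fix t :: real and k assume "t >= 0" "k \<in> K"
      then show "\<rho> (a + b) - \<rho> b <= norm (a + t *\<^sub>R k) - t * \<epsilon>" using N[of t k] by linarith
    qed
    then show "\<rho> (a + b) <= \<rho> a + \<rho> b" by simp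
  next
    fix c :: real and a assume c: "c >= 0"
    show "\<rho> (c *\<^sub>R a) <= c * \<rho> a"
    proof (cases "c = 0")
      case True
      then show ?thesis using le[of 0 k0 0] k0 by simp
    next
      case False
      have "\<rho> (c *\<^sub>R a) / c <= \<rho> a"
      proof (rule ge)
        fix t :: real and k assume t: "t >= 0" "k \<in> K"
        have "\<rho> (c *\<^sub>R a) <= norm (c *\<^sub>R a + (c * t) *\<^sub>R k) - (c * t) * \<epsilon>"
          by (rule le) (use c t in auto)
        also have "c *\<^sub>R a + (c * t) *\<^sub>R k = c *\<^sub>R (a + t *\<^sub>R k)" by (simp add: algebra_simps)
        also have "norm ... = c * norm (a + t *\<^sub>R k)" using c by simp
        finally show "\<rho> (c *\<^sub>R a) / c <= norm (a + t *\<^sub>R k) - t * \<epsilon>"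
          using c False by (simp add: field_simps)
      qed
      then show ?thesis using c False by (simp add: field_simps)
    qed
  qed
  then obtain \<Lambda> where L: "linear \<Lambda>" "!!x. \<Lambda> x <= \<rho> x" using hahn_banach_sublinear by blast
  have 1: "\<Lambda> x <= norm x" for x using L(2)[of x] le[of 0 k0 x] k0 by simp
  show thesis
  proof
    show "linear \<Lambda>" by (rule L)
    show "\<bar>\<Lambda> x\<bar> <= norm x" for x
      using 1[of x] 1[of "- x"] linear_neg[OF L(1), of x] by simp
    show "\<epsilon> <= \<Lambda> k" if "k \<in> K" for k
      using L(2)[of "- k"] le[of 1 k "- k"] that linear_neg[OF L(1), of k] by simp
  qed
qed

section \<open>Ultrafilters and limits along them\<close>

lemma ultrafilter_eventually_or:
  "eventually P (ultrafilter p) \<or> eventually (%x. \<not> P x) (ultrafilter p)"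
  using ultrafilter[of p] by blast

lemma ultrafilter_neq_bot [simp]: "ultrafilter p ~= bot"
  using ultrafilter[of p] by blast

lemma ultrafilter_eventually_not:
  "eventually (%x. \<not> P x) (ultrafilter p) \<longleftrightarrow> \<not> eventually P (ultrafilter p)"
  using ultrafilter_eventually_or[of P p] eventually_conj[of P "ultrafilter p" "%x. \<not> P x"]
  by (auto simp: trivial_limit_def[symmetric])

text \<open>Finer filters are smaller, so an ultrafilter is a minimal proper filter: restricting a
  minimal m to a set either gives \<open>bot\<close> or changes nothing, and this is the ultrafilter
  dichotomy.\<close>

lemma ex_ultrafilter_le:
  assumes "F ~= bot"
  shows "EX p. ultrafilter p <= F"
proof -
  define A where "A = {H. H ~= bot & H <= F}"
  define P where "P = (%H K :: 'a filter. K <= H)"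
  have po: "partial_order_on A (relation_of P A)"
    by (rule partial_order_on_relation_ofI) (auto simp: P_def)
  have ex: "\<exists>m\<in>A. \<forall>a\<in>A. P m a --> a = m"
  proof (rule predicate_Zorn[OF po])
    fix C assume C: "C \<in> Chains (relation_of P A)"
    have CA: "C \<subseteq> A" and ch: "!!q r. q \<in> C ==> r \<in> C ==> P q r \<or> P r q"
      using C unfolding Chains_def relation_of_def by auto
    show "\<exists>u\<in>A. \<forall>a\<in>C. P a u"
    proof (cases "C = {}")
      case True
      then show ?thesis using assms by (auto simp: A_def)
    next
      case ne: False
      have "eventually Q (Inf C) \<longleftrightarrow> (\<exists>H\<in>C. eventually Q H)" for Q
        by (rule eventually_Inf_base[OF ne]) (use ch in \<open>auto simp: P_def\<close>)
      then have "Inf C ~= bot" using CA by (auto simp: A_def trivial_limit_def)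
      moreover have "Inf C <= F"
      proof -
        obtain H where H: "H \<in> C" using ne by blast
        then have "Inf C <= H" by (rule Inf_lower)
        also have "H <= F" using H CA by (auto simp: A_def)
        finally show ?thesis .
      qed
      ultimately show ?thesis by (intro bexI[of _ "Inf C"]) (auto simp: A_def P_def Inf_lower)
    qed
  qed
  then obtain m where m: "m ~= bot" "m <= F" and min: "!!H. H ~= bot ==> H <= m ==> H = m"
    unfolding A_def P_def by (auto intro: order_trans)
  have "eventually P m \<or> eventually (%x. \<not> P x) m" for P
  proof (cases "inf m (principal {x. P x}) = bot")
    case True
    then have "eventually (%x. \<not> P x) m"
      unfolding trivial_limit_def eventually_inf_principal by simp
    then show ?thesis ..
  next
    case False
    then have "inf m (principal {x. P x}) = m" by (intro min) auto
    then have "m <= principal {x. P x}" by (metis inf_le2)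
    then have "eventually P m" by (simp add: le_principal)
    then show ?thesis ..
  qed
  then have "ultrafilter (Abs_stone_cech m) = m" using m by (intro Abs_stone_cech_inverse) blast
  then show ?thesis using m by metis
qed

text \<open>Compactness gives a cluster point, and an ultrafilter converges to each of its cluster
  points.\<close>

lemma ultrafilter_tendsto_ex:
  fixes X :: "'a => 'b::heine_borel"
  assumes "bounded (range X)"
  shows "EX L. (X ---> L) (ultrafilter p)"
proof -
  have c: "compact (closure (range X))" using assms by simp
  have "filtermap X (ultrafilter p) ~= bot" by (simp add: filtermap_bot_iff)
  moreover have "eventually (%x. x \<in> closure (range X)) (filtermap X (ultrafilter p))"
    unfolding eventually_filtermap by (rule always_eventually) (auto intro: subsetD[OF closure_subset])
  ultimately obtain L where L: "inf (nhds L) (filtermap X (ultrafilter p)) ~= bot"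
    using c unfolding compact_filter by blast
  have "(X ---> L) (ultrafilter p)"
    unfolding tendsto_def
  proof (intro allI impI)
    fix S assume S: "open S" "L \<in> S"
    show "eventually (%x. X x \<in> S) (ultrafilter p)"
    proof (rule ccontr)
      assume "\<not> ?thesis"
      then have "eventually (%x. x \<notin> S) (filtermap X (ultrafilter p))"
        by (simp add: eventually_filtermap ultrafilter_eventually_not)
      moreover have "eventually (%x. x \<in> S) (nhds L)" using S by (simp add: eventually_nhds) blast
      ultimately have "eventually (%x. False) (inf (nhds L) (filtermap X (ultrafilter p)))"
        unfolding eventually_inf by blast
      then show False using L by (simp add: trivial_limit_def)
    qed
  qed
  then show ?thesis by blast
qed

text \<open>One free ultrafilter on \<open>nat\<close>, fixed once and for all. Limits along it
  exist for all bounded real sequences and respect algebraic identities, so they replace weak-*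
  convergent subnets.\<close>

definition free_uf :: "nat filter" where
  "free_uf = ultrafilter (SOME p. ultrafilter p <= sequentially)"

lemma free_uf_le: "free_uf <= sequentially"
  unfolding free_uf_def by (rule someI_ex[OF ex_ultrafilter_le]) simp

lemma free_uf_neq_bot [simp]: "free_uf ~= bot"
  by (simp add: free_uf_def)

lemma free_uf_not:
  "eventually (%x. \<not> P x) free_uf \<longleftrightarrow> \<not> eventually P free_uf"
  by (simp add: free_uf_def ultrafilter_eventually_not)

lemma tendsto_free_uf: "X ----> L ==> (X ---> L) free_uf"
  by (rule tendsto_mono[OF free_uf_le])

lemma eventually_free_uf: "eventually P sequentially ==> eventually P free_uf"
  by (rule filter_leD[OF free_uf_le])

lemma free_uf_lim:
  fixes X :: "nat => 'b::heine_borel"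
  assumes "bounded (range X)"
  shows "(X ---> Lim free_uf X) free_uf"
proof -
  obtain L where "(X ---> L) free_uf"
    using ultrafilter_tendsto_ex[OF assms] unfolding free_uf_def by blast
  then show ?thesis by (metis free_uf_neq_bot tendsto_Lim)
qed

section \<open>Functions on the Stone-Cech compactification\<close>

lift_definition principal_point :: "'g => 'g stone_cech" is "%x. principal {x}"
  by (auto simp: eventually_principal principal_eq_bot_iff)

lemma eventually_principal_point [simp]: "eventually P (ultrafilter (principal_point x)) \<longleftrightarrow> P x"
  by (simp add: principal_point.rep_eq eventually_principal)

lemma stone_cech_act_principal_point: "stone_cech_act g (principal_point h) = principal_point (g + h)"
  by (rule ultrafilter_inject[THEN iffD1]) (simp add: stone_cech_act.rep_eq principal_point.rep_eq filtermap_principal)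

text \<open>A point x of \<beta>G is the limit, along the ultrafilter x, of the principal
  ultrafilters. Identities and bounds in C(\<beta>G) therefore need to be checked at group elements
  only.\<close>

lemma CX_tendsto:
  fixes s :: "'g CX"
  shows "((%h. s (principal_point h)) ---> s x) (ultrafilter x)"
  unfolding tendsto_def
proof (intro allI impI)
  fix U assume U: "open U" "s x \<in> U"
  have "open (s -` U)"
    using continuous_on_open_vimage[OF open_UNIV, of s] U(1) apply_bcontfun[of s] by (simp add: bcontfun_def)
  then obtain P where P: "eventually P (ultrafilter x)" "{q. eventually P (ultrafilter q)} \<subseteq> s -` U"
    using U(2) unfolding open_stone_cech_def by blast
  show "eventually (%h. s (principal_point h) \<in> U) (ultrafilter x)"
  proof (rule eventually_mono[OF P(1)])
    fix h assume "P h"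
    then have "principal_point h \<in> s -` U" by (intro subsetD[OF P(2)]) simp
    then show "s (principal_point h) \<in> U" by simp
  qed
qed

lemma CX_eqI:
  fixes s t :: "'g CX"
  assumes "!!h. s (principal_point h) = t (principal_point h)"
  shows "s = t"
proof (rule bcontfun_eqI)
  fix x
  show "s x = t x"
    using tendsto_unique[OF ultrafilter_neq_bot CX_tendsto[of s x]] CX_tendsto[of t x] assms by simp
qed

lemma CX_sum_abs_le:
  fixes f :: "'i => 'g CX"
  assumes "!!h. (\<Sum>i\<in>A. \<bar>f i (principal_point h)\<bar>) <= b"
  shows "(\<Sum>i\<in>A. \<bar>f i x\<bar>) <= b"
proof (rule tendsto_upperbound)
  show "((%h. \<Sum>i\<in>A. \<bar>f i (principal_point h)\<bar>) ---> (\<Sum>i\<in>A. \<bar>f i x\<bar>)) (ultrafilter x)"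
    by (intro tendsto_sum tendsto_rabs CX_tendsto)
qed (use assms in auto)

lemma CX_norm_le:
  fixes s :: "'g CX"
  assumes "!!h. \<bar>s (principal_point h)\<bar> <= b"
  shows "norm s <= b"
proof (rule norm_bound)
  show "norm (s x) <= b" for x
    using CX_sum_abs_le[of "%_. s" "{()}" b x] assms by simp
qed

text \<open>The inverse of restriction to G for bounded f: this is the identification of
  l^\<infinity>(G) with C(\<beta>G).\<close>

definition CX_ext :: "('g => real) => 'g CX" where
  "CX_ext f = Bcontfun (%x. Lim (ultrafilter x) f)"

lemma CX_ext:
  assumes "bounded (range f)"
  shows "(f ---> CX_ext f x) (ultrafilter x)"
proof -
  let ?L = "%x. Lim (ultrafilter x) f"
  have lim: "(f ---> ?L x) (ultrafilter x)" for x
  proof -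
    obtain L where "(f ---> L) (ultrafilter x)" using ultrafilter_tendsto_ex[OF assms] by blast
    then show ?thesis by (metis ultrafilter_neq_bot tendsto_Lim)
  qed
  have "open (?L -` U)" if U: "open U" for U
    unfolding open_stone_cech_def
  proof
    fix x assume "x \<in> ?L -` U"
    \<comment> \<open>The ball is closed so that a limit of values in it stays in it, while
      membership of \<open>f h\<close> in it is a basic open condition on the ultrafilter.\<close>
    then obtain e where e: "e > 0" "cball (?L x) e \<subseteq> U" using U open_contains_cball by (metis vimageE)
    let ?P = "%h. f h \<in> cball (?L x) e"
    have 1: "eventually ?P (ultrafilter x)"
      using tendstoD[OF lim[of x] e(1)] by (rule eventually_mono) (simp add: dist_commute less_imp_le)
    have 2: "?L q \<in> U" if "eventually ?P (ultrafilter q)" for q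
      using Lim_in_closed_set[OF closed_cball that _ lim[of q]] e(2) by auto
    show "EX P. eventually P (ultrafilter x) & {q. eventually P (ultrafilter q)} \<subseteq> ?L -` U"
      using 1 2 by blast
  qed
  then have "continuous_on UNIV ?L" by (auto simp: continuous_on_open_vimage)
  moreover obtain B where B: "!!h. norm (f h) <= B" using assms by (auto simp: bounded_iff)
  have "norm (?L x) <= B" for x
    by (rule tendsto_upperbound[OF tendsto_norm[OF lim]]) (use B in auto)
  ultimately have "?L \<in> bcontfun" by (intro bcontfun_normI)
  then show ?thesis using lim[of x] by (simp add: CX_ext_def Bcontfun_inverse)
qed

lemma CX_ext_principal_point:
  assumes "bounded (range f)"
  shows "CX_ext f (principal_point h) = f h"
proof -
  have "(f ---> f h) (ultrafilter (principal_point h))"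
    by (rule tendsto_eventually) simp
  then show ?thesis
    using tendsto_unique[OF _ CX_ext[OF assms, of "principal_point h"]] by simp
qed

definition CX_ind :: "'g set => 'g CX" where
  "CX_ind A = CX_ext (indicator A)"

lemma CX_ind_principal_point [simp]: "CX_ind A (principal_point h) = indicator A h"
  unfolding CX_ind_def
  by (rule CX_ext_principal_point) (auto simp: bounded_iff indicator_def intro!: exI[of _ 1])

lemma CX_ind_apply: "CX_ind A x = (if eventually (%h. h \<in> A) (ultrafilter x) then 1 else 0)"
proof -
  have t: "((%h. indicator A h :: real) ---> CX_ind A x) (ultrafilter x)"
    using CX_tendsto[of "CX_ind A" x] by simp
  have "((%h. indicator A h) ---> (if eventually (%h. h \<in> A) (ultrafilter x) then 1 else 0::real)) (ultrafilter x)"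
  proof (rule tendsto_eventually, cases "eventually (%h. h \<in> A) (ultrafilter x)")
    case True
    then show "eventually (%h. indicator A h = (if eventually (%h. h \<in> A) (ultrafilter x) then 1 else 0::real)) (ultrafilter x)"
      by (auto elim: eventually_mono)
  next
    case False
    then have "eventually (%h. h \<notin> A) (ultrafilter x)" by (simp add: ultrafilter_eventually_not)
    then show "eventually (%h. indicator A h = (if eventually (%h. h \<in> A) (ultrafilter x) then 1 else 0::real)) (ultrafilter x)"
      using False by (auto elim: eventually_mono)
  qed
  then show ?thesis using tendsto_unique[OF ultrafilter_neq_bot t] by blast
qed

lemma closed_support_CX_ind: "closed_support (CX_ind A) \<subseteq> {x. eventually (%h. h \<in> A) (ultrafilter x)}"
  unfolding closed_support_def
proof (rule closure_minimal)
  have "open {x. eventually (%h. h \<notin> A) (ultrafilter x)}" by (rule open_stone_cech_basic)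
  also have "{x. eventually (%h. h \<notin> A) (ultrafilter x)} = - {x. eventually (%h. h \<in> A) (ultrafilter x)}"
    by (auto simp: ultrafilter_eventually_not)
  finally show "closed {x. eventually (%h. h \<in> A) (ultrafilter x)}" by (simp add: closed_def)
qed (auto simp: CX_ind_apply)

lemma closed_support_CX_ind_disjoint:
  assumes "A \<inter> B = {}"
  shows "closed_support (CX_ind A) \<inter> closed_support (CX_ind B) = {}"
proof (rule ccontr)
  assume "\<not> ?thesis"
  then obtain x where "eventually (%h. h \<in> A) (ultrafilter x)" "eventually (%h. h \<in> B) (ultrafilter x)"
    using closed_support_CX_ind by blast
  then have "eventually (%h. False) (ultrafilter x)"
    by eventually_elim (use assms in auto)
  then show False by simp
qed

lemma CX_ind_idem: "CX_mult (CX_ind A) (CX_ind A) = CX_ind A"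
  by (rule CX_eqI) (simp add: CX_mult_apply indicator_def)

lemma CX_ind_Un: "A \<inter> B = {} ==> CX_ind (A \<union> B) = CX_ind A + CX_ind B"
  by (rule CX_eqI) (auto simp: indicator_def)

lemma CX_ind_UNIV: "CX_ind UNIV = one_CX"
  by (rule CX_eqI) simp

lemma CX_ind_empty: "CX_ind {} = 0"
  by (rule CX_eqI) simp

text \<open>The group elements where s does not vanish form a set A on which t vanishes, so disjoint
  supports can be exchanged for the complementary idempotents of A and - A.\<close>

lemma CX_mult_support_ind:
  fixes s t :: "'g CX"
  assumes "closed_support s \<inter> closed_support t = {}"
  obtains A where "CX_mult s (CX_ind A) = s" "CX_mult t (CX_ind (- A)) = t"
    "CX_mult s (CX_ind (- A)) = 0" "CX_mult t (CX_ind A) = 0"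
proof
  let ?A = "{h. s (principal_point h) ~= 0}"
  have t0: "t (principal_point h) = 0" if "s (principal_point h) ~= 0" for h
  proof (rule ccontr)
    assume "t (principal_point h) ~= 0"
    then have "principal_point h \<in> closed_support t" "principal_point h \<in> closed_support s"
      using that by (auto simp: closed_support_def intro!: subsetD[OF closure_subset])
    then show False using assms by blast
  qed
  show "CX_mult s (CX_ind ?A) = s" "CX_mult t (CX_ind (- ?A)) = t"
    "CX_mult s (CX_ind (- ?A)) = 0" "CX_mult t (CX_ind ?A) = 0"
    using t0 by (auto intro!: CX_eqI simp: CX_mult_apply indicator_def)
qed

section \<open>Geometric modules and bounded cohomology\<close>

context
  fixes smul :: "'g CX => 'e::banach => 'e"
  assumes CX_module: "CX_module smul"
begin

lemma smul_linear_left: "linear (%t. smul t v)" and smul_linear_right: "linear (smul t)"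
  and smul_mult: "smul (CX_mult s t) v = smul s (smul t v)" and smul_one: "smul one_CX v = v"
  and smul_norm: "norm (smul t v) <= norm t * norm v"
  using CX_module unfolding CX_module_def by auto

lemmas smul_simps = linear_add[OF smul_linear_left] linear_add[OF smul_linear_right]
  linear_scale[OF smul_linear_left] linear_scale[OF smul_linear_right]
  linear_diff[OF smul_linear_left] linear_diff[OF smul_linear_right]
  linear_0[OF smul_linear_left] linear_0[OF smul_linear_right]

text \<open>Disjoint sets of group elements have idempotents with disjoint closed supports, so
  geometricity applies one piece at a time.\<close>

lemma l1_geometric_sum_ind:
  assumes geo: "l1_geometric smul" and "finite L" and "disjoint_family_on A L"
  shows "norm (smul (CX_ind (\<Union>\<kappa>\<in>L. A \<kappa>)) v) = (\<Sum>\<kappa>\<in>L. norm (smul (CX_ind (A \<kappa>)) v))"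
  using assms(2,3)
proof (induction L)
  case empty
  then show ?case by (simp add: CX_ind_empty smul_simps)
next
  case (insert k L)
  let ?U = "\<Union>\<kappa>\<in>L. A \<kappa>"
  have dis: "A k \<inter> ?U = {}" using insert by (auto simp: disjoint_family_on_def)
  have "disjointly_supported smul (smul (CX_ind (A k)) v) (smul (CX_ind ?U) v)"
    unfolding disjointly_supported_def
    by (intro exI[of _ "CX_ind (A k)"] exI[of _ "CX_ind ?U"])
      (simp add: closed_support_CX_ind_disjoint[OF dis] smul_mult[symmetric] CX_ind_idem)
  then have "norm (smul (CX_ind (A k)) v + smul (CX_ind ?U) v) =
      norm (smul (CX_ind (A k)) v) + norm (smul (CX_ind ?U) v)"
    using geo unfolding l1_geometric_def by blast
  moreover have "norm (smul (CX_ind ?U) v) = (\<Sum>\<kappa>\<in>L. norm (smul (CX_ind (A \<kappa>)) v))"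
    using insert by (intro insert.IH) (auto simp: disjoint_family_on_def)
  ultimately show ?case
    using insert dis by (simp add: CX_ind_Un smul_simps)
qed

text \<open>The inequality is immediate for step functions, and on the totally disconnected space \<open>\<beta>G\<close>
  finitely many continuous functions are simultaneously uniformly close to step functions.\<close>

lemma l1_geometric_sum_le:
  fixes f :: "'i => 'g CX"
  assumes geo: "l1_geometric smul" and fin: "finite I"
    and C: "!!h. (\<Sum>i\<in>I. \<bar>f i (principal_point h)\<bar>) <= C"
  shows "(\<Sum>i\<in>I. norm (smul (f i) v)) <= C * norm v"
proof -
  \<comment> \<open>Each index i costs \<delta> twice, once in the coefficients of the step function
    and once in replacing \<open>f i\<close> by \<open>s i\<close>; this is the factor 2.\<close>
  have step: "(\<Sum>i\<in>I. norm (smul (f i) v)) <= C * norm v + \<delta> * (2 * card I * norm v)" if \<delta>: "\<delta> > 0" for \<delta>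
  proof -
    \<comment> \<open>\<open>k h\<close> records for all i at once the values at h, rounded down to
      multiples of \<delta>. It takes finitely many values and its level sets partition G, so all
      the \<open>s i\<close> are step functions over one partition.\<close>
    define k where "k h = restrict (%i. \<lfloor>f i (principal_point h) / \<delta>\<rfloor>) I" for h
    define L where "L = range k"
    define A where "A \<kappa> = {h. k h = \<kappa>}" for \<kappa>
    define s where "s i = (\<Sum>\<kappa>\<in>L. (\<delta> * of_int (\<kappa> i)) *\<^sub>R CX_ind (A \<kappa>))" for i
    have "L \<subseteq> (\<Pi>\<^sub>E i\<in>I. {- \<lceil>norm (f i) / \<delta>\<rceil> - 1..\<lceil>norm (f i) / \<delta>\<rceil> + 1})"
    proof -
      have "\<lfloor>f i x / \<delta>\<rfloor> \<in> {- \<lceil>norm (f i) / \<delta>\<rceil> - 1..\<lceil>norm (f i) / \<delta>\<rceil> + 1}" for i x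
      proof -
        have "\<bar>f i x / \<delta>\<bar> <= norm (f i) / \<delta>"
          using norm_bounded[of "f i" x] \<delta> by (simp add: divide_right_mono)
        then show ?thesis by (simp only: atLeastAtMost_iff) linarith
      qed
      then show ?thesis by (auto simp: L_def k_def PiE_def extensional_def)
    qed
    then have finL: "finite L" by (rule finite_subset) (intro finite_PiE fin, simp)
    have s_pt: "s i (principal_point h) = \<delta> * of_int \<lfloor>f i (principal_point h) / \<delta>\<rfloor>" if "i \<in> I" for i h
    proof -
      have "s i (principal_point h) = (\<Sum>\<kappa>\<in>L. if \<kappa> = k h then \<delta> * of_int (\<kappa> i) else 0)"
        unfolding s_def sum_bcontfun_apply by (intro sum.cong) (auto simp: A_def)
      also have "... = \<delta> * of_int (k h i)" using finL by (simp add: L_def)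
      finally show ?thesis using that by (simp add: k_def)
    qed
    have fl: "\<bar>y - \<delta> * of_int \<lfloor>y / \<delta>\<rfloor>\<bar> <= \<delta>" for y
    proof -
      have "\<bar>y / \<delta> - of_int \<lfloor>y / \<delta>\<rfloor>\<bar> <= 1" by linarith
      then have "\<delta> * \<bar>y / \<delta> - of_int \<lfloor>y / \<delta>\<rfloor>\<bar> <= \<delta> * 1" using \<delta> by (intro mult_left_mono) auto
      also have "\<delta> * \<bar>y / \<delta> - of_int \<lfloor>y / \<delta>\<rfloor>\<bar> = \<bar>\<delta> * (y / \<delta> - of_int \<lfloor>y / \<delta>\<rfloor>)\<bar>" using \<delta> by (simp add: abs_mult)
      also have "\<delta> * (y / \<delta> - of_int \<lfloor>y / \<delta>\<rfloor>) = y - \<delta> * of_int \<lfloor>y / \<delta>\<rfloor>" using \<delta> by (simp add: right_diff_distrib)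
      finally show ?thesis by simp
    qed
    have close: "norm (f i - s i) <= \<delta>" if "i \<in> I" for i
      by (rule CX_norm_le) (simp add: s_pt[OF that] fl)
    have dis: "disjoint_family_on A L" by (auto simp: disjoint_family_on_def A_def)
    have UL: "(\<Union>\<kappa>\<in>L. A \<kappa>) = UNIV" by (auto simp: A_def L_def)
    have tot: "(\<Sum>\<kappa>\<in>L. norm (smul (CX_ind (A \<kappa>)) v)) = norm v"
      using l1_geometric_sum_ind[OF geo finL dis, of v] by (simp add: UL CX_ind_UNIV smul_one)
    have coef: "(\<Sum>i\<in>I. \<bar>\<delta> * of_int (\<kappa> i)\<bar>) <= C + card I * \<delta>" if \<kappa>: "\<kappa> \<in> L" for \<kappa>
    proof -
      obtain h where h: "\<kappa> = k h" using \<kappa> by (auto simp: L_def)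
      have "(\<Sum>i\<in>I. \<bar>\<delta> * of_int (\<kappa> i)\<bar>) <= (\<Sum>i\<in>I. \<bar>f i (principal_point h)\<bar> + \<delta>)"
      proof (rule sum_mono)
        fix i assume "i \<in> I"
        then show "\<bar>\<delta> * of_int (\<kappa> i)\<bar> <= \<bar>f i (principal_point h)\<bar> + \<delta>"
          using fl[of "f i (principal_point h)"] by (simp add: h k_def)
      qed
      also have "... <= C + card I * \<delta>" using C[of h] by (simp add: sum.distrib)
      finally show ?thesis .
    qed
    have "(\<Sum>i\<in>I. norm (smul (s i) v)) <= (\<Sum>i\<in>I. \<Sum>\<kappa>\<in>L. \<bar>\<delta> * of_int (\<kappa> i)\<bar> * norm (smul (CX_ind (A \<kappa>)) v))"
    proof (rule sum_mono)
      fix i assume "i \<in> I"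
      have "smul (s i) v = (\<Sum>\<kappa>\<in>L. (\<delta> * of_int (\<kappa> i)) *\<^sub>R smul (CX_ind (A \<kappa>)) v)"
        unfolding s_def by (simp add: linear_sum[OF smul_linear_left] smul_simps)
      then show "norm (smul (s i) v) <= (\<Sum>\<kappa>\<in>L. \<bar>\<delta> * of_int (\<kappa> i)\<bar> * norm (smul (CX_ind (A \<kappa>)) v))"
        by (simp only:) (rule order_trans[OF norm_sum], simp)
    qed
    also have "... = (\<Sum>\<kappa>\<in>L. (\<Sum>i\<in>I. \<bar>\<delta> * of_int (\<kappa> i)\<bar>) * norm (smul (CX_ind (A \<kappa>)) v))"
      by (subst sum.swap) (simp only: sum_distrib_right)
    also have "... <= (\<Sum>\<kappa>\<in>L. (C + card I * \<delta>) * norm (smul (CX_ind (A \<kappa>)) v))"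
      by (intro sum_mono mult_right_mono coef) auto
    also have "... = (C + card I * \<delta>) * norm v" by (simp only: sum_distrib_left[symmetric] tot)
    finally have 1: "(\<Sum>i\<in>I. norm (smul (s i) v)) <= (C + card I * \<delta>) * norm v" .
    have "(\<Sum>i\<in>I. norm (smul (f i) v)) <= (\<Sum>i\<in>I. norm (smul (s i) v) + \<delta> * norm v)"
    proof (rule sum_mono)
      fix i assume i: "i \<in> I"
      have "smul (f i) v = smul (s i) v + smul (f i - s i) v" by (simp add: smul_simps)
      then have "norm (smul (f i) v) <= norm (smul (s i) v) + norm (smul (f i - s i) v)"
        by (metis norm_triangle_ineq)
      also have "norm (smul (f i - s i) v) <= norm (f i - s i) * norm v" by (rule smul_norm)
      also have "... <= \<delta> * norm v" by (intro mult_right_mono close i) simp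
      finally show "norm (smul (f i) v) <= norm (smul (s i) v) + \<delta> * norm v" by simp
    qed
    also have "... = (\<Sum>i\<in>I. norm (smul (s i) v)) + card I * (\<delta> * norm v)" by (simp add: sum.distrib)
    finally show ?thesis using 1 by (simp add: algebra_simps)
  qed
  show ?thesis
  proof (rule field_le_epsilon)
    fix e :: real assume e: "e > 0"
    let ?K = "2 * card I * norm v + 1"
    have "?K > 0" by (smt (verit) mult_nonneg_nonneg norm_ge_zero of_nat_0_le_iff)
    moreover have "e / ?K * (2 * card I * norm v) <= e / ?K * ?K"
      using e \<open>?K > 0\<close> by (intro mult_left_mono) auto
    ultimately show "(\<Sum>i\<in>I. norm (smul (f i) v)) <= C * norm v + e"
      using step[of "e / ?K"] e by simp
  qed
qed

end

text \<open>A Reiter-type condition for amenability of the action on \<open>\<beta>G\<close>.\<close>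

definition amenable_seq :: "(nat => 'g::group_add V) => bool" where
  "amenable_seq f \<longleftrightarrow> (ALL n. f n \<in> W00 & pi00 (f n) = 1) & (EX C. ALL n. norm (f n) <= C) &
     (ALL g. (%n. norm (V_act g (f n) - f n)) ----> 0)"

section \<open>Averaging cochains against measures with values in C(\<beta>G)\<close>

lemma V_minus_apply: "V_apply (f - g) h = V_apply f h - V_apply g h"
  unfolding minus_V_def plus_V.rep_eq uminus_V.rep_eq by simp

definition V_supp :: "'g V => 'g set" where "V_supp w = {h. V_apply w h ~= 0}"

text \<open>Integration of the family \<alpha> against w, regarded as a measure on G with values in
  C(\<beta>G) that acts through the module structure. For a constant family only the total mass
  \<open>pi00 w\<close> remains.\<close>

definition V_pairing :: "('g CX => 'e::banach => 'e) => ('g => 'e \<Rightarrow>\<^sub>L real) => 'g V => 'e => real" where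
  "V_pairing smul \<alpha> w v = (\<Sum>h\<in>V_supp w. \<alpha> h (smul (V_apply w h) v))"

lemma W00_finite_supp: "w \<in> W00 ==> finite (V_supp w)"
  by (simp add: W00_def V_supp_def)

text \<open>For a cocycle the left side vanishes, so prepending h inverts the differential. This is
  the contracting homotopy before averaging.\<close>

lemma differential_Cons:
  "differential \<phi> (h # gs) = \<phi> gs - differential (%xs. \<phi> (h # xs)) gs"
  unfolding differential_def length_Cons sum.lessThan_Suc_shift
  by (simp add: sum_negf)

lemma differential_linear_functional:
  assumes "linear L"
  shows "L (differential \<phi> gs) = differential (%xs. L (\<phi> xs)) gs"
  unfolding differential_def by (simp add: linear_sum[OF assms] linear_scale[OF assms])

context
  fixes act :: "'g::group_add => 'e::banach => 'e" and smul :: "'g CX => 'e => 'e"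
  assumes module: "G_CX_module act smul" and geo: "l1_geometric smul"
begin

lemma CX_mod: "CX_module smul" and iso: "isometric_action act"
  and act_smul: "act g (smul t v) = smul (CX_act g t) (act g v)"
  using module unfolding G_CX_module_def by auto

lemmas sm = smul_simps[OF CX_mod]

lemma V_pairing_superset:
  assumes "finite A" "V_supp w \<subseteq> A"
  shows "V_pairing smul \<alpha> w v = (\<Sum>h\<in>A. \<alpha> h (smul (V_apply w h) v))"
  unfolding V_pairing_def
  by (rule sum.mono_neutral_left) (use assms in \<open>auto simp: V_supp_def sm blinfun.zero_right\<close>)

text \<open>Geometricity enters here: it bounds the sum over h of the norms of all products of
  \<open>V_apply w h\<close> with v by \<open>norm w * norm v\<close>, although
  \<open>norm w\<close> is a supremum of pointwise sums and not a sum of suprema.\<close>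

lemma V_pairing_bound:
  assumes fin: "finite (V_supp w)" and \<alpha>: "!!h. norm (\<alpha> h) <= M" "M >= 0"
  shows "\<bar>V_pairing smul \<alpha> w v\<bar> <= M * (norm w * norm v)"
proof -
  have "\<bar>V_pairing smul \<alpha> w v\<bar> <= (\<Sum>h\<in>V_supp w. \<bar>\<alpha> h (smul (V_apply w h) v)\<bar>)"
    unfolding V_pairing_def by (rule sum_abs)
  also have "... <= (\<Sum>h\<in>V_supp w. M * norm (smul (V_apply w h) v))"
  proof (rule sum_mono)
    fix h
    have "\<bar>\<alpha> h (smul (V_apply w h) v)\<bar> <= norm (\<alpha> h) * norm (smul (V_apply w h) v)"
      using norm_blinfun[of "\<alpha> h" "smul (V_apply w h) v"] by simp
    also have "... <= M * norm (smul (V_apply w h) v)" by (intro mult_right_mono \<alpha>) simp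
    finally show "\<bar>\<alpha> h (smul (V_apply w h) v)\<bar> <= M * norm (smul (V_apply w h) v)" .
  qed
  also have "... = M * (\<Sum>h\<in>V_supp w. norm (smul (V_apply w h) v))" by (simp add: sum_distrib_left)
  also have "... <= M * (norm w * norm v)"
  proof (intro mult_left_mono \<alpha> l1_geometric_sum_le[OF CX_mod geo fin])
    fix h
    have "(\<Sum>i\<in>V_supp w. \<bar>V_apply w i (principal_point h)\<bar>) <= (\<Sum>\<^sub>\<infinity>i. \<bar>V_apply w i (principal_point h)\<bar>)"
      by (rule finite_sum_le_infsum) (use fin V_summable in simp_all)
    also have "... <= norm w" by (rule V_mass_le_norm)
    finally show "(\<Sum>i\<in>V_supp w. \<bar>V_apply w i (principal_point h)\<bar>) <= norm w" .
  qed
  finally show ?thesis .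
qed

lemma V_pairing_diff:
  assumes "finite (V_supp w)" "finite (V_supp u)"
  shows "V_pairing smul \<alpha> (w - u) v = V_pairing smul \<alpha> w v - V_pairing smul \<alpha> u v"
proof -
  let ?A = "V_supp w \<union> V_supp u"
  have "V_supp (w - u) \<subseteq> ?A" by (auto simp: V_supp_def V_minus_apply)
  then show ?thesis
    using assms V_pairing_superset[of ?A "w - u"] V_pairing_superset[of ?A w] V_pairing_superset[of ?A u]
    by (simp add: V_minus_apply sm blinfun.diff_right sum_subtractf)
qed

lemma V_pairing_add_right: "V_pairing smul \<alpha> w (v + v') = V_pairing smul \<alpha> w v + V_pairing smul \<alpha> w v'"
  by (simp add: V_pairing_def sm blinfun.add_right sum.distrib)

lemma V_pairing_scale_right: "V_pairing smul \<alpha> w (r *\<^sub>R v) = r * V_pairing smul \<alpha> w v"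
  by (simp add: V_pairing_def sm blinfun.scaleR_right sum_distrib_left)

lemma V_pairing_const:
  assumes "w \<in> W00"
  shows "V_pairing smul (%h. \<alpha>) w v = pi00 w * \<alpha> v"
proof -
  have "V_pairing smul (%h. \<alpha>) w v = \<alpha> (smul (\<Sum>h\<in>V_supp w. V_apply w h) v)"
    by (simp add: V_pairing_def linear_sum[OF smul_linear_left[OF CX_mod]] blinfun.sum_right)
  also have "(\<Sum>h\<in>V_supp w. V_apply w h) = pi00 w *\<^sub>R one_CX"
    using W00_sum[OF assms] by (simp only: V_supp_def)
  finally show ?thesis by (simp only: sm smul_one[OF CX_mod] blinfun.scaleR_right real_scaleR_def)
qed

lemma V_pairing_equivariant:
  assumes fin: "finite (V_supp w)"
    and eq: "!!h. \<alpha> (k + h) = dual_act act k (\<beta> h)"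
  shows "V_pairing smul \<alpha> w v = V_pairing smul \<beta> (V_act (- k) w) (act (- k) v)"
proof -
  have supp: "V_supp (V_act (- k) w) \<subseteq> (%h. - k + h) ` V_supp w"
  proof
    fix h assume "h \<in> V_supp (V_act (- k) w)"
    then have "V_apply w (k + h) ~= 0"
      using linear_0[OF CX_act_linear, of "- k"] by (auto simp: V_supp_def V_apply_act)
    then show "h \<in> (%h. - k + h) ` V_supp w"
      by (intro image_eqI[of _ _ "k + h"]) (simp_all add: V_supp_def add.assoc[symmetric])
  qed
  have "V_pairing smul \<beta> (V_act (- k) w) (act (- k) v) =
     (\<Sum>h\<in>(%h. - k + h) ` V_supp w. \<beta> h (smul (V_apply (V_act (- k) w) h) (act (- k) v)))"
    by (rule V_pairing_superset) (use fin supp in auto)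
  also have "... = (\<Sum>h\<in>V_supp w. \<beta> (- k + h) (smul (V_apply (V_act (- k) w) (- k + h)) (act (- k) v)))"
    by (subst sum.reindex) (auto simp: inj_on_def)
  also have "... = (\<Sum>h\<in>V_supp w. \<alpha> h (smul (V_apply w h) v))"
  proof (rule sum.cong[OF refl])
    fix h
    have "\<alpha> h = dual_act act k (\<beta> (- k + h))" using eq[of "- k + h"] by (simp add: add.assoc[symmetric])
    then have "\<alpha> h (smul (V_apply w h) v) = \<beta> (- k + h) (smul (CX_act (- k) (V_apply w h)) (act (- k) v))"
      by (simp add: dual_act_apply[OF iso] act_smul)
    then show "\<beta> (- k + h) (smul (V_apply (V_act (- k) w) (- k + h)) (act (- k) v)) = \<alpha> h (smul (V_apply w h) v)"
      by (simp add: V_apply_act add.assoc[symmetric])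
  qed
  finally show ?thesis by (simp add: V_pairing_def)
qed

text \<open>For fixed h the cone \<open>\<phi> (h # gs)\<close> is a primitive of \<phi>, but not an
  equivariant one. Averaging it over \<open>f n\<close> keeps it a primitive, since
  \<open>f n\<close> has total mass 1, and makes the failure of equivariance tend to 0; the
  ultralimit is a bounded equivariant primitive.\<close>

lemma bcocycle_is_bcoboundary:
  fixes f :: "nat => 'g V"
  assumes f: "amenable_seq f" and p: "p >= 1" and \<phi>: "\<phi> \<in> bcocycles (dual_act act) p"
  shows "\<phi> \<in> bcoboundaries (dual_act act) p"
proof -
  obtain C where C: "!!n. norm (f n) <= C" using f unfolding amenable_seq_def by blast
  have fW: "f n \<in> W00" and fpi: "pi00 (f n) = 1" for n using f unfolding amenable_seq_def by auto
  have fin: "finite (V_supp (f n))" for n by (rule W00_finite_supp[OF fW])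
  have C0: "C >= 0" using C[of 0] norm_ge_zero[of "f 0"] by linarith
  have \<phi>len: "\<phi> gs = 0" if "length gs ~= p + 1" for gs
    using \<phi> that by (auto simp: bcocycles_def bcochains_def)
  have \<phi>eq: "\<phi> (map ((+) k) gs) = dual_act act k (\<phi> gs)" if "length gs = p + 1" for k gs
    using \<phi> that by (auto simp: bcocycles_def bcochains_def)
  have d\<phi>: "differential \<phi> gs = 0" for gs
    using \<phi> by (auto simp: bcocycles_def fun_eq_iff)
  obtain M where M: "!!gs. norm (\<phi> gs) <= M"
    using \<phi> unfolding bcocycles_def bcochains_def bounded_iff by auto
  have M0: "M >= 0" using M[of "[]"] norm_ge_zero[of "\<phi> []"] by linarith
  define P where "P gs n v = V_pairing smul (%h. \<phi> (h # gs)) (f n) v" for gs n v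
  have Pb: "\<bar>P gs n v\<bar> <= (M * C) * norm v" for gs n v
  proof -
    have "\<bar>P gs n v\<bar> <= M * (norm (f n) * norm v)"
      unfolding P_def by (rule V_pairing_bound[OF fin M M0])
    also have "... <= M * (C * norm v)" by (intro mult_left_mono mult_right_mono C M0) simp
    finally show ?thesis by simp
  qed
  define Q where "Q gs v = Lim free_uf (%n. P gs n v)" for gs v
  have Q: "((%n. P gs n v) ---> Q gs v) free_uf" for gs v
    unfolding Q_def
    by (rule free_uf_lim) (use Pb in \<open>auto simp: bounded_iff\<close>)
  have Q_eq: "Q gs v = L" if "((%n. P gs n v) ---> L) free_uf" for gs v L
    by (rule tendsto_unique[OF _ Q that]) simp
  have Qb: "\<bar>Q gs v\<bar> <= norm v * (M * C)" for gs v
    by (rule tendsto_upperbound[OF tendsto_rabs[OF Q]]) (use Pb in \<open>simp_all add: mult.commute\<close>)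
  have Qlin: "bounded_linear (Q gs)" for gs
  proof (rule bounded_linear_intro[of _ "M * C"])
    show "Q gs (x + y) = Q gs x + Q gs y" for x y
      by (rule Q_eq) (simp add: P_def V_pairing_add_right tendsto_add[OF Q Q, unfolded P_def])
    show "Q gs (r *\<^sub>R x) = r *\<^sub>R Q gs x" for r x
      by (rule Q_eq) (simp add: P_def V_pairing_scale_right tendsto_mult_left[OF Q, unfolded P_def])
  qed (use Qb in simp)
  obtain m where m: "p = Suc m" using p by (cases p) auto
  define \<psi> where "\<psi> gs = (if length gs = p then Blinfun (Q gs) else 0)" for gs
  have \<psi>_apply: "\<psi> gs v = Q gs v" if "length gs = p" for gs v
    using that by (simp add: \<psi>_def bounded_linear_Blinfun_apply[OF Qlin])
  have "\<psi> \<in> bcochains (dual_act act) m"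
    unfolding bcochains_def
  proof (intro CollectI conjI allI impI)
    show "length gs ~= m + 1 ==> \<psi> gs = 0" for gs by (simp add: \<psi>_def m)
    have "norm (\<psi> gs) <= M * C" for gs
    proof (cases "length gs = p")
      case True
      show ?thesis
        by (rule norm_blinfun_bound) (use Qb M0 C0 in \<open>simp_all add: \<psi>_apply[OF True] mult.commute\<close>)
    qed (use M0 C0 in \<open>simp add: \<psi>_def\<close>)
    then show "bounded (range \<psi>)" by (auto simp: bounded_iff)
    fix k and gs :: "'g list" assume len: "length gs = m + 1"
    show "\<psi> (map ((+) k) gs) = dual_act act k (\<psi> gs)"
    proof (rule blinfun_eqI)
      fix v
      let ?u = "%n. V_act (- k) (f n)"
      have u: "finite (V_supp (?u n))" for n using W00_act[OF fW] W00_finite_supp by blast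
      have 1: "P (map ((+) k) gs) n v = V_pairing smul (%h. \<phi> (h # gs)) (?u n) (act (- k) v)" for n
        unfolding P_def
      proof (rule V_pairing_equivariant[OF fin])
        show "\<phi> ((k + h) # map ((+) k) gs) = dual_act act k (\<phi> (h # gs))" for h
          using \<phi>eq[of "h # gs" k] len m by simp
      qed
      \<comment> \<open>Translating by k replaces \<open>f n\<close> by its translate, so the defect
        of equivariance is a pairing with \<open>V_act (- k) (f n) - f n\<close>, whose norm tends
        to 0.\<close>
      have 2: "P (map ((+) k) gs) n v - P gs n (act (- k) v) =
          V_pairing smul (%h. \<phi> (h # gs)) (?u n - f n) (act (- k) v)" for n
        unfolding 1 using V_pairing_diff[OF u fin, of "%h. \<phi> (h # gs)" n n "act (- k) v"] by (simp add: P_def)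
      have "(%n. V_pairing smul (%h. \<phi> (h # gs)) (?u n - f n) (act (- k) v)) ----> 0"
      proof (rule Lim_null_comparison)
        have "finite (V_supp (?u n - f n))" for n
          using W00_finite_supp W00_diff[of "?u n" "f n"] W00_act[OF fW] fW by blast
        then show "\<forall>\<^sub>F n in sequentially. norm (V_pairing smul (%h. \<phi> (h # gs)) (?u n - f n) (act (- k) v))
           <= M * (norm (?u n - f n) * norm (act (- k) v))"
          by (intro always_eventually allI) (simp add: V_pairing_bound M M0)
        have "(%n. norm (?u n - f n)) ----> 0" using f unfolding amenable_seq_def by blast
        then have "(%n. M * (norm (?u n - f n) * norm (act (- k) v))) ----> M * (0 * norm (act (- k) v))"
          by (intro tendsto_intros)
        then show "(%n. M * (norm (?u n - f n) * norm (act (- k) v))) ----> 0" by simp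
      qed
      then have "((%n. P (map ((+) k) gs) n v - P gs n (act (- k) v)) ---> 0) free_uf"
        unfolding 2 by (rule tendsto_free_uf)
      then have "((%n. P (map ((+) k) gs) n v) ---> Q gs (act (- k) v)) free_uf"
        using tendsto_add[OF _ Q[of gs "act (- k) v"]] by fastforce
      then have "Q (map ((+) k) gs) v = Q gs (act (- k) v)" by (rule Q_eq)
      then show "\<psi> (map ((+) k) gs) v = dual_act act k (\<psi> gs) v"
        using len m by (simp add: \<psi>_apply dual_act_apply[OF iso])
    qed
  qed
  moreover have "differential \<psi> = \<phi>"
  proof
    fix gs
    have lin: "linear (%\<alpha>. blinfun_apply \<alpha> v)" for v :: 'e
      by (rule bounded_linear.linear[OF blinfun.bounded_linear_left])
    show "differential \<psi> gs = \<phi> gs"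
    proof (cases "length gs = p + 1")
      case False
      then have "\<psi> (take i gs @ drop (Suc i) gs) = 0" if "i < length gs" for i
        using that by (auto simp: \<psi>_def)
      then show ?thesis using \<phi>len[OF False] by (simp add: differential_def)
    next
      case True
      show ?thesis
      proof (rule blinfun_eqI)
        fix v
        have 1: "differential \<psi> gs v = differential (%xs. Q xs v) gs"
          unfolding differential_linear_functional[OF lin, of \<psi> gs v]
          unfolding differential_def using True by (intro sum.cong) (auto simp: \<psi>_apply)
        have "((%n. differential (%xs. P xs n v) gs) ---> differential (%xs. Q xs v) gs) free_uf"
          unfolding differential_def by (intro tendsto_intros Q)
        moreover have "differential (%xs. P xs n v) gs = \<phi> gs v" for n
        proof -
          have c: "differential (%xs. \<phi> (h # xs)) gs = \<phi> gs" for h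
            using d\<phi>[of "h # gs"] by (simp add: differential_Cons)
          have "differential (%xs. P xs n v) gs =
              (\<Sum>h\<in>V_supp (f n). differential (%xs. blinfun_apply (\<phi> (h # xs)) (smul (V_apply (f n) h) v)) gs)"
            unfolding differential_def P_def V_pairing_def
            by (subst sum.swap) (simp add: sum_distrib_left)
          also have "... = V_pairing smul (%h. \<phi> gs) (f n) v"
            unfolding V_pairing_def
            by (intro sum.cong refl) (simp add: differential_linear_functional[OF lin, symmetric] c)
          finally show ?thesis by (simp add: V_pairing_const[OF fW] fpi)
        qed
        ultimately have "((%n::nat. \<phi> gs v) ---> differential (%xs. Q xs v) gs) free_uf" by simp
        then have "\<phi> gs v = differential (%xs. Q xs v) gs"
          by (rule tendsto_unique[rotated, OF tendsto_const]) simp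
        then show "differential \<psi> gs v = \<phi> gs v" using 1 by simp
      qed
    qed
  qed
  ultimately show ?thesis using m by (auto simp: bcoboundaries_def)
qed

end

section \<open>Cohomology classes in terms of coboundaries\<close>

lemma differential_diff: "differential (%gs. \<phi> gs - \<psi> gs) gs = differential \<phi> gs - differential \<psi> gs"
  unfolding differential_def by (simp add: scaleR_diff_right sum_subtractf)

lemma differential_zero: "differential (%_. 0) gs = 0"
  by (simp add: differential_def)

lemma bcochains_diff:
  assumes a: "isometric_action a" and "\<phi> \<in> bcochains a m" "\<psi> \<in> bcochains a m"
  shows "(%gs. \<phi> gs - \<psi> gs) \<in> bcochains a m"
proof -
  obtain A where A: "!!gs. norm (\<phi> gs) <= A" using assms(2) unfolding bcochains_def bounded_iff by auto
  obtain B where B: "!!gs. norm (\<psi> gs) <= B" using assms(3) unfolding bcochains_def bounded_iff by auto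
  have "norm (\<phi> gs - \<psi> gs) <= A + B" for gs
    using norm_triangle_ineq4[of "\<phi> gs" "\<psi> gs"] A[of gs] B[of gs] by linarith
  then have "bounded (range (%gs. \<phi> gs - \<psi> gs))" by (auto simp: bounded_iff)
  moreover have "linear (a k)" for k using a by (simp add: isometric_action_def)
  ultimately show ?thesis using assms(2,3) by (auto simp: bcochains_def linear_diff)
qed

lemma bcocycles_diff:
  assumes "isometric_action a" "\<phi> \<in> bcocycles a m" "\<psi> \<in> bcocycles a m"
  shows "(%gs. \<phi> gs - \<psi> gs) \<in> bcocycles a m"
  using assms bcochains_diff[OF assms(1)] by (auto simp: bcocycles_def differential_diff fun_eq_iff)

lemma bcochains_zero:
  assumes "isometric_action a"
  shows "(%_. 0) \<in> bcochains a m"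
  using assms by (auto simp: bcochains_def isometric_action_def linear_0)

lemma bcocycles_zero:
  assumes "isometric_action a"
  shows "(%_. 0) \<in> bcocycles a m"
  using bcochains_zero[OF assms] by (auto simp: bcocycles_def differential_zero)

lemma bcohomology_class_eq_zero:
  assumes "isometric_action a" "bcocycles a m \<subseteq> bcoboundaries a m" "\<phi> \<in> bcocycles a m"
  shows "bcohomology_class a m \<phi> = bcohomology_class a m (%_. 0)"
proof -
  have "bcohomologous a m `` {\<psi>} = bcocycles a m" if \<psi>: "\<psi> \<in> bcocycles a m" for \<psi>
    using subsetD[OF assms(2) bcocycles_diff[OF assms(1) \<psi>]] \<psi> by (auto simp: bcohomologous_def)
  then show ?thesis using assms(3) bcocycles_zero[OF assms(1)] by (simp add: bcohomology_class_def)
qed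

lemma bcohomology_trivial:
  assumes "isometric_action a" "bcocycles a m \<subseteq> bcoboundaries a m"
  shows "bcohomology a m = {bcohomology_class a m (%_. 0)}"
proof -
  have "bcohomology a m = bcohomology_class a m ` bcocycles a m"
    by (auto simp: bcohomology_def quotient_def bcohomology_class_def)
  also have "... = (%_. bcohomology_class a m (%_. 0)) ` bcocycles a m"
    by (rule image_cong[OF refl bcohomology_class_eq_zero[OF assms]])
  also have "... = {bcohomology_class a m (%_. 0)}"
    using bcocycles_zero[OF assms(1), of m] by blast
  finally show ?thesis .
qed

lemma amenable_seq_vanishing:
  assumes "amenable_seq (f :: nat => 'g::group_add V)"
  shows "l1_geometric_vanishing TYPE('g) TYPE('e::banach)"
  unfolding l1_geometric_vanishing_def
proof (intro allI impI, elim conjE)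
  fix act :: "'g => 'e => 'e" and smul and p :: nat
  assume *: "G_CX_module act smul" "l1_geometric smul" "p >= 1"
  then have "isometric_action act" by (simp add: G_CX_module_def)
  then show "bcohomology (dual_act act) p = {bcohomology_class (dual_act act) p (%_. 0)}"
    using bcocycle_is_bcoboundary[OF *(1,2) assms *(3)]
    by (intro bcohomology_trivial isometric_action_dual) auto
qed

section \<open>The dual of \<open>N\<^sub>0\<close> as a geometric module\<close>

lift_definition V_mult :: "'g CX => 'g V => 'g V" is "%t f h. CX_mult t (f h)"
proof
  fix t :: "'g CX" and f :: "'g => 'g CX"
  assume f: "(ALL x. (%g. \<bar>f g x\<bar>) summable_on UNIV) & bdd_above (range (%x. \<Sum>\<^sub>\<infinity>g. \<bar>f g x\<bar>))"
  then obtain A where A: "!!x. (\<Sum>\<^sub>\<infinity>g. \<bar>f g x\<bar>) <= A" unfolding bdd_above_range_iff by blast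
  show "ALL x. (%g. \<bar>CX_mult t (f g) x\<bar>) summable_on UNIV"
    using f by (simp add: CX_mult_apply abs_mult summable_on_cmult_right)
  have "(\<Sum>\<^sub>\<infinity>g. \<bar>CX_mult t (f g) x\<bar>) <= norm t * A" for x
  proof -
    have "0 <= (\<Sum>\<^sub>\<infinity>g. \<bar>f g x\<bar>)" by (rule infsum_nonneg) simp
    moreover have "(\<Sum>\<^sub>\<infinity>g. \<bar>CX_mult t (f g) x\<bar>) = \<bar>t x\<bar> * (\<Sum>\<^sub>\<infinity>g. \<bar>f g x\<bar>)"
      using f by (simp add: CX_mult_apply abs_mult infsum_cmult_right)
    ultimately show ?thesis using A[of x] norm_bounded[of t x] by (simp add: mult_mono)
  qed
  then show "bdd_above (range (%x. \<Sum>\<^sub>\<infinity>g. \<bar>CX_mult t (f g) x\<bar>))" unfolding bdd_above_range_iff by blast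
qed

lemma V_mult_norm: "norm (V_mult t f) <= norm t * norm f"
proof (rule V_norm_le)
  fix x
  have "(\<Sum>\<^sub>\<infinity>h. \<bar>V_apply (V_mult t f) h x\<bar>) = \<bar>t x\<bar> * (\<Sum>\<^sub>\<infinity>h. \<bar>V_apply f h x\<bar>)"
    using V_summable[of f x] by (simp add: V_mult.rep_eq CX_mult_apply abs_mult infsum_cmult_right)
  also have "... <= norm t * norm f"
    using norm_bounded[of t x] by (intro mult_mono V_mass_le_norm infsum_nonneg) auto
  finally show "(\<Sum>\<^sub>\<infinity>h. \<bar>V_apply (V_mult t f) h x\<bar>) <= norm t * norm f" .
qed

lemma CX_mult_linear_left: "linear (%s. CX_mult s t)" and CX_mult_linear_right: "linear (CX_mult t)"
  by (rule linearI; rule bcontfun_eqI; simp add: CX_mult_apply algebra_simps)+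

lemma CX_mult_assoc: "CX_mult (CX_mult s t) u = CX_mult s (CX_mult t u)"
  by (rule bcontfun_eqI) (simp add: CX_mult_apply)

lemma CX_mult_one: "CX_mult one_CX t = t"
  by (rule bcontfun_eqI) (simp add: CX_mult_apply)

lemma CX_act_mult: "CX_act g (CX_mult s t) = CX_mult (CX_act g s) (CX_act g t)"
  by (rule bcontfun_eqI) (simp add: CX_mult_apply CX_act_apply)

lemma V_mult_linear_left: "linear (%t. V_mult t f)"
  by (rule linearI; rule V_eqI)
    (simp_all add: V_mult.rep_eq plus_V.rep_eq scaleR_V.rep_eq linear_add[OF CX_mult_linear_left] linear_scale[OF CX_mult_linear_left])

lemma V_mult_linear_right: "linear (V_mult t)"
  by (rule linearI; rule V_eqI)
    (simp_all add: V_mult.rep_eq plus_V.rep_eq scaleR_V.rep_eq linear_add[OF CX_mult_linear_right] linear_scale[OF CX_mult_linear_right])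

text \<open>Multiplication by t turns the total mass c into the function c t, which in general is
  constant only if c = 0. This is why the module structure is put on \<open>N0\<close> and not on
  \<open>W0\<close>.\<close>

lemma V_mult_W00:
  assumes "w \<in> W00" "pi00 w = 0"
  shows "V_mult t w \<in> W00 & pi00 (V_mult t w) = 0"
proof (rule W00_iff)
  show "finite (V_supp w)" by (rule W00_finite_supp[OF assms(1)])
  show "V_apply (V_mult t w) h = 0" if "h \<notin> V_supp w" for h
    using that by (simp add: V_mult.rep_eq V_supp_def linear_0[OF CX_mult_linear_right])
  have "(\<Sum>h\<in>V_supp w. V_apply (V_mult t w) h) = CX_mult t (\<Sum>h\<in>V_supp w. V_apply w h)"
    by (simp add: V_mult.rep_eq linear_sum[OF CX_mult_linear_right])
  also have "(\<Sum>h\<in>V_supp w. V_apply w h) = 0"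
    using W00_sum[OF assms(1)] assms(2) by (simp add: V_supp_def)
  finally show "(\<Sum>h\<in>V_supp w. V_apply (V_mult t w) h) = 0 *\<^sub>R one_CX"
    by (simp add: linear_0[OF CX_mult_linear_right])
qed

lemma N0_approx:
  fixes f :: "'g V"
  assumes "f \<in> W0" "pi0 f = 0"
  obtains w where "!!n::nat. w n \<in> W00" "!!n. pi00 (w n) = 0" "w ----> f"
proof -
  obtain v where v: "!!n. v n \<in> W00" "v ----> f" using W0_seq[OF assms(1)] by blast
  have p: "(%n. pi00 (v n)) ----> 0" using pi0_seq(1)[OF v] assms(2) by simp
  \<comment> \<open>The masses of an approximating sequence tend to 0; subtracting them at one group
    element makes them exactly 0.\<close>
  define w where "w n = v n - pi00 (v n) *\<^sub>R delta undefined" for n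
  show thesis
  proof
    have d: "r *\<^sub>R (delta undefined :: 'g V) \<in> W00 & pi00 (r *\<^sub>R (delta undefined :: 'g V)) = r" for r
      using W00_scaleR[of "delta undefined :: 'g V" r] delta_W00[of "undefined :: 'g"] by simp
    show "w n \<in> W00" "pi00 (w n) = 0" for n
      using W00_diff[OF v(1)[of n], of "pi00 (v n) *\<^sub>R delta undefined"] d[of "pi00 (v n)"] by (auto simp: w_def)
    have "w ----> f - 0 *\<^sub>R delta undefined" unfolding w_def by (intro tendsto_intros v p)
    then show "w ----> f" by simp
  qed
qed

lift_definition N0_mult :: "'g CX => 'g N0 => 'g N0" is V_mult
proof (elim conjE)
  fix t :: "'g CX" and f :: "'g V" assume "f \<in> W0" "pi0 f = 0"
  then obtain w where w: "!!n::nat. w n \<in> W00" "!!n. pi00 (w n) = 0" "w ----> f" by (rule N0_approx) blast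
  have "bounded_linear (V_mult t)"
    using linear_add[OF V_mult_linear_right, of t] linear_scale[OF V_mult_linear_right, of t] V_mult_norm[of t]
    by (intro bounded_linear_intro[of _ "norm t"]) (auto simp: mult.commute)
  then have "(%n. V_mult t (w n)) ----> V_mult t f" by (rule bounded_linear.tendsto) (rule w)
  then show "V_mult t f \<in> W0 & pi0 (V_mult t f) = 0"
    using V_mult_W00[OF w(1,2)] by (intro pi0_eqI[of "%n. V_mult t (w n)"]) simp_all
qed

lemma N0_mult_linear_left: "linear (%t. N0_mult t f)"
  by (rule linearI; transfer) (simp_all add: linear_add[OF V_mult_linear_left] linear_scale[OF V_mult_linear_left])

lemma N0_mult_linear_right: "linear (N0_mult t)"
  by (rule linearI; transfer) (simp_all add: linear_add[OF V_mult_linear_right] linear_scale[OF V_mult_linear_right])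

lemma N0_mult_assoc: "N0_mult (CX_mult s t) f = N0_mult s (N0_mult t f)"
  by transfer (rule V_eqI, simp add: V_mult.rep_eq CX_mult_assoc)

lemma N0_mult_one: "N0_mult one_CX f = f"
  by transfer (rule V_eqI, simp add: V_mult.rep_eq CX_mult_one)

lemma N0_mult_norm: "norm (N0_mult t f) <= norm t * norm f"
  by transfer (rule V_mult_norm)

lemma N0_act_mult: "N0_act g (N0_mult t f) = N0_mult (CX_act g t) (N0_act g f)"
  by transfer (rule V_eqI, simp add: V_mult.rep_eq V_apply_act CX_act_mult)

text \<open>At each ultrafilter exactly one of the two summands is present, and the norm is a
  supremum over ultrafilters. This maximum behaviour is what dualises to l1.\<close>

lemma norm_V_ind_le:
  "norm (V_mult (CX_ind A) f + V_mult (CX_ind (- A)) g) <= max (norm f) (norm g)"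
proof (rule V_norm_le)
  fix x
  have "V_apply (V_mult (CX_ind A) f + V_mult (CX_ind (- A)) g) h x =
      (if eventually (%h. h \<in> A) (ultrafilter x) then V_apply f h x else V_apply g h x)" for h
    by (simp add: plus_V.rep_eq V_mult.rep_eq CX_mult_apply CX_ind_apply ultrafilter_eventually_not)
  then have "(\<Sum>\<^sub>\<infinity>h. \<bar>V_apply (V_mult (CX_ind A) f + V_mult (CX_ind (- A)) g) h x\<bar>) =
      (if eventually (%h. h \<in> A) (ultrafilter x) then \<Sum>\<^sub>\<infinity>h. \<bar>V_apply f h x\<bar> else \<Sum>\<^sub>\<infinity>h. \<bar>V_apply g h x\<bar>)"
    by simp
  then show "(\<Sum>\<^sub>\<infinity>h. \<bar>V_apply (V_mult (CX_ind A) f + V_mult (CX_ind (- A)) g) h x\<bar>) <= max (norm f) (norm g)"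
    using V_mass_le_norm[of f x] V_mass_le_norm[of g x] by (auto simp: le_max_iff_disj)
qed

lemma norm_N0_ind_le:
  "norm (N0_mult (CX_ind A) f + N0_mult (CX_ind (- A)) g) <= max (norm f) (norm g)"
  by transfer (rule norm_V_ind_le)

definition N0_dual_mult :: "'g CX => ('g N0 \<Rightarrow>\<^sub>L real) => ('g N0 \<Rightarrow>\<^sub>L real)" where
  "N0_dual_mult t \<alpha> = Blinfun (%f. \<alpha> (N0_mult t f))"

lemma N0_dual_mult_apply: "N0_dual_mult t \<alpha> f = \<alpha> (N0_mult t f)"
proof -
  have "bounded_linear (N0_mult t)"
    using linear_add[OF N0_mult_linear_right, of t] linear_scale[OF N0_mult_linear_right, of t] N0_mult_norm[of t]
    by (intro bounded_linear_intro[of _ "norm t"]) (auto simp: mult.commute)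
  then show ?thesis
    unfolding N0_dual_mult_def
    by (intro fun_cong[OF bounded_linear_Blinfun_apply] bounded_linear_compose[OF blinfun.bounded_linear_right])
qed

lemma N0_dual_module: "G_CX_module (dual_act N0_act) N0_dual_mult"
  unfolding G_CX_module_def CX_module_def
proof (intro conjI allI)
  fix s t :: "'a CX" and v :: "'a N0 \<Rightarrow>\<^sub>L real" and g :: 'a
  show "linear (N0_dual_mult t)"
    by (rule linearI; rule blinfun_eqI) (simp_all add: N0_dual_mult_apply blinfun.add_left blinfun.scaleR_left)
  show "linear (%t. N0_dual_mult t v)"
    by (rule linearI; rule blinfun_eqI)
      (simp_all add: N0_dual_mult_apply blinfun.add_left blinfun.scaleR_left blinfun.add_right blinfun.scaleR_right
        linear_add[OF N0_mult_linear_left] linear_scale[OF N0_mult_linear_left])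
  \<comment> \<open>Transposition reverses products; commutativity of C(\<beta>G) turns the
    resulting right action into a left one.\<close>
  have comm: "CX_mult s t = CX_mult t s"
    by (rule bcontfun_eqI) (simp add: CX_mult_apply)
  show "N0_dual_mult (CX_mult s t) v = N0_dual_mult s (N0_dual_mult t v)"
    unfolding comm by (rule blinfun_eqI) (simp add: N0_dual_mult_apply N0_mult_assoc)
  show "N0_dual_mult one_CX v = v"
    by (rule blinfun_eqI) (simp add: N0_dual_mult_apply N0_mult_one)
  show "norm (N0_dual_mult t v) <= norm t * norm v"
  proof (rule norm_blinfun_bound)
    fix f
    have "norm (v (N0_mult t f)) <= norm v * norm (N0_mult t f)" by (rule norm_blinfun)
    also have "... <= norm v * (norm t * norm f)" by (intro mult_left_mono N0_mult_norm) simp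
    finally show "norm (N0_dual_mult t v f) <= norm t * norm v * norm f"
      by (simp add: N0_dual_mult_apply mult_ac)
  qed simp
  show "isometric_action (dual_act N0_act :: 'a => _)"
    by (rule isometric_action_dual[OF isometric_action_N0])
  have "CX_act (- g) (CX_act g t) = t"
    by (rule bcontfun_eqI) (simp add: CX_act_apply stone_cech_act_add[symmetric] stone_cech_act_zero)
  then show "dual_act N0_act g (N0_dual_mult t v) = N0_dual_mult (CX_act g t) (dual_act N0_act g v)"
    by (intro blinfun_eqI) (simp add: N0_dual_mult_apply dual_act_apply[OF isometric_action_N0] N0_act_mult)
qed

text \<open>Test vectors f for \<alpha> and g for \<beta> of norm at most 1 are glued along A into
  one vector of norm at most 1, on which \<alpha> + \<beta> takes the value \<alpha> f + \<beta> g.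
  Suprema over f and then over g give the nontrivial inequality.\<close>

lemma N0_dual_l1_geometric: "l1_geometric (N0_dual_mult :: 'g CX => _)"
  unfolding l1_geometric_def
proof (intro allI impI)
  fix \<alpha> \<beta> :: "'g N0 \<Rightarrow>\<^sub>L real"
  assume "disjointly_supported N0_dual_mult \<alpha> \<beta>"
  then obtain s t where st: "closed_support s \<inter> closed_support t = {}" "N0_dual_mult s \<alpha> = \<alpha>" "N0_dual_mult t \<beta> = \<beta>"
    unfolding disjointly_supported_def by blast
  obtain A where A: "CX_mult s (CX_ind A) = s" "CX_mult t (CX_ind (- A)) = t"
    "CX_mult s (CX_ind (- A)) = 0" "CX_mult t (CX_ind A) = 0"
    using CX_mult_support_ind[OF st(1)] by blast
  have a: "\<alpha> (N0_mult (CX_ind B) f) = \<alpha> (N0_mult (CX_mult s (CX_ind B)) f)" for B f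
    by (subst st(2)[symmetric]) (simp add: N0_dual_mult_apply N0_mult_assoc)
  have b: "\<beta> (N0_mult (CX_ind B) f) = \<beta> (N0_mult (CX_mult t (CX_ind B)) f)" for B f
    by (subst st(3)[symmetric]) (simp add: N0_dual_mult_apply N0_mult_assoc)
  have z: "N0_mult 0 f = 0" for f :: "'g N0" by (rule linear_0[OF N0_mult_linear_left])
  have a': "\<alpha> (N0_mult s f) = \<alpha> f" for f by (subst (2) st(2)[symmetric]) (simp add: N0_dual_mult_apply)
  have b': "\<beta> (N0_mult t f) = \<beta> f" for f by (subst (2) st(3)[symmetric]) (simp add: N0_dual_mult_apply)
  have le: "\<alpha> f + \<beta> g <= norm (\<alpha> + \<beta>) * max (norm f) (norm g)" for f g
  proof -
    let ?u = "N0_mult (CX_ind A) f + N0_mult (CX_ind (- A)) g"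
    have "\<alpha> f + \<beta> g = (\<alpha> + \<beta>) ?u"
      by (simp add: blinfun.add_left blinfun.add_right a b A z a' b')
    also have "... <= norm (\<alpha> + \<beta>) * norm ?u" using norm_blinfun[of "\<alpha> + \<beta>" ?u] by simp
    also have "... <= norm (\<alpha> + \<beta>) * max (norm f) (norm g)" by (intro mult_left_mono norm_N0_ind_le) simp
    finally show ?thesis .
  qed
  \<comment> \<open>The unit ball is symmetric, so testing without absolute values suffices.\<close>
  have gen: "norm \<gamma> <= c" if "!!f. norm f <= 1 ==> \<gamma> f <= c" for \<gamma> :: "'g N0 \<Rightarrow>\<^sub>L real" and c
  proof (rule norm_blinfun_bound)
    show c0: "0 <= c" using that[of 0] by simp
    fix f
    show "norm (\<gamma> f) <= c * norm f"
    proof (cases "f = 0")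
      case False
      have "\<gamma> ((1 / norm f) *\<^sub>R f) <= c" "\<gamma> ((- 1 / norm f) *\<^sub>R f) <= c"
        using False by (intro that; simp)+
      then show ?thesis using False by (simp add: blinfun.scaleR_right blinfun.minus_right field_simps abs_le_iff)
    qed simp
  qed
  have 1: "norm \<alpha> <= norm (\<alpha> + \<beta>) - \<beta> g" if "norm g <= 1" for g
  proof (rule gen)
    fix f :: "'g N0" assume "norm f <= 1"
    then have "norm (\<alpha> + \<beta>) * max (norm f) (norm g) <= norm (\<alpha> + \<beta>) * 1"
      using that by (intro mult_left_mono) auto
    then show "\<alpha> f <= norm (\<alpha> + \<beta>) - \<beta> g" using le[of f g] by simp
  qed
  have "norm \<beta> <= norm (\<alpha> + \<beta>) - norm \<alpha>"
    by (rule gen) (use 1 in \<open>fastforce simp: algebra_simps\<close>)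
  then show "norm (\<alpha> + \<beta>) = norm \<alpha> + norm \<beta>"
    using norm_triangle_ineq[of \<alpha> \<beta>] by linarith
qed

text \<open>The bidual of \<open>N0\<close> is the dual of a geometric module, namely of the dual of
  \<open>N0\<close>, so the hypothesis applies to the Johnson cocycle in degree 1.\<close>

lemma vanishing_imp_johnson_trivial:
  assumes "l1_geometric_vanishing TYPE('g::group_add) TYPE('g N0 \<Rightarrow>\<^sub>L real)"
  shows "johnson_class_trivial TYPE('g)"
proof -
  have "bcohomology (N0_bidual_act :: 'g => _) 1 = {bcohomology_class N0_bidual_act 1 (%_. 0)}"
    using assms N0_dual_module N0_dual_l1_geometric
    unfolding l1_geometric_vanishing_def N0_bidual_act_def by blast
  moreover have "johnson_class \<in> bcohomology (N0_bidual_act :: 'g => _) 1"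
    unfolding johnson_class_def bcohomology_def bcohomology_class_def
    by (rule quotientI[OF johnson_cocycle_bcocycle])
  ultimately show ?thesis by (auto simp: johnson_class_trivial_def)
qed

section \<open>From the Johnson class to an amenable sequence\<close>

text \<open>Finite tuples of every length m in one normed space: padding by 0 makes a tuple a
  bounded sequence whose norm is the maximum of the norms of the entries.\<close>

definition finite_seq :: "nat => (nat => 'v::real_normed_vector) => (nat \<Rightarrow>\<^sub>C 'v)" where
  "finite_seq m f = Bcontfun (%i. if i < m then f i else 0)"

lemma finite_seq_apply: "finite_seq m f i = (if i < m then f i else 0)"
proof -
  have "range (%i. if i < m then f i else 0) \<subseteq> insert 0 (f ` {..<m})" by auto
  then have "finite (range (%i. if i < m then f i else 0))" by (rule finite_subset) simp
  then have "(%i. if i < m then f i else 0) \<in> bcontfun"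
    by (simp add: bcontfun_def finite_imp_bounded)
  then show ?thesis unfolding finite_seq_def by (simp add: Bcontfun_inverse)
qed

lemma norm_finite_seq_le:
  assumes "!!i. i < m ==> norm (f i) <= b" "b >= 0"
  shows "norm (finite_seq m f) <= b"
  by (rule norm_bound) (use assms in \<open>simp add: finite_seq_apply\<close>)

lemma norm_finite_seq_ge: "i < m ==> norm (f i) <= norm (finite_seq m f)"
  using norm_bounded[of "finite_seq m f" i] by (simp add: finite_seq_apply)

definition single_seq :: "nat => 'v::real_normed_vector => (nat \<Rightarrow>\<^sub>C 'v)" where
  "single_seq j v = finite_seq (Suc j) (%i. if i = j then v else 0)"

lemma single_seq_apply: "single_seq j v i = (if i = j then v else 0)"
  by (simp add: single_seq_def finite_seq_apply)

lemma norm_single_seq_le: "norm (single_seq j v) <= norm v"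
  unfolding single_seq_def by (rule norm_finite_seq_le) auto

lemma linear_finite_seq:
  assumes "linear \<Lambda>"
  shows "\<Lambda> (finite_seq m f) = (\<Sum>i<m. \<Lambda> (single_seq i (f i)))"
proof (induction m)
  case 0
  have "finite_seq 0 f = 0" by (rule bcontfun_eqI) (simp add: finite_seq_apply)
  then show ?case using assms by (simp add: linear_0)
next
  case (Suc m)
  have "finite_seq (Suc m) f = finite_seq m f + single_seq m (f m)"
    by (rule bcontfun_eqI) (auto simp: finite_seq_apply single_seq_apply less_Suc_eq)
  then show ?case using assms Suc by (simp add: linear_add)
qed

lemma bounded_linear_single_seq:
  fixes \<Lambda> :: "(nat \<Rightarrow>\<^sub>C 'v::real_normed_vector) => real"
  assumes "linear \<Lambda>" "!!x. \<bar>\<Lambda> x\<bar> <= norm x"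
  shows "bounded_linear (%v. \<Lambda> (single_seq j v))"
proof (rule bounded_linear_intro[of _ 1])
  have "single_seq j (v + w) = single_seq j v + single_seq j w" for v w :: 'v
    by (rule bcontfun_eqI) (simp add: single_seq_apply)
  then show "\<Lambda> (single_seq j (v + w)) = \<Lambda> (single_seq j v) + \<Lambda> (single_seq j w)" for v w
    using assms(1) by (simp add: linear_add)
  have "single_seq j (r *\<^sub>R v) = r *\<^sub>R single_seq j v" for r and v :: 'v
    by (rule bcontfun_eqI) (simp add: single_seq_apply)
  then show "\<Lambda> (single_seq j (r *\<^sub>R v)) = r *\<^sub>R \<Lambda> (single_seq j v)" for r v
    using assms(1) by (simp add: linear_scale)
  show "norm (\<Lambda> (single_seq j v)) <= norm v * 1" for v
    using order_trans[OF assms(2) norm_single_seq_le[of j v]] by simp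
qed

text \<open>A 0-cochain is determined by its value at the list [0]. The minus sign comes from
  subtracting the Johnson cocycle from the zero cocycle, in this order.\<close>

lemma johnson_trivial_primitive:
  assumes "johnson_class_trivial TYPE('g::group_add)"
  obtains b where "!!g::'g. N0_bidual_act g b - b = - bidual_embed (johnson_diff 0 g)"
proof -
  let ?J = "johnson_cocycle :: 'g list => _" and ?a = "N0_bidual_act :: 'g => _"
  have iso: "isometric_action ?a"
    unfolding N0_bidual_act_def by (intro isometric_action_dual isometric_action_N0)
  have "differential (%_. 0) = (%_::'g list. 0 :: ('g N0 \<Rightarrow>\<^sub>L real) \<Rightarrow>\<^sub>L real)"
    by (rule ext) (rule differential_zero)
  then have "(%_. 0) \<in> bcoboundaries ?a 1"
    using bcochains_zero[OF iso, of 0] by (force simp: bcoboundaries_def)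
  then have "?J \<in> johnson_class"
    using johnson_cocycle_bcocycle by (simp add: johnson_class_def bcohomology_class_def bcohomologous_def)
  also have "johnson_class = bcohomology_class ?a 1 (%_. 0)"
    using assms by (simp only: johnson_class_trivial_def)
  finally have "(%gs. 0 - ?J gs) \<in> bcoboundaries ?a 1"
    by (simp add: bcohomology_class_def bcohomologous_def)
  then obtain B where B: "B \<in> bcochains ?a 0" "(%gs. - ?J gs) = differential B"
    by (auto simp: bcoboundaries_def)
  have eq: "?a g (B [0]) - B [0] = - bidual_embed (johnson_diff 0 g)" for g :: 'g
  proof -
    have "ALL k gs. length gs = 1 --> B (map ((+) k) gs) = ?a k (B gs)"
      using B(1) by (simp add: bcochains_def)
    from this[rule_format, of "[0]" g] have "B [g] = ?a g (B [0])" by simp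
    moreover have "- ?J [0, g] = differential B [0, g]" using B(2) by (metis)
    moreover have "differential B [0, g] = B [g] - B [0]" by (simp add: differential_def numeral_2_eq_2)
    ultimately show ?thesis by (simp add: johnson_cocycle_def)
  qed
  show thesis by (rule that[OF eq])
qed

text \<open>A quantitative form of Goldstine's theorem. If no n in the ball imitates b, the tuples
  of errors form a convex set at distance at least \<epsilon> from 0. The separating functional
  pulls back to some \<beta> in the dual of \<open>N0\<close> with \<beta> n + b \<beta> >=
  \<epsilon> on the whole ball, against the bound \<open>norm b * norm \<beta>\<close> for b
  \<beta>.\<close>

lemma johnson_trivial_approx:
  fixes F :: "'g::group_add list"
  assumes b: "!!g::'g. N0_bidual_act g b - b = - bidual_embed (johnson_diff 0 g)"
    and \<epsilon>: "\<epsilon> > 0"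
  shows "EX n. norm n <= norm b + 1 & (\<forall>g\<in>set F. norm (N0_act g n - n - johnson_diff 0 g) < \<epsilon>)"
proof (rule ccontr)
  assume no: "\<not> ?thesis"
  let ?m = "length F"
  define \<Phi> where "\<Phi> n = finite_seq ?m (%i. N0_act (F ! i) n - n - johnson_diff 0 (F ! i))" for n
  define K where "K = \<Phi> ` cball 0 (norm b + 1)"
  have lin: "linear (N0_act g)" for g :: 'g using isometric_action_N0[where 'a = 'g] by (simp add: isometric_action_def)
  have "convex K"
    unfolding convex_def K_def
  proof (intro ballI allI impI)
    fix x y and u v :: real
    assume "x \<in> \<Phi> ` cball 0 (norm b + 1)" "y \<in> \<Phi> ` cball 0 (norm b + 1)" and uv: "0 <= u" "0 <= v" "u + v = 1"
    then obtain n n' where n: "x = \<Phi> n" "y = \<Phi> n'" "n \<in> cball 0 (norm b + 1)" "n' \<in> cball 0 (norm b + 1)" by blast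
    have v: "v = 1 - u" using uv by simp
    have "u *\<^sub>R x + v *\<^sub>R y = \<Phi> (u *\<^sub>R n + v *\<^sub>R n')"
    proof (rule bcontfun_eqI)
      fix i
      have "N0_act (F ! i) (u *\<^sub>R n + (1 - u) *\<^sub>R n') = u *\<^sub>R N0_act (F ! i) n + (1 - u) *\<^sub>R N0_act (F ! i) n'"
        by (simp only: linear_add[OF lin] linear_scale[OF lin])
      then show "(u *\<^sub>R x + v *\<^sub>R y) i = \<Phi> (u *\<^sub>R n + v *\<^sub>R n') i"
        by (simp only: n \<Phi>_def v finite_seq_apply plus_bcontfun.rep_eq scaleR_bcontfun.rep_eq) (simp add: algebra_simps)
    qed
    moreover have "u *\<^sub>R n + v *\<^sub>R n' \<in> cball 0 (norm b + 1)"
      using n uv convex_cball[of 0 "norm b + 1"] by (intro convexD) auto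
    ultimately show "u *\<^sub>R x + v *\<^sub>R y \<in> \<Phi> ` cball 0 (norm b + 1)" by blast
  qed
  moreover have "0 <= norm b + 1" using norm_ge_zero[of b] by linarith
  then have "\<Phi> 0 \<in> K" unfolding K_def by (intro imageI) simp
  then have "K ~= {}" by blast
  moreover have "\<epsilon> <= norm k" if k: "k \<in> K" for k
  proof -
    obtain n where n: "k = \<Phi> n" "norm n <= norm b + 1" using k by (auto simp: K_def)
    then obtain g where g: "g \<in> set F" "norm (N0_act g n - n - johnson_diff 0 g) >= \<epsilon>" using no by force
    then obtain i where "i < ?m" "g = F ! i" by (auto simp: in_set_conv_nth)
    then show ?thesis using g n norm_finite_seq_ge[of i ?m "%i. N0_act (F ! i) n - n - johnson_diff 0 (F ! i)"]
      by (simp add: \<Phi>_def)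
  qed
  ultimately obtain \<Lambda> :: "(nat \<Rightarrow>\<^sub>C 'g N0) => real" where
    L: "linear \<Lambda>" "!!x. \<bar>\<Lambda> x\<bar> <= norm x" "!!k. k \<in> K ==> \<epsilon> <= \<Lambda> k"
    by (rule hahn_banach_separation) (assumption, rule that, assumption+)
  define \<alpha> where "\<alpha> i = Blinfun (%v. \<Lambda> (single_seq i v))" for i
  have \<alpha>: "\<alpha> i v = \<Lambda> (single_seq i v)" for i v
    by (simp add: \<alpha>_def bounded_linear_Blinfun_apply[OF bounded_linear_single_seq[OF L(1,2)]])
  \<comment> \<open>This is n \<mapsto> \<Sum> \<alpha> i (g n - n) with g = \<open>F ! i\<close>,
    written with transposes; b can be evaluated on it by the equation \<open>b\<close> at each
    \<open>F ! i\<close>.\<close>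
  define \<beta> where "\<beta> = (\<Sum>i<?m. dual_act N0_act (- (F ! i)) (\<alpha> i) - \<alpha> i)"
  have \<beta>: "\<beta> n = (\<Sum>i<?m. \<alpha> i (N0_act (F ! i) n) - \<alpha> i n)" for n
    by (simp add: \<beta>_def blinfun.sum_left blinfun.diff_left dual_act_apply[OF isometric_action_N0])
  have "b \<beta> = (\<Sum>i<?m. (N0_bidual_act (F ! i) b - b) (\<alpha> i))"
    by (simp add: \<beta>_def blinfun.sum_right blinfun.diff_left blinfun.diff_right N0_bidual_act_def
        dual_act_apply[OF isometric_action_dual[OF isometric_action_N0]])
  also have "... = - (\<Sum>i<?m. \<alpha> i (johnson_diff 0 (F ! i)))"
    by (simp add: b blinfun.minus_left bidual_embed_apply sum_negf)
  finally have b\<beta>: "b \<beta> = - (\<Sum>i<?m. \<alpha> i (johnson_diff 0 (F ! i)))" .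
  have key: "\<epsilon> <= \<beta> n + b \<beta>" if n: "norm n <= norm b + 1" for n
  proof -
    have "\<epsilon> <= \<Lambda> (\<Phi> n)" by (rule L(3)) (use n in \<open>auto simp: K_def\<close>)
    also have "... = (\<Sum>i<?m. \<alpha> i (N0_act (F ! i) n - n - johnson_diff 0 (F ! i)))"
      unfolding \<Phi>_def linear_finite_seq[OF L(1)] by (simp add: \<alpha>)
    also have "... = \<beta> n + b \<beta>"
      unfolding \<beta> b\<beta> by (simp add: blinfun.diff_right sum_subtractf)
    finally show ?thesis .
  qed
  \<comment> \<open>The radius exceeds \<open>norm b\<close>, so that \<beta> on the ball outweighs
    b \<beta>; it is positive even for b = 0, which allows every nonzero n to be rescaled to the
    boundary.\<close>
  let ?C = "norm b + 1"
  have C: "?C > 0" by (simp add: add_nonneg_pos)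
  have "norm \<beta> <= (b \<beta> - \<epsilon>) / ?C"
  proof (rule norm_blinfun_bound)
    show "0 <= (b \<beta> - \<epsilon>) / ?C" using key[of 0] C by (simp add: blinfun.zero_right)
    fix n
    show "norm (\<beta> n) <= (b \<beta> - \<epsilon>) / ?C * norm n"
    proof (cases "n = 0")
      case False
      then have nn: "norm n > 0" by simp
      have "\<epsilon> <= \<beta> ((?C / norm n) *\<^sub>R n) + b \<beta>" "\<epsilon> <= \<beta> ((- (?C / norm n)) *\<^sub>R n) + b \<beta>"
        using nn C by (intro key; simp)+
      then have "\<bar>?C / norm n * \<beta> n\<bar> <= b \<beta> - \<epsilon>"
        by (simp only: blinfun.scaleR_right real_scaleR_def abs_le_iff) linarith
      then have "?C / norm n * \<bar>\<beta> n\<bar> <= b \<beta> - \<epsilon>" using nn C by (simp add: abs_mult)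
      then show ?thesis using nn C by (simp add: field_simps)
    qed simp
  qed
  then have "norm \<beta> * ?C <= b \<beta> - \<epsilon>" using C by (simp add: field_simps)
  moreover have "b \<beta> <= norm b * norm \<beta>" using norm_blinfun[of b \<beta>] by simp
  moreover have "norm \<beta> * ?C = norm b * norm \<beta> + norm \<beta>" by (simp add: algebra_simps)
  ultimately show False using \<epsilon> norm_ge_zero[of \<beta>] by linarith
qed

text \<open>If g n - n is close to delta g - delta 0, then delta 0 - n is almost invariant under g.
  Countability lets the k-th vector take care of the first k group elements.\<close>

lemma johnson_trivial_imp_amenable_seq:
  assumes "johnson_class_trivial TYPE('g::{group_add, countable})"
  obtains f :: "nat => 'g::{group_add, countable} V" where "amenable_seq f"
proof -
  obtain b where b: "!!g::'g. N0_bidual_act g b - b = - bidual_embed (johnson_diff 0 g)"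
    using johnson_trivial_primitive[OF assms] by blast
  define e where "e k = 1 / real (Suc k)" for k
  have e: "e k > 0" for k by (simp add: e_def)
  have "ALL k. EX n. norm n <= norm b + 1 & (\<forall>g\<in>set (map from_nat [0..<k]). norm (N0_act g n - n - johnson_diff 0 (g::'g)) < e k)"
    using johnson_trivial_approx[OF b e] by blast
  then obtain n where n: "!!k. norm (n k) <= norm b + 1"
    "!!k g. g \<in> from_nat ` {0..<k} ==> norm (N0_act g (n k) - n k - johnson_diff 0 (g::'g)) < e k"
    by (metis list.set_map set_upt)
  have "ALL k. EX w. w \<in> W00 & pi00 w = 0 & norm (w - N0_V (n k)) < e k"
  proof
    fix k
    obtain w where w: "!!i::nat. w i \<in> W00" "!!i. pi00 (w i) = 0" "w ----> N0_V (n k)"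
      using N0_approx[of "N0_V (n k)"] N0_V[of "n k"] by blast
    have "eventually (%i. dist (w i) (N0_V (n k)) < e k) sequentially" by (rule tendstoD[OF w(3) e])
    then obtain i where "dist (w i) (N0_V (n k)) < e k" by (auto simp: eventually_sequentially)
    then show "EX w. w \<in> W00 & pi00 w = 0 & norm (w - N0_V (n k)) < e k"
      using w by (auto simp: dist_norm)
  qed
  then obtain w where w: "!!k. w k \<in> W00" "!!k. pi00 (w k) = 0" "!!k. norm (w k - N0_V (n k)) < e k" by metis
  define f where "f k = delta 0 - w k" for k
  have fW: "f k \<in> W00 & pi00 (f k) = 1" for k
    using W00_diff[of "delta 0" "w k"] delta_W00[of "0::'g"] w by (simp add: f_def)
  have fb: "norm (f k) <= norm (delta (0::'g)) + (norm b + 1) + 1" for k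
  proof -
    have "norm (w k) <= norm (N0_V (n k)) + norm (w k - N0_V (n k))" by (rule norm_triangle_sub)
    moreover have "norm (N0_V (n k)) <= norm b + 1" using n(1)[of k] by (simp add: norm_N0.rep_eq)
    moreover have "e k <= 1" by (simp add: e_def)
    moreover have "norm (f k) <= norm (delta (0::'g)) + norm (w k)" unfolding f_def by (rule norm_triangle_ineq4)
    ultimately show ?thesis using w(3)[of k] by linarith
  qed
  have lim: "(%k. norm (V_act g (f k) - f k)) ----> 0" for g
  proof (rule Lim_null_comparison)
    \<comment> \<open>One \<open>e k\<close> for the almost invariance of \<open>n k\<close>, and
      two for replacing \<open>n k\<close> by \<open>w k\<close>, once before and once after the
      isometric action of g.\<close>
    have "norm (V_act g (f k) - f k) <= 3 * e k" if k: "to_nat g < k" for k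
    proof -
      let ?N = "N0_V (n k)"
      have "g = from_nat (to_nat g)" by simp
      then have "g \<in> from_nat ` {0..<k}" using k by (intro image_eqI[of _ _ "to_nat g"]) auto
      then have "norm (N0_act g (n k) - n k - johnson_diff 0 g) < e k" by (rule n(2))
      then have 1: "norm (V_act g ?N - ?N - (delta g - delta 0)) < e k"
        by (simp add: norm_N0.rep_eq minus_N0.rep_eq N0_act.rep_eq johnson_diff.rep_eq)
      have 2: "V_act g (f k) - f k = (w k - ?N) - V_act g (w k - ?N) - (V_act g ?N - ?N - (delta g - delta 0))"
        by (simp add: f_def linear_diff[OF V_act_linear] V_act_delta)
      have "norm (V_act g (f k) - f k) <= norm (w k - ?N) + norm (V_act g (w k - ?N)) + norm (V_act g ?N - ?N - (delta g - delta 0))"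
        unfolding 2 by (meson add_mono norm_triangle_ineq4 order.trans order_refl)
      then show ?thesis using 1 w(3)[of k] by (simp add: V_act_norm)
    qed
    then show "\<forall>\<^sub>F k in sequentially. norm (norm (V_act g (f k) - f k)) <= 3 * e k"
      unfolding eventually_sequentially by (intro exI[of _ "Suc (to_nat g)"]) auto
    have "(%k. 3 * e k) ----> 3 * 0" unfolding e_def by (intro tendsto_mult tendsto_const lim_inverse_n' LIMSEQ_Suc[OF lim_1_over_n])
    then show "(%k. 3 * e k) ----> 0" by simp
  qed
  show thesis
    by (rule that[of f]) (use fW fb lim in \<open>auto simp: amenable_seq_def\<close>)
qed

section \<open>Property A\<close>

text \<open>The Higson-Roe form of Yu's condition: \<open>\<nu> s\<close> is a probability measure
  on s + E, and its l1 distance to the measure at s + f is small. Distances are tested on finite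
  sets A, which avoids infinite sums.\<close>

definition property_A :: "'g::group_add itself => bool" where
  "property_A _ \<longleftrightarrow> (\<forall>F (\<epsilon>::real). finite F & \<epsilon> > 0 --> (\<exists>E (\<nu> :: 'g => 'g => real). finite E &
     (ALL s g. \<nu> s g >= 0) & (ALL s g. \<nu> s g ~= 0 --> - s + g \<in> E) & (ALL s. (\<Sum>h\<in>E. \<nu> s (s + h)) = 1) &
     (ALL s. \<forall>f\<in>F. ALL A. finite A --> (\<Sum>g\<in>A. \<bar>\<nu> s g - \<nu> (s + f) g\<bar>) <= \<epsilon>)))"

text \<open>One \<delta> accounts for the change from p to q, another for the change of the
  normalising sums; both are divided by a sum of at least c.\<close>

lemma sum_abs_normalized_diff_le:
  fixes p q :: "'a => real"
  assumes p: "!!h. h \<in> H ==> p h >= 0" and q: "!!h. h \<in> H ==> q h >= 0"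
    and P: "sum p H >= c" and Q: "sum q H > 0" and c: "c > 0" and \<delta>: "(\<Sum>h\<in>H. \<bar>p h - q h\<bar>) <= \<delta>"
  shows "(\<Sum>h\<in>H. \<bar>p h / sum p H - q h / sum q H\<bar>) <= 2 * \<delta> / c"
proof -
  let ?P = "sum p H" and ?Q = "sum q H"
  have P0: "?P > 0" using P c by linarith
  have PQ: "\<bar>?P - ?Q\<bar> <= \<delta>"
    using sum_abs[of "%h. p h - q h" H] \<delta> by (simp add: sum_subtractf)
  have "(\<Sum>h\<in>H. \<bar>p h / ?P - q h / ?Q\<bar>) <= (\<Sum>h\<in>H. \<bar>p h - q h\<bar> / ?P + q h * (\<bar>?P - ?Q\<bar> / (?P * ?Q)))"
  proof (rule sum_mono)
    fix h assume h: "h \<in> H"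
    have "p h / ?P - q h / ?Q = (p h - q h) / ?P + q h * ((?Q - ?P) / (?P * ?Q))"
      using P0 Q by (simp add: field_simps)
    then have "\<bar>p h / ?P - q h / ?Q\<bar> <= \<bar>(p h - q h) / ?P\<bar> + \<bar>q h * ((?Q - ?P) / (?P * ?Q))\<bar>"
      by (simp only: abs_triangle_ineq)
    also have "... = \<bar>p h - q h\<bar> / ?P + q h * (\<bar>?P - ?Q\<bar> / (?P * ?Q))"
      using P0 Q q[OF h] by (simp add: abs_mult abs_minus_commute)
    finally show "\<bar>p h / ?P - q h / ?Q\<bar> <= \<bar>p h - q h\<bar> / ?P + q h * (\<bar>?P - ?Q\<bar> / (?P * ?Q))" .
  qed
  also have "... = (\<Sum>h\<in>H. \<bar>p h - q h\<bar>) / ?P + ?Q * (\<bar>?P - ?Q\<bar> / (?P * ?Q))"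
    by (simp only: sum.distrib sum_divide_distrib sum_distrib_right)
  also have "... = ((\<Sum>h\<in>H. \<bar>p h - q h\<bar>) + \<bar>?P - ?Q\<bar>) / ?P"
    using Q P0 by (simp add: field_simps)
  also have "... <= (2 * \<delta>) / c"
    using \<delta> PQ P c by (intro frac_le) auto
  finally show ?thesis .
qed

lemma notin_translate:
  assumes "h \<notin> (%k. t + k) ` E"
  shows "- t + h \<notin> (E :: 'a::group_add set)"
proof
  assume "- t + h \<in> E"
  then have "t + (- t + h) \<in> (%k. t + k) ` E" by (rule imageI)
  then show False using assms by simp
qed

lemma amenable_seq_imp_property_A:
  assumes "amenable_seq (f :: nat => 'g::group_add V)"
  shows "property_A TYPE('g)"
  unfolding property_A_def
proof (intro allI impI, elim conjE)
  fix F :: "'g set" and \<epsilon> :: real assume F: "finite F" and \<epsilon>: "\<epsilon> > 0"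
  \<comment> \<open>Half of \<epsilon>, because normalising by sums of at least 1 doubles the
    distance.\<close>
  have "\<forall>g\<in>F. \<forall>\<^sub>F n in sequentially. norm (V_act g (f n) - f n) < \<epsilon> / 2"
  proof
    fix g
    have "(%n. norm (V_act g (f n) - f n)) ----> 0" using assms by (auto simp: amenable_seq_def)
    then show "\<forall>\<^sub>F n in sequentially. norm (V_act g (f n) - f n) < \<epsilon> / 2"
      using \<epsilon> by (auto dest!: order_tendstoD(2)[where a = "\<epsilon> / 2"])
  qed
  then have "\<forall>\<^sub>F n in sequentially. \<forall>g\<in>F. norm (V_act g (f n) - f n) < \<epsilon> / 2"
    using F by (simp add: eventually_ball_finite)
  then obtain n where n: "!!g. g \<in> F ==> norm (V_act g (f n) - f n) < \<epsilon> / 2"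
    by (auto simp: eventually_sequentially)
  define w where "w = f n"
  have w: "w \<in> W00" "pi00 w = 1" using assms by (auto simp: w_def amenable_seq_def)
  define E where "E = V_supp w"
  have E: "finite E" unfolding E_def by (rule W00_finite_supp[OF w(1)])
  define a where "a x h = \<bar>V_apply w h (principal_point x)\<bar>" for x h
  define S where "S x = (\<Sum>h\<in>E. a x h)" for x
  have a0: "a x h = 0" if "h \<notin> E" for x h using that by (simp add: a_def E_def V_supp_def)
  have a_nn: "a x h >= 0" for x h by (simp add: a_def)
  \<comment> \<open>The signed coefficients sum to 1, so their absolute values sum to at least
    1.\<close>
  have S1: "S x >= 1" for x
  proof -
    have "(\<Sum>h\<in>E. V_apply w h) = pi00 w *\<^sub>R one_CX" using W00_sum[OF w(1)] by (simp only: E_def V_supp_def)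
    then have "(\<Sum>h\<in>E. V_apply w h) (principal_point x) = 1" by (simp add: w)
    then have "\<bar>\<Sum>h\<in>E. V_apply w h (principal_point x)\<bar> = 1" by (simp add: sum_bcontfun_apply)
    then show ?thesis using sum_abs[of "%h. V_apply w h (principal_point x)" E] by (simp add: S_def a_def)
  qed
  \<comment> \<open>The evaluation point is - s: the action on points is by left translation,
    whereas property A moves s to s + f, and negation exchanges the two sides. The shift by s in the
    other argument moves the support from E to s + E.\<close>
  define \<nu> where "\<nu> s g = a (- s) (- s + g) / S (- s)" for s g
  show "\<exists>E (\<nu> :: 'g => 'g => real). finite E &
     (ALL s g. \<nu> s g >= 0) & (ALL s g. \<nu> s g ~= 0 --> - s + g \<in> E) & (ALL s. (\<Sum>h\<in>E. \<nu> s (s + h)) = 1) &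
     (ALL s. \<forall>f\<in>F. ALL A. finite A --> (\<Sum>g\<in>A. \<bar>\<nu> s g - \<nu> (s + f) g\<bar>) <= \<epsilon>)"
  proof (intro exI[of _ E] exI[of _ \<nu>] conjI allI ballI impI)
    show "finite E" by (rule E)
    fix s g
    show "\<nu> s g >= 0" using S1[of "- s"] a_nn by (simp add: \<nu>_def)
    show "- s + g \<in> E" if "\<nu> s g ~= 0" using a0 that by (auto simp: \<nu>_def)
    show "(\<Sum>h\<in>E. \<nu> s (s + h)) = 1"
      using S1[of "- s"] by (simp add: \<nu>_def sum_divide_distrib[symmetric] S_def[symmetric])
    fix t A assume t: "t \<in> F" and A: "finite (A :: 'g set)"
    let ?y = "- s"
    define H where "H = (%g. - s + g) ` A \<union> E \<union> (%h. t + h) ` E"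
    have H: "finite H" using A E by (simp add: H_def)
    \<comment> \<open>These are the absolute values of the translate of w by t at the point - s, so
      their distance to \<open>a ?y\<close> is at most \<open>norm (V_act t w - w)\<close>.\<close>
    define q where "q h = a (- t + ?y) (- t + h)" for h
    have q_nn: "q h >= 0" for h by (simp add: q_def a_nn)
    have P: "sum (a ?y) H = S ?y"
      unfolding S_def by (rule sum.mono_neutral_right) (use H a0 in \<open>auto simp: H_def\<close>)
    have Q: "sum q H = S (- t + ?y)"
    proof -
      have "S (- t + ?y) = sum q ((%h. t + h) ` E)"
        unfolding S_def by (subst sum.reindex) (simp_all only: o_def q_def minus_add_cancel inj_on_add)
      also have "... = sum q H"
      proof (rule sum.mono_neutral_left)
        show "\<forall>h\<in>H - (%h. t + h) ` E. q h = 0"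
        proof
          fix h assume "h \<in> H - (%h. t + h) ` E"
          then have "- t + h \<notin> E"
            using notin_translate by (metis DiffD2)
          then show "q h = 0" by (simp add: q_def a0)
        qed
      qed (use H in \<open>auto simp: H_def\<close>)
      finally show ?thesis ..
    qed
    have d: "(\<Sum>h\<in>H. \<bar>a ?y h - q h\<bar>) <= \<epsilon> / 2"
    proof -
      let ?D = "V_act t w - w"
      have D: "V_apply (V_act t w) h (principal_point ?y) = V_apply w (- t + h) (principal_point (- t + ?y))" for h
        by (simp add: V_apply_act CX_act_apply stone_cech_act_principal_point)
      have "(\<Sum>h\<in>H. \<bar>a ?y h - q h\<bar>) <= (\<Sum>h\<in>H. \<bar>V_apply ?D h (principal_point ?y)\<bar>)"
      proof (rule sum_mono)
        fix h
        have "V_apply ?D h (principal_point ?y) = V_apply w (- t + h) (principal_point (- t + ?y)) - V_apply w h (principal_point ?y)"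
          by (simp only: V_minus_apply minus_bcontfun.rep_eq D)
        then show "\<bar>a ?y h - q h\<bar> <= \<bar>V_apply ?D h (principal_point ?y)\<bar>"
          unfolding a_def q_def by linarith
      qed
      also have "... <= (\<Sum>\<^sub>\<infinity>h. \<bar>V_apply ?D h (principal_point ?y)\<bar>)"
        by (rule finite_sum_le_infsum) (use H V_summable in simp_all)
      also have "... <= norm ?D" by (rule V_mass_le_norm)
      also have "... <= \<epsilon> / 2" using n[OF t] by (simp add: w_def)
      finally show ?thesis .
    qed
    have "(\<Sum>h\<in>H. \<bar>a ?y h / sum (a ?y) H - q h / sum q H\<bar>) <= 2 * (\<epsilon> / 2) / 1"
    proof (rule sum_abs_normalized_diff_le)
      show "sum (a ?y) H >= 1" unfolding P by (rule S1)
      have "sum q H >= 1" unfolding Q by (rule S1)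
      then show "sum q H > 0" by linarith
    qed (use a_nn q_nn d in auto)
    moreover have "(\<Sum>g\<in>A. \<bar>\<nu> s g - \<nu> (s + t) g\<bar>) = (\<Sum>h\<in>(%g. - s + g) ` A. \<bar>a ?y h / sum (a ?y) H - q h / sum q H\<bar>)"
      unfolding P Q
      by (subst sum.reindex)
        (auto simp: \<nu>_def q_def minus_add add.assoc simp del: add_uminus_conv_diff intro!: inj_onI)
    moreover have "... <= (\<Sum>h\<in>H. \<bar>a ?y h / sum (a ?y) H - q h / sum q H\<bar>)"
      by (rule sum_mono2) (use H in \<open>auto simp: H_def\<close>)
    ultimately show "(\<Sum>g\<in>A. \<bar>\<nu> s g - \<nu> (s + t) g\<bar>) <= \<epsilon>" by linarith
  qed
qed

lemma V_norm_le_principal: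
  assumes fin: "finite (V_supp f)" and le: "!!h. (\<Sum>i\<in>V_supp f. \<bar>V_apply f i (principal_point h)\<bar>) <= b"
  shows "norm f <= b"
proof (rule V_norm_le)
  fix x
  have "(\<Sum>\<^sub>\<infinity>h. \<bar>V_apply f h x\<bar>) = (\<Sum>\<^sub>\<infinity>h\<in>V_supp f. \<bar>V_apply f h x\<bar>)"
    by (rule infsum_cong_neutral) (auto simp: V_supp_def)
  also have "... = (\<Sum>i\<in>V_supp f. \<bar>V_apply f i x\<bar>)" using fin by simp
  also have "... <= b" by (rule CX_sum_abs_le[OF le])
  finally show "(\<Sum>\<^sub>\<infinity>h. \<bar>V_apply f h x\<bar>) <= b" .
qed

lemma V_apply_sum: "V_apply (\<Sum>i\<in>A. f i) h = (\<Sum>i\<in>A. V_apply (f i) h)"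
  by (induction A rule: infinite_finite_induct) (simp_all add: zero_V.rep_eq plus_V.rep_eq)

text \<open>The dictionary of \<open>amenable_seq_imp_property_A\<close> is read backwards: the
  bounded function x \<mapsto> \<open>\<nu> (- x) (- x + h)\<close> is extended to \<beta>G and
  becomes the coefficient at h. Finiteness of E makes the result finitely supported.\<close>

lemma property_A_imp_amenable_seq:
  assumes "property_A TYPE('g::{group_add, countable})"
  obtains f :: "nat => 'g::{group_add, countable} V" where "amenable_seq f"
proof -
  have "\<exists>w :: 'g V. w \<in> W00 & pi00 w = 1 & norm w <= 1 & (\<forall>g\<in>F. norm (V_act g w - w) <= \<epsilon>)"
    if F: "finite F" and \<epsilon>: "\<epsilon> > 0" for F \<epsilon>
  proof -
    obtain E and \<nu> :: "'g => 'g => real" where E: "finite E" and nn: "ALL s g. \<nu> s g >= 0"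
      and supp: "ALL s g. \<nu> s g ~= 0 --> - s + g \<in> E" and mass: "ALL s. (\<Sum>h\<in>E. \<nu> s (s + h)) = 1"
      and inv: "ALL s. \<forall>f\<in>F. ALL A. finite A --> (\<Sum>g\<in>A. \<bar>\<nu> s g - \<nu> (s + f) g\<bar>) <= \<epsilon>"
      using assms[unfolded property_A_def, rule_format, OF conjI[OF F \<epsilon>]] by (elim exE conjE) (rule that)
    note nn = nn[rule_format] and supp = supp[rule_format] and mass = mass[rule_format] and inv = inv[rule_format]
    have le1: "\<nu> s (s + h) <= 1" for s h
    proof (cases "h \<in> E")
      case True
      then have "\<nu> s (s + h) <= (\<Sum>h\<in>E. \<nu> s (s + h))"
        using E nn by (intro member_le_sum) auto
      then show ?thesis by (simp add: mass)
    next
      case False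
      then have "\<nu> s (s + h) = 0" using supp[of s "s + h"] by auto
      then show ?thesis by simp
    qed
    define t where "t h = CX_ext (%x. \<nu> (- x) (- x + h))" for h
    have t: "t h (principal_point x) = \<nu> (- x) (- x + h)" for h x
      unfolding t_def
      by (rule CX_ext_principal_point) (use le1 nn in \<open>auto simp: bounded_iff intro!: exI[of _ 1]\<close>)
    define w where "w = (\<Sum>h\<in>E. V_mult (t h) (delta h))"
    have wap: "V_apply w k = (if k \<in> E then t k else 0)" for k
    proof -
      have "V_apply w k = (\<Sum>h\<in>E. if h = k then t k else 0)"
        unfolding w_def V_apply_sum
        by (intro sum.cong refl bcontfun_eqI) (auto simp: V_mult.rep_eq delta.rep_eq CX_mult_apply)
      then show ?thesis using E by simp
    qed
    have wpt: "V_apply w k (principal_point x) = \<nu> (- x) (- x + k)" for k x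
      using supp[of "- x" "- x + k"] by (auto simp: wap t)
    have mass': "(\<Sum>h\<in>E. \<nu> (- x) (- x + h)) = 1" for x by (rule mass)
    have W: "w \<in> W00 & pi00 w = 1"
    proof (rule W00_iff[OF E])
      have "(\<Sum>h\<in>E. V_apply w h) = one_CX"
        by (rule CX_eqI) (simp add: sum_bcontfun_apply wpt mass')
      then show "(\<Sum>h\<in>E. V_apply w h) = 1 *\<^sub>R one_CX" by simp
    qed (simp add: wap)
    have fin: "finite (V_supp w)" by (rule W00_finite_supp) (use W in simp)
    have "norm w <= 1"
    proof (rule V_norm_le_principal[OF fin])
      fix x
      have "(\<Sum>i\<in>V_supp w. \<bar>V_apply w i (principal_point x)\<bar>) <= (\<Sum>i\<in>E. \<bar>V_apply w i (principal_point x)\<bar>)"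
        by (rule sum_mono2[OF E]) (auto simp: V_supp_def wap)
      also have "... = 1" using nn mass' by (simp add: wpt)
      finally show "(\<Sum>i\<in>V_supp w. \<bar>V_apply w i (principal_point x)\<bar>) <= 1" .
    qed
    moreover have "norm (V_act g w - w) <= \<epsilon>" if g: "g \<in> F" for g
    proof (rule V_norm_le_principal)
      show fin': "finite (V_supp (V_act g w - w))"
        using W W00_act[of w g] W00_diff[of "V_act g w" w] by (intro W00_finite_supp) simp
      fix x
      let ?A = "V_supp (V_act g w - w)"
      have "V_apply (V_act g w - w) h (principal_point x) = \<nu> (- x + g) (- x + h) - \<nu> (- x) (- x + h)" for h
        by (simp add: V_minus_apply V_apply_act CX_act_apply stone_cech_act_principal_point wpt minus_add
            add.assoc del: add_uminus_conv_diff)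
      then have "(\<Sum>i\<in>?A. \<bar>V_apply (V_act g w - w) i (principal_point x)\<bar>) =
          (\<Sum>i\<in>?A. \<bar>\<nu> (- x) (- x + i) - \<nu> (- x + g) (- x + i)\<bar>)"
        by (simp only: abs_minus_commute)
      also have "... = (\<Sum>i\<in>(%i. - x + i) ` ?A. \<bar>\<nu> (- x) i - \<nu> (- x + g) i\<bar>)"
        by (subst sum.reindex) auto
      also have "... <= \<epsilon>" by (rule inv[OF g]) (use fin' in simp)
      finally show "(\<Sum>i\<in>?A. \<bar>V_apply (V_act g w - w) i (principal_point x)\<bar>) <= \<epsilon>" .
    qed
    ultimately show ?thesis using W by blast
  qed
  note ex = this
  have "ALL k. \<exists>w :: 'g V. w \<in> W00 & pi00 w = 1 & norm w <= 1 &
      (\<forall>g\<in>from_nat ` {0..<k}. norm (V_act g w - w) <= 1 / Suc k)"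
  proof
    fix k :: nat
    show "\<exists>w :: 'g V. w \<in> W00 & pi00 w = 1 & norm w <= 1 &
      (\<forall>g\<in>from_nat ` {0..<k}. norm (V_act g w - w) <= 1 / Suc k)"
      by (rule ex) auto
  qed
  from choice[OF this] obtain f :: "nat => 'g V" where
    *: "ALL k. f k \<in> W00 & pi00 (f k) = 1 & norm (f k) <= 1 &
      (\<forall>g\<in>from_nat ` {0..<k}. norm (V_act g (f k) - f k) <= 1 / Suc k)" ..
  then have f: "f k \<in> W00" "pi00 (f k) = 1" "norm (f k) <= 1"
    "!!g. g \<in> from_nat ` {0..<k} ==> norm (V_act g (f k) - f k) <= 1 / Suc k" for k by blast+
  have "(%k. norm (V_act g (f k) - f k)) ----> 0" for g
  proof (rule Lim_null_comparison)
    have "norm (V_act g (f k) - f k) <= 1 / Suc k" if "to_nat g < k" for k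
      using that by (intro f(4) image_eqI[of _ _ "to_nat g"]) auto
    then show "\<forall>\<^sub>F k in sequentially. norm (norm (V_act g (f k) - f k)) <= 1 / Suc k"
      unfolding eventually_sequentially by (intro exI[of _ "Suc (to_nat g)"]) auto
    show "(%k. 1 / real (Suc k)) ----> 0" by (rule LIMSEQ_Suc[OF lim_1_over_n])
  qed
  then show thesis using f by (intro that[of f]) (auto simp: amenable_seq_def)
qed

section \<open>Positive kernels of finite width\<close>

definition sum_set :: "'g::group_add set => 'g set => 'g set" where
  "sum_set S E = (%(s, h). s + h) ` (S \<times> E)"

lemma finite_sum_set: "finite S ==> finite E ==> finite (sum_set S E)"
  by (simp add: sum_set_def)

text \<open>Gram kernels of vectors indexed by S, the one at s lying in R^m \<otimes> l2(s + E);
  \<open>sum_set S E\<close> contains all the supports. The auxiliary index j makes these kernels a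
  convex cone, as the separation argument requires.\<close>

definition pos_kernels :: "'g::group_add set => 'g set => ('g => 'g => real) set" where
  "pos_kernels S E = {k. \<exists>(m::nat) \<xi>. (ALL j s g. \<xi> j s g ~= 0 --> s \<in> S & - s + g \<in> E) &
     k = (%s t. \<Sum>j<m. \<Sum>g\<in>sum_set S E. \<xi> j s g * \<xi> j t g)}"

text \<open>Squaring the entries of a Gram vector and summing over j gives a measure on s + E with
  mass near 1. By a^2 - b^2 = (a - b) (a + b) and Cauchy-Schwarz, the kernel controls the l1
  distance of two such measures. As E does not depend on S, the measures obtained on an exhaustion
  by finite sets converge along the ultrafilter without loss of mass.\<close>

lemma property_A_pos_kernels:
  assumes kernels: "!!(F :: 'g::{group_add, countable} set) \<delta>. finite F ==> \<delta> > 0 ==> EX E. finite E & (ALL S. finite S -->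
      (\<exists>k\<in>pos_kernels S E. \<forall>s\<in>S. \<forall>t\<in>S. - s + t \<in> F --> \<bar>k s t - 1\<bar> <= \<delta>))"
  shows "property_A TYPE('g)"
  unfolding property_A_def
proof (intro allI impI, elim conjE)
  fix F :: "'g set" and \<epsilon> :: real assume F: "finite F" and \<epsilon>: "\<epsilon> > 0"
  \<comment> \<open>24 is 2 * 6 / (1 / 2): before normalisation the l1 distance is at most 6 sqrt
    \<delta>, and normalising by sums of at least 1 / 2 contributes the factor 2 / (1 / 2).\<close>
  define \<delta> where "\<delta> = min (1 / 2) ((\<epsilon> / 24) ^ 2)"
  have \<delta>: "\<delta> > 0" "\<delta> <= 1 / 2" and "\<delta> <= (\<epsilon> / 24) ^ 2" using \<epsilon> by (auto simp: \<delta>_def)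
  then have sq: "sqrt \<delta> <= \<epsilon> / 24" using \<epsilon> by (intro real_le_lsqrt) auto
  \<comment> \<open>Adding 0 to F controls the diagonal of the kernel, hence the total
    masses.\<close>
  obtain E where E: "finite E" and k: "!!S. finite S ==>
      \<exists>k\<in>pos_kernels S E. \<forall>s\<in>S. \<forall>t\<in>S. - s + t \<in> insert 0 F --> \<bar>k s t - 1\<bar> <= \<delta>"
    using kernels[of "insert 0 F" \<delta>] F \<delta> by auto
  have loc: "\<exists>\<nu> :: 'g => 'g => real. (ALL s g. \<nu> s g >= 0 & \<nu> s g <= 1) & (ALL s g. \<nu> s g ~= 0 --> - s + g \<in> E) &
      (\<forall>s\<in>S. (\<Sum>h\<in>E. \<nu> s (s + h)) = 1) &
      (\<forall>s\<in>S. \<forall>f\<in>F. s + f \<in> S --> (ALL A. finite A --> (\<Sum>g\<in>A. \<bar>\<nu> s g - \<nu> (s + f) g\<bar>) <= \<epsilon>))"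
    if S: "finite S" for S
  proof -
    obtain k where kk: "k \<in> pos_kernels S E" "!!s t. s \<in> S ==> t \<in> S ==> - s + t \<in> insert 0 F ==> \<bar>k s t - 1\<bar> <= \<delta>"
      using k[OF S] by blast
    then obtain m :: nat and \<xi> where \<xi>: "!!j s g. \<xi> j s g ~= 0 ==> s \<in> S & - s + g \<in> E"
      and k_def: "k = (%s t. \<Sum>j<m. \<Sum>g\<in>sum_set S E. \<xi> j s g * \<xi> j t g)"
      unfolding pos_kernels_def by blast
    let ?G = "sum_set S E" and ?I = "{..<m} \<times> sum_set S E"
    have G: "finite ?G" by (rule finite_sum_set[OF S E])
    define p where "p s g = (\<Sum>j<m. (\<xi> j s g)\<^sup>2)" for s g
    have p_nn: "p s g >= 0" for s g by (simp add: p_def sum_nonneg)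
    have p_supp: "s \<in> S & - s + g \<in> E" if "p s g ~= 0" for s g
    proof -
      have "EX j. \<xi> j s g ~= 0"
      proof (rule ccontr)
        assume "\<not> ?thesis"
        then have "p s g = 0" by (simp add: p_def)
        then show False using that by simp
      qed
      then show ?thesis using \<xi> by blast
    qed
    have p_G: "g \<in> ?G" if "p s g ~= 0" for s g
      using p_supp[OF that] unfolding sum_set_def by (intro image_eqI[of _ _ "(s, - s + g)"]) auto
    have k_I: "k s t = (\<Sum>(j, g)\<in>?I. \<xi> j s g * \<xi> j t g)" for s t
      by (simp add: k_def sum.cartesian_product)
    have kss: "k s s = (\<Sum>g\<in>?G. p s g)" for s
      unfolding k_def p_def by (subst sum.swap) (simp add: power2_eq_square)
    have k1: "k s s >= 1 / 2" if "s \<in> S" for s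
    proof -
      have "\<bar>k s s - 1\<bar> <= \<delta>" using kk(2)[OF that that] by simp
      then show ?thesis using \<delta>(2) by linarith
    qed
    have diff: "(\<Sum>g\<in>?G. \<bar>p s g - p t g\<bar>) <= 6 * sqrt \<delta>" if st: "s \<in> S" "t \<in> S" "- s + t \<in> F" for s t
    proof -
      have b: "\<bar>k s s - 1\<bar> <= \<delta>" "\<bar>k t t - 1\<bar> <= \<delta>" "\<bar>k s t - 1\<bar> <= \<delta>"
        using kk(2)[of s s] kk(2)[of t t] kk(2)[of s t] st by auto
      have "(\<Sum>g\<in>?G. \<bar>p s g - p t g\<bar>) <= (\<Sum>g\<in>?G. \<Sum>j<m. \<bar>\<xi> j s g - \<xi> j t g\<bar> * \<bar>\<xi> j s g + \<xi> j t g\<bar>)"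
      proof (rule sum_mono)
        fix g
        have "p s g - p t g = (\<Sum>j<m. (\<xi> j s g - \<xi> j t g) * (\<xi> j s g + \<xi> j t g))"
          by (simp add: p_def sum_subtractf[symmetric] power2_eq_square algebra_simps)
        then show "\<bar>p s g - p t g\<bar> <= (\<Sum>j<m. \<bar>\<xi> j s g - \<xi> j t g\<bar> * \<bar>\<xi> j s g + \<xi> j t g\<bar>)"
          by (simp only: abs_mult[symmetric] sum_abs)
      qed
      also have "... = (\<Sum>(j, g)\<in>?I. \<bar>\<xi> j s g - \<xi> j t g\<bar> * \<bar>\<xi> j s g + \<xi> j t g\<bar>)"
        by (subst sum.swap) (simp add: sum.cartesian_product)
      finally have 1: "(\<Sum>g\<in>?G. \<bar>p s g - p t g\<bar>) <= ..." .
      have "(\<Sum>(j, g)\<in>?I. \<bar>\<xi> j s g - \<xi> j t g\<bar> * \<bar>\<xi> j s g + \<xi> j t g\<bar>)\<^sup>2 <=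
          (\<Sum>(j, g)\<in>?I. \<bar>\<xi> j s g - \<xi> j t g\<bar>\<^sup>2) * (\<Sum>(j, g)\<in>?I. \<bar>\<xi> j s g + \<xi> j t g\<bar>\<^sup>2)"
        using Cauchy_Schwarz_ineq_sum[of "%(j, g). \<bar>\<xi> j s g - \<xi> j t g\<bar>" "%(j, g). \<bar>\<xi> j s g + \<xi> j t g\<bar>" ?I]
        by (simp add: case_prod_unfold)
      also have "(\<Sum>(j, g)\<in>?I. \<bar>\<xi> j s g - \<xi> j t g\<bar>\<^sup>2) = k s s + k t t - 2 * k s t"
        unfolding k_I by (simp add: case_prod_unfold sum.distrib[symmetric] sum_subtractf[symmetric] sum_distrib_left power2_diff power2_eq_square algebra_simps)
      also have "(\<Sum>(j, g)\<in>?I. \<bar>\<xi> j s g + \<xi> j t g\<bar>\<^sup>2) = k s s + k t t + 2 * k s t"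
        unfolding k_I by (simp add: case_prod_unfold sum.distrib[symmetric] sum_distrib_left power2_sum power2_eq_square algebra_simps)
      \<comment> \<open>The three kernel values are within \<delta> <= 1 / 2 of 1, so the first
        factor is at most 2 (1 + \<delta>) - 2 (1 - \<delta>) = 4 \<delta> and the second at most 4
        (1 + \<delta>) <= 6.\<close>
      also have "(k s s + k t t - 2 * k s t) * (k s s + k t t + 2 * k s t) <= (4 * \<delta>) * 6"
      proof (rule mult_mono)
        show "k s s + k t t - 2 * k s t <= 4 * \<delta>" "k s s + k t t + 2 * k s t <= 6" "0 <= k s s + k t t + 2 * k s t"
          using b \<delta>(2) by (simp_all add: abs_le_iff)
      qed (use \<delta> in simp)
      also have "... <= (6 * sqrt \<delta>)\<^sup>2" using \<delta> by (simp add: power_mult_distrib)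
      finally have "(\<Sum>(j, g)\<in>?I. \<bar>\<xi> j s g - \<xi> j t g\<bar> * \<bar>\<xi> j s g + \<xi> j t g\<bar>) <= 6 * sqrt \<delta>"
        by (rule power2_le_imp_le) (use \<delta> in simp)
      then show ?thesis using 1 by linarith
    qed
    \<comment> \<open>The default 0 off S disappears in the limit, since every s belongs to all
      sufficiently late sets of the exhaustion.\<close>
    define \<nu> where "\<nu> s g = (if s \<in> S then p s g / k s s else 0)" for s g
    have \<nu>0: "\<nu> s g = 0" if "g \<notin> ?G" for s g
    proof -
      have "p s g = 0" using p_G that by blast
      then show ?thesis by (simp add: \<nu>_def)
    qed
    show ?thesis
    proof (intro exI[of _ \<nu>] conjI allI ballI impI)
      fix s g
      show nn: "\<nu> s g >= 0" using k1[of s] p_nn by (auto simp: \<nu>_def)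
      show "\<nu> s g <= 1"
      proof (cases "s \<in> S & g \<in> ?G")
        case True
        then have "p s g <= k s s" unfolding kss using G p_nn by (intro member_le_sum) auto
        then show ?thesis using True k1[of s] by (simp add: \<nu>_def)
      next
        case False
        then have "s \<notin> S \<or> p s g = 0" using p_G by blast
        then show ?thesis by (auto simp: \<nu>_def)
      qed
      show "- s + g \<in> E" if "\<nu> s g ~= 0" using that p_supp[of s g] by (auto simp: \<nu>_def split: if_splits)
      show "(\<Sum>h\<in>E. \<nu> s (s + h)) = 1" if s: "s \<in> S"
      proof -
        have "(\<Sum>h\<in>E. \<nu> s (s + h)) = (\<Sum>g\<in>(%h. s + h) ` E. \<nu> s g)"
          by (subst sum.reindex) auto
        also have "... = (\<Sum>g\<in>?G. \<nu> s g)"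
        proof (rule sum.mono_neutral_left[OF G])
          show "(%h. s + h) ` E \<subseteq> ?G" using s by (auto simp: sum_set_def)
          show "\<forall>g\<in>?G - (%h. s + h) ` E. \<nu> s g = 0"
          proof
            fix g assume "g \<in> ?G - (%h. s + h) ` E"
            then have "- s + g \<notin> E" using notin_translate by (metis DiffD2)
            then show "\<nu> s g = 0" using p_supp[of s g] by (auto simp: \<nu>_def)
          qed
        qed
        also have "... = 1" using s k1[OF s] by (simp add: \<nu>_def sum_divide_distrib[symmetric] kss[symmetric])
        finally show ?thesis .
      qed
    next
      fix s f A assume s: "s \<in> S" and f: "f \<in> F" and sf: "s + f \<in> S" and A: "finite (A :: 'g set)"
      have "(\<Sum>g\<in>A. \<bar>\<nu> s g - \<nu> (s + f) g\<bar>) <= (\<Sum>g\<in>A \<union> ?G. \<bar>\<nu> s g - \<nu> (s + f) g\<bar>)"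
        using A G by (intro sum_mono2) auto
      also have "... = (\<Sum>g\<in>?G. \<bar>\<nu> s g - \<nu> (s + f) g\<bar>)"
        by (rule sum.mono_neutral_right) (use A G \<nu>0 in auto)
      also have "... = (\<Sum>g\<in>?G. \<bar>p s g / sum (p s) ?G - p (s + f) g / sum (p (s + f)) ?G\<bar>)"
        using s sf by (simp add: \<nu>_def kss)
      also have "... <= 2 * (6 * sqrt \<delta>) / (1 / 2)"
      proof (rule sum_abs_normalized_diff_le)
        show "(\<Sum>g\<in>?G. \<bar>p s g - p (s + f) g\<bar>) <= 6 * sqrt \<delta>"
          by (rule diff) (use s sf f in \<open>auto\<close>)
      qed (use p_nn k1[OF s] k1[OF sf] in \<open>auto simp: kss[symmetric]\<close>)
      also have "... <= \<epsilon>" using sq by simp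
      finally show "(\<Sum>g\<in>A. \<bar>\<nu> s g - \<nu> (s + f) g\<bar>) <= \<epsilon>" .
    qed
  qed
  define S :: "nat => 'g set" where "S n = from_nat ` {0..<n}" for n
  have S: "finite (S n)" for n by (simp add: S_def)
  have evS: "eventually (%n. s \<in> S n) free_uf" for s
  proof (rule eventually_free_uf)
    have "s \<in> S n" if "Suc (to_nat s) <= n" for n
      using that unfolding S_def by (intro image_eqI[of _ _ "to_nat s"]) auto
    then show "\<forall>\<^sub>F n in sequentially. s \<in> S n" unfolding eventually_sequentially by blast
  qed
  have "ALL n. \<exists>\<nu> :: 'g => 'g => real. (ALL s g. \<nu> s g >= 0 & \<nu> s g <= 1) & (ALL s g. \<nu> s g ~= 0 --> - s + g \<in> E) &
      (\<forall>s\<in>S n. (\<Sum>h\<in>E. \<nu> s (s + h)) = 1) &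
      (\<forall>s\<in>S n. \<forall>f\<in>F. s + f \<in> S n --> (ALL A. finite A --> (\<Sum>g\<in>A. \<bar>\<nu> s g - \<nu> (s + f) g\<bar>) <= \<epsilon>))"
    by (intro allI loc S)
  from choice[OF this] obtain \<nu>' :: "nat => 'g => 'g => real" where
    \<nu>': "ALL n. (ALL s g. \<nu>' n s g >= 0 & \<nu>' n s g <= 1) & (ALL s g. \<nu>' n s g ~= 0 --> - s + g \<in> E) &
      (\<forall>s\<in>S n. (\<Sum>h\<in>E. \<nu>' n s (s + h)) = 1) &
      (\<forall>s\<in>S n. \<forall>f\<in>F. s + f \<in> S n --> (ALL A. finite A --> (\<Sum>g\<in>A. \<bar>\<nu>' n s g - \<nu>' n (s + f) g\<bar>) <= \<epsilon>))" ..
  have nn: "\<nu>' n s g >= 0" and le1: "\<nu>' n s g <= 1" for n s g using \<nu>' by auto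
  have supp: "\<nu>' n s g ~= 0 ==> - s + g \<in> E" for n s g using \<nu>' by blast
  have mass: "s \<in> S n ==> (\<Sum>h\<in>E. \<nu>' n s (s + h)) = 1" for n s using \<nu>' by blast
  have inv: "s \<in> S n ==> f \<in> F ==> s + f \<in> S n ==> finite A ==> (\<Sum>g\<in>A. \<bar>\<nu>' n s g - \<nu>' n (s + f) g\<bar>) <= \<epsilon>" for n s f A
    using \<nu>' by blast
  define \<nu> where "\<nu> s g = Lim free_uf (%n. \<nu>' n s g)" for s g
  have \<nu>: "((%n. \<nu>' n s g) ---> \<nu> s g) free_uf" for s g
    unfolding \<nu>_def
    by (rule free_uf_lim) (use nn le1 in \<open>auto simp: bounded_iff intro!: exI[of _ 1]\<close>)
  show "\<exists>E (\<nu> :: 'g => 'g => real). finite E &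
     (ALL s g. \<nu> s g >= 0) & (ALL s g. \<nu> s g ~= 0 --> - s + g \<in> E) & (ALL s. (\<Sum>h\<in>E. \<nu> s (s + h)) = 1) &
     (ALL s. \<forall>f\<in>F. ALL A. finite A --> (\<Sum>g\<in>A. \<bar>\<nu> s g - \<nu> (s + f) g\<bar>) <= \<epsilon>)"
  proof (intro exI[of _ E] exI[of _ \<nu>] conjI allI ballI impI)
    show "finite E" by (rule E)
    fix s g
    show "\<nu> s g >= 0" by (rule tendsto_lowerbound[OF \<nu>]) (use nn in auto)
    show "- s + g \<in> E" if "\<nu> s g ~= 0"
    proof (rule ccontr)
      assume "- s + g \<notin> E"
      then have "\<nu>' n s g = 0" for n using supp by blast
      then have "\<nu> s g = 0" using tendsto_unique[OF _ \<nu>[of s g], of 0] by simp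
      then show False using that by simp
    qed
    show "(\<Sum>h\<in>E. \<nu> s (s + h)) = 1"
    proof (rule tendsto_unique)
      show "((%n. \<Sum>h\<in>E. \<nu>' n s (s + h)) ---> (\<Sum>h\<in>E. \<nu> s (s + h))) free_uf"
        by (intro tendsto_sum \<nu>)
      show "((%n. \<Sum>h\<in>E. \<nu>' n s (s + h)) ---> 1) free_uf"
        by (rule tendsto_eventually, rule eventually_mono[OF evS[of s]]) (rule mass)
    qed simp
    fix f A assume f: "f \<in> F" and A: "finite (A :: 'g set)"
    show "(\<Sum>g\<in>A. \<bar>\<nu> s g - \<nu> (s + f) g\<bar>) <= \<epsilon>"
    proof (rule tendsto_upperbound)
      show "((%n. \<Sum>g\<in>A. \<bar>\<nu>' n s g - \<nu>' n (s + f) g\<bar>) ---> (\<Sum>g\<in>A. \<bar>\<nu> s g - \<nu> (s + f) g\<bar>)) free_uf"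
        by (intro tendsto_intros \<nu>)
      show "\<forall>\<^sub>F n in free_uf. (\<Sum>g\<in>A. \<bar>\<nu>' n s g - \<nu>' n (s + f) g\<bar>) <= \<epsilon>"
        using evS[of s] evS[of "s + f"] by eventually_elim (rule inv[OF _ f _ A])
    qed simp
  qed
qed

section \<open>Operators on square-summable families\<close>

lemma ell2_apply_diff: "ell2_apply (x - y) i = ell2_apply x i - ell2_apply y i"
  unfolding minus_ell2_def plus_ell2.rep_eq uminus_ell2.rep_eq by simp

lemma ell2_apply_scaleR: "ell2_apply (r *\<^sub>R x) i = of_real r * ell2_apply x i"
  by (simp add: scaleR_ell2_def cscale.rep_eq)

lemma ell2_apply_sum: "ell2_apply (\<Sum>k\<in>A. f k) i = (\<Sum>k\<in>A. ell2_apply (f k) i)"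
  by (induction A rule: infinite_finite_induct) (simp_all add: zero_ell2.rep_eq plus_ell2.rep_eq)

lemmas ell2_coord = zero_ell2.rep_eq plus_ell2.rep_eq uminus_ell2.rep_eq ell2_apply_diff ell2_apply_scaleR
  cscale.rep_eq ell2_apply_sum

lemma ell2_finite_sum_le: "finite A ==> (\<Sum>i\<in>A. (cmod (ell2_apply x i))\<^sup>2) <= (norm x)\<^sup>2"
  unfolding norm_ell2
  by (subst real_sqrt_pow2) (auto intro!: infsum_nonneg finite_sum_le_infsum ell2_summable)

lemma ell2_norm_le:
  assumes "!!A. finite A ==> (\<Sum>i\<in>A. (cmod (ell2_apply x i))\<^sup>2) <= b\<^sup>2" "b >= 0"
  shows "norm x <= b"
  unfolding norm_ell2
  by (rule real_le_lsqrt) (use assms in \<open>auto intro!: infsum_nonneg infsum_le_finite_sums ell2_summable\<close>)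

lemma ell2_exI:
  assumes b: "!!A. finite A ==> (\<Sum>i\<in>A. (cmod (f i))\<^sup>2) <= b\<^sup>2" "b >= 0"
  shows "ell2_apply (Abs_ell2 f) = f & norm (Abs_ell2 f) <= b"
proof -
  have "(%i. (cmod (f i))\<^sup>2) summable_on UNIV"
    by (rule nonneg_bdd_above_summable_on) (use b in \<open>auto simp: bdd_above_def\<close>)
  then have eq: "ell2_apply (Abs_ell2 f) = f" by (simp add: Abs_ell2_inverse)
  then show ?thesis using ell2_norm_le[of "Abs_ell2 f" b] b by simp
qed

lemma ell2_coord_le: "cmod (ell2_apply x i) <= norm x"
  using ell2_finite_sum_le[of "{i}" x] by (simp add: abs_le_square_iff[symmetric])

text \<open>Completeness passes on to the spaces of operators, where the Banach fixed point theorem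
  is applied below.\<close>

instance ell2 :: (type) banach
proof
  fix X :: "nat => 'a ell2" assume X: "Cauchy X"
  have "Cauchy (%n. ell2_apply (X n) i)" for i
    unfolding Cauchy_def dist_norm ell2_apply_diff[symmetric]
    using X[unfolded Cauchy_def dist_norm] by (meson ell2_coord_le le_less_trans)
  then have "EX l. (%n. ell2_apply (X n) i) ----> l" for i
    using Cauchy_convergent convergent_def by blast
  then obtain f where f: "!!i. (%n. ell2_apply (X n) i) ----> f i" by metis
  have tail: "(\<Sum>i\<in>A. (cmod (ell2_apply (X n) i - f i))\<^sup>2) <= e\<^sup>2"
    if A: "finite A" and N: "!!m. m >= N ==> norm (X n - X m) <= e" for A n N e
  proof (rule LIMSEQ_le_const2)
    show "(%m. \<Sum>i\<in>A. (cmod (ell2_apply (X n) i - ell2_apply (X m) i))\<^sup>2) ----> (\<Sum>i\<in>A. (cmod (ell2_apply (X n) i - f i))\<^sup>2)"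
      by (intro tendsto_intros f)
    have "(\<Sum>i\<in>A. (cmod (ell2_apply (X n) i - ell2_apply (X m) i))\<^sup>2) <= e\<^sup>2" if "m >= N" for m
    proof -
      have "(\<Sum>i\<in>A. (cmod (ell2_apply (X n - X m) i))\<^sup>2) <= (norm (X n - X m))\<^sup>2"
        by (rule ell2_finite_sum_le[OF A])
      also have "... <= e\<^sup>2" using N[OF that] by (intro power_mono) auto
      finally show ?thesis by (simp add: ell2_apply_diff)
    qed
    then show "EX N. \<forall>m\<ge>N. (\<Sum>i\<in>A. (cmod (ell2_apply (X n) i - ell2_apply (X m) i))\<^sup>2) <= e\<^sup>2" by blast
  qed
  have cau: "EX N. \<forall>n\<ge>N. \<forall>m\<ge>N. norm (X n - X m) <= e" if "e > 0" for e
    using X[unfolded Cauchy_def dist_norm] that by (meson less_imp_le)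
  obtain N1 where N1: "\<forall>n\<ge>N1. \<forall>m\<ge>N1. norm (X n - X m) <= 1" using cau[of 1] by auto
  have "ell2_apply (Abs_ell2 (%i. ell2_apply (X N1) i - f i)) = (%i. ell2_apply (X N1) i - f i)"
    using ell2_exI[of "%i. ell2_apply (X N1) i - f i" 1] tail[of _ N1 N1 1] N1 by auto
  \<comment> \<open>Only differences are known to be square summable, so the limit is reached from
    the member \<open>X N1\<close>.\<close>
  define x where "x = X N1 - Abs_ell2 (%i. ell2_apply (X N1) i - f i)"
  have x: "ell2_apply x i = f i" for i
    unfolding x_def ell2_apply_diff \<open>ell2_apply (Abs_ell2 _) = _\<close> by simp
  have "X ----> x"
  proof (rule LIMSEQ_I)
    fix r :: real assume r: "r > 0"
    obtain N where N: "\<forall>n\<ge>N. \<forall>m\<ge>N. norm (X n - X m) <= r / 2" using cau[of "r / 2"] r by auto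
    have "norm (X n - x) <= r / 2" if "n >= N" for n
      by (rule ell2_norm_le) (use tail[of _ N n "r / 2"] N that r in \<open>auto simp: ell2_apply_diff x\<close>)
    then show "EX N. \<forall>n\<ge>N. norm (X n - x) < r" using r by (intro exI[of _ N]) fastforce
  qed
  then show "convergent X" by (auto simp: convergent_def)
qed

lift_definition ket :: "'i => 'i ell2" is "%i k. if k = i then 1 else 0"
proof -
  fix i :: 'i
  have "(%k. (cmod (if k = i then 1 else 0))\<^sup>2) summable_on UNIV \<longleftrightarrow> (%k. 1 :: real) summable_on {i}"
    by (rule summable_on_cong_neutral) auto
  then show "(%k. (cmod (if k = i then 1 else 0))\<^sup>2) summable_on UNIV" by simp
qed

lemma cinner_add_right: "cinner z (x + y) = cinner z x + cinner z y"
  by (subst (1 2 3) cinner_commute) (simp add: cinner_add_left)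

lemma inner_cinner: "inner x y = Re (cinner x y)"
  by (simp add: inner_ell2_def)

lemma scaleR_cscale: "r *\<^sub>R x = cscale (of_real r) x" for x :: "'i ell2"
  by (simp add: scaleR_ell2_def)

text \<open>A scalar of modulus 1 rotates \<open>cinner x y\<close> to the positive axis, where the
  real Cauchy-Schwarz inequality applies.\<close>

lemma cmod_cinner_le: "cmod (cinner x y) <= norm x * norm y"
proof (cases "cinner x y = 0")
  case False
  let ?z = "cinner x y"
  let ?c = "cnj ?z / of_real (cmod ?z)"
  have "cinner x (cscale ?c y) = of_real (cmod ?z)"
    unfolding cinner_cscale_right using False
    by (simp add: complex_norm_square[symmetric] power2_eq_square mult.commute)
  then have "cmod ?z = inner x (cscale ?c y)" by (simp add: inner_cinner)
  also have "... <= norm x * norm (cscale ?c y)" by (rule norm_cauchy_schwarz)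
  also have "norm (cscale ?c y) = norm y" using False by (simp add: norm_cscale norm_divide)
  finally show ?thesis .
qed simp

lemma bounded_bilinear_cinner: "bounded_bilinear cinner"
proof
  show "EX K. ALL a b. norm (cinner a b) <= norm a * norm b * K"
    by (intro exI[of _ 1]) (simp add: cmod_cinner_le)
qed (simp_all add: cinner_add_left cinner_add_right scaleR_cscale cinner_cscale_left cinner_cscale_right scaleR_conv_of_real)

lemmas cinner_bilinear = bounded_bilinear.diff_left[OF bounded_bilinear_cinner] bounded_bilinear.diff_right[OF bounded_bilinear_cinner]
  bounded_bilinear.minus_left[OF bounded_bilinear_cinner] bounded_bilinear.minus_right[OF bounded_bilinear_cinner]
  bounded_bilinear.zero_left[OF bounded_bilinear_cinner] bounded_bilinear.zero_right[OF bounded_bilinear_cinner]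
  cinner_add_left cinner_add_right

lemma cinner_ket_left: "cinner (ket i) x = ell2_apply x i"
proof -
  have "(\<Sum>\<^sub>\<infinity>k. cnj (ell2_apply (ket i) k) * ell2_apply x k) = (\<Sum>\<^sub>\<infinity>k\<in>{i}. cnj (ell2_apply (ket i) k) * ell2_apply x k)"
    by (rule infsum_cong_neutral) (auto simp: ket.rep_eq)
  then show ?thesis by (simp add: cinner_def ket.rep_eq)
qed

lemma cinner_ket_right: "cinner x (ket i) = cnj (ell2_apply x i)"
  by (subst cinner_commute) (simp add: cinner_ket_left)

lemma norm_ket [simp]: "norm (ket i) = 1"
proof -
  have "(norm (ket i))\<^sup>2 = 1"
    by (simp add: power2_norm_eq_inner inner_cinner cinner_ket_left ket.rep_eq)
  then show ?thesis using norm_ge_zero[of "ket i"] by (simp only: power2_eq_1_iff) linarith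
qed

definition finite_part :: "'i set => 'i ell2 => 'i ell2" where
  "finite_part A x = (\<Sum>i\<in>A. cscale (ell2_apply x i) (ket i))"

lemma finite_part_apply: "finite A ==> ell2_apply (finite_part A x) k = (if k \<in> A then ell2_apply x k else 0)"
proof -
  assume A: "finite A"
  have "ell2_apply (finite_part A x) k = (\<Sum>i\<in>A. if k = i then ell2_apply x k else 0)"
    unfolding finite_part_def ell2_coord by (intro sum.cong) (auto simp: ket.rep_eq)
  then show ?thesis using A by simp
qed

lemma finite_part_approx:
  assumes "e > 0"
  obtains A where "finite A" "!!B. finite B ==> A \<subseteq> B ==> norm (x - finite_part B x) < e"
proof -
  let ?f = "%i. (cmod (ell2_apply x i))\<^sup>2"
  have "(?f has_sum (norm x)\<^sup>2) UNIV"
    unfolding norm_ell2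
    by (subst real_sqrt_pow2) (auto intro!: infsum_nonneg has_sum_infsum ell2_summable)
  then have "eventually (%A. dist (sum ?f A) ((norm x)\<^sup>2) < e\<^sup>2 / 4) (finite_subsets_at_top UNIV)"
    unfolding has_sum_def by (rule tendstoD) (use assms in simp)
  then obtain A where A: "finite A" "!!B. finite B ==> A \<subseteq> B ==> dist (sum ?f B) ((norm x)\<^sup>2) < e\<^sup>2 / 4"
    unfolding eventually_finite_subsets_at_top by auto
  have "norm (x - finite_part B x) < e" if B: "finite B" "A \<subseteq> B" for B
  proof -
    have "norm (x - finite_part B x) <= e / 2"
    proof (rule ell2_norm_le)
      fix C :: "'a set" assume C: "finite C"
      have "(\<Sum>i\<in>C. (cmod (ell2_apply (x - finite_part B x) i))\<^sup>2) = sum ?f (C - B)"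
        using C B by (intro sum.mono_neutral_cong_right) (auto simp: ell2_apply_diff finite_part_apply)
      also have "... = sum ?f (C \<union> B) - sum ?f B"
        using sum.subset_diff[of B "C \<union> B" ?f] C B by (simp add: Un_Diff)
      also have "... <= (norm x)\<^sup>2 - sum ?f B"
        using ell2_finite_sum_le[of "C \<union> B" x] C B by simp
      also have "... <= e\<^sup>2 / 4"
        using A(2)[OF B] unfolding dist_real_def by linarith
      finally show "(\<Sum>i\<in>C. (cmod (ell2_apply (x - finite_part B x) i))\<^sup>2) <= (e / 2)\<^sup>2"
        by (simp add: power_divide)
    qed (use assms in simp)
    then show ?thesis using assms by linarith
  qed
  with A(1) show thesis by (rule that)
qed

text \<open>Finite combinations of basis vectors are dense. Complex multiples of basis vectors are
  built into the hypothesis, since P is only assumed to be additive.\<close>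

lemma ell2_dense_induct:
  assumes cl: "closed {\<psi>. P \<psi>}" and ket: "!!c p. P (cscale c (ket p))"
    and add: "!!x y. P x ==> P y ==> P (x + y)"
  shows "P \<psi>"
proof -
  have "cscale 0 x = 0" for x :: "'a ell2" by (rule ell2_eqI) (simp add: ell2_coord)
  then have 0: "P 0" using ket[of 0] by simp
  have fin: "P (finite_part A \<psi>)" for A
    unfolding finite_part_def
    by (induction A rule: infinite_finite_induct) (auto intro: 0 add ket)
  have "\<exists>y\<in>{\<psi>. P \<psi>}. dist y \<psi> < e" if e: "e > 0" for e
  proof -
    obtain A where "finite A" "!!B. finite B ==> A \<subseteq> B ==> norm (\<psi> - finite_part B \<psi>) < e"
      using finite_part_approx[OF e, of \<psi>] by blast
    then have "norm (\<psi> - finite_part A \<psi>) < e" by blast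
    then show ?thesis using fin by (intro bexI[of _ "finite_part A \<psi>"]) (auto simp: dist_norm norm_minus_commute)
  qed
  then have "\<psi> \<in> closure {\<psi>. P \<psi>}" by (simp add: closure_approachable)
  then show ?thesis using cl by (simp add: closure_closed)
qed

definition clinear :: "('i ell2 \<Rightarrow>\<^sub>L 'j ell2) => bool" where
  "clinear T \<longleftrightarrow> (ALL c x. T (cscale c x) = cscale c (T x))"

lemma cscale_simps:
  "cscale c (x + y) = cscale c x + cscale c y" "cscale c (x - y) = cscale c x - cscale c y"
  "cscale c (cscale d x) = cscale (c * d) x" "cscale 1 x = x" "cscale c 0 = 0" "cscale 0 x = 0"
  by (rule ell2_eqI; simp add: ell2_coord algebra_simps)+

lemma clinear_apply: "clinear T ==> T (cscale c x) = cscale c (T x)"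
  by (simp add: clinear_def)

lemma clinear_add: "clinear S ==> clinear T ==> clinear (S + T)"
  and clinear_diff: "clinear S ==> clinear T ==> clinear (S - T)"
  and clinear_0: "clinear 0"
  by (simp_all add: clinear_def blinfun.add_left blinfun.diff_left cscale_simps)

lemma clinear_compose: "clinear S ==> clinear T ==> clinear (S o\<^sub>L T)"
  by (simp add: clinear_def)

lemma closed_clinear: "closed {T. clinear T}"
proof -
  have eq: "{T :: 'a ell2 \<Rightarrow>\<^sub>L 'b ell2. clinear T} = (\<Inter>c. \<Inter>x. {T. blinfun_apply T (cscale c x) = cscale c (blinfun_apply T x)})"
    by (auto simp: clinear_def)
  have "continuous_on UNIV (cscale c :: 'b ell2 => _)" for c
    by (rule bounded_linear.continuous_on[OF bounded_linear_cscale continuous_on_id])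
  then have "continuous_on UNIV (%T :: 'a ell2 \<Rightarrow>\<^sub>L 'b ell2. cscale c (T x))" for c x
    by (rule continuous_on_compose2) (auto intro!: continuous_intros)
  then show ?thesis
    unfolding eq by (intro closed_INT ballI closed_Collect_eq) (auto intro!: continuous_intros)
qed

lemma blinfun_ket_eqI:
  assumes "clinear S" "clinear T" "!!i. S (ket i) = T (ket i)"
  shows "S = T"
proof (rule blinfun_eqI)
  fix x
  show "S x = T x"
  proof (rule ell2_dense_induct[where P = "%x. S x = T x"])
    show "closed {x. S x = T x}" by (intro closed_Collect_eq continuous_intros)
  qed (simp_all add: assms clinear_apply blinfun.add_right)
qed

lemma blinfun_norm_le_finite:
  fixes T :: "'i ell2 \<Rightarrow>\<^sub>L 'v::real_normed_vector"
  assumes "!!x A. finite A ==> norm (T (finite_part A x)) <= b * norm x" "b >= 0"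
  shows "norm T <= b"
proof (rule norm_blinfun_bound[OF assms(2)])
  fix x
  show "norm (T x) <= b * norm x"
  proof (rule field_le_epsilon)
    fix e :: real assume e: "e > 0"
    then obtain A where A: "finite A" "norm (x - finite_part A x) < e / (norm T + 1)"
      using finite_part_approx[of "e / (norm T + 1)" x] by (metis add_nonneg_pos divide_pos_pos norm_ge_zero order_refl zero_less_one)
    have "norm (T x) <= norm (T (finite_part A x)) + norm (T (x - finite_part A x))"
      by (simp only: blinfun.diff_right norm_triangle_sub)
    also have "norm (T (x - finite_part A x)) <= norm T * norm (x - finite_part A x)" by (rule norm_blinfun)
    also have "... <= (norm T + 1) * (e / (norm T + 1))" using A by (intro mult_mono) auto
    also have "... = e" using norm_ge_zero[of T] by (simp add: add_nonneg_eq_0_iff)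
    finally show "norm (T x) <= b * norm x + e" using assms(1)[OF A(1), of x] by simp
  qed
qed

subsection \<open>Adjoints\<close>

lemma is_adjoint_sym: "is_adjoint S T ==> is_adjoint T S"
  unfolding is_adjoint_def by (metis cinner_commute complex_cnj_cancel_iff)

lemma is_adjoint_add: "is_adjoint S T ==> is_adjoint S' T' ==> is_adjoint (S + S') (T + T')"
  and is_adjoint_diff: "is_adjoint S T ==> is_adjoint S' T' ==> is_adjoint (S - S') (T - T')"
  and is_adjoint_0: "is_adjoint 0 0"
  and is_adjoint_uminus: "is_adjoint S T ==> is_adjoint (- S) (- T)"
  by (simp_all add: is_adjoint_def blinfun.add_left blinfun.diff_left blinfun.minus_left cinner_bilinear)

lemma is_adjoint_sum: "(!!i. i \<in> I ==> is_adjoint (S i) (T i)) ==> is_adjoint (\<Sum>i\<in>I. S i) (\<Sum>i\<in>I. T i)"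
  by (induction I rule: infinite_finite_induct) (simp_all add: is_adjoint_0 is_adjoint_add)

lemma is_adjoint_compose: "is_adjoint S T ==> is_adjoint S' T' ==> is_adjoint (S' o\<^sub>L S) (T o\<^sub>L T')"
  by (simp add: is_adjoint_def)

lemma is_adjoint_cscale: "is_adjoint S T ==> is_adjoint (cscale_op (cnj c) S) (cscale_op c T)"
  by (simp add: is_adjoint_def cscale_op_apply cinner_cscale_left cinner_cscale_right)

lemma is_adjoint_scaleR: "is_adjoint S T ==> is_adjoint (r *\<^sub>R S) (r *\<^sub>R T)"
  by (simp add: is_adjoint_def blinfun.scaleR_left scaleR_cscale cinner_cscale_left cinner_cscale_right)

lemma scaleR_cscale_op: "r *\<^sub>R T = cscale_op (of_real r) T" for T :: "'i op"
  by (rule blinfun_eqI) (simp add: blinfun.scaleR_left cscale_op_apply scaleR_cscale)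

lemma is_adjoint_inner: "is_adjoint S T ==> inner (T x) y = inner x (S y)"
  by (simp add: is_adjoint_def inner_cinner)

lemma cinner_eqI: "(!!x. cinner x y = cinner x z) ==> y = z"
  by (rule ell2_eqI) (metis cinner_ket_left)

lemma is_adjoint_unique: "is_adjoint S T ==> is_adjoint S' T ==> S = S'"
  by (rule blinfun_eqI, rule cinner_eqI) (simp add: is_adjoint_def)

text \<open>Operators are a priori only real linear; complex linearity of an adjoint is inherited
  from the complex inner product in its second argument.\<close>

lemma is_adjoint_clinear:
  assumes "is_adjoint S T"
  shows "clinear S"
  unfolding clinear_def
proof (intro allI, rule cinner_eqI)
  fix c x z
  show "cinner z (S (cscale c x)) = cinner z (cscale c (S x))"
    using assms by (metis cinner_cscale_right is_adjoint_def)
qed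

lemma is_adjoint_norm_le:
  assumes "is_adjoint S T"
  shows "norm S <= norm T"
proof (rule norm_blinfun_bound)
  fix y
  have "(norm (S y))\<^sup>2 = inner (T (S y)) y"
    by (simp add: power2_norm_eq_inner is_adjoint_inner[OF assms])
  also have "... <= norm (T (S y)) * norm y" by (rule norm_cauchy_schwarz)
  also have "... <= (norm T * norm (S y)) * norm y" by (intro mult_right_mono norm_blinfun) simp
  finally have "norm (S y) * norm (S y) <= norm (S y) * (norm T * norm y)" by (simp add: power2_eq_square mult_ac)
  then show "norm (S y) <= norm T * norm y" by (cases "S y = 0") auto
qed simp

lemma is_adjoint_norm: "is_adjoint S T ==> norm S = norm T"
  using is_adjoint_norm_le[of S T] is_adjoint_norm_le[OF is_adjoint_sym, of S T] by simp

lemma is_adjoint_lim: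
  assumes "S ----> S'" "T ----> T'" "!!n::nat. is_adjoint (S n) (T n)"
  shows "is_adjoint S' T'"
  unfolding is_adjoint_def
proof (intro allI)
  fix x y
  have "(%n. cinner (T n x) y) ----> cinner (T' x) y" "(%n. cinner x (S n y)) ----> cinner x (S' y)"
    by (intro bounded_bilinear.tendsto[OF bounded_bilinear_cinner] tendsto_intros assms)+
  moreover have "(%n. cinner (T n x) y) = (%n. cinner x (S n y))" using assms(3) by (simp add: is_adjoint_def)
  ultimately show "cinner (T' x) y = cinner x (S' y)" using LIMSEQ_unique by metis
qed

lemma closed_selfadjoint: "closed {T :: 'i op. is_adjoint T T}"
  unfolding closed_sequential_limits using is_adjoint_lim by blast

lemma is_adjoint_ketI:
  fixes S T :: "'i op"
  assumes "clinear S" "clinear T"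
    and "!!i k. cinner (T (ket i)) (ket k) = cinner (ket i) (S (ket k))"
  shows "is_adjoint S T"
  unfolding is_adjoint_def
proof (intro allI)
  have cl: "closed {x. f x = g x}" if "continuous_on UNIV f" "continuous_on UNIV g" for f g :: "'i ell2 => complex"
    using that by (intro closed_Collect_eq)
  have cont: "continuous_on UNIV (%x. cinner (f x) (g x))" if "continuous_on UNIV f" "continuous_on UNIV g" for f g :: "'i ell2 => 'i ell2"
    using that by (rule bounded_bilinear.continuous_on[OF bounded_bilinear_cinner])
  fix x y
  have 1: "cinner (T (ket i)) y = cinner (ket i) (S y)" for i
    by (rule ell2_dense_induct[where P = "%y. cinner (T (ket i)) y = cinner (ket i) (S y)"])
      (auto intro!: cl cont continuous_intros simp: assms clinear_apply cinner_cscale_right cinner_add_right blinfun.add_right)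
  show "cinner (T x) y = cinner x (S y)"
    by (rule ell2_dense_induct[where P = "%x. cinner (T x) y = cinner x (S y)"])
      (auto intro!: cl cont continuous_intros simp: 1 assms clinear_apply cinner_cscale_left cinner_add_left blinfun.add_right)
qed

section \<open>Concrete C*-algebras\<close>

lemma cstar_D:
  assumes "concrete_cstar_algebra A"
  shows cstar_clinear: "T \<in> A ==> clinear T"
    and cstar_0: "0 \<in> A"
    and cstar_add: "S \<in> A ==> T \<in> A ==> S + T \<in> A"
    and cstar_cscale: "T \<in> A ==> cscale_op c T \<in> A"
    and cstar_compose: "S \<in> A ==> T \<in> A ==> S o\<^sub>L T \<in> A"
    and cstar_adjoint: "T \<in> A ==> \<exists>S\<in>A. is_adjoint S T"
    and cstar_closed: "closed A"
  using assms unfolding concrete_cstar_algebra_def clinear_def by auto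

lemma cstar_scaleR: "concrete_cstar_algebra A ==> T \<in> A ==> r *\<^sub>R T \<in> A"
  by (simp add: scaleR_cscale_op cstar_cscale)

lemma cstar_uminus: "concrete_cstar_algebra A ==> T \<in> A ==> - T \<in> A"
  using cstar_scaleR[of A T "- 1"] by simp

lemma cstar_diff: "concrete_cstar_algebra A ==> S \<in> A ==> T \<in> A ==> S - T \<in> A"
  using cstar_add[of A S "- T"] cstar_uminus[of A T] by simp

lemma cstar_sum: "concrete_cstar_algebra A ==> (!!i. i \<in> I ==> f i \<in> A) ==> (\<Sum>i\<in>I. f i) \<in> A"
  by (induction I rule: infinite_finite_induct) (auto simp: cstar_0 cstar_add)

lemma star_hom_D:
  assumes "star_hom A B f"
  shows star_hom_in: "T \<in> A ==> f T \<in> B"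
    and star_hom_add: "S \<in> A ==> T \<in> A ==> f (S + T) = f S + f T"
    and star_hom_cscale: "T \<in> A ==> f (cscale_op c T) = cscale_op c (f T)"
    and star_hom_compose: "S \<in> A ==> T \<in> A ==> f (S o\<^sub>L T) = f S o\<^sub>L f T"
    and star_hom_adjoint: "S \<in> A ==> T \<in> A ==> is_adjoint S T ==> is_adjoint (f S) (f T)"
  using assms unfolding star_hom_def by auto

lemma star_hom_scaleR: "star_hom A B f ==> T \<in> A ==> f (r *\<^sub>R T) = r *\<^sub>R f T"
  by (simp add: scaleR_cscale_op star_hom_cscale)

lemma star_hom_diff:
  assumes "concrete_cstar_algebra A" "star_hom A B f" "S \<in> A" "T \<in> A"
  shows "f (S - T) = f S - f T"
proof -
  have "f (S + (- 1) *\<^sub>R T) = f S + (- 1) *\<^sub>R f T"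
    using assms by (simp only: star_hom_add[OF assms(2)] cstar_scaleR star_hom_scaleR[OF assms(2)])
  then show ?thesis by simp
qed

lemma star_hom_0: "concrete_cstar_algebra A ==> star_hom A B f ==> f 0 = 0"
  using star_hom_diff[of A B f 0 0] by (simp add: cstar_0)

lemma star_hom_sum:
  assumes "concrete_cstar_algebra A" "star_hom A B f"
  shows "(!!i. i \<in> I ==> g i \<in> A) ==> f (\<Sum>i\<in>I. g i) = (\<Sum>i\<in>I. f (g i))"
  by (induction I rule: infinite_finite_induct) (simp_all add: star_hom_0[OF assms] star_hom_add[OF assms(2)] cstar_sum[OF assms(1)])

lemmas op_compose_simps = bounded_bilinear.add_left[OF bounded_bilinear_blinfun_compose]
  bounded_bilinear.add_right[OF bounded_bilinear_blinfun_compose]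
  bounded_bilinear.diff_left[OF bounded_bilinear_blinfun_compose]
  bounded_bilinear.diff_right[OF bounded_bilinear_blinfun_compose]
  bounded_bilinear.minus_left[OF bounded_bilinear_blinfun_compose]
  bounded_bilinear.minus_right[OF bounded_bilinear_blinfun_compose]
  bounded_bilinear.scaleR_left[OF bounded_bilinear_blinfun_compose]
  bounded_bilinear.scaleR_right[OF bounded_bilinear_blinfun_compose]
  bounded_bilinear.zero_left[OF bounded_bilinear_blinfun_compose]
  bounded_bilinear.zero_right[OF bounded_bilinear_blinfun_compose]

text \<open>The element \<open>1 + y\<close> is the square root of \<open>1 - h\<close>; a fixed point argument avoids the
  functional calculus and unitizations.\<close>

lemma cstar_sqrt:
  assumes D: "concrete_cstar_algebra D" and h: "h \<in> D" "is_adjoint h h" "norm h < 1"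
  obtains y where "y \<in> D" "is_adjoint y y" "2 *\<^sub>R y + (y o\<^sub>L y) = - h"
proof -
  \<comment> \<open>The smaller root of r^2 - 2 r + \<open>norm h\<close> = 0. It makes the ball of
    radius r invariant under f, and r < 1 is also the Lipschitz constant there.\<close>
  define r where "r = 1 - sqrt (1 - norm h)"
  have r: "0 <= r" "r < 1" "norm h + r\<^sup>2 = 2 * r"
    using h(3) by (auto simp: r_def power2_diff)
  define s where "s = D \<inter> {y. is_adjoint y y} \<inter> cball 0 r"
  define f where "f y = (- 1 / 2) *\<^sub>R (h + (y o\<^sub>L y))" for y
  have "\<exists>!y. y \<in> s & f y = y"
  proof (rule Banach_fix)
    show "complete s"
      unfolding complete_eq_closed s_def by (intro closed_Int cstar_closed[OF D] closed_selfadjoint closed_cball)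
    show "s ~= {}" using cstar_0[OF D] is_adjoint_0 r by (auto simp: s_def)
    show "f ` s \<subseteq> s"
    proof
      fix z assume "z \<in> f ` s"
      then obtain y where y: "z = f y" "y \<in> D" "is_adjoint y y" "norm y <= r" by (auto simp: s_def)
      have "norm (y o\<^sub>L y) <= r\<^sup>2"
        using norm_blinfun_compose[of y y] mult_mono[OF y(4) y(4)] r by (simp add: power2_eq_square)
      then have "norm (h + (y o\<^sub>L y)) <= 2 * r" using norm_triangle_ineq[of h "y o\<^sub>L y"] r by linarith
      then have "norm z <= r" by (simp add: y f_def)
      moreover have "z \<in> D" unfolding y f_def by (intro cstar_scaleR cstar_add cstar_compose D h y)
      moreover have "is_adjoint z z" unfolding y f_def
        by (intro is_adjoint_scaleR is_adjoint_add is_adjoint_compose h y)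
      ultimately show "z \<in> s" by (simp add: s_def)
    qed
    show "dist (f y) (f z) <= r * dist y z" if "y \<in> s" "z \<in> s" for y z
    proof -
      have n: "norm y <= r" "norm z <= r" using that by (auto simp: s_def)
      have "f y - f z = (- 1 / 2) *\<^sub>R ((y o\<^sub>L (y - z)) + ((y - z) o\<^sub>L z))"
        by (simp add: f_def op_compose_simps algebra_simps)
      then have "norm (f y - f z) = norm ((y o\<^sub>L (y - z)) + ((y - z) o\<^sub>L z)) / 2" by simp
      also have "... <= (norm y * norm (y - z) + norm (y - z) * norm z) / 2"
        by (intro divide_right_mono order_trans[OF norm_triangle_ineq] add_mono norm_blinfun_compose) simp
      also have "... <= (r * norm (y - z) + norm (y - z) * r) / 2"
        using n by (intro divide_right_mono add_mono mult_right_mono mult_left_mono) auto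
      finally show ?thesis by (simp add: dist_norm mult.commute)
    qed
  qed (use r in auto)
  then obtain y where y: "y \<in> s" "f y = y" by blast
  have "2 *\<^sub>R y = (2 * (- 1 / 2)) *\<^sub>R (h + (y o\<^sub>L y))"
    by (subst y(2)[symmetric]) (simp only: f_def scaleR_scaleR)
  then have "2 *\<^sub>R y = - (h + (y o\<^sub>L y))" by simp
  then show thesis using y(1) by (intro that[of y]) (auto simp: s_def)
qed

text \<open>Let 1 + y be the square root of 1 - x' x, where x' is the adjoint of x. The equation for
  y contains no unit and is preserved by f; it says that \<parallel>v\<parallel>^2 - \<parallel>f x
  v\<parallel>^2 is the squared norm of v + f y v.\<close>

lemma star_hom_contractive:
  assumes A: "concrete_cstar_algebra A" and f: "star_hom A B f" and x: "x \<in> A"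
  shows "norm (f x) <= norm x"
proof -
  have unit: "norm (f x) <= 1" if x: "x \<in> A" and n: "norm x < 1" for x
  proof -
    obtain x' where x': "x' \<in> A" "is_adjoint x' x" using cstar_adjoint[OF A x] by blast
    let ?h = "x' o\<^sub>L x"
    have h: "?h \<in> A" by (intro cstar_compose A x x')
    have hs: "is_adjoint ?h ?h" using is_adjoint_compose[OF is_adjoint_sym[OF x'(2)] _] x'(2)
      by (metis is_adjoint_compose is_adjoint_sym)
    have "norm ?h <= norm x * norm x" using norm_blinfun_compose[of x' x] is_adjoint_norm[OF x'(2)] by simp
    also have "... <= 1 * norm x" using n by (intro mult_right_mono) auto
    also have "... < 1" using n by simp
    finally have hn: "norm ?h < 1" .
    obtain y where y: "y \<in> A" "is_adjoint y y" "2 *\<^sub>R y + (y o\<^sub>L y) = - ?h"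
      using cstar_sqrt[OF A h hs hn] by blast
    have yy: "y o\<^sub>L y \<in> A" by (intro cstar_compose A y)
    have "f (2 *\<^sub>R y + (y o\<^sub>L y)) = 2 *\<^sub>R f y + (f y o\<^sub>L f y)"
      by (simp add: star_hom_add[OF f] star_hom_scaleR[OF f] star_hom_compose[OF f] cstar_scaleR[OF A] y(1) yy)
    then have "f (- ?h) = 2 *\<^sub>R f y + (f y o\<^sub>L f y)" unfolding y(3) .
    moreover have "f (- ?h) = - (f x' o\<^sub>L f x)"
      using star_hom_diff[OF A f cstar_0[OF A] h] by (simp add: star_hom_0[OF A f] star_hom_compose[OF f] x' x)
    ultimately have eq: "2 *\<^sub>R f y + (f y o\<^sub>L f y) = - (f x' o\<^sub>L f x)" by simp
    have ys: "is_adjoint (f y) (f y)" by (intro star_hom_adjoint[OF f] y)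
    have xs: "is_adjoint (f x') (f x)" by (intro star_hom_adjoint[OF f] x' x)
    show ?thesis
    proof (rule norm_blinfun_bound)
      fix v
      have "inner v ((2 *\<^sub>R f y + (f y o\<^sub>L f y)) v) = - inner v ((f x' o\<^sub>L f x) v)"
        by (simp add: eq blinfun.minus_left)
      then have 1: "2 * inner v (f y v) + inner (f y v) (f y v) = - inner (f x v) (f x v)"
        using is_adjoint_inner[OF ys, of v "f y v"] is_adjoint_inner[OF xs, of v "f x v"]
        by (simp add: blinfun.add_left blinfun.scaleR_left inner_add_right)
      have "0 <= inner (v + f y v) (v + f y v)" by simp
      also have "... = inner v v + (2 * inner v (f y v) + inner (f y v) (f y v))"
        by (simp add: inner_add_left inner_add_right inner_commute)
      finally have "(norm (f x v))\<^sup>2 <= (norm v)\<^sup>2" using 1 by (simp add: power2_norm_eq_inner)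
      then show "norm (f x v) <= 1 * norm v" by (simp add: abs_le_square_iff[symmetric])
    qed simp
  qed
  show ?thesis
  proof (rule field_le_epsilon)
    fix e :: real assume e: "e > 0"
    let ?c = "norm x + e"
    have c: "?c > 0" using e by (simp add: add_nonneg_pos)
    have "norm (f ((1 / ?c) *\<^sub>R x)) <= 1"
      by (rule unit) (use c e in \<open>simp_all add: cstar_scaleR[OF A x]\<close>)
    then have "norm (f x) / ?c <= 1" using c by (simp add: star_hom_scaleR[OF f x])
    then show "norm (f x) <= norm x + e" using c by (simp add: field_simps)
  qed
qed

section \<open>Positive operators, resolvents, approximate units and closed ranges\<close>

definition positive_op :: "'i op => bool" where
  "positive_op h \<longleftrightarrow> is_adjoint h h & (ALL v. inner v (h v) >= 0)"

lemma positive_op_adjoint_compose: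
  assumes "is_adjoint x' x"
  shows "positive_op (x' o\<^sub>L x)"
  unfolding positive_op_def
proof (intro conjI allI)
  show "is_adjoint (x' o\<^sub>L x) (x' o\<^sub>L x)" by (intro is_adjoint_compose assms is_adjoint_sym[OF assms])
  show "inner v ((x' o\<^sub>L x) v) >= 0" for v
    using is_adjoint_inner[OF assms, of v "x v"] inner_ge_zero[of "x v"] by simp
qed

text \<open>This is h^2 <= M h; it comes from positivity of h at the vector v - h v / M.\<close>

lemma positive_op_norm_sq_le:
  assumes h: "positive_op h" and M: "norm h <= M" "M > 0"
  shows "(norm (h v))\<^sup>2 <= M * inner v (h v)"
proof -
  let ?w = "v - (1 / M) *\<^sub>R h v"
  have sa: "inner (h a) b = inner a (h b)" for a b
    using h is_adjoint_inner by (auto simp: positive_op_def)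
  have e: "inner (h v) (h v) = (norm (h v))\<^sup>2" "inner v (h (h v)) = (norm (h v))\<^sup>2"
    using sa[of v "h v"] by (simp_all add: power2_norm_eq_inner)
  have "0 <= inner ?w (h ?w)" using h by (simp add: positive_op_def)
  also have "... = inner v (h v) - (2 / M) * (norm (h v))\<^sup>2 + (1 / M)\<^sup>2 * inner (h v) (h (h v))"
    by (simp add: blinfun.diff_right blinfun.scaleR_right inner_diff_left inner_diff_right e algebra_simps)
      (simp add: power2_eq_square)
  also have "inner (h v) (h (h v)) <= M * (norm (h v))\<^sup>2"
  proof -
    have "inner (h v) (h (h v)) <= norm (h v) * norm (h (h v))" by (rule norm_cauchy_schwarz)
    also have "... <= norm (h v) * (M * norm (h v))"
      by (intro mult_left_mono order_trans[OF norm_blinfun] mult_right_mono M) auto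
    finally show ?thesis by (simp add: power2_eq_square mult_ac)
  qed
  finally have "0 <= inner v (h v) - (2 / M) * (norm (h v))\<^sup>2 + (1 / M)\<^sup>2 * (M * (norm (h v))\<^sup>2)"
    by (simp add: mult_left_mono)
  then have "(norm (h v))\<^sup>2 / M <= inner v (h v)" using M by (simp add: power2_eq_square field_simps)
  then show ?thesis using M by (simp add: field_simps)
qed

text \<open>Here \<open>1 - z\<close> is the inverse of \<open>1 + h\<close>.\<close>

lemma cstar_resolvent:
  assumes D: "concrete_cstar_algebra D" and h: "h \<in> D" "positive_op h"
  obtains z where "z \<in> D" "z + (h o\<^sub>L z) = h"
proof -
  define M where "M = norm h + 1"
  \<comment> \<open>c solves c M = 1 - c. Together with h^2 <= M h this bounds the norm of (1 - c) u
    - c h u by (1 - c) \<parallel>u\<parallel>, so the iteration z - c ((1 + h) z - h) contracts by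
    the factor 1 - c.\<close>
  define c where "c = 1 / (1 + M)"
  have M: "norm h <= M" "M > 0" by (auto simp: M_def add_nonneg_pos)
  have c: "0 < c" "c < 1" "c * M = 1 - c" using M by (auto simp: c_def field_simps)
  define f where "f z = z - c *\<^sub>R (z + (h o\<^sub>L z) - h)" for z
  have "\<exists>!z. z \<in> D & f z = z"
  proof (rule Banach_fix)
    show "complete D" using cstar_closed[OF D] by (simp add: complete_eq_closed)
    show "D ~= {}" using cstar_0[OF D] by blast
    show "f ` D \<subseteq> D" by (auto simp: f_def intro!: cstar_diff cstar_add cstar_scaleR cstar_compose D h)
    show "dist (f y) (f z) <= (1 - c) * dist y z" if "y \<in> D" "z \<in> D" for y z
      unfolding dist_norm
    proof (rule norm_blinfun_bound)
      fix v
      define u where "u = (y - z) v"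
      have "(f y - f z) v = (1 - c) *\<^sub>R u - c *\<^sub>R h u"
        by (simp add: f_def u_def blinfun.add_left blinfun.diff_left blinfun.diff_right blinfun.scaleR_left algebra_simps)
      moreover have "(norm (a *\<^sub>R u - c *\<^sub>R h u))\<^sup>2 = a\<^sup>2 * (norm u)\<^sup>2 - 2 * c * a * inner u (h u) + c\<^sup>2 * (norm (h u))\<^sup>2" for a
        by (simp only: power2_norm_eq_inner inner_diff_left inner_diff_right inner_commute[of "h u" u])
          (simp add: power2_eq_square algebra_simps inner_commute[of "h u" u])
      ultimately have "(norm ((f y - f z) v))\<^sup>2 = (1 - c)\<^sup>2 * (norm u)\<^sup>2 - 2 * c * (1 - c) * inner u (h u) + c\<^sup>2 * (norm (h u))\<^sup>2"
        by simp
      also have "c\<^sup>2 * (norm (h u))\<^sup>2 <= c\<^sup>2 * (M * inner u (h u))"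
        by (intro mult_left_mono positive_op_norm_sq_le h M) simp
      also have "c\<^sup>2 * (M * inner u (h u)) = c * (1 - c) * inner u (h u)"
        by (simp add: power2_eq_square c(3)[symmetric])
      finally have "(norm ((f y - f z) v))\<^sup>2 <= (1 - c)\<^sup>2 * (norm u)\<^sup>2 - c * (1 - c) * inner u (h u)"
        by (simp add: algebra_simps)
      also have "... <= ((1 - c) * norm u)\<^sup>2"
        using c h(2) by (simp add: power_mult_distrib positive_op_def)
      finally have "norm ((f y - f z) v) <= (1 - c) * norm u"
        by (rule power2_le_imp_le) (use c in simp)
      also have "... <= (1 - c) * (norm (y - z) * norm v)"
        unfolding u_def using c by (intro mult_left_mono norm_blinfun) simp
      finally show "norm ((f y - f z) v) <= (1 - c) * norm (y - z) * norm v" by (simp add: mult_ac)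
    qed (use c in simp)
  qed (use c in auto)
  then obtain z where z: "z \<in> D" "f z = z" by blast
  have "c *\<^sub>R (z + (h o\<^sub>L z) - h) = 0" using z(2) by (simp add: f_def)
  then show thesis using z(1) c by (intro that[of z]) auto
qed

text \<open>The vector u = v - z v is (1 + h)^{-1} v, so \<open>positive_op_resolvent_bounds\<close>
  applies to it.\<close>

lemma resolvent_apply:
  fixes h z :: "'i op"
  assumes "z + (h o\<^sub>L z) = h"
  shows "(v - z v) + h (v - z v) = v"
proof -
  have "z v + h (z v) = h v" using arg_cong[OF assms, of "%T. blinfun_apply T v"] by (simp add: blinfun.add_left)
  then show ?thesis by (simp add: blinfun.diff_right algebra_simps)
qed

text \<open>The factor 4 reflects the scalar inequality t / (1 + t)^2 <= 1 / 4; here it comes from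
  \<parallel>u - h u\<parallel>^2 >= 0. The other two bounds hold because all terms of \<parallel>u
  + h u\<parallel>^2 are nonnegative.\<close>

lemma positive_op_resolvent_bounds:
  assumes "positive_op h" "u + h u = v"
  shows "4 * inner u (h u) <= (norm v)\<^sup>2" "norm u <= norm v" "norm (h u) <= norm v"
proof -
  have eq: "(norm v)\<^sup>2 = (norm u)\<^sup>2 + 2 * inner u (h u) + (norm (h u))\<^sup>2"
    unfolding assms(2)[symmetric] by (simp add: power2_norm_eq_inner inner_add_left inner_add_right inner_commute)
  have p: "inner u (h u) >= 0" using assms(1) by (simp add: positive_op_def)
  have "0 <= (norm (u - h u))\<^sup>2" by simp
  also have "... = (norm u)\<^sup>2 - 2 * inner u (h u) + (norm (h u))\<^sup>2"
    by (simp add: power2_norm_eq_inner inner_diff_left inner_diff_right inner_commute)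
  finally show "4 * inner u (h u) <= (norm v)\<^sup>2" using eq by linarith
  have "(norm u)\<^sup>2 <= (norm v)\<^sup>2" "(norm (h u))\<^sup>2 <= (norm v)\<^sup>2"
    using eq p by (simp_all add: add_increasing add_increasing2)
  then show "norm u <= norm v" "norm (h u) <= norm v" by (simp_all add: abs_le_square_iff[symmetric])
qed

text \<open>The standard choice n h (1 + n h)^{-1}, where h is the sum of the products of the
  adjoint of \<open>j i\<close> with \<open>j i\<close>, so that \<parallel>j i u\<parallel>^2 is at
  most the inner product of u and h u.\<close>

lemma cstar_approx_unit:
  assumes J: "concrete_cstar_algebra J" and I: "finite I" "!!i. i \<in> I ==> j i \<in> J" and \<epsilon>: "\<epsilon> > 0"
  obtains e where "e \<in> J" "!!v. norm (v - e v) <= norm v" "!!i. i \<in> I ==> norm (j i - (j i o\<^sub>L e)) <= \<epsilon>"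
proof -
  have "\<forall>i\<in>I. \<exists>a\<in>J. is_adjoint a (j i)" using I cstar_adjoint[OF J] by blast
  then obtain a where a: "!!i. i \<in> I ==> a i \<in> J" "!!i. i \<in> I ==> is_adjoint (a i) (j i)" by metis
  define h where "h = (\<Sum>i\<in>I. a i o\<^sub>L j i)"
  \<comment> \<open>For u = v - z v the resolvent bound gives 4 n times the inner product of u and h
    u at most \<parallel>v\<parallel>^2; this n turns it into \<epsilon>^2
    \<parallel>v\<parallel>^2.\<close>
  define n where "n = 1 / (4 * \<epsilon>\<^sup>2)"
  have n: "n > 0" using \<epsilon> by (simp add: n_def)
  have ih: "inner v (h v) = (\<Sum>i\<in>I. (norm (j i v))\<^sup>2)" for v
    unfolding h_def blinfun.sum_left inner_sum_right
    by (intro sum.cong refl) (simp add: is_adjoint_inner[OF a(2), symmetric] power2_norm_eq_inner)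
  have hJ: "n *\<^sub>R h \<in> J" unfolding h_def by (intro cstar_scaleR cstar_sum cstar_compose J a I)
  have "is_adjoint h h"
    unfolding h_def by (intro is_adjoint_sum is_adjoint_compose is_adjoint_sym[OF a(2)] a(2))
  then have hp: "positive_op (n *\<^sub>R h)"
    using n by (auto simp: positive_op_def blinfun.scaleR_left ih intro!: is_adjoint_scaleR mult_nonneg_nonneg sum_nonneg)
  obtain z where z: "z \<in> J" "z + ((n *\<^sub>R h) o\<^sub>L z) = n *\<^sub>R h" using cstar_resolvent[OF J hJ hp] by blast
  note b = positive_op_resolvent_bounds[OF hp resolvent_apply[OF z(2)]]
  show thesis
  proof (rule that[of z])
    show "z \<in> J" by (rule z)
    show "norm (v - z v) <= norm v" for v by (rule b(2))
    fix i assume i: "i \<in> I"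
    show "norm (j i - (j i o\<^sub>L z)) <= \<epsilon>"
    proof (rule norm_blinfun_bound)
      fix v
      let ?u = "v - z v"
      have "4 * n * (norm (j i ?u))\<^sup>2 <= 4 * (n * inner ?u (h ?u))"
        unfolding ih using n member_le_sum[OF i, of "%i. (norm (j i ?u))\<^sup>2"] I(1) by (simp add: mult_left_mono)
      also have "... <= (norm v)\<^sup>2" using b(1)[of v] by (simp add: blinfun.scaleR_left)
      finally have "(norm (j i ?u))\<^sup>2 <= (\<epsilon> * norm v)\<^sup>2" using \<epsilon> by (simp add: n_def field_simps power_mult_distrib)
      then have "norm (j i ?u) <= \<epsilon> * norm v" by (rule power2_le_imp_le) (use \<epsilon> in simp)
      then show "norm ((j i - (j i o\<^sub>L z)) v) <= \<epsilon> * norm v" by (simp add: blinfun.diff_left blinfun.diff_right)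
    qed (use \<epsilon> in simp)
  qed
qed

text \<open>A preimage x of uncontrolled norm is replaced by x (1 + a x)^{-1}, with a the adjoint of
  x, which has norm at most 1 / 2. The image moves by at most \<parallel>f x\<parallel>^3. Rescaling
  w to norm 1 / 2 makes this 1 / 8, and undoing the scaling gives a quarter of
  \<open>norm w\<close>.\<close>

lemma star_hom_approx_lift:
  assumes A: "concrete_cstar_algebra A" and f: "star_hom A B f" and w: "w \<in> f ` A"
  obtains x where "x \<in> A" "norm x <= norm w" "norm (w - f x) <= norm w / 4"
proof -
  have main: "\<exists>x'\<in>A. norm x' <= 1 / 2 & norm (f x - f x') <= norm (f x) * (norm (f x))\<^sup>2" if x: "x \<in> A" for x
  proof -
    obtain a where a: "a \<in> A" "is_adjoint a x" using cstar_adjoint[OF A x] by blast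
    let ?h = "a o\<^sub>L x"
    have h: "?h \<in> A" by (intro cstar_compose A x a)
    have hp: "positive_op ?h" by (rule positive_op_adjoint_compose[OF a(2)])
    obtain z where z: "z \<in> A" "z + (?h o\<^sub>L z) = ?h" using cstar_resolvent[OF A h hp] by blast
    let ?x = "x - (x o\<^sub>L z)"
    have xz: "x o\<^sub>L z \<in> A" by (intro cstar_compose A x z)
    have "norm ?x <= 1 / 2"
    proof (rule norm_blinfun_bound)
      fix v
      let ?u = "v - z v"
      have "(norm (?x v))\<^sup>2 = inner ?u (?h ?u)"
        using is_adjoint_inner[OF a(2), of ?u "x ?u"] by (simp add: power2_norm_eq_inner blinfun.diff_left blinfun.diff_right)
      then have "(norm (?x v))\<^sup>2 <= (1 / 2 * norm v)\<^sup>2"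
        using positive_op_resolvent_bounds(1)[OF hp resolvent_apply[OF z(2), of v]] by (simp add: power_mult_distrib power2_eq_square)
      then show "norm (?x v) <= 1 / 2 * norm v" by (rule power2_le_imp_le) simp
    qed simp
    moreover have "norm (f x - f ?x) <= norm (f x) * (norm (f x))\<^sup>2"
    proof -
      let ?k = "f a o\<^sub>L f x"
      have fa: "is_adjoint (f a) (f x)" by (intro star_hom_adjoint[OF f] a x)
      have kp: "positive_op ?k" by (rule positive_op_adjoint_compose[OF fa])
      have "f (z + (?h o\<^sub>L z)) = f z + (?k o\<^sub>L f z)"
        by (simp add: star_hom_add[OF f] star_hom_compose[OF f] cstar_compose[OF A] z(1) a x h)
      then have fz: "f z + (?k o\<^sub>L f z) = ?k" using z(2) by (simp add: star_hom_compose[OF f] a x)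
      have "norm (f z) <= norm ?k"
      proof (rule norm_blinfun_bound)
        fix v
        have "f z v + ?k (f z v) = ?k v"
          using arg_cong[OF fz, of "%T. blinfun_apply T v"] by (simp add: blinfun.add_left)
        then have "norm (f z v) <= norm (?k v)" by (rule positive_op_resolvent_bounds(2)[OF kp])
        also have "... <= norm ?k * norm v" by (rule norm_blinfun)
        finally show "norm (f z v) <= norm ?k * norm v" .
      qed simp
      also have "norm ?k <= (norm (f x))\<^sup>2"
        using norm_blinfun_compose[of "f a" "f x"] is_adjoint_norm[OF fa] by (simp add: power2_eq_square)
      finally have nz: "norm (f z) <= (norm (f x))\<^sup>2" .
      have "f x - f ?x = f x o\<^sub>L f z"
        by (simp add: star_hom_diff[OF A f x xz] star_hom_compose[OF f] x z)
      then have "norm (f x - f ?x) <= norm (f x) * norm (f z)" using norm_blinfun_compose[of "f x" "f z"] by simp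
      also have "... <= norm (f x) * (norm (f x))\<^sup>2" by (intro mult_left_mono nz) simp
      finally show ?thesis .
    qed
    moreover have "?x \<in> A" by (intro cstar_diff A x xz)
    ultimately show ?thesis by blast
  qed
  show thesis
  proof (cases "w = 0")
    case True
    then show ?thesis using that[of 0] cstar_0[OF A] star_hom_0[OF A f] by simp
  next
    case False
    obtain y where y: "y \<in> A" "w = f y" using w by blast
    let ?c = "1 / (2 * norm w)"
    have cA: "?c *\<^sub>R y \<in> A" by (intro cstar_scaleR A y)
    have fc: "f (?c *\<^sub>R y) = ?c *\<^sub>R w" by (simp add: star_hom_scaleR[OF f y(1)] y(2))
    have nc: "norm (?c *\<^sub>R w) = 1 / 2" using False by simp
    obtain x where x: "x \<in> A" "norm x <= 1 / 2" "norm (?c *\<^sub>R w - f x) <= 1 / 8"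
      using main[OF cA] unfolding fc nc by (auto simp: power2_eq_square)
    let ?X = "(2 * norm w) *\<^sub>R x"
    have "w - f ?X = (2 * norm w) *\<^sub>R (?c *\<^sub>R w - f x)"
      using False by (simp add: star_hom_scaleR[OF f x(1)] scaleR_diff_right)
    then have "norm (w - f ?X) = 2 * norm w * norm (?c *\<^sub>R w - f x)" by simp
    also have "... <= 2 * norm w * (1 / 8)" by (intro mult_left_mono x) simp
    finally have "norm (w - f ?X) <= norm w / 4" by simp
    moreover have "norm ?X <= norm w"
      using mult_left_mono[OF x(2), of "2 * norm w"] by simp
    ultimately show ?thesis using that[of ?X] cstar_scaleR[OF A x(1)] by blast
  qed
qed

text \<open>As in the open mapping theorem, approximate lifts of controlled norm are iterated with
  errors that halve each time; their sum converges in A to an exact lift.\<close>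

lemma star_hom_image_closed:
  assumes A: "concrete_cstar_algebra A" and f: "star_hom A B f"
  shows "closed (f ` A)"
proof -
  have sub: "v - f x \<in> closure (f ` A)" if v: "v \<in> closure (f ` A)" and x: "x \<in> A" for v x
  proof -
    obtain s where s: "!!n. s n \<in> f ` A" "s ----> v" using v unfolding closure_sequential by blast
    have "s n - f x \<in> f ` A" for n
    proof -
      obtain y where "y \<in> A" "s n = f y" using s(1)[of n] by blast
      then show ?thesis using star_hom_diff[OF A f _ x, of y] cstar_diff[OF A _ x, of y] by (metis imageI)
    qed
    moreover have "(%n. s n - f x) ----> v - f x" by (intro tendsto_intros s)
    ultimately show ?thesis
      unfolding closure_sequential by (intro exI[of _ "%n. s n - f x"]) auto
  qed
  have step: "EX x. x \<in> A & norm x <= 2 * norm w & norm (w - f x) <= norm w / 2" if w: "w \<in> closure (f ` A)" for w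
  proof (cases "w = 0")
    case True
    then show ?thesis using cstar_0[OF A] star_hom_0[OF A f] by (intro exI[of _ 0]) simp
  next
    case False
    \<comment> \<open>An eighth suffices: the final error is at most 1 / 8 + (9 / 8) / 4 < 1 / 2 of
      \<open>norm w\<close>.\<close>
    then obtain w' where w': "w' \<in> f ` A" "dist w' w < norm w / 8"
      using w unfolding closure_approachable by (metis divide_pos_pos zero_less_norm_iff zero_less_numeral)
    obtain x where x: "x \<in> A" "norm x <= norm w'" "norm (w' - f x) <= norm w' / 4"
      using star_hom_approx_lift[OF A f w'(1)] by blast
    have d: "norm (w - w') < norm w / 8" using w'(2) by (simp add: dist_norm norm_minus_commute)
    have "norm w' <= norm w + norm (w - w')" by (metis norm_minus_commute norm_triangle_sub)
    moreover have "norm (w - f x) <= norm (w - w') + norm (w' - f x)"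
      using norm_triangle_ineq[of "w - w'" "w' - f x"] by simp
    moreover have "norm w > 0" using False by simp
    ultimately have "norm x <= 2 * norm w" "norm (w - f x) <= norm w / 2" using x d by linarith+
    then show ?thesis using x(1) by blast
  qed
  define g where "g w = (SOME x. x \<in> A & norm x <= 2 * norm w & norm (w - f x) <= norm w / 2)" for w
  have g: "g w \<in> A" "norm (g w) <= 2 * norm w" "norm (w - f (g w)) <= norm w / 2" if "w \<in> closure (f ` A)" for w
    using someI_ex[OF step[OF that]] by (auto simp: g_def)
  have "w \<in> f ` A" if w: "w \<in> closure (f ` A)" for w
  proof -
    define W where "W n = ((%v. v - f (g v)) ^^ n) w" for n
    have W: "W n \<in> closure (f ` A) & norm (W n) <= norm w * (1 / 2) ^ n" for n
    proof (induction n)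
      case (Suc n)
      have "W (Suc n) = W n - f (g (W n))" by (simp add: W_def)
      moreover have "norm (W n - f (g (W n))) <= norm (W n) / 2" using g(3) Suc by blast
      ultimately show ?case using sub[of "W n" "g (W n)"] g(1)[of "W n"] Suc by auto
    qed (use w in \<open>simp add: W_def\<close>)
    define x where "x n = g (W n)" for n
    have x: "x n \<in> A" "norm (x n) <= 2 * norm w * (1 / 2) ^ n" for n
      using g(1,2)[of "W n"] W[of n] by (auto simp: x_def)
    have sm: "summable x"
    proof (rule summable_comparison_test')
      show "summable (%n. 2 * norm w * (1 / 2) ^ n)" by (intro summable_mult summable_geometric) simp
    qed (use x in simp)
    have S: "(\<Sum>i<n. x i) \<in> A" for n by (intro cstar_sum A x)
    have "(%n. \<Sum>i<n. x i) ----> suminf x" by (rule summable_LIMSEQ[OF sm])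
    then have xA: "suminf x \<in> A" by (rule closed_sequentially[OF cstar_closed[OF A] S])
    have fs: "f (\<Sum>i<n. x i) = w - W n" for n
    proof (induction n)
      case (Suc n)
      have "f (\<Sum>i<Suc n. x i) = f (\<Sum>i<n. x i) + f (x n)" by (simp add: star_hom_add[OF f] S x)
      then show ?case using Suc by (simp add: W_def x_def)
    qed (simp add: W_def star_hom_0[OF A f])
    have "(%n. f (\<Sum>i<n. x i)) ----> f (suminf x)"
    proof (rule LIM_zero_cancel, rule Lim_null_comparison)
      have "norm (f (\<Sum>i<n. x i) - f (suminf x)) <= norm ((\<Sum>i<n. x i) - suminf x)" for n
        using star_hom_contractive[OF A f cstar_diff[OF A S xA, of n]] star_hom_diff[OF A f S xA] by simp
      then show "\<forall>\<^sub>F n in sequentially. norm (f (\<Sum>i<n. x i) - f (suminf x)) <= norm ((\<Sum>i<n. x i) - suminf x)"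
        by simp
      show "(%n. norm ((\<Sum>i<n. x i) - suminf x)) ----> 0"
        using summable_LIMSEQ[OF sm] by (simp add: LIM_zero_iff tendsto_norm_zero)
    qed
    moreover have "W ----> 0"
    proof (rule Lim_null_comparison)
      show "\<forall>\<^sub>F n in sequentially. norm (W n) <= norm w * (1 / 2) ^ n" using W by simp
      have "(%n. norm w * (1 / 2) ^ n) ----> norm w * 0" by (intro tendsto_intros LIMSEQ_realpow_zero) auto
      then show "(%n. norm w * (1 / 2) ^ n) ----> 0" by simp
    qed
    then have "(%n. w - W n) ----> w - 0" by (intro tendsto_intros)
    ultimately have "f (suminf x) = w" using LIMSEQ_unique unfolding fs by fastforce
    then show ?thesis using xA by blast
  qed
  then have "closure (f ` A) = f ` A" using closure_subset by blast
  then show ?thesis by (metis closed_closure)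
qed

section \<open>Tensor products of operators\<close>

lemma ell2_eqI_pair: "(!!i j. ell2_apply x (i, j) = ell2_apply y (i, j)) ==> x = y"
  by (rule ell2_eqI) auto

lemma op_compose_id: "id_blinfun o\<^sub>L T = T" "T o\<^sub>L id_blinfun = T"
  by (rule blinfun_eqI, simp)+

lemma op_compose_assoc: "(f o\<^sub>L g) o\<^sub>L h = f o\<^sub>L (g o\<^sub>L h)"
  by (rule blinfun_eqI) simp

lift_definition col :: "'j => ('i \<times> 'j) ell2 => 'i ell2" is "%j \<psi> i. \<psi> (i, j)"
proof -
  fix j :: 'j and \<psi> :: "'i \<times> 'j => complex"
  assume "(%p. (cmod (\<psi> p))\<^sup>2) summable_on UNIV"
  then have "(%p. (cmod (\<psi> p))\<^sup>2) summable_on range (%i. (i, j))"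
    by (rule summable_on_subset_banach) simp
  then show "(%i. (cmod (\<psi> (i, j)))\<^sup>2) summable_on UNIV"
    by (subst (asm) summable_on_reindex) (auto simp: inj_on_def o_def)
qed

lift_definition swap_ell2 :: "('i \<times> 'j) ell2 => ('j \<times> 'i) ell2" is "%\<psi> p. \<psi> (prod.swap p)"
proof -
  fix \<psi> :: "'i \<times> 'j => complex"
  assume "(%p. (cmod (\<psi> p))\<^sup>2) summable_on UNIV"
  then have "(%p. (cmod (\<psi> p))\<^sup>2) summable_on range prod.swap" by simp
  then show "(%p. (cmod (\<psi> (prod.swap p)))\<^sup>2) summable_on UNIV"
    by (subst (asm) summable_on_reindex) (auto simp: o_def)
qed

definition row :: "'i => ('i \<times> 'j) ell2 => 'j ell2" where "row i \<psi> = col i (swap_ell2 \<psi>)"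

lemma row_apply: "ell2_apply (row i \<psi>) j = ell2_apply \<psi> (i, j)"
  by (simp add: row_def col.rep_eq swap_ell2.rep_eq)

lemma norm_swap_ell2: "norm (swap_ell2 \<psi>) = norm \<psi>"
proof -
  have "norm (swap_ell2 \<psi>) <= norm \<psi>" for \<psi> :: "('x \<times> 'y) ell2"
  proof (rule ell2_norm_le)
    fix A :: "('y \<times> 'x) set" assume A: "finite A"
    have "(\<Sum>i\<in>A. (cmod (ell2_apply (swap_ell2 \<psi>) i))\<^sup>2) = (\<Sum>i\<in>prod.swap ` A. (cmod (ell2_apply \<psi> i))\<^sup>2)"
      by (subst sum.reindex) (auto simp: swap_ell2.rep_eq)
    also have "... <= (norm \<psi>)\<^sup>2" by (rule ell2_finite_sum_le) (use A in simp)
    finally show "(\<Sum>i\<in>A. (cmod (ell2_apply (swap_ell2 \<psi>) i))\<^sup>2) <= (norm \<psi>)\<^sup>2" .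
  qed simp
  from this[of \<psi>] this[of "swap_ell2 \<psi>"] show ?thesis
    by (simp add: ell2_eqI[of "swap_ell2 (swap_ell2 \<psi>)" \<psi>] swap_ell2.rep_eq)
qed

lemma norm_sq_ell2: "(norm x)\<^sup>2 = (\<Sum>\<^sub>\<infinity>i. (cmod (ell2_apply x i))\<^sup>2)"
  unfolding norm_ell2 by (rule real_sqrt_pow2) (auto intro!: infsum_nonneg)

lemma has_sum_finite_sum:
  fixes f :: "'j => 'i => 'a::topological_comm_monoid_add"
  assumes "!!j. j \<in> F ==> (f j has_sum s j) A"
  shows "((%i. \<Sum>j\<in>F. f j i) has_sum (\<Sum>j\<in>F. s j)) A"
  using assms by (induction F rule: infinite_finite_induct) (auto intro: has_sum_add has_sum_0)

lemma sum_col_le: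
  assumes F: "finite F"
  shows "(\<Sum>j\<in>F. (norm (col j \<psi>))\<^sup>2) <= (norm \<psi>)\<^sup>2"
proof -
  have s: "(%i. (cmod (ell2_apply \<psi> (i, j)))\<^sup>2) summable_on UNIV" for j
    using ell2_summable[of "col j \<psi>"] by (simp add: col.rep_eq)
  have "(\<Sum>j\<in>F. (norm (col j \<psi>))\<^sup>2) = (\<Sum>\<^sub>\<infinity>i. \<Sum>j\<in>F. (cmod (ell2_apply \<psi> (i, j)))\<^sup>2)"
    unfolding norm_sq_ell2 col.rep_eq
    by (rule infsumI[symmetric], rule has_sum_finite_sum, rule has_sum_infsum, rule s)
  also have "... <= (norm \<psi>)\<^sup>2"
  proof (rule infsum_le_finite_sums)
    show "(%i. \<Sum>j\<in>F. (cmod (ell2_apply \<psi> (i, j)))\<^sup>2) summable_on UNIV"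
      by (rule has_sum_imp_summable, rule has_sum_finite_sum, rule has_sum_infsum, rule s)
    show "(\<Sum>i\<in>G. \<Sum>j\<in>F. (cmod (ell2_apply \<psi> (i, j)))\<^sup>2) <= (norm \<psi>)\<^sup>2" if "finite G" for G
      using ell2_finite_sum_le[of "G \<times> F" \<psi>] that F by (simp add: sum.cartesian_product)
  qed
  finally show ?thesis .
qed

text \<open>The operator S \<otimes> 1, with l2(I \<times> J) seen as families of columns in l2(I)
  indexed by J.\<close>

definition amplify :: "'i op => ('i \<times> 'j) ell2 => ('i \<times> 'j) ell2" where
  "amplify S \<psi> = Abs_ell2 (%(i, j). ell2_apply (S (col j \<psi>)) i)"

lemma amplify: "ell2_apply (amplify S \<psi>) (i, j) = ell2_apply (S (col j \<psi>)) i" "norm (amplify S \<psi>) <= norm S * norm \<psi>"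
proof -
  let ?f = "%(i, j). ell2_apply (S (col j \<psi>)) i"
  have "(\<Sum>p\<in>A. (cmod (?f p))\<^sup>2) <= (norm S * norm \<psi>)\<^sup>2" if A: "finite A" for A
  proof -
    have "(\<Sum>p\<in>A. (cmod (?f p))\<^sup>2) <= (\<Sum>p\<in>fst ` A \<times> snd ` A. (cmod (?f p))\<^sup>2)"
      by (rule sum_mono2[OF _ subset_fst_snd]) (use A in auto)
    also have "... = (\<Sum>j\<in>snd ` A. \<Sum>i\<in>fst ` A. (cmod (ell2_apply (S (col j \<psi>)) i))\<^sup>2)"
      by (subst sum.swap) (simp add: sum.cartesian_product case_prod_unfold)
    also have "... <= (\<Sum>j\<in>snd ` A. (norm (S (col j \<psi>)))\<^sup>2)"
      by (intro sum_mono ell2_finite_sum_le) (use A in simp)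
    also have "... <= (\<Sum>j\<in>snd ` A. (norm S * norm (col j \<psi>))\<^sup>2)"
      by (intro sum_mono power_mono norm_blinfun) simp
    also have "... = (norm S)\<^sup>2 * (\<Sum>j\<in>snd ` A. (norm (col j \<psi>))\<^sup>2)"
      by (simp add: power_mult_distrib sum_distrib_left)
    also have "... <= (norm S)\<^sup>2 * (norm \<psi>)\<^sup>2"
      by (intro mult_left_mono sum_col_le) (use A in simp_all)
    finally show ?thesis by (simp add: power_mult_distrib)
  qed
  then have "ell2_apply (amplify S \<psi>) = ?f & norm (amplify S \<psi>) <= norm S * norm \<psi>"
    unfolding amplify_def by (intro ell2_exI) auto
  then show "ell2_apply (amplify S \<psi>) (i, j) = ell2_apply (S (col j \<psi>)) i" "norm (amplify S \<psi>) <= norm S * norm \<psi>"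
    by simp_all
qed

lemma col_linear: "col j (x + y) = col j x + col j y" "col j (cscale c x) = cscale c (col j x)"
  "col j (r *\<^sub>R x) = r *\<^sub>R col j x" "col j 0 = 0"
  and swap_ell2_linear: "swap_ell2 (u + v) = swap_ell2 u + swap_ell2 v" "swap_ell2 (cscale c u) = cscale c (swap_ell2 u)"
  "swap_ell2 (r *\<^sub>R u) = r *\<^sub>R swap_ell2 u"
  and row_linear: "row i (x + y) = row i x + row i y" "row i (cscale c x) = cscale c (row i x)"
  "row i (r *\<^sub>R x) = r *\<^sub>R row i x"
  by (rule ell2_eqI; simp add: ell2_coord col.rep_eq swap_ell2.rep_eq row_apply)+

definition op_tensor_id :: "'i op => ('i \<times> 'j) op" where "op_tensor_id S = Blinfun (amplify S)"
definition id_tensor_op :: "'j op => ('i \<times> 'j) op" where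
  "id_tensor_op T = Blinfun (%\<psi>. swap_ell2 (amplify T (swap_ell2 \<psi>)))"

lemma bounded_linear_amplify: "bounded_linear (amplify S :: ('i \<times> 'j) ell2 => _)"
proof (rule bounded_linear_intro[of _ "norm S"])
  fix x y :: "('i \<times> 'j) ell2" and r
  show "amplify S (x + y) = amplify S x + amplify S y"
    by (rule ell2_eqI_pair) (auto simp: amplify ell2_coord col_linear blinfun.add_right)
  show "amplify S (r *\<^sub>R x) = r *\<^sub>R amplify S x"
    by (rule ell2_eqI_pair) (auto simp: amplify ell2_coord col_linear blinfun.scaleR_right)
  show "norm (amplify S x) <= norm x * norm S" using amplify(2)[of S x] by (simp add: mult.commute)
qed

lemma op_tensor_id_apply: "ell2_apply (op_tensor_id S \<psi>) (i, j) = ell2_apply (S (col j \<psi>)) i"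
  by (simp add: op_tensor_id_def bounded_linear_Blinfun_apply[OF bounded_linear_amplify] amplify)

lemma norm_op_tensor_id: "norm (op_tensor_id S \<psi>) <= norm S * norm \<psi>"
  by (simp add: op_tensor_id_def bounded_linear_Blinfun_apply[OF bounded_linear_amplify] amplify)

lemma id_tensor_op_apply: "ell2_apply (id_tensor_op T \<psi>) (i, j) = ell2_apply (T (row i \<psi>)) j"
  and norm_id_tensor_op: "norm (id_tensor_op T \<psi>) <= norm T * norm \<psi>"
proof -
  have b: "norm (swap_ell2 (amplify T (swap_ell2 \<psi>))) <= norm T * norm \<psi>" for \<psi> :: "('a \<times> 'b) ell2"
    using amplify(2)[of T "swap_ell2 \<psi>"] by (simp add: norm_swap_ell2)
  have "bounded_linear (%\<psi> :: ('a \<times> 'b) ell2. swap_ell2 (amplify T (swap_ell2 \<psi>)))"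
    using b by (intro bounded_linear_intro[of _ "norm T"])
      (auto simp: swap_ell2_linear linear_add[OF bounded_linear.linear[OF bounded_linear_amplify]]
        linear_scale[OF bounded_linear.linear[OF bounded_linear_amplify]] mult.commute)
  then have eq: "id_tensor_op T \<psi> = swap_ell2 (amplify T (swap_ell2 \<psi>))"
    by (simp add: id_tensor_op_def bounded_linear_Blinfun_apply)
  show "ell2_apply (id_tensor_op T \<psi>) (i, j) = ell2_apply (T (row i \<psi>)) j"
    unfolding eq by (simp add: swap_ell2.rep_eq amplify row_def)
  show "norm (id_tensor_op T \<psi>) <= norm T * norm \<psi>" unfolding eq by (rule b)
qed

lemma tensor_vec_apply: "ell2_apply (tensor_vec x y) (i, j) = ell2_apply x i * ell2_apply y j"
  by (simp add: tensor_vec.rep_eq)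

lemma tensor_vec_ket: "tensor_vec (ket i) (ket j) = ket (i, j)"
  by (rule ell2_eqI_pair) (auto simp: tensor_vec_apply ket.rep_eq)

lemma tensor_vec_linear:
  "tensor_vec (x + x') y = tensor_vec x y + tensor_vec x' y"
  "tensor_vec x (y + y') = tensor_vec x y + tensor_vec x y'"
  "tensor_vec (cscale c x) y = cscale c (tensor_vec x y)" "tensor_vec x (cscale c y) = cscale c (tensor_vec x y)"
  "tensor_vec x (r *\<^sub>R y) = r *\<^sub>R tensor_vec x y"
  by (rule ell2_eqI_pair, simp add: tensor_vec_apply ell2_coord algebra_simps)+

lemma col_tensor_vec: "col j (tensor_vec x y) = cscale (ell2_apply y j) x"
  and row_tensor_vec: "row i (tensor_vec x y) = cscale (ell2_apply x i) y"
  by (rule ell2_eqI; simp add: tensor_vec_apply ell2_coord col.rep_eq row_apply)+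

lemma tensor_eqI:
  fixes R R' :: "('i \<times> 'j) op"
  assumes "!!x y. R (tensor_vec x y) = R' (tensor_vec x y)"
  shows "R = R'"
proof (rule blinfun_eqI)
  fix \<psi>
  show "R \<psi> = R' \<psi>"
  proof (rule ell2_dense_induct[where P = "%x. R x = R' x"])
    show "closed {x. R x = R' x}" by (intro closed_Collect_eq continuous_intros)
    fix c and p :: "'i \<times> 'j"
    have "cscale c (ket p) = tensor_vec (cscale c (ket (fst p))) (ket (snd p))"
      by (simp add: tensor_vec_linear tensor_vec_ket)
    then show "R (cscale c (ket p)) = R' (cscale c (ket p))" by (simp add: assms)
  qed (simp add: blinfun.add_right)
qed

lemma op_tensor_id_tensor_vec:
  "clinear S ==> op_tensor_id S (tensor_vec x y) = tensor_vec (S x) y"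
  by (rule ell2_eqI_pair)
    (auto simp: op_tensor_id_apply col_tensor_vec tensor_vec_apply clinear_apply ell2_coord)

lemma id_tensor_op_tensor_vec:
  "clinear T ==> id_tensor_op T (tensor_vec x y) = tensor_vec x (T y)"
  by (rule ell2_eqI_pair)
    (auto simp: id_tensor_op_apply row_tensor_vec tensor_vec_apply clinear_apply ell2_coord)

text \<open>The product of S \<otimes> 1 and 1 \<otimes> T is a witness for the definite description
  in \<open>tensor_op\<close>. Complex linearity matters, because (c x) \<otimes> y = x \<otimes> (c
  y).\<close>

lemma tensor_op_eq:
  assumes "clinear S" "clinear T"
  shows "tensor_op S T = op_tensor_id S o\<^sub>L id_tensor_op T"
  unfolding tensor_op_def
  by (rule the_equality) (auto intro!: tensor_eqI simp: op_tensor_id_tensor_vec id_tensor_op_tensor_vec assms)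

lemma tensor_op_tensor_vec:
  assumes "clinear S" "clinear T"
  shows "tensor_op S T (tensor_vec x y) = tensor_vec (S x) (T y)"
  by (simp add: tensor_op_eq op_tensor_id_tensor_vec id_tensor_op_tensor_vec assms)

lemma tensor_op_clinear:
  fixes S :: "'i op" and T :: "'j op"
  assumes "clinear S" "clinear T"
  shows "clinear (tensor_op S T)"
  unfolding clinear_def
proof (intro allI)
  fix c and \<psi> :: "('i \<times> 'j) ell2"
  have 1: "op_tensor_id S (cscale c \<psi>) = cscale c (op_tensor_id S \<psi>)" for \<psi> :: "('i \<times> 'j) ell2"
    by (rule ell2_eqI_pair) (auto simp: op_tensor_id_apply col_linear clinear_apply[OF assms(1)] ell2_coord)
  have 2: "id_tensor_op T (cscale c \<psi>) = cscale c (id_tensor_op T \<psi>)"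
    by (rule ell2_eqI_pair) (auto simp: id_tensor_op_apply row_linear clinear_apply[OF assms(2)] ell2_coord)
  show "tensor_op S T (cscale c \<psi>) = cscale c (tensor_op S T \<psi>)"
    by (simp add: tensor_op_eq assms 1 2)
qed

lemma tensor_op_compose:
  assumes "clinear S" "clinear T" "clinear S'" "clinear T'"
  shows "tensor_op S T o\<^sub>L tensor_op S' T' = tensor_op (S o\<^sub>L S') (T o\<^sub>L T')"
  by (rule tensor_eqI) (simp add: tensor_op_tensor_vec clinear_compose assms)

lemma clinear_cscale_op: "clinear T ==> clinear (cscale_op c T)"
  by (simp add: clinear_def cscale_op_apply cscale_simps mult.commute)

lemma tensor_op_cscale_right:
  assumes "clinear S" "clinear T"
  shows "tensor_op S (cscale_op c T) = cscale_op c (tensor_op S T)"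
  by (rule tensor_eqI)
    (simp add: tensor_op_tensor_vec clinear_cscale_op assms cscale_op_apply tensor_vec_linear)

lemma tensor_op_add_right:
  assumes "clinear S" "clinear T" "clinear T'"
  shows "tensor_op S (T + T') = tensor_op S T + tensor_op S T'"
  by (rule tensor_eqI) (simp add: tensor_op_tensor_vec clinear_add assms blinfun.add_left tensor_vec_linear)

lemma tensor_op_add_left:
  assumes "clinear S" "clinear T" "clinear S'"
  shows "tensor_op (S + S') T = tensor_op S T + tensor_op S' T"
  by (rule tensor_eqI) (simp add: tensor_op_tensor_vec clinear_add assms blinfun.add_left tensor_vec_linear)

lemma tensor_op_adjoint:
  assumes "clinear S" "clinear T" "is_adjoint S' S" "is_adjoint T' T"
  shows "is_adjoint (tensor_op S' T') (tensor_op S T)"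
proof -
  have S': "clinear S'" "clinear T'" using assms is_adjoint_clinear by auto
  have S: "cnj (ell2_apply (S (ket i)) k) = ell2_apply (S' (ket k)) i" for i k
    using assms(3) unfolding is_adjoint_def by (metis cinner_ket_left cinner_ket_right)
  have T: "cnj (ell2_apply (T (ket i)) k) = ell2_apply (T' (ket k)) i" for i k
    using assms(4) unfolding is_adjoint_def by (metis cinner_ket_left cinner_ket_right)
  show ?thesis
  proof (rule is_adjoint_ketI)
    fix p q :: "'a \<times> 'b"
    obtain i j k l where p: "p = (i, j)" "q = (k, l)" by (cases p, cases q) auto
    show "cinner (tensor_op S T (ket p)) (ket q) = cinner (ket p) (tensor_op S' T' (ket q))"
      unfolding p tensor_vec_ket[symmetric] tensor_op_tensor_vec[OF assms(1,2)] tensor_op_tensor_vec[OF S']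
      unfolding tensor_vec_ket by (simp add: cinner_ket_left cinner_ket_right tensor_vec_apply S T)
  qed (intro tensor_op_clinear assms S')+
qed

subsection \<open>Slices\<close>

definition row_op :: "'i => ('i \<times> 'j) ell2 \<Rightarrow>\<^sub>L 'j ell2" where "row_op i = Blinfun (row i)"
definition emb_op :: "'i => 'j ell2 \<Rightarrow>\<^sub>L ('i \<times> 'j) ell2" where "emb_op i = Blinfun (tensor_vec (ket i))"

lemma norm_row_le: "norm (row i \<psi>) <= norm \<psi>"
  using sum_col_le[of "{i}" "swap_ell2 \<psi>"] by (simp add: row_def norm_swap_ell2 abs_le_square_iff[symmetric])

lemma norm_tensor_ket_le: "norm (tensor_vec (ket i) y) <= norm y"
proof (rule ell2_norm_le)
  fix A :: "('a \<times> 'b) set" assume A: "finite A"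
  let ?B = "{j. (i, j) \<in> A}"
  have B: "finite ?B" using finite_vimageI[OF A, of "Pair i"] by (simp add: vimage_def inj_on_def)
  have "(\<Sum>p\<in>A. (cmod (ell2_apply (tensor_vec (ket i) y) p))\<^sup>2) = (\<Sum>p\<in>Pair i ` ?B. (cmod (ell2_apply (tensor_vec (ket i) y) p))\<^sup>2)"
    by (rule sum.mono_neutral_right) (use A in \<open>auto simp: tensor_vec_apply ket.rep_eq split: if_splits\<close>)
  also have "... = (\<Sum>j\<in>?B. (cmod (ell2_apply y j))\<^sup>2)"
    by (subst sum.reindex) (auto simp: tensor_vec_apply ket.rep_eq inj_on_def)
  also have "... <= (norm y)\<^sup>2" by (rule ell2_finite_sum_le[OF B])
  finally show "(\<Sum>p\<in>A. (cmod (ell2_apply (tensor_vec (ket i) y) p))\<^sup>2) <= (norm y)\<^sup>2" .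
qed simp

lemma row_op_apply: "row_op i \<psi> = row i \<psi>"
  unfolding row_op_def
  by (subst bounded_linear_Blinfun_apply)
    (auto intro!: bounded_linear_intro[of _ 1] simp: row_linear norm_row_le)

lemma emb_op_apply: "emb_op i y = tensor_vec (ket i) y"
  unfolding emb_op_def
  by (subst bounded_linear_Blinfun_apply)
    (auto intro!: bounded_linear_intro[of _ 1] simp: tensor_vec_linear norm_tensor_ket_le)

lemma norm_row_op: "norm (row_op i) <= 1" and norm_emb_op: "norm (emb_op i) <= 1"
  by (rule norm_blinfun_bound; simp add: row_op_apply emb_op_apply norm_row_le norm_tensor_ket_le)+

lemma row_op_emb_op: "row_op i o\<^sub>L emb_op k = (if i = k then id_blinfun else 0)"
  by (rule blinfun_eqI) (auto simp: row_op_apply emb_op_apply row_tensor_vec ket.rep_eq cscale_simps)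

lemma clinear_row_op: "clinear (row_op i)" and clinear_emb_op: "clinear (emb_op i)"
  by (simp_all add: clinear_def row_op_apply emb_op_apply row_linear tensor_vec_linear)

lemma cinner_emb_op: "cinner (emb_op k y) \<psi> = cinner y (row_op k \<psi>)"
proof (rule ell2_dense_induct[where P = "%y. cinner (emb_op k y) \<psi> = cinner y (row_op k \<psi>)"])
  show "closed {y. cinner (emb_op k y) \<psi> = cinner y (row_op k \<psi>)}"
    by (intro closed_Collect_eq bounded_bilinear.continuous_on[OF bounded_bilinear_cinner] continuous_intros)
  have "cinner (emb_op k (ket p)) \<psi> = cinner (ket p) (row_op k \<psi>)" for p
    by (simp add: emb_op_apply tensor_vec_ket cinner_ket_left row_op_apply row_apply)
  then show "cinner (emb_op k (cscale c (ket p))) \<psi> = cinner (cscale c (ket p)) (row_op k \<psi>)" for c p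
    by (simp add: clinear_apply[OF clinear_emb_op] cinner_cscale_left)
qed (simp add: cinner_add_left blinfun.add_right)

text \<open>The entry (i, k) of R, regarded as a matrix over I whose entries are operators on
  l2(J).\<close>

definition slice :: "('i \<times> 'j) op => 'i => 'i => 'j op" where
  "slice R i k = row_op i o\<^sub>L R o\<^sub>L emb_op k"

lemma slice_apply: "slice R i k y = row i (R (tensor_vec (ket k) y))"
  by (simp add: slice_def row_op_apply emb_op_apply)

lemma norm_slice_le:
  fixes R :: "('i \<times> 'j) op"
  shows "norm (slice R i k) <= norm R"
proof -
  have "norm (slice R i k) <= norm (row_op i o\<^sub>L R) * norm (emb_op k :: 'j ell2 \<Rightarrow>\<^sub>L ('i \<times> 'j) ell2)"
    unfolding slice_def by (rule norm_blinfun_compose)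
  also have "... <= (norm (row_op i :: ('i \<times> 'j) ell2 \<Rightarrow>\<^sub>L _) * norm R) * 1"
    by (intro mult_mono norm_blinfun_compose norm_emb_op) auto
  also have "... <= (1 * norm R) * 1" by (intro mult_right_mono norm_row_op) auto
  finally show ?thesis by simp
qed

lemma slice_linear: "slice (R + R') i k = slice R i k + slice R' i k" "slice (R - R') i k = slice R i k - slice R' i k"
  "slice (r *\<^sub>R R) i k = r *\<^sub>R slice R i k" "slice 0 i k = 0"
  by (simp_all add: slice_def op_compose_simps)

lemma slice_cscale: "slice (cscale_op c R) i k = cscale_op c (slice R i k)"
  by (rule blinfun_eqI) (simp add: slice_apply cscale_op_apply row_linear)

lemma bounded_linear_slice: "bounded_linear (%R. slice R i k)"
  by (rule bounded_linear_intro[of _ 1]) (simp_all add: slice_linear norm_slice_le)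

lemma slice_tensor_op:
  assumes "clinear S" "clinear T"
  shows "slice (tensor_op S T) i k = cscale_op (ell2_apply (S (ket k)) i) T"
  by (rule blinfun_eqI) (simp add: slice_apply tensor_op_tensor_vec assms row_tensor_vec cscale_op_apply)

lemma slice_adjoint:
  assumes "is_adjoint S T"
  shows "is_adjoint (slice S i k) (slice T k i)"
  unfolding is_adjoint_def
proof (intro allI)
  fix x y
  have "cinner (slice T k i x) y = cnj (cinner y (row_op k (T (emb_op i x))))"
    by (subst cinner_commute) (simp add: slice_def)
  also have "... = cnj (cinner (emb_op k y) (T (emb_op i x)))" by (simp add: cinner_emb_op)
  also have "... = cinner (T (emb_op i x)) (emb_op k y)" by (subst (2) cinner_commute) simp
  also have "... = cinner (emb_op i x) (S (emb_op k y))" using assms by (simp add: is_adjoint_def)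
  also have "... = cinner x (slice S i k y)" by (simp add: cinner_emb_op slice_def)
  finally show "cinner (slice T k i x) y = cinner x (slice S i k y)" .
qed

section \<open>Finite corners of operator matrices\<close>

definition matrix_op :: "'i set => ('i => 'i => 'j op) => ('i \<times> 'j) op" where
  "matrix_op F T = (\<Sum>i\<in>F. \<Sum>k\<in>F. emb_op i o\<^sub>L T i k o\<^sub>L row_op k)"

definition compress :: "'i set => ('i \<times> 'j) op" where
  "compress F = (\<Sum>i\<in>F. emb_op i o\<^sub>L row_op i)"

lemmas op_compose_sum = bounded_bilinear.sum_left[OF bounded_bilinear_blinfun_compose]
  bounded_bilinear.sum_right[OF bounded_bilinear_blinfun_compose]

lemma matrix_op_cong: "(!!i k. i \<in> F ==> k \<in> F ==> S i k = T i k) ==> matrix_op F S = matrix_op F T"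
  by (simp add: matrix_op_def)

lemma compress_apply: "finite F ==> ell2_apply (compress F \<psi>) (i, j) = (if i \<in> F then ell2_apply \<psi> (i, j) else 0)"
proof -
  assume F: "finite F"
  have "ell2_apply (compress F \<psi>) (i, j) = (\<Sum>k\<in>F. if k = i then ell2_apply \<psi> (i, j) else 0)"
    unfolding compress_def blinfun.sum_left ell2_apply_sum
    by (intro sum.cong refl) (auto simp: emb_op_apply row_op_apply tensor_vec_apply ket.rep_eq row_apply)
  then show ?thesis using F by simp
qed

lemma norm_compress_le:
  assumes "finite F"
  shows "norm (compress F) <= 1"
proof (rule norm_blinfun_bound)
  fix \<psi> :: "('a \<times> 'b) ell2"
  have le: "(cmod (ell2_apply (compress F \<psi>) p))\<^sup>2 <= (cmod (ell2_apply \<psi> p))\<^sup>2" for p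
    by (cases p) (simp add: compress_apply[OF assms])
  have "norm (compress F \<psi>) <= norm \<psi>"
    by (rule ell2_norm_le) (auto intro!: order_trans[OF sum_mono[OF le] ell2_finite_sum_le])
  then show "norm (compress F \<psi>) <= 1 * norm \<psi>" by simp
qed simp

text \<open>The norm is determined by finite corners: a finitely supported vector lives on finitely
  many rows, and its image nearly does.\<close>

lemma compress_norm_le:
  fixes R :: "('i \<times> 'j) op"
  assumes M: "!!F. finite F ==> norm (compress F o\<^sub>L R o\<^sub>L compress F) <= M"
  shows "norm R <= M"
proof (rule blinfun_norm_le_finite)
  show M0: "0 <= M" using M[of "{}"] norm_ge_zero order_trans by blast
  fix x :: "('i \<times> 'j) ell2" and A :: "('i \<times> 'j) set" assume A: "finite A"
  let ?u = "finite_part A x"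
  define y where "y = R ?u"
  have u: "norm ?u <= norm x"
  proof (rule ell2_norm_le)
    fix B :: "('i \<times> 'j) set" assume B: "finite B"
    have "(\<Sum>p\<in>B. (cmod (ell2_apply ?u p))\<^sup>2) <= (\<Sum>p\<in>B. (cmod (ell2_apply x p))\<^sup>2)"
      by (rule sum_mono) (simp add: finite_part_apply[OF A])
    also have "... <= (norm x)\<^sup>2" by (rule ell2_finite_sum_le[OF B])
    finally show "(\<Sum>p\<in>B. (cmod (ell2_apply ?u p))\<^sup>2) <= (norm x)\<^sup>2" .
  qed simp
  have "norm y <= M * norm x + 2 * e" if e: "e > 0" for e
  proof -
    obtain B where B: "finite B" "norm (y - finite_part B y) < e"
      using finite_part_approx[OF e, of y] by blast
    let ?F = "fst ` (A \<union> B)"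
    have F: "finite ?F" using A B by simp
    have fp: "compress ?F (finite_part C z) = finite_part C z" if "C \<subseteq> A \<union> B" for C and z :: "('i \<times> 'j) ell2"
    proof (rule ell2_eqI)
      fix p :: "'i \<times> 'j"
      obtain i j where p: "p = (i, j)" by (cases p)
      have "finite C" using that A B by (meson finite_UnI finite_subset)
      then show "ell2_apply (compress ?F (finite_part C z)) p = ell2_apply (finite_part C z) p"
        using that unfolding p compress_apply[OF F] by (force simp: finite_part_apply image_iff)
    qed
    \<comment> \<open>\<open>compress ?F\<close> is a contraction that fixes the finite part of y,
      so the error of that part counts twice.\<close>
    have "norm (y - compress ?F y) <= 2 * e"
    proof -
      let ?d = "y - finite_part B y"
      have "y - compress ?F y = ?d - compress ?F ?d" by (simp add: blinfun.diff_right fp)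
      then have "norm (y - compress ?F y) <= norm ?d + norm (compress ?F ?d)" by (metis norm_triangle_ineq4)
      also have "norm (compress ?F ?d) <= norm (compress ?F :: ('i \<times> 'j) op) * norm ?d" by (rule norm_blinfun)
      also have "... <= 1 * norm ?d" by (intro mult_right_mono norm_compress_le F) simp
      finally show ?thesis using B by simp
    qed
    moreover have "norm (compress ?F y) <= M * norm x"
    proof -
      have "compress ?F y = (compress ?F o\<^sub>L R o\<^sub>L compress ?F) ?u" by (simp add: y_def fp)
      then have "norm (compress ?F y) <= norm (compress ?F o\<^sub>L R o\<^sub>L compress ?F) * norm ?u" by (simp only: norm_blinfun)
      also have "... <= M * norm x" by (intro mult_mono M F u M0) simp
      finally show ?thesis .
    qed
    moreover have "norm y <= norm (compress ?F y) + norm (y - compress ?F y)" by (rule norm_triangle_sub)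
    ultimately show ?thesis by linarith
  qed
  note est = this
  show "norm (R ?u) <= M * norm x"
  proof (rule field_le_epsilon)
    fix e :: real assume "e > 0"
    then show "norm (R ?u) <= M * norm x + e" using est[of "e / 2"] by (simp add: y_def)
  qed
qed

lemma compress_slice: "compress F o\<^sub>L R o\<^sub>L compress F = matrix_op F (slice R)"
  unfolding compress_def matrix_op_def op_compose_sum
  by (subst sum.swap) (simp add: slice_def op_compose_assoc)

lemma compress_matrix_op:
  assumes F: "finite F"
  shows "compress F o\<^sub>L matrix_op F T = matrix_op F T" "matrix_op F T o\<^sub>L compress F = matrix_op F T"
proof -
  have 1: "compress F o\<^sub>L emb_op i = (emb_op i :: 'b ell2 \<Rightarrow>\<^sub>L _)" if "i \<in> F" for i
  proof -
    have "compress F o\<^sub>L emb_op i = (\<Sum>k\<in>F. emb_op k o\<^sub>L (row_op k o\<^sub>L emb_op i))"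
      unfolding compress_def op_compose_sum by (simp add: op_compose_assoc)
    also have "... = (\<Sum>k\<in>F. if k = i then emb_op i else 0)"
      by (intro sum.cong refl) (auto simp: row_op_emb_op op_compose_simps intro!: blinfun_eqI)
    finally show ?thesis using F that by simp
  qed
  have 2: "row_op i o\<^sub>L compress F = (row_op i :: _ \<Rightarrow>\<^sub>L 'b ell2)" if "i \<in> F" for i
  proof -
    have "row_op i o\<^sub>L compress F = (\<Sum>k\<in>F. (row_op i o\<^sub>L emb_op k) o\<^sub>L row_op k)"
      unfolding compress_def op_compose_sum by (simp add: op_compose_assoc)
    also have "... = (\<Sum>k\<in>F. if k = i then row_op i else 0)"
      by (intro sum.cong refl) (auto simp: row_op_emb_op op_compose_simps intro!: blinfun_eqI)
    finally show ?thesis using F that by simp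
  qed
  show "compress F o\<^sub>L matrix_op F T = matrix_op F T"
    unfolding matrix_op_def op_compose_sum op_compose_assoc[symmetric]
    by (intro sum.cong refl) (simp add: 1)
  show "matrix_op F T o\<^sub>L compress F = matrix_op F T"
    unfolding matrix_op_def op_compose_sum op_compose_assoc
    by (intro sum.cong refl) (simp add: 2)
qed

lemma slice_matrix_op:
  assumes F: "finite F" "i \<in> F" "k \<in> F"
  shows "slice (matrix_op F T) i k = T i k"
proof -
  have "slice (matrix_op F T) i k = (\<Sum>a\<in>F. \<Sum>b\<in>F. (row_op i o\<^sub>L emb_op a) o\<^sub>L (T a b o\<^sub>L (row_op b o\<^sub>L emb_op k)))"
    unfolding slice_def matrix_op_def op_compose_sum by (simp add: op_compose_assoc)
  also have "... = (\<Sum>a\<in>F. \<Sum>b\<in>F. if a = i then (if b = k then T i k else 0) else 0)"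
    by (intro sum.cong refl) (auto simp: row_op_emb_op op_compose_simps intro!: blinfun_eqI)
  also have "... = (\<Sum>a\<in>F. if a = i then T i k else 0)"
    using F by (intro sum.cong refl) auto
  finally show ?thesis using F by simp
qed

lemma slice_compose_matrix_op:
  assumes F: "finite F" "i \<in> F" "k \<in> F" and R: "compress F o\<^sub>L R o\<^sub>L compress F = R"
  shows "slice (R o\<^sub>L R') i k = (\<Sum>l\<in>F. slice R i l o\<^sub>L slice R' l k)"
proof -
  have "slice (R o\<^sub>L R') i k = slice (matrix_op F (slice R) o\<^sub>L R') i k"
    using R by (simp add: compress_slice)
  also have "... = (\<Sum>a\<in>F. \<Sum>b\<in>F. (row_op i o\<^sub>L emb_op a) o\<^sub>L (slice R a b o\<^sub>L slice R' b k))"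
    unfolding matrix_op_def op_compose_sum slice_def[of "_ o\<^sub>L _"] slice_def[of "sum _ _"]
    by (simp add: op_compose_assoc slice_def[of R'])
  also have "... = (\<Sum>a\<in>F. if a = i then \<Sum>b\<in>F. slice R i b o\<^sub>L slice R' b k else 0)"
    by (intro sum.cong refl) (auto simp: row_op_emb_op op_compose_simps op_compose_id)
  finally show ?thesis using F by simp
qed

lemma matrix_op_compose:
  assumes "finite F"
  shows "matrix_op F T o\<^sub>L matrix_op F T' = matrix_op F (%i k. \<Sum>l\<in>F. T i l o\<^sub>L T' l k)"
proof -
  let ?X = "matrix_op F T o\<^sub>L matrix_op F T'"
  have "?X = compress F o\<^sub>L ?X o\<^sub>L compress F"
    using assms by (metis op_compose_assoc compress_matrix_op)
  also have "... = matrix_op F (slice ?X)" by (rule compress_slice)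
  also have "... = matrix_op F (%i k. \<Sum>l\<in>F. T i l o\<^sub>L T' l k)"
  proof (rule matrix_op_cong)
    fix i k assume ik: "i \<in> F" "k \<in> F"
    have "slice ?X i k = (\<Sum>l\<in>F. slice (matrix_op F T) i l o\<^sub>L slice (matrix_op F T') l k)"
      by (rule slice_compose_matrix_op[OF assms ik]) (simp add: compress_matrix_op[OF assms] op_compose_assoc)
    also have "... = (\<Sum>l\<in>F. T i l o\<^sub>L T' l k)"
      by (intro sum.cong refl) (simp add: slice_matrix_op assms ik)
    finally show "slice ?X i k = (\<Sum>l\<in>F. T i l o\<^sub>L T' l k)" .
  qed
  finally show ?thesis .
qed

section \<open>Functoriality of the minimal tensor product\<close>

lemma subspace_closure:
  fixes S :: "'v::real_normed_vector set"
  assumes "subspace S"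
  shows "subspace (closure S)"
proof (rule subspaceI)
  show "0 \<in> closure S" using subspace_0[OF assms] closure_subset by blast
next
  fix x y assume "x \<in> closure S" "y \<in> closure S"
  then obtain a b where a: "!!n::nat. a n \<in> S" "a ----> x" and b: "!!n. b n \<in> S" "b ----> y"
    unfolding closure_sequential by blast
  have "(%n. a n + b n) ----> x + y" by (intro tendsto_intros a b)
  then show "x + y \<in> closure S"
    unfolding closure_sequential using subspace_add[OF assms a(1) b(1)] by (intro exI[of _ "%n. a n + b n"]) simp
next
  fix c x assume "x \<in> closure S"
  then obtain a where a: "!!n::nat. a n \<in> S" "a ----> x" unfolding closure_sequential by blast
  have "(%n. c *\<^sub>R a n) ----> c *\<^sub>R x" by (intro tendsto_intros a)
  then show "c *\<^sub>R x \<in> closure S"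
    unfolding closure_sequential using subspace_scale[OF assms a(1)] by (intro exI[of _ "%n. c *\<^sub>R a n"]) simp
qed

lemma adjoint_matrix_op:
  assumes "!!i k. i \<in> F ==> k \<in> F ==> is_adjoint (S i k) (T k i)"
  shows "is_adjoint (matrix_op F S) (matrix_op F T)"
proof -
  have "is_adjoint (emb_op i o\<^sub>L S i k o\<^sub>L row_op k) (emb_op k o\<^sub>L T k i o\<^sub>L row_op i)" if "i \<in> F" "k \<in> F" for i k
    unfolding is_adjoint_def
  proof (intro allI)
    fix x y
    have r: "cinner (row_op i x) z = cinner x (emb_op i z)" for i x and z :: "'b ell2"
      by (subst (1 2) cinner_commute) (simp add: cinner_emb_op)
    show "cinner ((emb_op k o\<^sub>L T k i o\<^sub>L row_op i) x) y = cinner x ((emb_op i o\<^sub>L S i k o\<^sub>L row_op k) y)"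
      using assms[OF that] by (simp add: cinner_emb_op r[symmetric] is_adjoint_def)
  qed
  then have "is_adjoint (\<Sum>i\<in>F. \<Sum>k\<in>F. emb_op i o\<^sub>L S i k o\<^sub>L row_op k) (\<Sum>i\<in>F. \<Sum>k\<in>F. emb_op k o\<^sub>L T k i o\<^sub>L row_op i)"
    by (intro is_adjoint_sum)
  then show ?thesis unfolding matrix_op_def by (subst (2) sum.swap)
qed

lemma matrix_op_simps:
  "matrix_op F (%i k. S i k + T i k) = matrix_op F S + matrix_op F T"
  by (simp add: matrix_op_def op_compose_simps sum.distrib)

lemma cscale_op_compose: "clinear S ==> S o\<^sub>L cscale_op c T = cscale_op c (S o\<^sub>L T)" "cscale_op c T o\<^sub>L S = cscale_op c (T o\<^sub>L S)"
  for S T :: "'i op"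
  by (rule blinfun_eqI; simp add: cscale_op_apply clinear_apply)+

lemma matrix_op_cscale: "matrix_op F (%i k. cscale_op c (T i k)) = cscale_op c (matrix_op F T)"
proof (rule blinfun_eqI)
  fix x
  have "cscale c (\<Sum>i\<in>I. f i) = (\<Sum>i\<in>I. cscale c (f i))" for I :: "'a set" and f :: "'a => ('a \<times> 'b) ell2"
    by (rule linear_sum[OF bounded_linear.linear[OF bounded_linear_cscale]])
  then show "matrix_op F (%i k. cscale_op c (T i k)) x = cscale_op c (matrix_op F T) x"
    by (simp add: matrix_op_def blinfun.sum_left cscale_op_apply clinear_apply[OF clinear_emb_op])
qed

lemma matrix_op_clinear:
  assumes "!!i k. i \<in> F ==> k \<in> F ==> clinear (T i k)"
  shows "clinear (matrix_op F T)"
proof -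
  have "clinear (\<Sum>i\<in>I. f i)" if "!!i. i \<in> I ==> clinear (f i)"
    for I :: "'a set" and f :: "'a => ('a \<times> 'b) op"
    using that by (induction I rule: infinite_finite_induct) (auto simp: clinear_0 clinear_add)
  then show ?thesis
    unfolding matrix_op_def
    by (simp add: assms clinear_compose clinear_row_op clinear_emb_op)
qed

text \<open>The C*-algebra of finite matrices over \<open>B\<close>, placed in a corner.\<close>

definition corner_matrices :: "'i set => 'j op set => ('i \<times> 'j) op set" where
  "corner_matrices F B = {R. clinear R & compress F o\<^sub>L R o\<^sub>L compress F = R & (\<forall>i\<in>F. \<forall>k\<in>F. slice R i k \<in> B)}"

lemma corner_matricesI:
  assumes "finite F" "!!i k. i \<in> F ==> k \<in> F ==> T i k \<in> B" "concrete_cstar_algebra B"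
  shows "matrix_op F T \<in> corner_matrices F B"
  unfolding corner_matrices_def
  using assms by (auto intro!: matrix_op_clinear cstar_clinear[OF assms(3)]
      simp: compress_matrix_op slice_matrix_op)

lemma corner_matricesD:
  assumes "R \<in> corner_matrices F B"
  shows "R = matrix_op F (slice R)" "i \<in> F ==> k \<in> F ==> slice R i k \<in> B" "clinear R"
    "compress F o\<^sub>L R o\<^sub>L compress F = R"
  using assms unfolding corner_matrices_def by (auto simp: compress_slice)

lemma corner_matrices_cstar:
  assumes F: "finite (F :: 'i set)" and B: "concrete_cstar_algebra (B :: 'j op set)"
  shows "concrete_cstar_algebra (corner_matrices F B)"
  unfolding concrete_cstar_algebra_def
proof (intro conjI ballI allI)
  show "0 \<in> corner_matrices F B"
    by (auto simp: corner_matrices_def clinear_0 op_compose_simps slice_linear cstar_0[OF B])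
  fix S T :: "('i \<times> 'j) op" and c x assume S: "S \<in> corner_matrices F B" and T: "T \<in> corner_matrices F B"
  note S' = corner_matricesD[OF S] and T' = corner_matricesD[OF T]
  show "T (cscale c x) = cscale c (T x)" using T'(3) by (rule clinear_apply)
  show "S + T \<in> corner_matrices F B"
    using S'(2-4) T'(2-4) by (auto simp: corner_matrices_def clinear_add op_compose_simps slice_linear cstar_add[OF B])
  have "cscale_op c T = matrix_op F (%i k. cscale_op c (slice T i k))"
    by (subst T'(1)) (simp add: matrix_op_cscale)
  then show "cscale_op c T \<in> corner_matrices F B"
    using corner_matricesI[OF F _ B, of "%i k. cscale_op c (slice T i k)"] T'(2) cstar_cscale[OF B] by simp
  have "S o\<^sub>L T = matrix_op F (%i k. \<Sum>l\<in>F. slice S i l o\<^sub>L slice T l k)"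
    by (subst S'(1), subst T'(1)) (rule matrix_op_compose[OF F])
  then show "S o\<^sub>L T \<in> corner_matrices F B"
    using corner_matricesI[OF F _ B, of "%i k. \<Sum>l\<in>F. slice S i l o\<^sub>L slice T l k"]
    by (simp add: S'(2) T'(2) cstar_sum[OF B] cstar_compose[OF B])
  have "\<forall>i\<in>F. \<forall>k\<in>F. \<exists>a\<in>B. is_adjoint a (slice T k i)" using T'(2) cstar_adjoint[OF B] by blast
  then obtain a where a: "!!i k. i \<in> F ==> k \<in> F ==> a i k \<in> B & is_adjoint (a i k) (slice T k i)" by metis
  have "is_adjoint (matrix_op F a) T"
    by (subst T'(1)) (rule adjoint_matrix_op, use a in blast)
  then show "\<exists>S\<in>corner_matrices F B. is_adjoint S T"
    using corner_matricesI[OF F _ B, of a] a by blast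
next
  have 1: "closed {R :: ('i \<times> 'j) op. compress F o\<^sub>L R o\<^sub>L compress F = R}"
    by (intro closed_Collect_eq continuous_intros bounded_bilinear.continuous_on[OF bounded_bilinear_blinfun_compose])
  have 2: "closed {R :: ('i \<times> 'j) op. slice R i k \<in> B}" for i k
  proof -
    have "closed ((%R :: ('i \<times> 'j) op. slice R i k) -` B)"
      by (rule closed_vimage[OF cstar_closed[OF B]])
        (rule bounded_linear.continuous_on[OF bounded_linear_slice continuous_on_id])
    then show ?thesis by (simp add: vimage_def)
  qed
  have "corner_matrices F B = {R. clinear R} \<inter> {R. compress F o\<^sub>L R o\<^sub>L compress F = R} \<inter>
      (\<Inter>i\<in>F. \<Inter>k\<in>F. {R. slice R i k \<in> B})"
    by (auto simp: corner_matrices_def)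
  then show "closed (corner_matrices F B)"
    by (simp only:) (intro closed_Int closed_INT ballI closed_clinear 1 2)
qed

lemma corner_star_hom:
  assumes F: "finite F" and B: "concrete_cstar_algebra B" and q: "star_hom B C q"
  shows "star_hom (corner_matrices F B) UNIV (%R. matrix_op F (%i k. q (slice R i k)))"
  unfolding star_hom_def
proof (intro conjI ballI allI impI)
  fix S T c assume S: "S \<in> corner_matrices F B" and T: "T \<in> corner_matrices F B"
  note S' = corner_matricesD[OF S] and T' = corner_matricesD[OF T]
  show "matrix_op F (%i k. q (slice (S + T) i k)) = matrix_op F (%i k. q (slice S i k)) + matrix_op F (%i k. q (slice T i k))"
    unfolding matrix_op_simps[symmetric]
    by (rule matrix_op_cong) (simp add: slice_linear star_hom_add[OF q] S'(2) T'(2))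
  show "matrix_op F (%i k. q (slice (cscale_op c T) i k)) = cscale_op c (matrix_op F (%i k. q (slice T i k)))"
    unfolding matrix_op_cscale[symmetric]
    by (rule matrix_op_cong) (simp add: slice_cscale star_hom_cscale[OF q] T'(2))
  show "matrix_op F (%i k. q (slice (S o\<^sub>L T) i k)) = matrix_op F (%i k. q (slice S i k)) o\<^sub>L matrix_op F (%i k. q (slice T i k))"
    unfolding matrix_op_compose[OF F]
    by (rule matrix_op_cong)
      (simp add: slice_compose_matrix_op[OF F _ _ S'(4)] star_hom_sum[OF B q] star_hom_compose[OF q] S'(2) T'(2) cstar_compose[OF B])
  assume "is_adjoint S T"
  then show "is_adjoint (matrix_op F (%i k. q (slice S i k))) (matrix_op F (%i k. q (slice T i k)))"
    by (intro adjoint_matrix_op star_hom_adjoint[OF q] slice_adjoint S'(2) T'(2))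
qed simp

text \<open>Complete contractivity of q: on a finite corner, q applied entrywise is a homomorphism
  on the algebra of matrices over B, hence contractive, and finite corners determine the
  norm.\<close>

lemma slicewise_contractive:
  fixes X Y :: "('i \<times> 'j) op"
  assumes B: "concrete_cstar_algebra B" and q: "star_hom B C q"
    and X: "!!i k. slice X i k \<in> B" and Y: "!!i k. slice Y i k = q (slice X i k)"
  shows "norm Y <= norm X"
proof (rule compress_norm_le)
  fix F :: "'i set" assume F: "finite F"
  have M: "matrix_op F (slice X) \<in> corner_matrices F B" by (rule corner_matricesI[OF F X B])
  have "compress F o\<^sub>L Y o\<^sub>L compress F = matrix_op F (%i k. q (slice (matrix_op F (slice X)) i k))"
    unfolding compress_slice by (rule matrix_op_cong) (simp add: slice_matrix_op F Y)
  then have "norm (compress F o\<^sub>L Y o\<^sub>L compress F) <= norm (matrix_op F (slice X))"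
    using star_hom_contractive[OF corner_matrices_cstar[OF F B] corner_star_hom[OF F B q] M] by simp
  also have "... = norm (compress F o\<^sub>L X o\<^sub>L compress F)" by (simp add: compress_slice)
  also have "... <= norm (compress F o\<^sub>L X) * norm (compress F :: ('i \<times> 'j) op)" by (rule norm_blinfun_compose)
  also have "... <= (norm (compress F :: ('i \<times> 'j) op) * norm X) * 1"
    by (intro mult_mono norm_blinfun_compose norm_compress_le F) auto
  also have "... <= (1 * norm X) * 1" by (intro mult_right_mono norm_compress_le F) auto
  finally show "norm (compress F o\<^sub>L Y o\<^sub>L compress F) <= norm X" by simp
qed

text \<open>The closure of the graph of id \<otimes> q. Starting from the graph, one need not show
  first that id \<otimes> q is well defined on the algebraic tensor product; single-valuedness comes
  out of contractivity, which is read off from slices.\<close>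

definition tensor_pairs :: "'i op set => 'j op set => ('j op => 'j op) => (('i \<times> 'j) op \<times> ('i \<times> 'j) op) set" where
  "tensor_pairs A B q = closure (span {(tensor_op S T, tensor_op S (q T)) | S T. S \<in> A & T \<in> B})"

context
  fixes A :: "'i op set" and B C :: "'j op set" and q :: "'j op => 'j op"
  assumes A: "concrete_cstar_algebra A" and B: "concrete_cstar_algebra B"
    and C: "concrete_cstar_algebra C" and q: "star_hom B C q"
begin

abbreviation "gens \<equiv> {(tensor_op S T, tensor_op S (q T)) | S T. S \<in> A & T \<in> B}"

lemmas clA = cstar_clinear[OF A] and clB = cstar_clinear[OF B] and clC = cstar_clinear[OF C]
lemmas qC = star_hom_in[OF q]

lemma tensor_pairs_induct:
  assumes G: "(X, Y) \<in> tensor_pairs A B q" and cl: "closed {p. P p}" and gen: "!!S T. S \<in> A ==> T \<in> B ==> P (tensor_op S T, tensor_op S (q T))"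
    and sub: "subspace {p. P p}"
  shows "P (X, Y)"
proof -
  have "span gens \<subseteq> {p. P p}" by (rule span_minimal[OF _ sub]) (use gen in auto)
  then have "closure (span gens) \<subseteq> {p. P p}" by (rule closure_minimal[OF _ cl])
  then show ?thesis using G by (auto simp: tensor_pairs_def)
qed

lemma tensor_pairs_gen: "S \<in> A ==> T \<in> B ==> (tensor_op S T, tensor_op S (q T)) \<in> tensor_pairs A B q"
  unfolding tensor_pairs_def by (intro subsetD[OF closure_subset] span_base) blast

lemma tensor_pairs_subspace: "subspace (tensor_pairs A B q)"
  unfolding tensor_pairs_def by (intro subspace_closure subspace_span)

lemma tensor_pairs_closed: "closed (tensor_pairs A B q)"
  unfolding tensor_pairs_def by simp

text \<open>On an elementary tensor a slice is a scalar multiple of the second factor. Continuity of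
  slicing and of q, together with closedness of B, extends the relation to the closed graph.\<close>

lemma tensor_pairs_slices:
  assumes "(X, Y) \<in> tensor_pairs A B q"
  shows "clinear X" "clinear Y" "slice X i k \<in> B" "slice Y i k = q (slice X i k)"
proof -
  let ?P = "%p. clinear (fst p) & clinear (snd p) & slice (fst p) i k \<in> B & slice (snd p) i k = q (slice (fst p) i k)"
  have "?P (X, Y)"
  proof (rule tensor_pairs_induct[OF assms])
    have "closed (fst -` {X :: ('i \<times> 'j) op. clinear X} \<inter> snd -` {X :: ('i \<times> 'j) op. clinear X})"
      by (intro closed_Int closed_vimage closed_clinear continuous_on_fst continuous_on_snd continuous_on_id)
    moreover have "closed {p :: ('i \<times> 'j) op \<times> ('i \<times> 'j) op. slice (fst p) i k \<in> B & slice (snd p) i k = q (slice (fst p) i k)}"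
      unfolding closed_sequential_limits
    proof (intro allI impI, elim conjE)
      fix s :: "nat => ('i \<times> 'j) op \<times> ('i \<times> 'j) op" and l
      assume s: "ALL n. s n \<in> {p. slice (fst p) i k \<in> B & slice (snd p) i k = q (slice (fst p) i k)}" and lim: "s ----> l"
      have 1: "(%n. slice (fst (s n)) i k) ----> slice (fst l) i k" "(%n. slice (snd (s n)) i k) ----> slice (snd l) i k"
        by (intro bounded_linear.tendsto[OF bounded_linear_slice] tendsto_fst tendsto_snd lim)+
      have inB: "slice (fst (s n)) i k \<in> B" for n using s by simp
      have lB: "slice (fst l) i k \<in> B" by (rule closed_sequentially[OF cstar_closed[OF B] inB 1(1)])
      have "(%n. q (slice (fst (s n)) i k)) ----> q (slice (fst l) i k)"
      proof (rule LIM_zero_cancel, rule Lim_null_comparison)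
        have "norm (q (slice (fst (s n)) i k) - q (slice (fst l) i k)) <= norm (slice (fst (s n)) i k - slice (fst l) i k)" for n
          using star_hom_contractive[OF B q cstar_diff[OF B inB lB, of n]] by (simp add: star_hom_diff[OF B q inB lB])
        then show "\<forall>\<^sub>F n in sequentially. norm (q (slice (fst (s n)) i k) - q (slice (fst l) i k)) <= norm (slice (fst (s n)) i k - slice (fst l) i k)"
          by simp
        show "(%n. norm (slice (fst (s n)) i k - slice (fst l) i k)) ----> 0"
          using 1(1) by (simp add: LIM_zero_iff tendsto_norm_zero)
      qed
      moreover have "(%n. q (slice (fst (s n)) i k)) ----> slice (snd l) i k" using 1(2) s by simp
      ultimately have "slice (snd l) i k = q (slice (fst l) i k)" using LIMSEQ_unique by blast
      then show "l \<in> {p. slice (fst p) i k \<in> B & slice (snd p) i k = q (slice (fst p) i k)}" using lB by simp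
    qed
    ultimately have "closed ((fst -` {X :: ('i \<times> 'j) op. clinear X} \<inter> snd -` {X :: ('i \<times> 'j) op. clinear X}) \<inter>
        {p. slice (fst p) i k \<in> B & slice (snd p) i k = q (slice (fst p) i k)})" by (rule closed_Int)
    also have "((fst -` {X :: ('i \<times> 'j) op. clinear X} \<inter> snd -` {X :: ('i \<times> 'j) op. clinear X}) \<inter>
        {p. slice (fst p) i k \<in> B & slice (snd p) i k = q (slice (fst p) i k)}) = {p. ?P p}" by auto
    finally show "closed {p. ?P p}" .
    show "?P (tensor_op S T, tensor_op S (q T))" if "S \<in> A" "T \<in> B" for S T
      using that by (simp add: tensor_op_clinear clA clB clC qC slice_tensor_op cstar_cscale[OF B] star_hom_cscale[OF q])
    show "subspace {p. ?P p}"
      unfolding subspace_def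
      by (auto simp: clinear_0 clinear_add slice_linear cstar_0[OF B] cstar_add[OF B] cstar_scaleR[OF B]
          star_hom_0[OF B q] star_hom_add[OF q] star_hom_scaleR[OF q] scaleR_cscale_op clinear_cscale_op
          slice_cscale star_hom_cscale[OF q] cstar_cscale[OF B])
  qed
  then show "clinear X" "clinear Y" "slice X i k \<in> B" "slice Y i k = q (slice X i k)" by auto
qed

lemma tensor_pairs_contractive: "(X, Y) \<in> tensor_pairs A B q ==> norm Y <= norm X"
  by (rule slicewise_contractive[OF B q]) (rule tensor_pairs_slices; assumption)+

lemma tensor_pairs_diff: "(X, Y) \<in> tensor_pairs A B q ==> (X', Y') \<in> tensor_pairs A B q ==> (X - X', Y - Y') \<in> tensor_pairs A B q"
  using subspace_diff[OF tensor_pairs_subspace] by fastforce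

lemma tensor_pairs_unique: "(X, Y) \<in> tensor_pairs A B q ==> (X, Y') \<in> tensor_pairs A B q ==> Y = Y'"
  using tensor_pairs_contractive[OF tensor_pairs_diff, of X Y X Y'] by simp

lemma fst_gens: "fst ` span gens = span {tensor_op S T | S T. S \<in> A & T \<in> B}"
proof -
  have "fst ` span gens = span (fst ` gens)"
    by (rule linear_span_image[symmetric]) (simp add: bounded_linear.linear bounded_linear_fst)
  also have "fst ` gens = {tensor_op S T | S T. S \<in> A & T \<in> B}" by force
  finally show ?thesis .
qed

text \<open>Approximants of X in the algebraic tensor product have partners, and contractivity on
  differences makes the partners a Cauchy sequence.\<close>

lemma tensor_pairs_ex:
  assumes "X \<in> min_tensor A B"
  shows "EX Y. (X, Y) \<in> tensor_pairs A B q"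
proof -
  obtain x where x: "!!n::nat. x n \<in> fst ` span gens" "x ----> X"
    using assms unfolding min_tensor_def fst_gens[symmetric] closure_sequential by blast
  have "EX y. (x n, y) \<in> tensor_pairs A B q" for n
    using x(1)[of n] unfolding tensor_pairs_def by (force intro: subsetD[OF closure_subset])
  then obtain y where y: "!!n. (x n, y n) \<in> tensor_pairs A B q" by metis
  have "Cauchy x" using x(2) by (rule LIMSEQ_imp_Cauchy)
  have "Cauchy y"
    unfolding Cauchy_def dist_norm
  proof (intro allI impI)
    fix e :: real assume "e > 0"
    then obtain M where M: "\<forall>m\<ge>M. \<forall>n\<ge>M. norm (x m - x n) < e" using \<open>Cauchy x\<close> unfolding Cauchy_def dist_norm by blast
    have "norm (y m - y n) <= norm (x m - x n)" for m n by (rule tensor_pairs_contractive[OF tensor_pairs_diff[OF y y]])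
    then show "EX M. \<forall>m\<ge>M. \<forall>n\<ge>M. norm (y m - y n) < e" using M by (meson le_less_trans)
  qed
  then obtain Y where "y ----> Y" using Cauchy_convergent convergent_def by blast
  then have "(%n. (x n, y n)) ----> (X, Y)" by (intro tendsto_Pair x)
  then have "(X, Y) \<in> tensor_pairs A B q" by (rule closed_sequentially[OF tensor_pairs_closed y])
  then show ?thesis ..
qed

lemma tensor_pairs_fst:
  assumes "(X, Y) \<in> tensor_pairs A B q"
  shows "X \<in> min_tensor A B"
proof -
  have "fst (X, Y) \<in> min_tensor A B"
  proof (rule tensor_pairs_induct[OF assms])
    have "closed (fst -` min_tensor A B :: (('i \<times> 'j) op \<times> ('i \<times> 'j) op) set)"
      by (intro closed_vimage continuous_on_fst continuous_on_id) (simp add: min_tensor_def)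
    then show "closed {p :: ('i \<times> 'j) op \<times> ('i \<times> 'j) op. fst p \<in> min_tensor A B}" by (simp add: vimage_def)
    show "fst (tensor_op S T, tensor_op S (q T)) \<in> min_tensor A B" if "S \<in> A" "T \<in> B" for S T
      unfolding min_tensor_def using that by (intro subsetD[OF closure_subset] span_base) auto
    have "subspace (min_tensor A B)" unfolding min_tensor_def by (intro subspace_closure subspace_span)
    then show "subspace {p :: ('i \<times> 'j) op \<times> ('i \<times> 'j) op. fst p \<in> min_tensor A B}"
      unfolding subspace_def by auto
  qed
  then show ?thesis by simp
qed

lemma tensor_pairs_snd:
  assumes "(X, Y) \<in> tensor_pairs A B q"
  shows "Y \<in> min_tensor A C"
proof -
  have "snd (X, Y) \<in> min_tensor A C"
  proof (rule tensor_pairs_induct[OF assms])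
    have "closed (snd -` min_tensor A C :: (('i \<times> 'j) op \<times> ('i \<times> 'j) op) set)"
      by (intro closed_vimage continuous_on_snd continuous_on_id) (simp add: min_tensor_def)
    then show "closed {p :: ('i \<times> 'j) op \<times> ('i \<times> 'j) op. snd p \<in> min_tensor A C}" by (simp add: vimage_def)
    show "snd (tensor_op S T, tensor_op S (q T)) \<in> min_tensor A C" if "S \<in> A" "T \<in> B" for S T
      unfolding min_tensor_def using that qC by (intro subsetD[OF closure_subset] span_base) auto
    have "subspace (min_tensor A C)" unfolding min_tensor_def by (intro subspace_closure subspace_span)
    then show "subspace {p :: ('i \<times> 'j) op \<times> ('i \<times> 'j) op. snd p \<in> min_tensor A C}"
      unfolding subspace_def by auto
  qed
  then show ?thesis by simp
qed

lemma tensor_pairs_cscale: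
  assumes "(X, Y) \<in> tensor_pairs A B q"
  shows "(cscale_op c X, cscale_op c Y) \<in> tensor_pairs A B q"
proof -
  have bl: "bounded_linear (cscale_op c :: ('i \<times> 'j) op => _)"
  proof (rule bounded_linear_intro[of _ "cmod c"])
    fix T T' :: "('i \<times> 'j) op" and r :: real
    show "cscale_op c (T + T') = cscale_op c T + cscale_op c T'"
      by (rule blinfun_eqI) (simp add: cscale_op_apply blinfun.add_left cscale_simps)
    show "cscale_op c (r *\<^sub>R T) = r *\<^sub>R cscale_op c T"
      by (rule blinfun_eqI) (simp add: cscale_op_apply blinfun.scaleR_left scaleR_cscale cscale_simps mult.commute)
    show "norm (cscale_op c T) <= norm T * cmod c"
    proof (rule norm_blinfun_bound)
      fix x
      show "norm (cscale_op c T x) <= norm T * cmod c * norm x"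
        using mult_left_mono[OF norm_blinfun[of T x], of "cmod c"] by (simp add: cscale_op_apply norm_cscale mult_ac)
    qed simp
  qed
  have "(cscale_op c (fst (X, Y)), cscale_op c (snd (X, Y))) \<in> tensor_pairs A B q"
  proof (rule tensor_pairs_induct[OF assms])
    have "closed ((%p. (cscale_op c (fst p), cscale_op c (snd p))) -` tensor_pairs A B q)"
      by (intro closed_vimage tensor_pairs_closed continuous_on_Pair bounded_linear.continuous_on[OF bl]
          continuous_on_fst continuous_on_snd continuous_on_id)
    then show "closed {p. (cscale_op c (fst p), cscale_op c (snd p)) \<in> tensor_pairs A B q}" by (simp add: vimage_def)
    show "(cscale_op c (fst (tensor_op S T, tensor_op S (q T))), cscale_op c (snd (tensor_op S T, tensor_op S (q T)))) \<in> tensor_pairs A B q"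
      if "S \<in> A" "T \<in> B" for S T
      using tensor_pairs_gen[OF that(1) cstar_cscale[OF B that(2)], of c] that
      by (simp add: star_hom_cscale[OF q] tensor_op_cscale_right clA clB clC qC)
    show "subspace {p. (cscale_op c (fst p), cscale_op c (snd p)) \<in> tensor_pairs A B q}"
      using subspace_0[OF tensor_pairs_subspace] subspace_add[OF tensor_pairs_subspace] subspace_scale[OF tensor_pairs_subspace]
      unfolding subspace_def
      by (fastforce simp: linear_0[OF bounded_linear.linear[OF bl]] linear_add[OF bounded_linear.linear[OF bl]]
          linear_scale[OF bounded_linear.linear[OF bl]] zero_prod_def)
  qed
  then show ?thesis by simp
qed

lemma tensor_pairs_compose:
  assumes 1: "(X, Y) \<in> tensor_pairs A B q" and 2: "(X', Y') \<in> tensor_pairs A B q"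
  shows "(X o\<^sub>L X', Y o\<^sub>L Y') \<in> tensor_pairs A B q"
proof -
  let ?G = "tensor_pairs A B q"
  have sub0: "(0, 0) \<in> ?G" using subspace_0[OF tensor_pairs_subspace] by (simp add: zero_prod_def)
  have subadd: "(a + a', b + b') \<in> ?G" if "(a, b) \<in> ?G" "(a', b') \<in> ?G" for a b a' b'
    using subspace_add[OF tensor_pairs_subspace that] by simp
  have subscale: "(r *\<^sub>R a, r *\<^sub>R b) \<in> ?G" if "(a, b) \<in> ?G" for r a b
    using subspace_scale[OF tensor_pairs_subspace that, of r] by simp
  have gen: "(tensor_op S T o\<^sub>L fst (X', Y'), tensor_op S (q T) o\<^sub>L snd (X', Y')) \<in> ?G" if ST: "S \<in> A" "T \<in> B" for S T
  proof (rule tensor_pairs_induct[OF 2])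
    have "closed ((%p. (tensor_op S T o\<^sub>L fst p, tensor_op S (q T) o\<^sub>L snd p)) -` ?G)"
      by (intro closed_vimage tensor_pairs_closed continuous_on_Pair bounded_bilinear.continuous_on[OF bounded_bilinear_blinfun_compose]
          continuous_on_const continuous_on_fst continuous_on_snd continuous_on_id)
    then show "closed {p. (tensor_op S T o\<^sub>L fst p, tensor_op S (q T) o\<^sub>L snd p) \<in> ?G}" by (simp add: vimage_def)
    show "(tensor_op S T o\<^sub>L fst (tensor_op S' T', tensor_op S' (q T')), tensor_op S (q T) o\<^sub>L snd (tensor_op S' T', tensor_op S' (q T'))) \<in> ?G"
      if "S' \<in> A" "T' \<in> B" for S' T'
      using tensor_pairs_gen[of "S o\<^sub>L S'" "T o\<^sub>L T'"] that ST
      by (simp add: tensor_op_compose clA clB clC qC star_hom_compose[OF q] cstar_compose[OF A] cstar_compose[OF B])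
    show "subspace {p. (tensor_op S T o\<^sub>L fst p, tensor_op S (q T) o\<^sub>L snd p) \<in> ?G}"
      unfolding subspace_def by (auto simp: op_compose_simps intro: sub0 subadd subscale)
  qed
  have "(fst (X, Y) o\<^sub>L X', snd (X, Y) o\<^sub>L Y') \<in> ?G"
  proof (rule tensor_pairs_induct[OF 1])
    have "closed ((%p. (fst p o\<^sub>L X', snd p o\<^sub>L Y')) -` ?G)"
      by (intro closed_vimage tensor_pairs_closed continuous_on_Pair bounded_bilinear.continuous_on[OF bounded_bilinear_blinfun_compose]
          continuous_on_const continuous_on_fst continuous_on_snd continuous_on_id)
    then show "closed {p. (fst p o\<^sub>L X', snd p o\<^sub>L Y') \<in> ?G}" by (simp add: vimage_def)
    show "(fst (tensor_op S T, tensor_op S (q T)) o\<^sub>L X', snd (tensor_op S T, tensor_op S (q T)) o\<^sub>L Y') \<in> ?G"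
      if "S \<in> A" "T \<in> B" for S T
      using gen[OF that] by simp
    show "subspace {p. (fst p o\<^sub>L X', snd p o\<^sub>L Y') \<in> ?G}"
      unfolding subspace_def by (auto simp: op_compose_simps intro: sub0 subadd subscale)
  qed
  then show ?thesis by simp
qed

lemma tensor_pairs_adjoint:
  assumes "(X, Y) \<in> tensor_pairs A B q"
  shows "EX X' Y'. (X', Y') \<in> tensor_pairs A B q & is_adjoint X' X & is_adjoint Y' Y"
proof -
  let ?G = "tensor_pairs A B q"
  let ?P = "%p. EX X' Y'. (X', Y') \<in> ?G & is_adjoint X' (fst p) & is_adjoint Y' (snd p)"
  have "?P (X, Y)"
  proof (rule tensor_pairs_induct[OF assms])
    show "closed {p. ?P p}"
      unfolding closed_sequential_limits
    proof (intro allI impI, elim conjE)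
      fix s :: "nat => ('i \<times> 'j) op \<times> ('i \<times> 'j) op" and l
      assume "ALL n. s n \<in> {p. ?P p}" and lim: "s ----> l"
      then have "ALL n. EX r. r \<in> ?G & is_adjoint (fst r) (fst (s n)) & is_adjoint (snd r) (snd (s n))" by fastforce
      from choice[OF this] obtain r where r: "!!n. r n \<in> ?G" "!!n. is_adjoint (fst (r n)) (fst (s n))"
        "!!n. is_adjoint (snd (r n)) (snd (s n))" by blast
      \<comment> \<open>The adjoint pairs are chosen separately for each n, but passing to adjoints
        is isometric on differences, so the choices form a Cauchy sequence.\<close>
      have "dist (r m) (r n) = dist (s m) (s n)" for m n
        using is_adjoint_norm[OF is_adjoint_diff[OF r(2)[of m] r(2)[of n]]]
          is_adjoint_norm[OF is_adjoint_diff[OF r(3)[of m] r(3)[of n]]]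
        by (simp add: dist_prod_def dist_norm)
      then have "Cauchy r" using LIMSEQ_imp_Cauchy[OF lim] by (simp add: Cauchy_def)
      then obtain R where R: "r ----> R" using Cauchy_convergent convergent_def by blast
      have "R \<in> ?G" by (rule closed_sequentially[OF tensor_pairs_closed r(1) R])
      moreover have "is_adjoint (fst R) (fst l)" "is_adjoint (snd R) (snd l)"
        using is_adjoint_lim[OF tendsto_fst[OF R] tendsto_fst[OF lim] r(2)]
          is_adjoint_lim[OF tendsto_snd[OF R] tendsto_snd[OF lim] r(3)] by auto
      ultimately have "(fst R, snd R) \<in> ?G & is_adjoint (fst R) (fst l) & is_adjoint (snd R) (snd l)" by simp
      then show "l \<in> {p. ?P p}" by blast
    qed
    show "?P (tensor_op S T, tensor_op S (q T))" if ST: "S \<in> A" "T \<in> B" for S T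
    proof -
      obtain S' T' where a: "S' \<in> A" "is_adjoint S' S" "T' \<in> B" "is_adjoint T' T"
        using cstar_adjoint[OF A] cstar_adjoint[OF B] ST by metis
      have "is_adjoint (q T') (q T)" by (intro star_hom_adjoint[OF q] a ST)
      then show ?thesis
        using tensor_pairs_gen[OF a(1,3)] a ST
        by (intro exI[of _ "tensor_op S' T'"] exI[of _ "tensor_op S' (q T')"]) (simp add: tensor_op_adjoint clA clB clC qC)
    qed
    show "subspace {p. ?P p}"
      unfolding subspace_def
    proof (intro conjI ballI allI)
      show "0 \<in> {p. ?P p}"
        using subspace_0[OF tensor_pairs_subspace] is_adjoint_0 by (force simp: zero_prod_def)
      fix x y assume "x \<in> {p. ?P p}" "y \<in> {p. ?P p}"
      then obtain a b a' b' where "(a, b) \<in> ?G" "is_adjoint a (fst x)" "is_adjoint b (snd x)"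
        "(a', b') \<in> ?G" "is_adjoint a' (fst y)" "is_adjoint b' (snd y)" by auto
      then have "(a + a', b + b') \<in> ?G & is_adjoint (a + a') (fst (x + y)) & is_adjoint (b + b') (snd (x + y))"
        using subspace_add[OF tensor_pairs_subspace, of "(a, b)" "(a', b')"] by (simp add: is_adjoint_add)
      then show "x + y \<in> {p. ?P p}" by blast
    next
      fix c :: real and x assume "x \<in> {p. ?P p}"
      then obtain a b where "(a, b) \<in> ?G" "is_adjoint a (fst x)" "is_adjoint b (snd x)" by auto
      then have "(c *\<^sub>R a, c *\<^sub>R b) \<in> ?G & is_adjoint (c *\<^sub>R a) (fst (c *\<^sub>R x)) & is_adjoint (c *\<^sub>R b) (snd (c *\<^sub>R x))"
        using subspace_scale[OF tensor_pairs_subspace, of "(a, b)" c] by (simp add: is_adjoint_scaleR)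
      then show "c *\<^sub>R x \<in> {p. ?P p}" by blast
    qed
  qed
  then show ?thesis by simp
qed

lemma min_tensor_cstar: "concrete_cstar_algebra (min_tensor A B)"
  unfolding concrete_cstar_algebra_def
proof (intro conjI ballI allI)
  have sub: "subspace (min_tensor A B)" unfolding min_tensor_def by (intro subspace_closure subspace_span)
  show "0 \<in> min_tensor A B" by (rule subspace_0[OF sub])
  show "closed (min_tensor A B)" by (simp add: min_tensor_def)
  fix S T c x assume S: "S \<in> min_tensor A B" and T: "T \<in> min_tensor A B"
  obtain S1 where S1: "(S, S1) \<in> tensor_pairs A B q" using tensor_pairs_ex[OF S] ..
  obtain T1 where T1: "(T, T1) \<in> tensor_pairs A B q" using tensor_pairs_ex[OF T] ..
  show "S + T \<in> min_tensor A B" by (rule subspace_add[OF sub S T])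
  show "T (cscale c x) = cscale c (T x)" by (rule clinear_apply[OF tensor_pairs_slices(1)[OF T1]])
  show "cscale_op c T \<in> min_tensor A B" by (rule tensor_pairs_fst[OF tensor_pairs_cscale[OF T1]])
  show "S o\<^sub>L T \<in> min_tensor A B" by (rule tensor_pairs_fst[OF tensor_pairs_compose[OF S1 T1]])
  show "\<exists>S\<in>min_tensor A B. is_adjoint S T" using tensor_pairs_adjoint[OF T1] tensor_pairs_fst by blast
qed

text \<open>Besides the homomorphism itself, its description by slices is recorded:
  \<open>Q X = 0\<close> then forces all slices of X into the kernel of q, which is the form in
  which kernel elements are treated later.\<close>

lemma min_tensor_star_hom_ex:
  obtains Q where "star_hom (min_tensor A B) (min_tensor A C) Q"
    "!!S T. S \<in> A ==> T \<in> B ==> Q (tensor_op S T) = tensor_op S (q T)"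
    "!!X i k. X \<in> min_tensor A B ==> slice X i k \<in> B"
    "!!X i k. X \<in> min_tensor A B ==> slice (Q X) i k = q (slice X i k)"
    "!!X. X \<in> min_tensor A B ==> clinear X & clinear (Q X)"
proof -
  define Q where "Q X = (THE Y. (X, Y) \<in> tensor_pairs A B q)" for X
  have Qeq: "Q X = Y" if "(X, Y) \<in> tensor_pairs A B q" for X Y
    unfolding Q_def by (rule the_equality, rule that) (rule tensor_pairs_unique[OF _ that])
  have Q: "(X, Q X) \<in> tensor_pairs A B q" if X: "X \<in> min_tensor A B" for X
  proof -
    obtain Y where "(X, Y) \<in> tensor_pairs A B q" using tensor_pairs_ex[OF X] ..
    then show ?thesis using Qeq by simp
  qed
  show thesis
  proof (rule that[of Q])
    show "star_hom (min_tensor A B) (min_tensor A C) Q"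
      unfolding star_hom_def
    proof (intro conjI ballI allI impI)
      show "Q ` min_tensor A B \<subseteq> min_tensor A C" using Q tensor_pairs_snd by blast
      fix S T c assume S: "S \<in> min_tensor A B" and T: "T \<in> min_tensor A B"
      show "Q (S + T) = Q S + Q T"
        using subspace_add[OF tensor_pairs_subspace Q[OF S] Q[OF T]] by (intro Qeq) simp
      show "Q (cscale_op c T) = cscale_op c (Q T)" by (intro Qeq tensor_pairs_cscale Q T)
      show "Q (S o\<^sub>L T) = Q S o\<^sub>L Q T" by (intro Qeq tensor_pairs_compose Q S T)
      assume adj: "is_adjoint S T"
      obtain X' Y' where X': "(X', Y') \<in> tensor_pairs A B q" "is_adjoint X' T" "is_adjoint Y' (Q T)"
        using tensor_pairs_adjoint[OF Q[OF T]] by blast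
      have "X' = S" by (rule is_adjoint_unique[OF X'(2) adj])
      then have "Q S = Y'" using X'(1) by (intro Qeq) simp
      then show "is_adjoint (Q S) (Q T)" using X'(3) by simp
    qed
    show "Q (tensor_op S T) = tensor_op S (q T)" if "S \<in> A" "T \<in> B" for S T
      using that by (intro Qeq tensor_pairs_gen)
    fix X i k assume X: "X \<in> min_tensor A B"
    show "slice X i k \<in> B" "slice (Q X) i k = q (slice X i k)" "clinear X & clinear (Q X)"
      using tensor_pairs_slices[OF Q[OF X]] by auto
  qed
qed

end

section \<open>The reduced group C*-algebra\<close>

lemma cstar_closure:
  fixes D :: "'i op set"
  assumes sub: "subspace D" and cl: "!!T. T \<in> D ==> clinear T"
    and sc: "!!c T. T \<in> D ==> cscale_op c T \<in> D" and co: "!!S T. S \<in> D ==> T \<in> D ==> S o\<^sub>L T \<in> D"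
    and adj: "!!T. T \<in> D ==> \<exists>S\<in>D. is_adjoint S T"
  shows "concrete_cstar_algebra (closure D)"
  unfolding concrete_cstar_algebra_def
proof (intro conjI ballI allI)
  have sub': "subspace (closure D)" by (rule subspace_closure[OF sub])
  show "0 \<in> closure D" by (rule subspace_0[OF sub'])
  show "closed (closure D)" by simp
  have "closure D \<subseteq> {T. clinear T}"
    by (rule closure_minimal[OF _ closed_clinear]) (use cl in auto)
  then show "T (cscale c x) = cscale c (T x)" if "T \<in> closure D" for T c x
    using that clinear_apply by blast
  fix S T c assume "S \<in> closure D" "T \<in> closure D"
  then obtain s t where s: "!!n::nat. s n \<in> D" "s ----> S" and t: "!!n::nat. t n \<in> D" "t ----> T"
    unfolding closure_sequential by blast
  show "S + T \<in> closure D" by (rule subspace_add[OF sub']) fact+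
  show "S o\<^sub>L T \<in> closure D"
    unfolding closure_sequential
    by (intro exI[of _ "%n. s n o\<^sub>L t n"] conjI allI co s t bounded_bilinear.tendsto[OF bounded_bilinear_blinfun_compose])
  have "norm (cscale_op c R) <= norm R * cmod c" for R :: "'i op"
  proof (rule norm_blinfun_bound)
    show "norm (cscale_op c R x) <= norm R * cmod c * norm x" for x
      using mult_left_mono[OF norm_blinfun[of R x], of "cmod c"] by (simp add: cscale_op_apply norm_cscale mult_ac)
  qed simp
  moreover have "cscale_op c (R + R') = cscale_op c R + cscale_op c R'" "cscale_op c (r *\<^sub>R R) = r *\<^sub>R cscale_op c R"
    for r and R R' :: "'i op"
    by (rule blinfun_eqI; simp add: cscale_op_apply blinfun.add_left blinfun.scaleR_left scaleR_cscale cscale_simps mult.commute)+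
  ultimately have "bounded_linear (cscale_op c :: 'i op => _)" by (intro bounded_linear_intro)
  then have "(%n. cscale_op c (t n)) ----> cscale_op c T" by (rule bounded_linear.tendsto) (rule t)
  then show "cscale_op c T \<in> closure D"
    unfolding closure_sequential using sc t by (intro exI[of _ "%n. cscale_op c (t n)"]) simp
  have "ALL n. EX a. a \<in> D & is_adjoint a (t n)" using adj t by blast
  from choice[OF this] obtain a where a: "!!n. a n \<in> D" "!!n. is_adjoint (a n) (t n)" by blast
  have "norm (a m - a n) = norm (t m - t n)" for m n
    by (rule is_adjoint_norm[OF is_adjoint_diff[OF a(2) a(2)]])
  then have "Cauchy a" using LIMSEQ_imp_Cauchy[OF t(2)] by (simp add: Cauchy_def dist_norm)
  then obtain A where A: "a ----> A" using Cauchy_convergent convergent_def by blast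
  have "A \<in> closure D" unfolding closure_sequential using a A by blast
  moreover have "is_adjoint A T" by (rule is_adjoint_lim[OF A t(2) a(2)])
  ultimately show "\<exists>S\<in>closure D. is_adjoint S T" by blast
qed

lemma kernel_cstar:
  assumes B: "concrete_cstar_algebra B" and q: "star_hom B C q"
  shows "concrete_cstar_algebra {T \<in> B. q T = 0}"
  unfolding concrete_cstar_algebra_def
proof (intro conjI ballI allI)
  let ?J = "{T \<in> B. q T = 0}"
  show "0 \<in> ?J" by (simp add: cstar_0[OF B] star_hom_0[OF B q])
  show "closed ?J"
    unfolding closed_sequential_limits
  proof (intro allI impI, elim conjE)
    fix s l assume s: "ALL n. s n \<in> ?J" and lim: "s ----> l"
    have sB: "s n \<in> B" for n using s by simp
    have lB: "l \<in> B" by (rule closed_sequentially[OF cstar_closed[OF B] sB lim])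
    have "norm (q l) <= norm (l - s n)" for n
      using star_hom_contractive[OF B q cstar_diff[OF B lB sB[of n]]] s by (simp add: star_hom_diff[OF B q lB sB])
    moreover have "(%n. norm (l - s n)) ----> 0"
      using tendsto_norm[OF tendsto_diff[OF tendsto_const lim], of l] by simp
    ultimately have "norm (q l) <= 0" by (intro LIMSEQ_le_const[of "%n. norm (l - s n)"]) auto
    then show "l \<in> ?J" using lB by simp
  qed
  fix S T c x assume S: "S \<in> ?J" and T: "T \<in> ?J"
  show "T (cscale c x) = cscale c (T x)" using T cstar_clinear[OF B] clinear_apply by blast
  show "S + T \<in> ?J" using S T by (simp add: cstar_add[OF B] star_hom_add[OF q])
  show "cscale_op c T \<in> ?J"
    using T by (auto simp: cstar_cscale[OF B] star_hom_cscale[OF q] intro!: blinfun_eqI simp: cscale_op_apply cscale_simps)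
  show "S o\<^sub>L T \<in> ?J" using S T by (simp add: cstar_compose[OF B] star_hom_compose[OF q] op_compose_simps)
  obtain S' where S': "S' \<in> B" "is_adjoint S' T" using cstar_adjoint[OF B, of T] T by blast
  have "is_adjoint (q S') (q T)" using star_hom_adjoint[OF q S'(1) _ S'(2)] T by simp
  then have "q S' = 0" using is_adjoint_unique[of "q S'" 0 0] is_adjoint_0 T by simp
  then show "\<exists>S\<in>?J. is_adjoint S T" using S' by blast
qed

lemma left_regular_compose: "left_regular g o\<^sub>L left_regular h = left_regular (g + h)"
  by (rule blinfun_eqI, rule ell2_eqI) (simp add: left_regular_apply left_shift.rep_eq minus_add add.assoc del: add_uminus_conv_diff)

lemma left_regular_clinear: "clinear (left_regular g)"
  unfolding clinear_def
  by (intro allI, rule ell2_eqI) (simp add: left_regular_apply left_shift.rep_eq cscale.rep_eq)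

lemma left_regular_ket: "left_regular g (ket h) = ket (g + h)"
proof (rule ell2_eqI)
  fix k
  have "- g + k = h \<longleftrightarrow> k = g + h" by (metis add.assoc add.left_neutral left_minus right_minus)
  then show "ell2_apply (left_regular g (ket h)) k = ell2_apply (ket (g + h)) k"
    by (simp add: left_regular_apply left_shift.rep_eq ket.rep_eq)
qed

lemma left_regular_adjoint: "is_adjoint (left_regular (- g)) (left_regular g)"
proof (rule is_adjoint_ketI[OF left_regular_clinear left_regular_clinear])
  fix i k
  have "k = g + i \<longleftrightarrow> i = - g + k" by (metis add.assoc add.left_neutral left_minus right_minus)
  then show "cinner (left_regular g (ket i)) (ket k) = cinner (ket i) (left_regular (- g) (ket k))"
    by (auto simp: left_regular_ket cinner_ket_left ket.rep_eq)
qed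

lemma norm_left_regular_le: "norm (left_regular g) <= 1"
  by (rule norm_blinfun_bound) (simp_all add: left_regular_apply norm_left_shift)

lemma left_regular_0: "left_regular 0 = id_blinfun"
  by (rule blinfun_eqI, rule ell2_eqI) (simp add: left_regular_apply left_shift.rep_eq)

definition group_span :: "'g::group_add op set" where
  "group_span = span {cscale_op c (left_regular g) | c g. True}"

text \<open>Finite sums with one coefficient per group element are rewritten as a span, so that
  induction over generators becomes available.\<close>

lemma reduced_group_cstar_algebra_eq: "reduced_group_cstar_algebra = closure group_span"
proof -
  let ?D = "{\<Sum>g\<in>F. cscale_op (c g) (left_regular g) | F c. finite F} :: 'a op set"
  have "subspace ?D"
  proof (rule subspaceI)
    show "0 \<in> ?D" by (intro CollectI exI[of _ "{}"]) simp
  next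
    fix x y assume "x \<in> ?D" "y \<in> ?D"
    then obtain F c F' c' where x: "x = (\<Sum>g\<in>F. cscale_op (c g) (left_regular g))" "finite F"
      and y: "y = (\<Sum>g\<in>F'. cscale_op (c' g) (left_regular g))" "finite F'" by blast
    define e where "e g = (if g \<in> F then c g else 0)" for g
    define e' where "e' g = (if g \<in> F' then c' g else 0)" for g
    have z: "cscale_op 0 T = 0" for T :: "'a op" by (rule blinfun_eqI) (simp add: cscale_op_apply cscale_simps)
    have x': "x = (\<Sum>g\<in>F \<union> F'. cscale_op (e g) (left_regular g))"
      unfolding x by (rule sum.mono_neutral_cong_left) (use x y in \<open>auto simp: e_def z\<close>)
    have y': "y = (\<Sum>g\<in>F \<union> F'. cscale_op (e' g) (left_regular g))"
      unfolding y by (rule sum.mono_neutral_cong_left) (use x y in \<open>auto simp: e'_def z\<close>)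
    have d: "cscale_op a T + cscale_op b T = cscale_op (a + b) T" for a b and T :: "'a op"
      by (rule blinfun_eqI, rule ell2_eqI) (simp add: blinfun.add_left cscale_op_apply ell2_coord algebra_simps)
    have "x + y = (\<Sum>g\<in>F \<union> F'. cscale_op (e g + e' g) (left_regular g))"
      unfolding x' y' sum.distrib[symmetric] by (simp add: d)
    then show "x + y \<in> ?D" using x y by (intro CollectI exI[of _ "F \<union> F'"] exI[of _ "%g. e g + e' g"]) simp
  next
    fix r x assume "x \<in> ?D"
    then obtain F c where x: "x = (\<Sum>g\<in>F. cscale_op (c g) (left_regular g))" "finite F" by blast
    have d: "r *\<^sub>R cscale_op a T = cscale_op (of_real r * a) T" for a and T :: "'a op"
      by (rule blinfun_eqI) (simp add: blinfun.scaleR_left cscale_op_apply scaleR_cscale cscale_simps)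
    have "r *\<^sub>R x = (\<Sum>g\<in>F. cscale_op (of_real r * c g) (left_regular g))"
      unfolding x scaleR_sum_right by (simp add: d)
    then show "r *\<^sub>R x \<in> ?D" using x by (intro CollectI exI[of _ F] exI[of _ "%g. of_real r * c g"]) simp
  qed
  moreover have "{cscale_op c (left_regular g) | c g. True} \<subseteq> ?D"
  proof
    fix x assume "x \<in> {cscale_op c (left_regular g) | c (g :: 'a). True}"
    then obtain c g where "x = cscale_op c (left_regular g)" by blast
    then show "x \<in> ?D" by (intro CollectI exI[of _ "{g}"] exI[of _ "%_. c"]) simp
  qed
  ultimately have "group_span \<subseteq> ?D" unfolding group_span_def by (intro span_minimal)
  moreover have "?D \<subseteq> group_span"
  proof
    fix x assume "x \<in> ?D"
    then obtain F c where "x = (\<Sum>g\<in>F. cscale_op (c g) (left_regular g))" by blast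
    then show "x \<in> group_span" unfolding group_span_def by (simp only:) (intro span_sum span_base, blast)
  qed
  ultimately have "?D = group_span" by (intro subset_antisym)
  then show ?thesis unfolding reduced_group_cstar_algebra_def by (simp only:)
qed

lemma cscale_op_linear: "cscale_op c (S + T) = cscale_op c S + cscale_op c T" "cscale_op c (r *\<^sub>R T) = r *\<^sub>R cscale_op c T"
  "cscale_op c 0 = 0" "cscale_op c (cscale_op d T) = cscale_op (c * d) T" "cscale_op 1 T = T"
  by (rule blinfun_eqI; simp add: cscale_op_apply blinfun.add_left blinfun.scaleR_left scaleR_cscale cscale_simps mult.commute)+

lemma reduced_group_cstar: "concrete_cstar_algebra (reduced_group_cstar_algebra :: 'g::group_add op set)"
  unfolding reduced_group_cstar_algebra_eq
proof (rule cstar_closure)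
  let ?L = "{cscale_op c (left_regular g) | c (g :: 'g). True}"
  show sub: "subspace (group_span :: 'g op set)" by (simp add: group_span_def subspace_span)
  have base: "cscale_op c (left_regular g) \<in> group_span" for c and g :: 'g
    unfolding group_span_def by (rule span_base) blast
  have ind: "P T" if "T \<in> group_span" "subspace {T. P T}" "!!c g. P (cscale_op c (left_regular g))" for P and T :: "'g op"
    using span_induct[OF that(1)[unfolded group_span_def] that(2)] that(3) by blast
  show "clinear T" if "T \<in> group_span" for T :: "'g op"
    by (rule ind[OF that])
      (auto simp: subspace_def clinear_0 clinear_add scaleR_cscale_op clinear_cscale_op left_regular_clinear)
  show "cscale_op c T \<in> group_span" if "T \<in> group_span" for c and T :: "'g op"
    by (rule ind[OF that])
      (auto simp: subspace_def cscale_op_linear base intro: subspace_0[OF sub] subspace_add[OF sub] subspace_scale[OF sub])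
  show "S o\<^sub>L T \<in> group_span" if S: "S \<in> group_span" and T: "T \<in> group_span" for S T :: "'g op"
  proof (rule ind[OF S])
    show "subspace {S. S o\<^sub>L T \<in> group_span}"
      by (auto simp: subspace_def op_compose_simps intro: subspace_0[OF sub] subspace_add[OF sub] subspace_scale[OF sub])
    fix c g
    show "cscale_op c (left_regular g) o\<^sub>L T \<in> group_span"
    proof (rule ind[OF T])
      show "subspace {T. cscale_op c (left_regular g) o\<^sub>L T \<in> group_span}"
        by (auto simp: subspace_def op_compose_simps intro: subspace_0[OF sub] subspace_add[OF sub] subspace_scale[OF sub])
      show "cscale_op c (left_regular g) o\<^sub>L cscale_op d (left_regular h) \<in> group_span" for d h
        by (simp add: cscale_op_compose left_regular_clinear clinear_cscale_op cscale_op_linear left_regular_compose base)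
    qed
  qed
  show "\<exists>S\<in>group_span. is_adjoint S T" if "T \<in> group_span" for T :: "'g op"
  proof (rule ind[OF that])
    show "subspace {T :: 'g op. \<exists>S\<in>group_span. is_adjoint S T}"
    proof (rule subspaceI)
      show "0 \<in> {T :: 'g op. \<exists>S\<in>group_span. is_adjoint S T}"
        using subspace_0[OF sub] is_adjoint_0 by blast
      show "x + y \<in> {T :: 'g op. \<exists>S\<in>group_span. is_adjoint S T}"
        if "x \<in> {T. \<exists>S\<in>group_span. is_adjoint S T}" "y \<in> {T. \<exists>S\<in>group_span. is_adjoint S T}" for x y
        using that subspace_add[OF sub] is_adjoint_add by blast
      show "c *\<^sub>R x \<in> {T :: 'g op. \<exists>S\<in>group_span. is_adjoint S T}"
        if "x \<in> {T. \<exists>S\<in>group_span. is_adjoint S T}" for c x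
        using that subspace_scale[OF sub] is_adjoint_scaleR by blast
    qed
    show "\<exists>S\<in>group_span. is_adjoint S (cscale_op c (left_regular g))" for c and g :: 'g
      using is_adjoint_cscale[OF left_regular_adjoint, of c g] base by blast
  qed
qed

lemma left_regular_in: "left_regular g \<in> reduced_group_cstar_algebra"
  unfolding reduced_group_cstar_algebra_eq group_span_def
  by (rule subsetD[OF closure_subset], rule span_base) (use cscale_op_linear(5)[symmetric] in blast)

text \<open>Elements of the reduced algebra are left convolution operators, so their entries depend
  on g + - h only; this survives limits because entries are continuous.\<close>

lemma reduced_group_coeff:
  assumes "S \<in> reduced_group_cstar_algebra"
  shows "ell2_apply (S (ket h)) g = ell2_apply (S (ket 0)) (g + - h)"
proof -
  let ?P = "%S :: 'a op. ell2_apply (S (ket h)) g = ell2_apply (S (ket 0)) (g + - h)"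
  have "closure group_span \<subseteq> {S. ?P S}"
  proof (rule closure_minimal)
    show "group_span \<subseteq> {S. ?P S}"
      unfolding group_span_def
    proof (rule span_minimal)
      show "subspace {S. ?P S}"
        by (auto simp: subspace_def blinfun.add_left blinfun.scaleR_left ell2_coord)
      have "g = k + h \<longleftrightarrow> g + - h = k" for k
        by (metis add.assoc add.right_neutral left_minus right_minus)
      then show "{cscale_op c (left_regular g) | c g. True} \<subseteq> {S. ?P S}"
        by (auto simp: cscale_op_apply left_regular_ket ell2_coord ket.rep_eq)
    qed
    have "continuous_on UNIV (%S :: 'a op. ell2_apply (S (ket k)) l)" for k l
      unfolding cinner_ket_left[symmetric]
      by (intro bounded_bilinear.continuous_on[OF bounded_bilinear_cinner] continuous_intros)
    then show "closed {S. ?P S}" by (intro closed_Collect_eq)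
  qed
  then show ?thesis using assms unfolding reduced_group_cstar_algebra_eq by blast
qed

section \<open>Property A implies exactness\<close>

lemma norm_tensor_op_le:
  assumes "clinear S" "clinear T"
  shows "norm (tensor_op S T) <= norm S * norm T"
proof (rule norm_blinfun_bound)
  fix \<psi>
  have "norm (tensor_op S T \<psi>) <= norm S * norm (id_tensor_op T \<psi>)"
    by (simp add: tensor_op_eq assms norm_op_tensor_id)
  also have "... <= norm S * (norm T * norm \<psi>)" by (intro mult_left_mono norm_id_tensor_op) simp
  finally show "norm (tensor_op S T \<psi>) <= norm S * norm T * norm \<psi>" by (simp add: mult_ac)
qed simp

section \<open>Schur multipliers from property A\<close>

definition diag_op :: "('i => real) => 'i op" where
  "diag_op f = Blinfun (%x. Abs_ell2 (%i. of_real (f i) * ell2_apply x i))"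

lemma diag_op:
  assumes f: "!!i. \<bar>f i\<bar> <= b"
  shows diag_op_apply: "ell2_apply (diag_op f x) i = of_real (f i) * ell2_apply x i"
    and norm_diag_op: "norm (diag_op f) <= b"
proof -
  have b0: "b >= 0" using f[of undefined] by linarith
  have le: "(\<Sum>i\<in>A. (cmod (of_real (f i) * ell2_apply x i))\<^sup>2) <= (b * norm x)\<^sup>2" if A: "finite A" for A x
  proof -
    have "(\<Sum>i\<in>A. (cmod (of_real (f i) * ell2_apply x i))\<^sup>2) <= (\<Sum>i\<in>A. b\<^sup>2 * (cmod (ell2_apply x i))\<^sup>2)"
    proof (rule sum_mono)
      fix i
      have "(cmod (of_real (f i) * ell2_apply x i))\<^sup>2 = \<bar>f i\<bar>\<^sup>2 * (cmod (ell2_apply x i))\<^sup>2"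
        by (simp add: norm_mult power_mult_distrib)
      also have "... <= b\<^sup>2 * (cmod (ell2_apply x i))\<^sup>2" by (intro mult_right_mono power_mono f) auto
      finally show "(cmod (of_real (f i) * ell2_apply x i))\<^sup>2 <= b\<^sup>2 * (cmod (ell2_apply x i))\<^sup>2" .
    qed
    also have "... = b\<^sup>2 * (\<Sum>i\<in>A. (cmod (ell2_apply x i))\<^sup>2)" by (simp add: sum_distrib_left)
    also have "... <= b\<^sup>2 * (norm x)\<^sup>2" by (intro mult_left_mono ell2_finite_sum_le A) simp
    finally show ?thesis by (simp add: power_mult_distrib)
  qed
  define D where "D x = Abs_ell2 (%i. of_real (f i) * ell2_apply x i)" for x
  have D: "ell2_apply (D x) = (%i. of_real (f i) * ell2_apply x i)" "norm (D x) <= b * norm x" for x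
    using ell2_exI[OF le] b0 unfolding D_def by auto
  have "bounded_linear D"
    by (rule bounded_linear_intro[of _ b]; (rule ell2_eqI)?) (simp_all add: D ell2_coord algebra_simps mult.commute)
  then have eq: "diag_op f x = D x" for x
    by (simp add: diag_op_def D_def[symmetric] bounded_linear_Blinfun_apply)
  show "ell2_apply (diag_op f x) i = of_real (f i) * ell2_apply x i" by (simp add: eq D)
  show "norm (diag_op f) <= b" by (rule norm_blinfun_bound) (simp_all add: eq D b0)
qed

lemma diag_op_clinear: "(!!i. \<bar>f i\<bar> <= b) ==> clinear (diag_op f)"
  unfolding clinear_def by (intro allI, rule ell2_eqI) (simp add: diag_op_apply[of f b] ell2_coord)

lemma inner_emb_op: "inner (emb_op k y) \<psi> = inner y (row_op k \<psi>)" "inner \<psi> (emb_op k y) = inner (row_op k \<psi>) y"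
proof -
  show *: "inner (emb_op k y) \<psi> = inner y (row_op k \<psi>)" by (simp add: inner_cinner cinner_emb_op)
  show "inner \<psi> (emb_op k y) = inner (row_op k \<psi>) y" using * by (simp only: inner_commute)
qed

lemma inner_matrix_op:
  "inner \<zeta> (matrix_op F T \<psi>) = (\<Sum>i\<in>F. \<Sum>k\<in>F. inner (row_op i \<zeta>) (T i k (row_op k \<psi>)))"
  by (simp add: matrix_op_def blinfun.sum_left inner_sum_right inner_emb_op)

text \<open>Let a_x be the diagonal operator with entries \<open>\<xi> i x\<close>. On a finite
  corner, Y is the sum over x of a_x X a_x, and the squares of the a_x sum to the identity;
  Cauchy-Schwarz over x gives the bound.\<close>

lemma schur_multiplier_contractive:
  fixes X Y :: "('i \<times> 'j) op" and \<xi> :: "'i => 'x => real"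
  assumes fin: "!!i. finite {x. \<xi> i x ~= 0}" and one: "!!i. (\<Sum>x\<in>{x. \<xi> i x ~= 0}. (\<xi> i x)\<^sup>2) = 1"
    and k: "!!i j. k i j = (\<Sum>x\<in>{x. \<xi> i x ~= 0}. \<xi> i x * \<xi> j x)"
    and Y: "!!i j. slice Y i j = k i j *\<^sub>R slice X i j"
  shows "norm Y <= norm X"
proof (rule compress_norm_le, rule norm_blinfun_bound)
  fix F :: "'i set" and \<psi> assume F: "finite F"
  define U where "U = (\<Union>i\<in>F. {x. \<xi> i x ~= 0})"
  have U: "finite U" using F fin by (simp add: U_def)
  have kU: "k i j = (\<Sum>x\<in>U. \<xi> i x * \<xi> j x)" if "i \<in> F" for i j
    unfolding k by (rule sum.mono_neutral_left) (use U that in \<open>auto simp: U_def\<close>)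
  have oneU: "(\<Sum>x\<in>U. (\<xi> i x)\<^sup>2) = 1" if "i \<in> F" for i
    unfolding one[of i, symmetric] by (rule sum.mono_neutral_right) (use U that in \<open>auto simp: U_def\<close>)
  define a where "a x \<zeta> = (\<Sum>i\<in>F. \<xi> i x *\<^sub>R emb_op i (row_op i \<zeta>))" for x and \<zeta> :: "('i \<times> 'j) ell2"
  have rowa: "row_op i (a x \<zeta>) = \<xi> i x *\<^sub>R row_op i \<zeta>" if "i \<in> F" for i x \<zeta>
  proof -
    have re: "row_op i (emb_op k y) = (if i = k then y else 0)" for k and y :: "'j ell2"
      using arg_cong[OF row_op_emb_op[of i k], of "%T. blinfun_apply T y"] by (simp split: if_splits)
    have "row_op i (a x \<zeta>) = (\<Sum>k\<in>F. if k = i then \<xi> i x *\<^sub>R row_op i \<zeta> else 0)"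
      unfolding a_def blinfun.sum_right by (intro sum.cong refl) (auto simp: blinfun.scaleR_right re)
    then show ?thesis using F that by simp
  qed
  have na: "(\<Sum>x\<in>U. (norm (a x \<zeta>))\<^sup>2) <= (norm \<zeta>)\<^sup>2" for \<zeta>
  proof -
    have "(norm (a x \<zeta>))\<^sup>2 = (\<Sum>i\<in>F. (\<xi> i x)\<^sup>2 * (norm (row_op i \<zeta>))\<^sup>2)" for x
    proof -
      have "(norm (a x \<zeta>))\<^sup>2 = inner (a x \<zeta>) (\<Sum>i\<in>F. \<xi> i x *\<^sub>R emb_op i (row_op i \<zeta>))"
        by (simp add: power2_norm_eq_inner a_def)
      also have "... = (\<Sum>i\<in>F. \<xi> i x * inner (row_op i (a x \<zeta>)) (row_op i \<zeta>))"
        by (simp add: inner_sum_right inner_emb_op)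
      also have "... = (\<Sum>i\<in>F. (\<xi> i x)\<^sup>2 * (norm (row_op i \<zeta>))\<^sup>2)"
        by (intro sum.cong refl) (simp add: rowa power2_norm_eq_inner, simp add: power2_eq_square)
      finally show ?thesis .
    qed
    then have "(\<Sum>x\<in>U. (norm (a x \<zeta>))\<^sup>2) = (\<Sum>i\<in>F. (\<Sum>x\<in>U. (\<xi> i x)\<^sup>2) * (norm (row_op i \<zeta>))\<^sup>2)"
      by (simp add: sum_distrib_right) (rule sum.swap)
    also have "... = (\<Sum>i\<in>F. (norm (col i (swap_ell2 \<zeta>)))\<^sup>2)" by (simp add: oneU row_op_apply row_def)
    also have "... <= (norm \<zeta>)\<^sup>2" using sum_col_le[OF F, of "swap_ell2 \<zeta>"] by (simp add: norm_swap_ell2)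
    finally show ?thesis .
  qed
  define \<zeta> where "\<zeta> = (compress F o\<^sub>L Y o\<^sub>L compress F) \<psi>"
  have "(norm \<zeta>)\<^sup>2 = inner \<zeta> (matrix_op F (slice Y) \<psi>)"
    by (simp add: power2_norm_eq_inner \<zeta>_def compress_slice)
  also have "... = (\<Sum>i\<in>F. \<Sum>j\<in>F. k i j * inner (row_op i \<zeta>) (slice X i j (row_op j \<psi>)))"
    by (simp add: inner_matrix_op Y blinfun.scaleR_left)
  also have "... = (\<Sum>i\<in>F. \<Sum>j\<in>F. \<Sum>x\<in>U. \<xi> i x * \<xi> j x * inner (row_op i \<zeta>) (slice X i j (row_op j \<psi>)))"
    by (intro sum.cong refl) (simp add: kU sum_distrib_right)
  also have "... = (\<Sum>i\<in>F. \<Sum>x\<in>U. \<Sum>j\<in>F. \<xi> i x * \<xi> j x * inner (row_op i \<zeta>) (slice X i j (row_op j \<psi>)))"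
    by (intro sum.cong refl) (rule sum.swap)
  also have "... = (\<Sum>x\<in>U. \<Sum>i\<in>F. \<Sum>j\<in>F. \<xi> i x * \<xi> j x * inner (row_op i \<zeta>) (slice X i j (row_op j \<psi>)))"
    by (rule sum.swap)
  also have "... = (\<Sum>x\<in>U. inner (a x \<zeta>) (X (a x \<psi>)))"
    by (intro sum.cong refl, subst sum.swap)
      (simp add: a_def blinfun.sum_right blinfun.scaleR_right inner_sum_left inner_sum_right inner_emb_op slice_def sum_distrib_left mult_ac)
  also have "... <= (\<Sum>x\<in>U. norm X * (\<bar>norm (a x \<zeta>)\<bar> * \<bar>norm (a x \<psi>)\<bar>))"
  proof (rule sum_mono)
    fix x
    have "inner (a x \<zeta>) (X (a x \<psi>)) <= norm (a x \<zeta>) * norm (X (a x \<psi>))" by (rule norm_cauchy_schwarz)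
    also have "... <= norm (a x \<zeta>) * (norm X * norm (a x \<psi>))" by (intro mult_left_mono norm_blinfun) simp
    finally show "inner (a x \<zeta>) (X (a x \<psi>)) <= norm X * (\<bar>norm (a x \<zeta>)\<bar> * \<bar>norm (a x \<psi>)\<bar>)" by (simp add: mult_ac)
  qed
  also have "... = norm X * (\<Sum>x\<in>U. \<bar>norm (a x \<zeta>)\<bar> * \<bar>norm (a x \<psi>)\<bar>)" by (simp add: sum_distrib_left)
  also have "... <= norm X * (norm \<zeta> * norm \<psi>)"
  proof (intro mult_left_mono order_trans[OF L2_set_mult_ineq] mult_mono)
    show "L2_set (%x. norm (a x \<zeta>)) U <= norm \<zeta>" "L2_set (%x. norm (a x \<psi>)) U <= norm \<psi>"
      unfolding L2_set_def by (intro real_le_lsqrt na sum_nonneg; simp)+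
  qed (auto simp: L2_set_nonneg)
  finally have "norm \<zeta> * norm \<zeta> <= norm \<zeta> * (norm X * norm \<psi>)" by (simp add: power2_eq_square mult_ac)
  then show "norm ((compress F o\<^sub>L Y o\<^sub>L compress F) \<psi>) <= norm X * norm \<psi>"
    unfolding \<zeta>_def[symmetric] by (cases "\<zeta> = 0") auto
qed simp

text \<open>The vectors are square roots of the measures \<open>\<nu> (- i)\<close>, hence unit
  vectors, and 1 - k i j is half the squared distance of two of them. It is bounded by half the l1
  distance through (sqrt a - sqrt b)^2 <= \<bar>a - b\<bar>. The index - i makes closeness a
  condition on i + - j, where the entries of left translations sit.\<close>

lemma property_A_kernel:
  fixes F :: "'g::group_add set"
  assumes "property_A TYPE('g)" "finite F" "\<delta> > 0"
  obtains E :: "'g set" and \<xi> k :: "'g => 'g => real" where "finite E" "!!i. finite {x. \<xi> i x ~= 0}"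
    "!!i. (\<Sum>x\<in>{x. \<xi> i x ~= 0}. (\<xi> i x)\<^sup>2) = 1" "!!i j. k i j = (\<Sum>x\<in>{x. \<xi> i x ~= 0}. \<xi> i x * \<xi> j x)"
    "!!i j. k i j ~= 0 ==> i + - j \<in> E" "!!i j. \<bar>k i j\<bar> <= 1" "!!i j. i + - j \<in> F ==> \<bar>k i j - 1\<bar> <= \<delta>"
proof -
  obtain E and \<nu> :: "'g => 'g => real" where E: "finite E" and nn: "ALL s g. \<nu> s g >= 0"
    and supp: "ALL s g. \<nu> s g ~= 0 --> - s + g \<in> E" and mass: "ALL s. (\<Sum>h\<in>E. \<nu> s (s + h)) = 1"
    and inv: "ALL s. \<forall>f\<in>F. ALL A. finite A --> (\<Sum>g\<in>A. \<bar>\<nu> s g - \<nu> (s + f) g\<bar>) <= \<delta>"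
    using assms(1)[unfolded property_A_def, rule_format, OF conjI[OF assms(2,3)]] by (elim exE conjE) (rule that)
  define \<xi> where "\<xi> i x = sqrt (\<nu> (- i) x)" for i x
  define k where "k i j = (\<Sum>x\<in>{x. \<xi> i x ~= 0}. \<xi> i x * \<xi> j x)" for i j
  have \<xi>2: "(\<xi> i x)\<^sup>2 = \<nu> (- i) x" for i x using nn by (simp add: \<xi>_def)
  have sE: "i + x \<in> E" if "\<xi> i x ~= 0" for i x
    using supp[rule_format, of "- i" x] that by (simp add: \<xi>_def)
  have sub: "{x. \<xi> i x ~= 0} \<subseteq> (%h. - i + h) ` E" for i
  proof
    fix x assume "x \<in> {x. \<xi> i x ~= 0}"
    then have "i + x \<in> E" using sE by simp
    then show "x \<in> (%h. - i + h) ` E" by (intro image_eqI[of _ _ "i + x"]) simp_all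
  qed
  have fin: "finite {x. \<xi> i x ~= 0}" for i by (rule finite_subset[OF sub]) (use E in simp)
  have one: "(\<Sum>x\<in>{x. \<xi> i x ~= 0}. (\<xi> i x)\<^sup>2) = 1" for i
  proof -
    have "(\<Sum>x\<in>{x. \<xi> i x ~= 0}. (\<xi> i x)\<^sup>2) = (\<Sum>x\<in>(%h. - i + h) ` E. (\<xi> i x)\<^sup>2)"
      by (rule sum.mono_neutral_left) (use E sub in auto)
    also have "... = (\<Sum>h\<in>E. \<nu> (- i) (- i + h))"
      by (subst sum.reindex) (auto simp: \<xi>2)
    finally show ?thesis using mass by simp
  qed
  have half: "\<bar>k i j\<bar> <= 1 & 1 - k i j = (\<Sum>x\<in>{x. \<xi> i x ~= 0} \<union> {x. \<xi> j x ~= 0}. (\<xi> i x - \<xi> j x)\<^sup>2) / 2" for i j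
  proof -
    let ?U = "{x. \<xi> i x ~= 0} \<union> {x. \<xi> j x ~= 0}"
    have U: "finite ?U" using fin by simp
    have 1: "(\<Sum>x\<in>?U. (\<xi> i x)\<^sup>2) = 1" "(\<Sum>x\<in>?U. (\<xi> j x)\<^sup>2) = 1"
      by (subst one[symmetric, of i] one[symmetric, of j]; intro sum.mono_neutral_right; use U in auto)+
    have 2: "k i j = (\<Sum>x\<in>?U. \<xi> i x * \<xi> j x)"
      unfolding k_def by (rule sum.mono_neutral_left) (use U in auto)
    have "(\<Sum>x\<in>?U. (\<xi> i x - \<xi> j x)\<^sup>2) = (\<Sum>x\<in>?U. (\<xi> i x)\<^sup>2) + (\<Sum>x\<in>?U. (\<xi> j x)\<^sup>2) - 2 * k i j"
      unfolding 2 by (simp add: sum.distrib[symmetric] sum_subtractf[symmetric] sum_distrib_left power2_diff mult.assoc)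
    then have a: "1 - k i j = (\<Sum>x\<in>?U. (\<xi> i x - \<xi> j x)\<^sup>2) / 2" by (simp add: 1)
    moreover have "0 <= (\<Sum>x\<in>?U. (\<xi> i x - \<xi> j x)\<^sup>2)" by (simp add: sum_nonneg)
    moreover have "0 <= k i j" unfolding k_def using nn by (intro sum_nonneg mult_nonneg_nonneg) (auto simp: \<xi>_def)
    ultimately show ?thesis by auto
  qed
  show thesis
  \<comment> \<open>The width is E - E: if two vectors overlap at x, then i + x and j + x both lie
    in E.\<close>
  proof (rule that[of "(%(a, b). a + - b) ` (E \<times> E)" \<xi> k])
    show "finite ((%(a, b). a + - b) ` (E \<times> E))" using E by simp
    show "i + - j \<in> (%(a, b). a + - b) ` (E \<times> E)" if "k i j ~= 0" for i j
    proof -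
      have "EX x. \<xi> i x ~= 0 & \<xi> j x ~= 0"
      proof (rule ccontr)
        assume "\<not> ?thesis"
        then have "ALL x. \<xi> i x * \<xi> j x = 0" by auto
        then have "k i j = 0" unfolding k_def by (intro sum.neutral) blast
        then show False using \<open>k i j ~= 0\<close> by simp
      qed
      then obtain x where x: "\<xi> i x ~= 0" "\<xi> j x ~= 0" by blast
      have "i + - j = (i + x) + - (j + x)" by (simp add: minus_add add.assoc del: add_uminus_conv_diff)
      then show ?thesis using sE[OF x(1)] sE[OF x(2)] by (intro image_eqI[of _ _ "(i + x, j + x)"]) simp_all
    qed
    show "\<bar>k i j - 1\<bar> <= \<delta>" if ij: "i + - j \<in> F" for i j
    proof -
      let ?U = "{x. \<xi> i x ~= 0} \<union> {x. \<xi> j x ~= 0}"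
      have "(\<Sum>x\<in>?U. (\<xi> i x - \<xi> j x)\<^sup>2) <= (\<Sum>x\<in>?U. \<bar>\<nu> (- i) x - \<nu> (- j) x\<bar>)"
      proof (rule sum_mono)
        fix x
        have n: "\<xi> i x >= 0" "\<xi> j x >= 0" using nn by (auto simp: \<xi>_def)
        have "(\<xi> i x - \<xi> j x)\<^sup>2 = \<bar>\<xi> i x - \<xi> j x\<bar> * \<bar>\<xi> i x - \<xi> j x\<bar>" by (simp add: power2_eq_square)
        also have "... <= \<bar>\<xi> i x - \<xi> j x\<bar> * \<bar>\<xi> i x + \<xi> j x\<bar>" using n by (intro mult_left_mono) auto
        also have "... = \<bar>\<nu> (- i) x - \<nu> (- j) x\<bar>"
          unfolding \<xi>2[symmetric] by (simp add: abs_mult[symmetric] power2_eq_square algebra_simps)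
        finally show "(\<xi> i x - \<xi> j x)\<^sup>2 <= \<bar>\<nu> (- i) x - \<nu> (- j) x\<bar>" .
      qed
      also have "... = (\<Sum>x\<in>?U. \<bar>\<nu> (- i) x - \<nu> (- i + (i + - j)) x\<bar>)" by (simp only: minus_add_cancel)
      also have "... <= \<delta>" using inv ij fin by blast
      finally show ?thesis using half[of i j] assms(3) by (simp add: abs_le_iff sum_nonneg)
    qed
  qed (use fin one half k_def in auto)
qed

definition elementary_tensors :: "'j op set => ('g::group_add \<times> 'j) op set" where
  "elementary_tensors B = {tensor_op (left_regular g) T | g T. T \<in> B}"

text \<open>A relation, since multiplying the entries of X by an arbitrary kernel need not give a
  bounded operator.\<close>

definition schur :: "('i => 'i => real) => ('i \<times> 'j) op => ('i \<times> 'j) op => bool" where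
  "schur k X Y \<longleftrightarrow> clinear Y & (ALL g h. slice Y g h = k g h *\<^sub>R slice X g h)"

text \<open>An element of A is a limit of combinations of left translations, and scalar coefficients
  can be absorbed into the second tensor factor.\<close>

lemma min_tensor_reduced_subset:
  fixes A :: "'g::group_add op set" and B :: "'j op set"
  assumes A_def: "A = reduced_group_cstar_algebra" and B: "concrete_cstar_algebra B"
  shows "min_tensor A B \<subseteq> closure (span (elementary_tensors B))"
proof -
  have A: "concrete_cstar_algebra A" unfolding A_def by (rule reduced_group_cstar)
  note clA = cstar_clinear[OF A] and clB = cstar_clinear[OF B] and lr = left_regular_clinear
  let ?L = "{tensor_op (left_regular g) T | (g :: 'g) T. T \<in> B}"
  show "min_tensor A B \<subseteq> closure (span (elementary_tensors B))"
    unfolding min_tensor_def elementary_tensors_def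
  proof (rule closure_minimal, rule span_minimal)
    show sL: "subspace (closure (span ?L))" by (intro subspace_closure subspace_span)
    show "{tensor_op S T | S T. S \<in> A & T \<in> B} \<subseteq> closure (span ?L)"
    proof safe
      fix S T assume S: "S \<in> A" and T: "T \<in> B"
      have in_span: "tensor_op S T \<in> span ?L" if "S \<in> group_span" for S :: "'g op"
      proof -
        have "clinear S & tensor_op S T \<in> span ?L"
          using that unfolding group_span_def
        proof (induction S rule: span_induct_alt)
          case base
          have "tensor_op (0 :: 'g op) T = 0"
            by (rule tensor_eqI) (simp add: tensor_op_tensor_vec clinear_0 clB T, rule ell2_eqI_pair, simp add: tensor_vec_apply ell2_coord)
          then show ?case by (simp add: clinear_0 span_zero)
        next
          case (step r x y)
          then obtain c g where x: "x = cscale_op c (left_regular g)" by blast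
          have clx: "clinear (r *\<^sub>R x)" unfolding x by (simp add: scaleR_cscale_op clinear_cscale_op lr)
          have "tensor_op (r *\<^sub>R x) T = tensor_op (left_regular g) (cscale_op (of_real r * c) T)"
            by (rule tensor_eqI)
              (simp add: tensor_op_tensor_vec clx[unfolded x] lr clinear_cscale_op clB T x blinfun.scaleR_left cscale_op_apply scaleR_cscale tensor_vec_linear cscale_simps)
          moreover have "tensor_op (left_regular g) (cscale_op (of_real r * c) T) \<in> span ?L"
            by (rule span_base) (use cstar_cscale[OF B T] in blast)
          ultimately show ?case
            using step clx by (auto simp: tensor_op_add_left clB T clinear_add intro: span_add)
        qed
        then show ?thesis ..
      qed
      obtain s where s: "!!n::nat. s n \<in> group_span" "s ----> S"
        using S unfolding A_def reduced_group_cstar_algebra_eq closure_sequential by blast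
      have cls: "clinear (s n)" for n
      proof -
        have "s n \<in> A" unfolding A_def reduced_group_cstar_algebra_eq by (rule subsetD[OF closure_subset s(1)])
        then show ?thesis by (rule clA)
      qed
      have "(%n. tensor_op (s n) T) ----> tensor_op S T"
      proof (rule LIM_zero_cancel, rule Lim_null_comparison)
        have "norm (tensor_op (s n) T - tensor_op S T) <= norm (s n - S) * norm T" for n
        proof -
          have "tensor_op (s n) T = tensor_op (s n - S) T + tensor_op S T"
            using tensor_op_add_left[of "s n - S" T S] by (simp add: cls clA S clB T clinear_diff)
          then show ?thesis using norm_tensor_op_le[of "s n - S" T] by (simp add: cls clA S clB T clinear_diff)
        qed
        then show "\<forall>\<^sub>F n in sequentially. norm (tensor_op (s n) T - tensor_op S T) <= norm (s n - S) * norm T" by simp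
        have "(%n. norm (s n - S)) ----> 0" using s(2) by (simp add: LIM_zero_iff tendsto_norm_zero)
        from tendsto_mult_right[OF this, of "norm T"] show "(%n. norm (s n - S) * norm T) ----> 0" by simp
      qed
      then show "tensor_op S T \<in> closure (span ?L)"
        unfolding closure_sequential using in_span[OF s(1)]
        by (intro exI[of _ "%n. tensor_op (s n) T"] conjI allI)
    qed
  qed simp
qed

text \<open>On \<lambda>_g \<otimes> T the multiplier acts as left multiplication by a diagonal
  operator, because all entries of \<lambda>_g sit on one diagonal. F collects the translations that
  occur in X, and C the norms of their coefficients; both serve all kernels k at once.\<close>

lemma schur_approx:
  fixes X :: "('g::group_add \<times> 'j) op"
  assumes B: "concrete_cstar_algebra B" and X: "X \<in> span (elementary_tensors B)"
  shows "EX F C. finite F & C >= 0 & (\<forall>k \<delta>. \<delta> > 0 & (ALL g h. \<bar>k g h\<bar> <= 1) & (ALL g h. g + - h \<in> F --> \<bar>k g h - 1\<bar> <= \<delta>) -->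
      (EX Y. schur k X Y & norm (Y - X) <= C * \<delta>))"
proof -
  note clB = cstar_clinear[OF B] and lr = left_regular_clinear
  show ?thesis
    using X unfolding elementary_tensors_def
  proof (induction X rule: span_induct_alt)
    case base
    show ?case
      by (intro exI[of _ "{}"] exI[of _ 0]) (auto simp: schur_def clinear_0 slice_linear intro!: exI[of _ 0])
  next
    case (step r x y)
    obtain g0 T where x: "x = tensor_op (left_regular g0) T" "T \<in> B" using step(1) by blast
    obtain F C where F: "finite F" "C >= 0" and FC: "\<forall>k \<delta>. \<delta> > 0 & (ALL g h. \<bar>k g h\<bar> <= 1) & (ALL g h. g + - h \<in> F --> \<bar>k g h - 1\<bar> <= \<delta>) -->
      (EX Y. schur k y Y & norm (Y - y) <= C * \<delta>)" using step(2) by (elim exE conjE) (rule that)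
    show ?case
    proof (intro exI[of _ "insert g0 F"] exI[of _ "C + \<bar>r\<bar> * norm T"] conjI allI impI, goal_cases)
      case 1 show ?case using F by simp
    next
      case 2 show ?case using F by simp
    next
      case (3 k \<delta>)
      then obtain Y where Y: "schur k y Y" "norm (Y - y) <= C * \<delta>" using FC[rule_format, of \<delta> k] by auto
      \<comment> \<open>Row g of the translation by g0 has its only entry in column - g0 + g, so
        this diagonal realises the multiplication by k. D' is D minus the identity and has norm at
        most \<delta>.\<close>
      define D where "D = diag_op (%g. k g (- g0 + g))"
      define D' where "D' = diag_op (%g. k g (- g0 + g) - 1)"
      have k1: "\<bar>k g (- g0 + g)\<bar> <= 1" for g using 3 by blast
      have kd: "\<bar>k g (- g0 + g) - 1\<bar> <= \<delta>" for g
      proof -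
        have "g + - (- g0 + g) = g0" by (metis add.assoc add.right_neutral add.left_neutral minus_add minus_minus right_minus)
        then show ?thesis using 3 by (metis insertI1)
      qed
      have clD: "clinear D" "clinear D'"
        unfolding D_def D'_def by (rule diag_op_clinear[OF k1]) (rule diag_op_clinear[OF kd])
      have DD: "D o\<^sub>L left_regular g0 = (D' o\<^sub>L left_regular g0) + left_regular g0"
      proof (rule blinfun_eqI, rule ell2_eqI)
        fix v i
        have "ell2_apply (D (left_regular g0 v)) i = of_real (k i (- g0 + i)) * ell2_apply (left_regular g0 v) i"
          unfolding D_def by (rule diag_op_apply[OF k1])
        moreover have "ell2_apply (D' (left_regular g0 v)) i = of_real (k i (- g0 + i) - 1) * ell2_apply (left_regular g0 v) i"
          unfolding D'_def by (rule diag_op_apply[OF kd])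
        ultimately show "ell2_apply ((D o\<^sub>L left_regular g0) v) i = ell2_apply (((D' o\<^sub>L left_regular g0) + left_regular g0) v) i"
          by (simp add: blinfun.add_left ell2_coord left_diff_distrib)
      qed
      define x' where "x' = tensor_op (D o\<^sub>L left_regular g0) T"
      have cl: "clinear (D o\<^sub>L left_regular g0)" "clinear (D' o\<^sub>L left_regular g0)"
        by (intro clinear_compose clD lr)+
      have sx: "schur k x x'"
        unfolding schur_def
      proof (intro conjI allI)
        show "clinear x'" unfolding x'_def by (intro tensor_op_clinear cl clB x)
        fix g h
        have "ell2_apply ((D o\<^sub>L left_regular g0) (ket h)) g = of_real (k g h) * ell2_apply (left_regular g0 (ket h)) g"
          by (auto simp: D_def diag_op_apply[OF k1] left_regular_ket ket.rep_eq)
        then show "slice x' g h = k g h *\<^sub>R slice x g h"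
          by (simp add: x'_def x slice_tensor_op cl lr clB scaleR_cscale_op cscale_op_linear)
      qed
      have "x' - x = tensor_op (D' o\<^sub>L left_regular g0) T"
        unfolding x'_def x(1) DD by (simp add: tensor_op_add_left cl lr clB x)
      then have "norm (x' - x) <= norm (D' o\<^sub>L left_regular g0) * norm T"
        using norm_tensor_op_le[OF cl(2) clB[OF x(2)]] by simp
      also have "norm (D' o\<^sub>L left_regular g0) <= norm D' * norm (left_regular g0)" by (rule norm_blinfun_compose)
      also have "... <= \<delta> * 1"
        unfolding D'_def using 3 by (intro mult_mono norm_diag_op[OF kd] norm_left_regular_le) auto
      finally have nx: "norm (x' - x) <= \<delta> * norm T" by (simp add: mult_right_mono)
      show ?case
      proof (intro exI[of _ "r *\<^sub>R x' + Y"] conjI)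
        show "schur k (r *\<^sub>R x + y) (r *\<^sub>R x' + Y)"
          using sx Y(1) by (auto simp: schur_def slice_linear clinear_add scaleR_cscale_op[of r] clinear_cscale_op algebra_simps)
             (simp_all add: scaleR_cscale_op[of r, symmetric] slice_linear algebra_simps)
        have "norm (r *\<^sub>R x' + Y - (r *\<^sub>R x + y)) = norm (r *\<^sub>R (x' - x) + (Y - y))" by (simp add: algebra_simps)
        also have "... <= \<bar>r\<bar> * norm (x' - x) + norm (Y - y)" by (rule order_trans[OF norm_triangle_ineq]) simp
        also have "... <= \<bar>r\<bar> * (\<delta> * norm T) + C * \<delta>" by (intro add_mono mult_left_mono nx Y) simp
        finally show "norm (r *\<^sub>R x' + Y - (r *\<^sub>R x + y)) <= (C + \<bar>r\<bar> * norm T) * \<delta>" by (simp add: algebra_simps)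
      qed
    qed
  qed
qed

lemma slice_shift:
  fixes A :: "'g::group_add op set" and B :: "'j op set"
  assumes A_def: "A = reduced_group_cstar_algebra" and B: "concrete_cstar_algebra B" and z: "z \<in> min_tensor A B"
  shows "slice z g h = slice z (g + - h) 0"
proof -
  have A: "concrete_cstar_algebra A" unfolding A_def by (rule reduced_group_cstar)
  note clA = cstar_clinear[OF A] and clB = cstar_clinear[OF B] and lr = left_regular_clinear
    let ?P = "%X :: ('g \<times> 'j) op. slice X g h = slice X (g + - h) 0"
    have "min_tensor A B \<subseteq> {X. ?P X}"
      unfolding min_tensor_def
    proof (rule closure_minimal, rule span_minimal)
      show "{tensor_op S T | S T. S \<in> A & T \<in> B} \<subseteq> {X. ?P X}"
        using reduced_group_coeff[of _ h g] by (auto simp: slice_tensor_op clA clB A_def[symmetric])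
      show "subspace {X. ?P X}" by (auto simp: subspace_def slice_linear)
      show "closed {X. ?P X}"
        by (intro closed_Collect_eq bounded_linear.continuous_on[OF bounded_linear_slice continuous_on_id])
    qed
    then show ?thesis using z by blast
qed

text \<open>The Schur multiple Y of z by a kernel of finite width is close to z and is a finite sum
  of \<open>D s\<close> \<otimes> \<open>zs s\<close> with \<open>zs s\<close> in J, but
  \<open>D s\<close> is in general not in A. So Y only serves to find e in J such that Y (1
  \<otimes> e) is near Y. Then z (1 \<otimes> e) is near z, and it lies in A \<otimes> J because z
  is in A \<otimes> B and J absorbs products from B.\<close>

lemma property_A_imp_kernel_tensor:
  fixes A :: "'g::group_add op set" and B :: "'j op set"
  assumes A_def: "A = reduced_group_cstar_algebra" and pA: "property_A TYPE('g)"
    and B: "concrete_cstar_algebra B" and J: "concrete_cstar_algebra J" and JB: "J \<subseteq> B"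
    and ideal: "!!S T. S \<in> B ==> T \<in> J ==> S o\<^sub>L T \<in> J"
    and z: "z \<in> min_tensor A B" and zJ: "!!g h. slice z g h \<in> J"
  shows "z \<in> min_tensor A J"
proof -
  have A: "concrete_cstar_algebra A" unfolding A_def by (rule reduced_group_cstar)
  note clA = cstar_clinear[OF A] and clB = cstar_clinear[OF B] and clJ = cstar_clinear[OF J]
  note lr = left_regular_clinear
  have sub: "subspace (min_tensor A J)" unfolding min_tensor_def by (intro subspace_closure subspace_span)
  have "\<exists>y\<in>min_tensor A J. dist y z < \<epsilon>" if \<epsilon>: "\<epsilon> > 0" for \<epsilon>
  proof -
    \<comment> \<open>The distance from z to Y is at most \<epsilon> / 2: one sixth for z - z0, one
      for z0 against its multiple Y0, and one for Y - Y0 by contractivity. The approximate unit adds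
      \<epsilon> / 4.\<close>
    obtain z0 where z0: "z0 \<in> span (elementary_tensors B)" "norm (z - z0) < \<epsilon> / 6"
      using subsetD[OF min_tensor_reduced_subset[OF A_def B] z] \<epsilon> unfolding closure_approachable by (metis dist_norm norm_minus_commute divide_pos_pos zero_less_numeral)
    obtain F C where F: "finite F" "C >= 0" and FC: "\<forall>k \<delta>. \<delta> > 0 & (ALL g h. \<bar>k g h\<bar> <= 1) & (ALL g h. g + - h \<in> F --> \<bar>k g h - 1\<bar> <= \<delta>) -->
      (EX Y. schur k z0 Y & norm (Y - z0) <= C * \<delta>)" using schur_approx[OF B z0(1)] by (elim exE conjE) (rule that)
    define \<delta> where "\<delta> = \<epsilon> / (6 * (C + 1))"
    have \<delta>: "\<delta> > 0" "C * \<delta> <= \<epsilon> / 6" using \<epsilon> F(2) by (auto simp: \<delta>_def field_simps)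
    obtain E and \<xi> k :: "'g => 'g => real" where E: "finite E" and \<xi>: "!!i. finite {x. \<xi> i x ~= 0}"
      "!!i. (\<Sum>x\<in>{x. \<xi> i x ~= 0}. (\<xi> i x)\<^sup>2) = 1" "!!i j. k i j = (\<Sum>x\<in>{x. \<xi> i x ~= 0}. \<xi> i x * \<xi> j x)"
      and k: "!!i j. k i j ~= 0 ==> i + - j \<in> E" "!!i j. \<bar>k i j\<bar> <= 1" "!!i j. i + - j \<in> F ==> \<bar>k i j - 1\<bar> <= \<delta>"
      by (rule property_A_kernel[OF pA F(1) \<delta>(1)]) (rule that; assumption)
    obtain Y0 where Y0: "schur k z0 Y0" "norm (Y0 - z0) <= C * \<delta>" using FC[rule_format, of \<delta> k] \<delta>(1) k(2,3) by auto
    define D where "D s = diag_op (%g. k g (- s + g)) o\<^sub>L left_regular s" for s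
    define zs where "zs s = slice z s 0" for s
    have zsJ: "zs s \<in> J" for s by (simp add: zs_def zJ)
    have kb: "\<bar>k g (- s + g)\<bar> <= 1" for g s by (rule k)
    have clD: "clinear (D s)" for s unfolding D_def by (intro clinear_compose lr diag_op_clinear[OF kb])
    have nD: "norm (D s) <= 1" for s
    proof -
      have "norm (D s) <= norm (diag_op (%g. k g (- s + g))) * norm (left_regular s)"
        unfolding D_def by (rule norm_blinfun_compose)
      also have "... <= 1 * 1" by (intro mult_mono norm_diag_op[OF kb] norm_left_regular_le) auto
      finally show ?thesis by simp
    qed
    define Y where "Y = (\<Sum>s\<in>E. tensor_op (D s) (zs s))"
    have clY: "clinear Y"
      unfolding Y_def using E
      by (induction E rule: finite_induct) (auto simp: clinear_0 intro!: clinear_add tensor_op_clinear clD clJ zsJ)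
    have sY: "slice Y g h = k g h *\<^sub>R slice z g h" for g h
    proof -
      have sl: "slice Y g h = (\<Sum>s\<in>E. slice (tensor_op (D s) (zs s)) g h)"
        unfolding Y_def by (rule linear_sum[OF bounded_linear.linear[OF bounded_linear_slice]])
      have "slice (tensor_op (D s) (zs s)) g h = (if s = g + - h then k g h *\<^sub>R zs s else 0)" for s
      proof -
        have gs: "g = s + h \<longleftrightarrow> s = g + - h" by (metis add.assoc add.right_neutral left_minus right_minus)
        have "ell2_apply (D s (ket h)) g = (if s = g + - h then of_real (k g h) else 0)"
          using gs by (auto simp: D_def diag_op_apply[OF kb] left_regular_ket ket.rep_eq)
        then show ?thesis
          by (simp add: slice_tensor_op clD clJ zsJ scaleR_cscale_op)
            (auto intro!: blinfun_eqI simp: cscale_op_apply cscale_simps)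
      qed
      then have "slice Y g h = (if g + - h \<in> E then k g h *\<^sub>R zs (g + - h) else 0)" unfolding sl using E by simp
      also have "... = k g h *\<^sub>R slice z g h" using k(1)[of g h] by (auto simp: zs_def slice_shift[OF A_def B z, of g h])
      finally show ?thesis .
    qed
    have "norm (Y - Y0) <= norm (z - z0)"
    proof (rule schur_multiplier_contractive[OF \<xi>])
      show "slice (Y - Y0) i j = k i j *\<^sub>R slice (z - z0) i j" for i j
        using Y0(1) by (simp add: slice_linear sY schur_def algebra_simps)
    qed
    moreover have "norm (z - Y) <= norm (z - z0) + norm (Y0 - z0) + norm (Y - Y0)"
      using norm_triangle_ineq4[of "z - z0 - (Y0 - z0)" "Y - Y0"] norm_triangle_ineq4[of "z - z0" "Y0 - z0"] by simp
    ultimately have zY: "norm (z - Y) <= \<epsilon> / 2" using z0(2) Y0(2) \<delta>(2) by linarith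
    define \<eta> where "\<eta> = \<epsilon> / (4 * (card E + 1))"
    have \<eta>: "\<eta> > 0" "card E * \<eta> <= \<epsilon> / 4" using \<epsilon> by (auto simp: \<eta>_def field_simps)
    obtain e where e: "e \<in> J" "!!v. norm (v - e v) <= norm v" "!!s. s \<in> E ==> norm (zs s - (zs s o\<^sub>L e)) <= \<eta>"
      by (rule cstar_approx_unit[OF J E zsJ \<eta>(1), of "%s. s"]) (rule that; assumption)
    define R :: "('g \<times> 'j) op" where "R = tensor_op id_blinfun e"
    have cli: "clinear (id_blinfun :: 'g op)" "clinear (id_blinfun :: 'j op)" by (simp_all add: clinear_def)
    have zR: "z o\<^sub>L R \<in> min_tensor A J"
    proof -
      have "min_tensor A B \<subseteq> {X. X o\<^sub>L R \<in> min_tensor A J}"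
        unfolding min_tensor_def[of A B]
      proof (rule closure_minimal, rule span_minimal)
        show "{tensor_op S T | S T. S \<in> A & T \<in> B} \<subseteq> {X. X o\<^sub>L R \<in> min_tensor A J}"
        proof safe
          fix S T assume ST: "S \<in> A" "T \<in> B"
          have "tensor_op S T o\<^sub>L R = tensor_op S (T o\<^sub>L e)"
            unfolding R_def by (simp add: tensor_op_compose clA clB clJ cli e ST op_compose_id)
          moreover have "tensor_op S (T o\<^sub>L e) \<in> min_tensor A J"
            unfolding min_tensor_def using ST ideal e(1) by (intro subsetD[OF closure_subset] span_base) blast
          ultimately show "tensor_op S T o\<^sub>L R \<in> min_tensor A J" by simp
        qed
        show "subspace {X. X o\<^sub>L R \<in> min_tensor A J}"
          using subspace_0[OF sub] subspace_add[OF sub] subspace_scale[OF sub] by (auto simp: subspace_def op_compose_simps)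
        have "closed ((%X. X o\<^sub>L R) -` min_tensor A J)"
          by (intro closed_vimage bounded_bilinear.continuous_on[OF bounded_bilinear_blinfun_compose] continuous_intros)
            (simp add: min_tensor_def)
        then show "closed {X. X o\<^sub>L R \<in> min_tensor A J}" by (simp add: vimage_def)
      qed
      then show ?thesis using z by blast
    qed
    have contr: "norm (X - (X o\<^sub>L R)) <= norm X" for X
    proof -
      have ne: "norm (id_blinfun - e) <= 1" by (rule norm_blinfun_bound) (simp_all add: blinfun.diff_left e)
      have cle: "clinear (id_blinfun - e)" by (intro clinear_diff cli clJ e)
      have "tensor_op id_blinfun (id_blinfun - e) + R = (tensor_op id_blinfun id_blinfun :: ('g \<times> 'j) op)"
        unfolding R_def using tensor_op_add_right[OF cli(1) cle clJ[OF e(1)]] by simp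
      also have "... = id_blinfun" by (rule tensor_eqI) (simp add: tensor_op_tensor_vec cli)
      finally have "id_blinfun - R = tensor_op id_blinfun (id_blinfun - e)" by (simp add: algebra_simps)
      then have "norm (id_blinfun - R) <= norm (id_blinfun :: 'g op) * norm (id_blinfun - e)"
        using norm_tensor_op_le[OF cli(1) cle] by simp
      also have "... <= 1 * 1" by (intro mult_mono ne norm_blinfun_bound) auto
      finally have nR: "norm (id_blinfun - R) <= 1" by simp
      have "X - (X o\<^sub>L R) = X o\<^sub>L (id_blinfun - R)" by (simp add: op_compose_simps op_compose_id)
      then have "norm (X - (X o\<^sub>L R)) <= norm X * norm (id_blinfun - R)" by (simp only: norm_blinfun_compose)
      also have "... <= norm X * 1" by (intro mult_left_mono nR) simp
      finally show ?thesis by simp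
    qed
    have YR: "norm (Y - (Y o\<^sub>L R)) <= \<epsilon> / 4"
    proof -
      have "Y - (Y o\<^sub>L R) = (\<Sum>s\<in>E. tensor_op (D s) (zs s - (zs s o\<^sub>L e)))"
        unfolding Y_def op_compose_sum sum_subtractf[symmetric]
      proof (rule sum.cong[OF refl])
        fix s
        have c: "clinear (zs s o\<^sub>L e)" "clinear (zs s - (zs s o\<^sub>L e))"
          by (intro clinear_diff clinear_compose clJ zsJ e)+
        have "tensor_op (D s) (zs s) o\<^sub>L R = tensor_op (D s) (zs s o\<^sub>L e)"
          unfolding R_def by (simp add: tensor_op_compose clD clJ zsJ cli e op_compose_id)
        moreover have "tensor_op (D s) (zs s) = tensor_op (D s) (zs s - (zs s o\<^sub>L e)) + tensor_op (D s) (zs s o\<^sub>L e)"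
          using tensor_op_add_right[OF clD c(2,1)] by simp
        ultimately show "tensor_op (D s) (zs s) - (tensor_op (D s) (zs s) o\<^sub>L R) = tensor_op (D s) (zs s - (zs s o\<^sub>L e))" by simp
      qed
      also have "norm ... <= (\<Sum>s\<in>E. \<eta>)"
      proof (rule sum_norm_le)
        fix s assume s: "s \<in> E"
        have c: "clinear (zs s - (zs s o\<^sub>L e))" by (intro clinear_diff clinear_compose clJ zsJ e)
        have "norm (tensor_op (D s) (zs s - (zs s o\<^sub>L e))) <= norm (D s) * norm (zs s - (zs s o\<^sub>L e))"
          by (rule norm_tensor_op_le[OF clD c])
        also have "... <= 1 * \<eta>" by (intro mult_mono nD e s) auto
        finally show "norm (tensor_op (D s) (zs s - (zs s o\<^sub>L e))) <= \<eta>" by simp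
      qed
      also have "... <= \<epsilon> / 4" using \<eta>(2) by simp
      finally show ?thesis .
    qed
    have "z - (z o\<^sub>L R) = ((z - Y) - ((z - Y) o\<^sub>L R)) + (Y - (Y o\<^sub>L R))" by (simp add: op_compose_simps)
    then have "norm (z - (z o\<^sub>L R)) <= norm ((z - Y) - ((z - Y) o\<^sub>L R)) + norm (Y - (Y o\<^sub>L R))" by (metis norm_triangle_ineq)
    also have "... <= \<epsilon> / 2 + \<epsilon> / 4" by (intro add_mono order_trans[OF contr zY] YR)
    also have "... < \<epsilon>" using \<epsilon> by simp
    finally show ?thesis using zR by (intro bexI[of _ "z o\<^sub>L R"]) (auto simp: dist_norm norm_minus_commute)
  qed
  then have "z \<in> closure (min_tensor A J)" by (simp add: closure_approachable)
  then show ?thesis by (simp add: min_tensor_def)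
qed

text \<open>Property A is used for one inclusion, that of the kernel of Q in A \<otimes> J; the rest
  is functoriality of the minimal tensor product.\<close>

lemma property_A_imp_exact:
  assumes "property_A TYPE('g::group_add)"
  shows "exact_group TYPE('u) TYPE('g)"
  unfolding exact_group_def exact_cstar_algebra_def
proof (intro allI impI, elim conjE)
  fix B C :: "'u op set" and q
  assume B: "concrete_cstar_algebra B" and C: "concrete_cstar_algebra C" and q: "star_hom B C q" and onto: "q ` B = C"
  define A where "A = (reduced_group_cstar_algebra :: 'g op set)"
  have A: "concrete_cstar_algebra A" unfolding A_def by (rule reduced_group_cstar)
  let ?J = "{T \<in> B. q T = 0}"
  have J: "concrete_cstar_algebra ?J" by (rule kernel_cstar[OF B q])
  obtain Q where Q: "star_hom (min_tensor A B) (min_tensor A C) Q"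
    "!!S T. S \<in> A ==> T \<in> B ==> Q (tensor_op S T) = tensor_op S (q T)"
    "!!X i k. X \<in> min_tensor A B ==> slice X i k \<in> B"
    "!!X i k. X \<in> min_tensor A B ==> slice (Q X) i k = q (slice X i k)"
    using min_tensor_star_hom_ex[OF A B C q] by metis
  have AB: "concrete_cstar_algebra (min_tensor A B)" by (rule min_tensor_cstar[OF A B C q])
  have gen: "tensor_op S T \<in> min_tensor A B" if "S \<in> A" "T \<in> B" for S T
    unfolding min_tensor_def using that by (intro subsetD[OF closure_subset] span_base) blast
  \<comment> \<open>The image contains the elementary tensors, hence their span, and the image of a
    homomorphism is closed.\<close>
  have surj: "Q ` min_tensor A B = min_tensor A C"
  proof
    show "Q ` min_tensor A B \<subseteq> min_tensor A C" using Q(1) by (simp add: star_hom_def)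
    have sQ: "subspace (Q ` min_tensor A B)"
    proof (rule subspaceI)
      show "0 \<in> Q ` min_tensor A B" using star_hom_0[OF AB Q(1)] cstar_0[OF AB] by (metis imageI)
      show "x + y \<in> Q ` min_tensor A B" if "x \<in> Q ` min_tensor A B" "y \<in> Q ` min_tensor A B" for x y
        using that star_hom_add[OF Q(1)] cstar_add[OF AB] by (smt (verit, ccfv_threshold) image_iff)
      show "c *\<^sub>R x \<in> Q ` min_tensor A B" if "x \<in> Q ` min_tensor A B" for c x
        using that star_hom_scaleR[OF Q(1)] cstar_scaleR[OF AB] by (metis (no_types, lifting) image_iff)
    qed
    show "min_tensor A C \<subseteq> Q ` min_tensor A B"
      unfolding min_tensor_def[of A C]
    proof (rule closure_minimal[OF span_minimal[OF _ sQ] star_hom_image_closed[OF AB Q(1)]])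
      show "{tensor_op S T | S T. S \<in> A & T \<in> C} \<subseteq> Q ` min_tensor A B"
      proof safe
        fix S T assume S: "S \<in> A" and "T \<in> C"
        then obtain T' where T': "T' \<in> B" "T = q T'" using onto by blast
        then show "tensor_op S T \<in> Q ` min_tensor A B"
          using Q(2)[OF S T'(1)] gen[OF S T'(1)] by (metis imageI)
      qed
    qed
  qed
  have ker: "{R \<in> min_tensor A B. Q R = 0} = min_tensor A ?J"
  proof
    show "{R \<in> min_tensor A B. Q R = 0} \<subseteq> min_tensor A ?J"
    proof safe
      fix z assume z: "z \<in> min_tensor A B" "Q z = 0"
      show "z \<in> min_tensor A ?J"
      proof (rule property_A_imp_kernel_tensor[OF A_def assms B J _ _ z(1)])
        show "S o\<^sub>L T \<in> ?J" if "S \<in> B" "T \<in> ?J" for S T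
          using that by (simp add: cstar_compose[OF B] star_hom_compose[OF q] op_compose_simps)
        show "slice z g h \<in> ?J" for g h
          using Q(3)[OF z(1), of g h] Q(4)[OF z(1), of g h] z(2) by (simp add: slice_linear)
      qed auto
    qed
    have K: "concrete_cstar_algebra {R \<in> min_tensor A B. Q R = 0}" by (rule kernel_cstar[OF AB Q(1)])
    show "min_tensor A ?J \<subseteq> {R \<in> min_tensor A B. Q R = 0}"
      unfolding min_tensor_def[of A ?J]
    proof (rule closure_minimal[OF span_minimal cstar_closed[OF K]])
      show "subspace {R \<in> min_tensor A B. Q R = 0}"
        by (rule subspaceI) (use cstar_0[OF K] cstar_add[OF K] cstar_scaleR[OF K] in blast)+
      have t0: "tensor_op S (0 :: 'u op) = 0" if "S \<in> A" for S
      proof (rule tensor_eqI)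
        show "tensor_op S (0 :: 'u op) (tensor_vec x y) = (0 :: ('g \<times> 'u) op) (tensor_vec x y)" for x and y :: "'u ell2"
          using cstar_clinear[OF A that]
          by (simp add: tensor_op_tensor_vec clinear_0) (rule ell2_eqI_pair, simp add: tensor_vec_apply ell2_coord)
      qed
      then show "{tensor_op S T | S T. S \<in> A & T \<in> ?J} \<subseteq> {R \<in> min_tensor A B. Q R = 0}"
        using gen Q(2) by auto
    qed
  qed
  show "EX Q. star_hom (min_tensor reduced_group_cstar_algebra B) (min_tensor reduced_group_cstar_algebra C) Q &
      (\<forall>S\<in>reduced_group_cstar_algebra. \<forall>T\<in>B. Q (tensor_op S T) = tensor_op (S :: 'g op) (q T)) &
      Q ` min_tensor reduced_group_cstar_algebra B = min_tensor reduced_group_cstar_algebra C &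
      {R \<in> min_tensor reduced_group_cstar_algebra B. Q R = 0} = min_tensor reduced_group_cstar_algebra ?J"
    using Q(1,2) surj ker unfolding A_def by blast
qed

section \<open>Exactness implies property A\<close>

lemma sum_lessThan_add: "(\<Sum>j<m + n. f j) = (\<Sum>j<m. f j) + (\<Sum>j<n. f (m + j))" for f :: "nat => 'a::comm_monoid_add"
  by (induction n) (simp_all add: add.assoc)

lemma pos_kernels_0: "(%_ _. 0) \<in> pos_kernels S E"
  unfolding pos_kernels_def by (intro CollectI exI[of _ 0] exI[of _ "%_ _ _. 0"]) simp

lemma pos_kernels_scale:
  assumes k: "k \<in> pos_kernels S E" and c: "c >= 0"
  shows "(%s t. c * k s t) \<in> pos_kernels S E"
proof -
  obtain m :: nat and \<xi> where \<xi>: "ALL j s g. \<xi> j s g ~= 0 --> s \<in> S & - s + g \<in> E"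
    and k_def: "k = (%s t. \<Sum>j<m. \<Sum>g\<in>sum_set S E. \<xi> j s g * \<xi> j t g)" using k unfolding pos_kernels_def by blast
  have sq: "sqrt c * x * (sqrt c * y) = c * (x * y)" for x y
    using c by (metis mult.assoc mult.left_commute real_sqrt_mult_self abs_of_nonneg)
  have "(%s t. c * k s t) = (%s t. \<Sum>j<m. \<Sum>g\<in>sum_set S E. (sqrt c * \<xi> j s g) * (sqrt c * \<xi> j t g))"
    by (simp only: k_def sum_distrib_left sq)
  then show ?thesis
    unfolding pos_kernels_def using \<xi> by (intro CollectI exI[of _ m] exI[of _ "%j s g. sqrt c * \<xi> j s g"]) auto
qed

lemma pos_kernels_add:
  assumes k: "k \<in> pos_kernels S E" and l: "l \<in> pos_kernels S E"
  shows "(%s t. k s t + l s t) \<in> pos_kernels S E"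
proof -
  obtain m :: nat and \<xi> where \<xi>: "ALL j s g. \<xi> j s g ~= 0 --> s \<in> S & - s + g \<in> E"
    and k_def: "k = (%s t. \<Sum>j<m. \<Sum>g\<in>sum_set S E. \<xi> j s g * \<xi> j t g)" using k unfolding pos_kernels_def by blast
  obtain n :: nat and \<zeta> where \<zeta>: "ALL j s g. \<zeta> j s g ~= 0 --> s \<in> S & - s + g \<in> E"
    and l_def: "l = (%s t. \<Sum>j<n. \<Sum>g\<in>sum_set S E. \<zeta> j s g * \<zeta> j t g)" using l unfolding pos_kernels_def by blast
  define \<theta> where "\<theta> j = (if j < m then \<xi> j else \<zeta> (j - m))" for j
  have "(%s t. k s t + l s t) = (%s t. \<Sum>j<m + n. \<Sum>g\<in>sum_set S E. \<theta> j s g * \<theta> j t g)"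
    by (simp add: sum_lessThan_add k_def l_def \<theta>_def)
  then show ?thesis
    unfolding pos_kernels_def using \<xi> \<zeta> by (intro CollectI exI[of _ "m + n"] exI[of _ \<theta>]) (auto simp: \<theta>_def)
qed

lemma pos_kernels_sym: "k \<in> pos_kernels S E ==> k s t = k t s"
  unfolding pos_kernels_def by (auto simp: mult.commute)

text \<open>The tuples of values 1 - k over the pairs within F form a convex set at sup-distance at
  least \<delta> from 0, and a separating functional c has l1 norm at most 1. Since the kernels form
  a cone, c is nonpositive on all of them, while the zero kernel gives that c sums to at least
  \<delta>. The matrix a is the symmetrisation of - c.\<close>

lemma kernel_separation:
  fixes S E F :: "'g::group_add set"
  assumes S: "finite S" and F: "!!f. f \<in> F ==> - f \<in> F" and \<delta>: "\<delta> > 0"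
    and no: "!!k. k \<in> pos_kernels S E ==> \<exists>s\<in>S. \<exists>t\<in>S. - s + t \<in> F & \<bar>k s t - 1\<bar> > \<delta>"
  obtains a :: "'g => 'g => real" where "!!s t. a s t ~= 0 ==> s \<in> S & t \<in> S & - s + t \<in> F"
    "!!s t. a s t = a t s" "(\<Sum>s\<in>S. \<Sum>t\<in>S. \<bar>a s t\<bar>) <= 1"
    "!!k. k \<in> pos_kernels S E ==> (\<Sum>s\<in>S. \<Sum>t\<in>S. a s t * k s t) >= 0" "(\<Sum>s\<in>S. \<Sum>t\<in>S. a s t) <= - \<delta>"
proof -
  define P where "P = {(s, t). s \<in> S & t \<in> S & - s + t \<in> F}"
  have "P \<subseteq> S \<times> S" by (auto simp: P_def)
  then have "finite P" using S by (simp add: finite_subset)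
  then obtain p where "bij_betw p {0..<card P} P" using ex_bij_betw_nat_finite by blast
  then have p: "p ` {..<card P} = P" by (simp add: bij_betw_def atLeast0LessThan)
  define m where "m = card P"
  have pP: "p i \<in> S \<times> S" if "i < m" for i using p that \<open>P \<subseteq> S \<times> S\<close> unfolding m_def by blast
  define X where "X k = finite_seq m (%i. 1 - k (fst (p i)) (snd (p i)) :: real)" for k
  define K where "K = X ` pos_kernels S E"
  have cv: "convex K"
  proof (rule convexI)
    fix x y and u v :: real assume "x \<in> K" "y \<in> K" and uv: "u >= 0" "v >= 0" "u + v = 1"
    then obtain k l where kl: "k \<in> pos_kernels S E" "l \<in> pos_kernels S E" "x = X k" "y = X l" unfolding K_def by blast
    have "u *\<^sub>R x + v *\<^sub>R y = X (%s t. u * k s t + v * l s t)"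
    proof (rule bcontfun_eqI)
      fix i
      have "u * (1 - a) + v * (1 - b) = 1 - (u * a + v * b)" for a b using uv(3) by (simp add: algebra_simps flip: distrib_left)
      then show "(u *\<^sub>R x + v *\<^sub>R y) i = X (%s t. u * k s t + v * l s t) i"
        by (simp add: kl X_def finite_seq_apply)
    qed
    moreover have "(%s t. u * k s t + v * l s t) \<in> pos_kernels S E"
      using pos_kernels_add[OF pos_kernels_scale[OF kl(1) uv(1)] pos_kernels_scale[OF kl(2) uv(2)]] .
    ultimately show "u *\<^sub>R x + v *\<^sub>R y \<in> K" unfolding K_def by simp
  qed
  have ne: "K ~= {}" unfolding K_def using pos_kernels_0 by blast
  have far: "\<delta> <= norm x" if "x \<in> K" for x
  proof -
    obtain k where k: "k \<in> pos_kernels S E" "x = X k" using \<open>x \<in> K\<close> unfolding K_def by (elim imageE) auto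
    obtain s t where st: "(s, t) \<in> P" "\<bar>k s t - 1\<bar> > \<delta>" using no[OF k(1)] unfolding P_def by blast
    then obtain i where i: "i < m" "p i = (s, t)" using p unfolding m_def by (metis imageE lessThan_iff)
    have "\<bar>1 - k (fst (p i)) (snd (p i))\<bar> <= norm x"
      using norm_finite_seq_ge[OF i(1), of "%i. 1 - k (fst (p i)) (snd (p i))"] by (simp add: k X_def)
    then show ?thesis using st(2) i(2) by simp
  qed
  obtain \<Lambda> :: "(nat \<Rightarrow>\<^sub>C real) => real" where \<Lambda>: "linear \<Lambda>" "!!x. \<bar>\<Lambda> x\<bar> <= norm x" "!!x. x \<in> K ==> \<delta> <= \<Lambda> x"
  proof (rule hahn_banach_separation[OF cv ne far])
    fix \<Lambda> :: "(nat \<Rightarrow>\<^sub>C real) => real" assume "linear \<Lambda>" "!!x. \<bar>\<Lambda> x\<bar> <= norm x" "!!x. x \<in> K ==> \<delta> <= \<Lambda> x"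
    then show thesis by (rule that)
  qed
  define c where "c i = \<Lambda> (single_seq i 1)" for i
  have \<Lambda>s: "\<Lambda> (finite_seq m f) = (\<Sum>i<m. f i * c i)" for f
  proof -
    have "single_seq i r = r *\<^sub>R single_seq i 1" for i and r :: real
      by (rule bcontfun_eqI) (simp add: single_seq_apply)
    then have "\<Lambda> (single_seq i r) = r * c i" for i r unfolding c_def by (metis linear_scale[OF \<Lambda>(1)] real_scaleR_def)
    then show ?thesis by (simp add: linear_finite_seq[OF \<Lambda>(1)])
  qed
  have c1: "(\<Sum>i<m. \<bar>c i\<bar>) <= 1"
  proof -
    have "norm (finite_seq m (%i. sgn (c i))) <= 1" by (rule norm_finite_seq_le) (auto simp: sgn_if)
    moreover have "(\<Sum>i<m. \<bar>c i\<bar>) = \<Lambda> (finite_seq m (%i. sgn (c i)))" unfolding \<Lambda>s by (simp add: abs_sgn mult.commute)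
    ultimately show ?thesis using \<Lambda>(2)[of "finite_seq m (%i. sgn (c i))"] by linarith
  qed
  define \<tau> where "\<tau> k = (\<Sum>i<m. c i * k (fst (p i)) (snd (p i)))" for k
  have main: "\<delta> <= (\<Sum>i<m. c i) - \<tau> k" if "k \<in> pos_kernels S E" for k
    using \<Lambda>(3)[of "X k"] that unfolding K_def X_def \<Lambda>s \<tau>_def by (simp add: left_diff_distrib right_diff_distrib sum_subtractf mult.commute)
  have \<sigma>: "\<delta> <= (\<Sum>i<m. c i)" using main[OF pos_kernels_0] by (simp add: \<tau>_def)
  have \<tau>: "\<tau> k <= 0" if k: "k \<in> pos_kernels S E" for k
  proof (rule ccontr)
    assume "\<not> \<tau> k <= 0"
    then have pos: "\<tau> k > 0" by simp
    \<comment> \<open>Scaling k by r makes the right side of \<open>main\<close> vanish, against the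
      lower bound \<delta>.\<close>
    define r where "r = (\<Sum>i<m. c i) / \<tau> k"
    have r: "r >= 0" "r * \<tau> k = (\<Sum>i<m. c i)" using pos \<sigma> \<delta> by (simp_all add: r_def)
    have "\<tau> (%s t. r * k s t) = r * \<tau> k" by (simp add: \<tau>_def sum_distrib_left mult.left_commute)
    then show False using main[OF pos_kernels_scale[OF k r(1)]] r(2) \<delta> by simp
  qed
  define b where "b s t = (\<Sum>i<m. if p i = (s, t) then c i else 0)" for s t
  have b_sum: "(\<Sum>s\<in>S. \<Sum>t\<in>S. (\<Sum>i<m. if p i = (s, t) then d i else 0) * k s t) = (\<Sum>i<m. d i * k (fst (p i)) (snd (p i)))"
    for d and k :: "'g => 'g => real"
  proof -
    have "(\<Sum>s\<in>S. \<Sum>t\<in>S. (\<Sum>i<m. if p i = (s, t) then d i else 0) * k s t)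
        = (\<Sum>x\<in>S \<times> S. \<Sum>i<m. if p i = x then d i * k (fst x) (snd x) else 0)"
      by (subst sum.cartesian_product) (intro sum.cong refl, auto simp: sum_distrib_right intro!: sum.cong)
    also have "... = (\<Sum>i<m. \<Sum>x\<in>S \<times> S. if p i = x then d i * k (fst x) (snd x) else 0)" by (rule sum.swap)
    also have "... = (\<Sum>i<m. d i * k (fst (p i)) (snd (p i)))"
      using pP S by (intro sum.cong refl) (simp add: sum.delta')
    finally show ?thesis .
  qed
  have bk: "(\<Sum>s\<in>S. \<Sum>t\<in>S. b s t * k s t) = \<tau> k" for k unfolding b_def \<tau>_def by (rule b_sum)
  have bs: "(\<Sum>s\<in>S. \<Sum>t\<in>S. b s t) = (\<Sum>i<m. c i)" using bk[of "%_ _. 1"] by (simp add: \<tau>_def)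
  have ba: "(\<Sum>s\<in>S. \<Sum>t\<in>S. \<bar>b s t\<bar>) <= 1"
  proof -
    have "(\<Sum>s\<in>S. \<Sum>t\<in>S. \<bar>b s t\<bar>) <= (\<Sum>s\<in>S. \<Sum>t\<in>S. (\<Sum>i<m. if p i = (s, t) then \<bar>c i\<bar> else 0) * 1)"
      unfolding b_def by (intro sum_mono) (auto intro!: order_trans[OF sum_abs] sum_mono)
    also have "... = (\<Sum>i<m. \<bar>c i\<bar> * 1)" by (rule b_sum)
    finally show ?thesis using c1 by simp
  qed
  have b0: "s \<in> S & t \<in> S & - s + t \<in> F" if "b s t ~= 0" for s t
  proof -
    have "\<exists>i<m. p i = (s, t)"
    proof (rule ccontr)
      assume "\<not> ?thesis"
      then have "b s t = 0" unfolding b_def by (intro sum.neutral) auto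
      then show False using that by simp
    qed
    then have "(s, t) \<in> P" using p unfolding m_def by (metis imageI lessThan_iff)
    then show ?thesis by (simp add: P_def)
  qed
  have Fs: "- t + s \<in> F" if "- s + t \<in> F" for s t
    using F[OF that] by (simp add: minus_add)
  show ?thesis
  proof (rule that[of "%s t. - (b s t + b t s) / 2"])
    show "s \<in> S & t \<in> S & - s + t \<in> F" if "- (b s t + b t s) / 2 ~= 0" for s t
      using that b0[of s t] b0[of t s] Fs[of t s] by fastforce
    show "- (b s t + b t s) / 2 = - (b t s + b s t) / 2" for s t by simp
    have sw: "(\<Sum>s\<in>S. \<Sum>t\<in>S. f t s) = (\<Sum>s\<in>S. \<Sum>t\<in>S. f s t)" for f :: "'g => 'g => real" by (rule sum.swap)
    have "(\<Sum>s\<in>S. \<Sum>t\<in>S. \<bar>- (b s t + b t s) / 2\<bar>) <= (\<Sum>s\<in>S. \<Sum>t\<in>S. (\<bar>b s t\<bar> + \<bar>b t s\<bar>) / 2)"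
      by (intro sum_mono) simp
    also have "... = ((\<Sum>s\<in>S. \<Sum>t\<in>S. \<bar>b s t\<bar>) + (\<Sum>s\<in>S. \<Sum>t\<in>S. \<bar>b t s\<bar>)) / 2"
      by (simp add: sum.distrib flip: sum_divide_distrib)
    also have "... <= 1" using ba sw[of "%s t. \<bar>b s t\<bar>"] by simp
    finally show "(\<Sum>s\<in>S. \<Sum>t\<in>S. \<bar>- (b s t + b t s) / 2\<bar>) <= 1" .
    show "(\<Sum>s\<in>S. \<Sum>t\<in>S. - (b s t + b t s) / 2 * k s t) >= 0" if k: "k \<in> pos_kernels S E" for k
    proof -
      have "(\<Sum>s\<in>S. \<Sum>t\<in>S. - (b s t + b t s) / 2 * k s t) = (\<Sum>s\<in>S. \<Sum>t\<in>S. - (b s t * k s t + b t s * k t s) / 2)"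
        using pos_kernels_sym[OF k] by (intro sum.cong refl) (simp add: algebra_simps)
      also have "... = - ((\<Sum>s\<in>S. \<Sum>t\<in>S. b s t * k s t) + (\<Sum>s\<in>S. \<Sum>t\<in>S. b t s * k t s)) / 2"
        by (simp add: sum.distrib sum_negf sum_subtractf flip: sum_divide_distrib)
      finally show ?thesis using sw[of "%s t. b s t * k s t"] \<tau>[OF k] by (simp add: bk)
    qed
    have "(\<Sum>s\<in>S. \<Sum>t\<in>S. - (b s t + b t s) / 2) = - ((\<Sum>s\<in>S. \<Sum>t\<in>S. b s t) + (\<Sum>s\<in>S. \<Sum>t\<in>S. b t s)) / 2"
      by (simp add: sum.distrib sum_negf sum_subtractf flip: sum_divide_distrib)
    then show "(\<Sum>s\<in>S. \<Sum>t\<in>S. - (b s t + b t s) / 2) <= - \<delta>"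
      using sw[of b] \<sigma> by (simp add: bs)
  qed
qed

section \<open>Weighted partial permutations of coordinates\<close>

definition weighted_comp :: "('a => real) => ('a => 'b) => 'b ell2 \<Rightarrow>\<^sub>L 'a ell2" where
  "weighted_comp c \<phi> = Blinfun (%x. Abs_ell2 (%i. of_real (c i) * ell2_apply x (\<phi> i)))"

lemma weighted_comp:
  assumes c: "!!i. \<bar>c i\<bar> <= 1" and inj: "inj_on \<phi> {i. c i ~= 0}"
  shows weighted_comp_apply: "ell2_apply (weighted_comp c \<phi> x) i = of_real (c i) * ell2_apply x (\<phi> i)"
    and norm_weighted_comp: "norm (weighted_comp c \<phi>) <= 1"
    and weighted_comp_clinear: "clinear (weighted_comp c \<phi>)"
proof -
  define w where "w x = Abs_ell2 (%i. of_real (c i) * ell2_apply x (\<phi> i))" for x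
  have f: "ell2_apply (w x) = (%i. of_real (c i) * ell2_apply x (\<phi> i)) & norm (w x) <= norm x" for x
    unfolding w_def
  proof (rule ell2_exI)
    fix A :: "'a set" assume A: "finite A"
    let ?A = "{i \<in> A. c i ~= 0}"
    have sq: "(c i)\<^sup>2 <= 1" for i using c[of i] by (simp add: abs_square_le_1)
    have "(\<Sum>i\<in>A. (cmod (of_real (c i) * ell2_apply x (\<phi> i)))\<^sup>2) = (\<Sum>i\<in>?A. (cmod (of_real (c i) * ell2_apply x (\<phi> i)))\<^sup>2)"
      using A by (intro sum.mono_neutral_right) auto
    also have "... <= (\<Sum>i\<in>?A. (cmod (ell2_apply x (\<phi> i)))\<^sup>2)"
      by (intro sum_mono) (simp add: norm_mult power_mult_distrib mult_left_le_one_le sq)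
    also have "... = (\<Sum>j\<in>\<phi> ` ?A. (cmod (ell2_apply x j))\<^sup>2)"
      by (rule sum.reindex_cong[symmetric, where l = \<phi>]) (auto intro: inj_on_subset[OF inj])
    also have "... <= (norm x)\<^sup>2" using A by (intro ell2_finite_sum_le) simp
    finally show "(\<Sum>i\<in>A. (cmod (of_real (c i) * ell2_apply x (\<phi> i)))\<^sup>2) <= (norm x)\<^sup>2" .
  qed simp
  have bl: "bounded_linear w"
  proof (rule bounded_linear_intro[of _ 1])
    show "w (x + y) = w x + w y" "w (r *\<^sub>R x) = r *\<^sub>R w x" for x y r
      by (rule ell2_eqI; simp add: f ell2_coord algebra_simps)+
    show "norm (w x) <= norm x * 1" for x using f[of x] by simp
  qed
  have wc: "weighted_comp c \<phi> x = w x" for x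
    unfolding weighted_comp_def w_def[symmetric] by (simp add: bounded_linear_Blinfun_apply[OF bl])
  show ap: "ell2_apply (weighted_comp c \<phi> x) i = of_real (c i) * ell2_apply x (\<phi> i)" for x i
    by (simp add: wc f)
  show "norm (weighted_comp c \<phi>) <= 1"
    using f by (intro norm_blinfun_bound) (simp_all add: wc)
  show "clinear (weighted_comp c \<phi>)"
    unfolding clinear_def by (auto intro!: ell2_eqI simp: ap ell2_coord)
qed

text \<open>A weighted substitution between the index sets of p and q, transported along J and J' to
  the ambient index types and extended by 0 off the range of J. The concrete operators on the large
  Hilbert space below are all of this form.\<close>

definition lift_op :: "('p => 'a) => ('p => real) => ('p => 'q) => ('q => 'b) => 'b ell2 \<Rightarrow>\<^sub>L 'a ell2" where
  "lift_op J c \<phi> J' = weighted_comp (%k. if k \<in> range J then c (inv J k) else 0) (%k. J' (\<phi> (inv J k)))"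

lemma lift_op:
  assumes J: "inj J" and J': "inj J'" and c: "!!p. \<bar>c p\<bar> <= 1" and \<phi>: "inj_on \<phi> {p. c p ~= 0}"
  shows lift_op_apply: "ell2_apply (lift_op J c \<phi> J' x) (J p) = of_real (c p) * ell2_apply x (J' (\<phi> p))"
    and lift_op_outside: "k \<notin> range J ==> ell2_apply (lift_op J c \<phi> J' x) k = 0"
    and norm_lift_op: "norm (lift_op J c \<phi> J') <= 1"
    and lift_op_clinear: "clinear (lift_op J c \<phi> J')"
proof -
  let ?c = "%k. if k \<in> range J then c (inv J k) else 0" and ?\<phi> = "%k. J' (\<phi> (inv J k))"
  have 1: "\<bar>?c k\<bar> <= 1" for k using c by simp
  have 2: "inj_on ?\<phi> {k. ?c k ~= 0}"
  proof (rule inj_onI)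
    fix k l assume "k \<in> {k. ?c k ~= 0}" "l \<in> {k. ?c k ~= 0}" and eq: "?\<phi> k = ?\<phi> l"
    then obtain p q where pq: "k = J p" "l = J q" "c p ~= 0" "c q ~= 0" using J by (auto split: if_splits)
    then have "\<phi> p = \<phi> q" using eq J J' by (simp add: inj_eq)
    then show "k = l" using inj_onD[OF \<phi>, of p q] pq by simp
  qed
  show "ell2_apply (lift_op J c \<phi> J' x) (J p) = of_real (c p) * ell2_apply x (J' (\<phi> p))"
    "k \<notin> range J ==> ell2_apply (lift_op J c \<phi> J' x) k = 0"
    "norm (lift_op J c \<phi> J') <= 1" "clinear (lift_op J c \<phi> J')"
    unfolding lift_op_def using J
    by (simp_all add: weighted_comp_apply[OF 1 2] norm_weighted_comp[OF 1 2] weighted_comp_clinear[OF 1 2])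
qed

lemma lift_op_adjoint:
  fixes J J' :: "_ => 'k"
  assumes J: "inj J" and J': "inj J'" and c: "!!p. \<bar>c p\<bar> <= 1" "!!q. \<bar>d q\<bar> <= 1"
    and inj: "inj_on \<phi> {p. c p ~= 0}" "inj_on \<psi> {q. d q ~= 0}"
    and eq: "!!p q. (if \<phi> p = q then c p else 0) = (if \<psi> q = p then d q else 0)"
  shows "is_adjoint (lift_op J' d \<psi> J) (lift_op J c \<phi> J')"
proof (rule is_adjoint_ketI)
  note l1 = lift_op[OF J J' c(1) inj(1)] and l2 = lift_op[OF J' J c(2) inj(2)]
  show "clinear (lift_op J' d \<psi> J)" "clinear (lift_op J c \<phi> J')" by (rule l1 l2)+
  fix i k
  have "cnj (ell2_apply (lift_op J c \<phi> J' (ket i)) k) = ell2_apply (lift_op J' d \<psi> J (ket k)) i"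
  proof (cases "k \<in> range J & i \<in> range J'")
    case True
    then obtain p q where k: "k = J p" and i: "i = J' q" by blast
    show ?thesis unfolding k i l1(1) l2(1) ket.rep_eq using eq[of p q] J J' by (auto simp: inj_eq)
  next
    case False
    have "ell2_apply (lift_op J c \<phi> J' (ket i)) k = 0"
    proof (cases "k \<in> range J")
      case k: True
      then show ?thesis using False by (auto simp: l1(1) ket.rep_eq)
    qed (simp add: l1(2))
    moreover have "ell2_apply (lift_op J' d \<psi> J (ket k)) i = 0"
    proof (cases "i \<in> range J'")
      case i: True
      then show ?thesis using False by (auto simp: l2(1) ket.rep_eq)
    qed (simp add: l2(2))
    ultimately show ?thesis by simp
  qed
  then show "cinner (lift_op J c \<phi> J' (ket i)) (ket k) = cinner (ket i) (lift_op J' d \<psi> J (ket k))"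
    by (simp add: cinner_ket_left cinner_ket_right)
qed

section \<open>Coding of the index sets and coordinate projections\<close>

definition seq_index :: "nat \<times> 'g::countable => 'u + nat set" where
  "seq_index p = Inr {to_nat p}"

text \<open>The group element is prepended to the sequence, and the result is coded by its graph, a
  set of natural numbers. Sequences in G can be uncountable in number, so natural numbers alone
  cannot index them.\<close>

definition fam_index :: "(nat => 'g::countable) \<times> 'g => 'u + nat set" where
  "fam_index p = Inr (range (%i. to_nat (i, case_nat (snd p) (fst p) i)))"

lemma inj_seq_index: "inj seq_index"
  by (auto simp: inj_def seq_index_def)

lemma inj_fam_index: "inj (fam_index :: (nat => 'g::countable) \<times> 'g => 'u + nat set)"
proof (rule injI)
  fix p q :: "(nat => 'g) \<times> 'g" assume "(fam_index p :: 'u + nat set) = fam_index q"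
  then have eq: "range (%i. to_nat (i, case_nat (snd p) (fst p) i)) = range (%i. to_nat (i, case_nat (snd q) (fst q) i))"
    by (simp add: fam_index_def)
  have "case_nat (snd p) (fst p) i = case_nat (snd q) (fst q) i" for i
  proof -
    have "to_nat (i, case_nat (snd p) (fst p) i) \<in> range (%i. to_nat (i, case_nat (snd q) (fst q) i))"
      using eq by blast
    then show ?thesis by auto
  qed
  from this[of 0] this[of "Suc _"] show "p = q" by (auto intro!: prod_eqI)
qed

definition coord_proj :: "'a set => 'a op" where
  "coord_proj A = lift_op id (indicator A) id id"

lemma coord_proj_apply: "ell2_apply (coord_proj A x) k = indicator A k * ell2_apply x k"
  and norm_coord_proj: "norm (coord_proj A) <= 1"
  and coord_proj_clinear: "clinear (coord_proj A)"
proof -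
  have i: "!!k. \<bar>indicator A k :: real\<bar> <= 1" by (simp add: indicator_def)
  note l = lift_op[where J = id and J' = id and \<phi> = id and c = "indicator A", OF inj_on_id inj_on_id i inj_on_id]
  show "ell2_apply (coord_proj A x) k = indicator A k * ell2_apply x k"
    using l(1)[of x k] by (simp add: coord_proj_def indicator_def)
  show "norm (coord_proj A) <= 1" "clinear (coord_proj A)" unfolding coord_proj_def by (rule l)+
qed

lemma coord_proj_adjoint: "is_adjoint (coord_proj A) (coord_proj A)"
  by (rule is_adjoint_ketI) (simp_all add: coord_proj_clinear cinner_ket_left cinner_ket_right coord_proj_apply ket.rep_eq indicator_def)

lemma coord_proj_compose: "coord_proj A o\<^sub>L coord_proj B = coord_proj (A \<inter> B)"
  by (rule blinfun_eqI, rule ell2_eqI) (simp add: coord_proj_apply indicator_def)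

lemma norm_coord_proj_apply: "norm (coord_proj A x) <= norm x"
  using norm_blinfun[of "coord_proj A" x] norm_coord_proj[of A] by (meson mult_left_le_one_le norm_ge_zero order_trans)

lemma inner_coord_proj: "inner (coord_proj A x) (coord_proj A y) = inner (coord_proj A x) y"
proof -
  have "inner (coord_proj A x) (coord_proj A y) = inner x ((coord_proj A o\<^sub>L coord_proj A) y)"
    using is_adjoint_inner[OF coord_proj_adjoint] by simp
  then show ?thesis using is_adjoint_inner[OF coord_proj_adjoint, of A x y] by (simp add: coord_proj_compose)
qed

lemma sum_norm_coord_proj:
  assumes "finite I" "disjoint_family_on A I"
  shows "(\<Sum>i\<in>I. (norm (coord_proj (A i) x))\<^sup>2) = (norm (coord_proj (\<Union>i\<in>I. A i) x))\<^sup>2"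
  using assms
proof (induction I rule: finite_induct)
  case empty
  have "coord_proj {} x = 0" by (rule ell2_eqI) (simp add: coord_proj_apply ell2_coord)
  then show ?case by simp
next
  case (insert j I)
  let ?B = "\<Union>i\<in>I. A i"
  have disj: "A j \<inter> ?B = {}" using insert.prems insert.hyps(2) by (auto simp: disjoint_family_on_def)
  have eq: "coord_proj (\<Union>i\<in>insert j I. A i) x = coord_proj (A j) x + coord_proj ?B x"
    by (rule ell2_eqI) (use disj in \<open>auto simp: coord_proj_apply ell2_coord indicator_def\<close>)
  have "inner (coord_proj (A j) x) (coord_proj ?B x) = inner x ((coord_proj (A j) o\<^sub>L coord_proj ?B) x)"
    using is_adjoint_inner[OF coord_proj_adjoint] by simp
  also have "... = inner x (coord_proj {} x)" by (simp add: coord_proj_compose disj)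
  also have "coord_proj {} x = 0" by (rule ell2_eqI) (simp add: coord_proj_apply ell2_coord)
  finally have "(norm (coord_proj (A j) x + coord_proj ?B x))\<^sup>2 = (norm (coord_proj (A j) x))\<^sup>2 + (norm (coord_proj ?B x))\<^sup>2"
    by (simp add: power2_norm_eq_inner inner_add_left inner_add_right inner_commute)
  moreover have "disjoint_family_on A I" using insert.prems by (rule disjoint_family_on_mono[rotated]) auto
  ultimately show ?case using insert unfolding eq by simp
qed

section \<open>Limits along base points and the symbol homomorphism\<close>

definition transfer_family :: "('f => nat => 'k op) => ('f => 'k set) => bool" where
  "transfer_family U A \<longleftrightarrow> disjoint_family A &
     (\<forall>\<sigma> i. clinear (U \<sigma> i) & (EX U'. is_adjoint U' (U \<sigma> i) & U' o\<^sub>L U \<sigma> i = coord_proj (A \<sigma>)))"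

text \<open>S is what T looks like asymptotically through the partial isometries
  \<open>U \<sigma> i\<close>, in the strong topology. The support condition discards the part of S
  that no \<open>U \<sigma> i\<close> detects and thereby makes S unique.\<close>

definition limit_rel :: "('f => nat => 'k op) => ('f => 'k set) => 'k op => 'k op => bool" where
  "limit_rel U A T S \<longleftrightarrow> clinear T & clinear S & coord_proj (\<Union>\<sigma>. A \<sigma>) o\<^sub>L S = S &
     (\<forall>\<sigma> w. ((%i. T (U \<sigma> i w) - U \<sigma> i (S w)) ---> 0) free_uf)"

lemma transfer_clinear: "transfer_family U A ==> clinear (U \<sigma> i)"
  by (simp add: transfer_family_def)

lemma transfer_inner:
  assumes "transfer_family U A"
  shows "inner (U \<sigma> i v) (U \<sigma> i w) = inner v (coord_proj (A \<sigma>) w)"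
proof -
  obtain U' where U': "is_adjoint U' (U \<sigma> i)" "U' o\<^sub>L U \<sigma> i = coord_proj (A \<sigma>)"
    using assms by (meson transfer_family_def)
  have "inner (U \<sigma> i v) (U \<sigma> i w) = inner v ((U' o\<^sub>L U \<sigma> i) w)" using is_adjoint_inner[OF U'(1)] by simp
  then show ?thesis by (simp add: U'(2))
qed

lemma transfer_norm:
  assumes "transfer_family U A"
  shows "norm (U \<sigma> i w) = norm (coord_proj (A \<sigma>) w)"
proof -
  have "inner (U \<sigma> i w) (U \<sigma> i w) = inner (coord_proj (A \<sigma>) w) (coord_proj (A \<sigma>) w)"
    unfolding transfer_inner[OF assms] inner_coord_proj using is_adjoint_inner[OF coord_proj_adjoint] by metis
  then show ?thesis by (simp add: norm_eq_sqrt_inner)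
qed

lemma transfer_norm_le: "transfer_family U A ==> norm (U \<sigma> i w) <= norm w"
  by (simp add: transfer_norm norm_coord_proj_apply)

text \<open>In the limit, the component of S w in block \<sigma> is bounded by \<open>norm T\<close>
  times the component of w in the same block; orthogonality of the blocks adds these bounds
  up.\<close>

lemma limit_rel_norm:
  assumes U: "transfer_family U A" and rel: "limit_rel U A T S"
  shows "norm S <= norm T"
proof (rule norm_blinfun_bound)
  fix w
  have blk: "norm (coord_proj (A \<sigma>) (S w)) <= norm T * norm (coord_proj (A \<sigma>) w)" for \<sigma>
  proof (rule tendsto_lowerbound)
    have "((%i. T (U \<sigma> i w) - U \<sigma> i (S w)) ---> 0) free_uf" using rel by (simp add: limit_rel_def)
    from tendsto_add[OF tendsto_norm_zero[OF this] tendsto_const[of "norm T * norm (coord_proj (A \<sigma>) w)"]]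
    show "((%i. norm (T (U \<sigma> i w) - U \<sigma> i (S w)) + norm T * norm (coord_proj (A \<sigma>) w)) ---> norm T * norm (coord_proj (A \<sigma>) w)) free_uf"
      by simp
    show "\<forall>\<^sub>F i in free_uf. norm (coord_proj (A \<sigma>) (S w)) <= norm (T (U \<sigma> i w) - U \<sigma> i (S w)) + norm T * norm (coord_proj (A \<sigma>) w)"
    proof (intro always_eventually allI)
      fix i
      have "norm (U \<sigma> i (S w)) <= norm (T (U \<sigma> i w) - U \<sigma> i (S w)) + norm (T (U \<sigma> i w))"
        using norm_triangle_sub[of "U \<sigma> i (S w)" "T (U \<sigma> i w)"] by (simp add: norm_minus_commute)
      moreover have "norm (T (U \<sigma> i w)) <= norm T * norm (U \<sigma> i w)" by (rule norm_blinfun)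
      ultimately show "norm (coord_proj (A \<sigma>) (S w)) <= norm (T (U \<sigma> i w) - U \<sigma> i (S w)) + norm T * norm (coord_proj (A \<sigma>) w)"
        by (simp add: transfer_norm[OF U])
    qed
  qed simp
  show "norm (S w) <= norm T * norm w"
  proof (rule ell2_norm_le)
    fix F :: "'b set" assume F: "finite F"
    define \<Sigma> where "\<Sigma> = (%k. SOME \<sigma>. k \<in> A \<sigma>) ` (F \<inter> (\<Union>\<sigma>. A \<sigma>))"
    have disj: "disjoint_family_on A \<Sigma>" using U by (auto simp: transfer_family_def intro: disjoint_family_on_mono)
    have fin: "finite \<Sigma>" using F by (simp add: \<Sigma>_def)
    let ?A = "\<Union>\<sigma>\<in>\<Sigma>. A \<sigma>"
    have FA: "k \<in> ?A" if "k \<in> F" "k \<in> (\<Union>\<sigma>. A \<sigma>)" for k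
    proof -
      have "k \<in> A (SOME \<sigma>. k \<in> A \<sigma>)" by (rule someI_ex[where P = "%\<sigma>. k \<in> A \<sigma>"]) (use that(2) in simp)
      then show ?thesis using that unfolding \<Sigma>_def by blast
    qed
    have "coord_proj (\<Union>\<sigma>. A \<sigma>) (S w) = S w" using rel by (metis blinfun_apply_blinfun_compose limit_rel_def)
    then have "ell2_apply (S w) k = ell2_apply (coord_proj ?A (S w)) k" if "k \<in> F" for k
      using FA[OF that] coord_proj_apply[of "\<Union>\<sigma>. A \<sigma>" "S w" k] by (auto simp: coord_proj_apply indicator_def)
    then have "(\<Sum>k\<in>F. (cmod (ell2_apply (S w) k))\<^sup>2) = (\<Sum>k\<in>F. (cmod (ell2_apply (coord_proj ?A (S w)) k))\<^sup>2)" by simp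
    also have "... <= (norm (coord_proj ?A (S w)))\<^sup>2" by (rule ell2_finite_sum_le[OF F])
    also have "... = (\<Sum>\<sigma>\<in>\<Sigma>. (norm (coord_proj (A \<sigma>) (S w)))\<^sup>2)" by (rule sum_norm_coord_proj[OF fin disj, symmetric])
    also have "... <= (\<Sum>\<sigma>\<in>\<Sigma>. (norm T)\<^sup>2 * (norm (coord_proj (A \<sigma>) w))\<^sup>2)"
      using blk by (intro sum_mono) (metis norm_ge_zero power_mono power_mult_distrib)
    also have "... = (norm T)\<^sup>2 * (norm (coord_proj ?A w))\<^sup>2"
      by (simp add: sum_norm_coord_proj[OF fin disj, symmetric] sum_distrib_left)
    also have "... <= (norm T)\<^sup>2 * (norm w)\<^sup>2" by (intro mult_left_mono power_mono norm_coord_proj_apply) auto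
    finally show "(\<Sum>k\<in>F. (cmod (ell2_apply (S w) k))\<^sup>2) <= (norm T * norm w)\<^sup>2" by (simp add: power_mult_distrib)
  qed simp
qed simp

lemma limit_rel_D:
  assumes "limit_rel U A T S"
  shows "clinear T" "clinear S" "coord_proj (\<Union>\<sigma>. A \<sigma>) o\<^sub>L S = S"
    "((%i. T (U \<sigma> i w) - U \<sigma> i (S w)) ---> 0) free_uf"
  using assms by (simp_all add: limit_rel_def)

lemma limit_rel_0: "limit_rel U A 0 0"
  by (simp add: limit_rel_def clinear_0)

lemma limit_rel_add:
  assumes "limit_rel U A T S" "limit_rel U A T' S'"
  shows "limit_rel U A (T + T') (S + S')"
  unfolding limit_rel_def
proof (intro conjI allI)
  note r = limit_rel_D[OF assms(1)] limit_rel_D[OF assms(2)]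
  show "clinear (T + T')" "clinear (S + S')" by (simp_all add: r clinear_add)
  show "coord_proj (\<Union>\<sigma>. A \<sigma>) o\<^sub>L (S + S') = S + S'" by (simp add: op_compose_simps r)
  fix \<sigma> w
  have eq: "(T + T') (U \<sigma> i w) - U \<sigma> i ((S + S') w) = (T (U \<sigma> i w) - U \<sigma> i (S w)) + (T' (U \<sigma> i w) - U \<sigma> i (S' w))" for i
    by (simp add: blinfun.add_left blinfun.add_right)
  show "((%i. (T + T') (U \<sigma> i w) - U \<sigma> i ((S + S') w)) ---> 0) free_uf"
    unfolding eq using tendsto_add[OF r(4)[of \<sigma> w] r(8)[of \<sigma> w]] by simp
qed

lemma limit_rel_cscale:
  assumes U: "transfer_family U A" and "limit_rel U A T S"
  shows "limit_rel U A (cscale_op c T) (cscale_op c S)"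
  unfolding limit_rel_def
proof (intro conjI allI)
  note r = limit_rel_D[OF assms(2)]
  show "clinear (cscale_op c T)" "clinear (cscale_op c S)" by (simp_all add: r clinear_cscale_op)
  show "coord_proj (\<Union>\<sigma>. A \<sigma>) o\<^sub>L cscale_op c S = cscale_op c S" by (simp add: cscale_op_compose coord_proj_clinear r)
  fix \<sigma> w
  have eq: "cscale_op c T (U \<sigma> i w) - U \<sigma> i (cscale_op c S w) = cscale c (T (U \<sigma> i w) - U \<sigma> i (S w))" for i
    by (simp add: cscale_op_apply clinear_apply transfer_clinear[OF U] cscale_simps)
  show "((%i. cscale_op c T (U \<sigma> i w) - U \<sigma> i (cscale_op c S w)) ---> 0) free_uf"
    unfolding eq using bounded_linear.tendsto[OF bounded_linear_cscale r(4)[of \<sigma> w]] by (simp add: cscale_simps)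
qed

lemma limit_rel_compose:
  assumes U: "transfer_family U A" and "limit_rel U A T S" "limit_rel U A T' S'"
  shows "limit_rel U A (T o\<^sub>L T') (S o\<^sub>L S')"
  unfolding limit_rel_def
proof (intro conjI allI)
  note r = limit_rel_D[OF assms(2)] limit_rel_D[OF assms(3)]
  show "clinear (T o\<^sub>L T')" "clinear (S o\<^sub>L S')" by (simp_all add: r clinear_compose)
  show "coord_proj (\<Union>\<sigma>. A \<sigma>) o\<^sub>L (S o\<^sub>L S') = S o\<^sub>L S'" by (simp add: op_compose_assoc[symmetric] r)
  fix \<sigma> w
  have eq: "(T o\<^sub>L T') (U \<sigma> i w) - U \<sigma> i ((S o\<^sub>L S') w)
      = T (T' (U \<sigma> i w) - U \<sigma> i (S' w)) + (T (U \<sigma> i (S' w)) - U \<sigma> i (S (S' w)))" for i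
    by (simp add: blinfun.diff_right)
  show "((%i. (T o\<^sub>L T') (U \<sigma> i w) - U \<sigma> i ((S o\<^sub>L S') w)) ---> 0) free_uf"
    unfolding eq
    using tendsto_add[OF bounded_linear.tendsto[OF blinfun.bounded_linear_right r(8)[of \<sigma> w], of T] r(4)[of \<sigma> "S' w"]] by simp
qed

lemma limit_rel_diff:
  assumes U: "transfer_family U A" and "limit_rel U A T S" "limit_rel U A T' S'"
  shows "limit_rel U A (T - T') (S - S')"
proof -
  have "cscale_op (- 1) R = - R" for R :: "'b op"
    using scaleR_cscale_op[of "- 1" R] by simp
  then show ?thesis using limit_rel_add[OF assms(2) limit_rel_cscale[OF U assms(3), of "- 1"]] by simp
qed

lemma limit_rel_unique:
  assumes U: "transfer_family U A" and "limit_rel U A T S" "limit_rel U A T S'"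
  shows "S = S'"
  using limit_rel_norm[OF U limit_rel_diff[OF assms]] by simp

lemma limit_rel_closed:
  assumes U: "transfer_family U A" and rel: "!!n::nat. limit_rel U A (T n) (S n)" and lim: "T ----> T'" "S ----> S'"
  shows "limit_rel U A T' S'"
  unfolding limit_rel_def
proof (intro conjI allI)
  show "clinear T'" by (rule closed_sequentially[OF closed_clinear, of T, simplified]) (use lim limit_rel_D(1)[OF rel] in auto)
  show "clinear S'" by (rule closed_sequentially[OF closed_clinear, of S, simplified]) (use lim limit_rel_D(2)[OF rel] in auto)
  have "(%n. coord_proj (\<Union>\<sigma>. A \<sigma>) o\<^sub>L S n) ----> (coord_proj (\<Union>\<sigma>. A \<sigma>) o\<^sub>L S')"
    by (intro bounded_bilinear.tendsto[OF bounded_bilinear_blinfun_compose] tendsto_const lim)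
  then show "coord_proj (\<Union>\<sigma>. A \<sigma>) o\<^sub>L S' = S'" using lim(2) LIMSEQ_unique by (simp add: limit_rel_D(3)[OF rel]) blast
  fix \<sigma> w
  show "((%i. T' (U \<sigma> i w) - U \<sigma> i (S' w)) ---> 0) free_uf"
  proof (rule tendstoI)
    fix e :: real assume e: "e > 0"
    have "(%n. norm (T' - T n) * norm w + norm (S' - S n) * norm w) ----> norm (T' - T') * norm w + norm (S' - S') * norm w"
      by (intro tendsto_intros lim)
    then have "\<forall>\<^sub>F n in sequentially. norm (T' - T n) * norm w + norm (S' - S n) * norm w < e / 2"
      by (rule order_tendstoD(2)) (use e in simp)
    then obtain n where n: "norm (T' - T n) * norm w + norm (S' - S n) * norm w < e / 2" by (meson eventually_happens trivial_limit_sequentially)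
    have "\<forall>\<^sub>F i in free_uf. norm (T n (U \<sigma> i w) - U \<sigma> i (S n w)) < e / 2"
      using tendstoD[OF limit_rel_D(4)[OF rel[of n]], of "e / 2"] e by (simp add: dist_norm)
    then show "\<forall>\<^sub>F i in free_uf. dist (T' (U \<sigma> i w) - U \<sigma> i (S' w)) 0 < e"
    proof (rule eventually_mono)
      fix i assume i: "norm (T n (U \<sigma> i w) - U \<sigma> i (S n w)) < e / 2"
      have "norm ((T' - T n) (U \<sigma> i w)) <= norm (T' - T n) * norm w"
        by (rule order_trans[OF norm_blinfun]) (intro mult_left_mono transfer_norm_le[OF U] norm_ge_zero)
      moreover have "norm (U \<sigma> i ((S' - S n) w)) <= norm (S' - S n) * norm w"
        by (rule order_trans[OF transfer_norm_le[OF U]]) (rule norm_blinfun)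
      moreover have "norm (T' (U \<sigma> i w) - U \<sigma> i (S' w)) <= norm (T n (U \<sigma> i w) - U \<sigma> i (S n w)) + norm ((T' - T n) (U \<sigma> i w)) + norm (U \<sigma> i ((S' - S n) w))"
      proof -
        have "T' (U \<sigma> i w) - U \<sigma> i (S' w) = (T n (U \<sigma> i w) - U \<sigma> i (S n w)) + (T' - T n) (U \<sigma> i w) - U \<sigma> i ((S' - S n) w)"
          by (simp add: blinfun.diff_left blinfun.diff_right)
        moreover have "norm (a + b - c) <= norm a + norm b + norm c" for a b c :: "'b ell2"
          using norm_triangle_ineq4[of "a + b" c] norm_triangle_ineq[of a b] by linarith
        ultimately show ?thesis by simp
      qed
      ultimately show "dist (T' (U \<sigma> i w) - U \<sigma> i (S' w)) 0 < e" using n i by (simp add: dist_norm)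
    qed
  qed
qed

text \<open>Strong limits are not compatible with adjoints, so the adjoint of T is required to have
  a limit of its own, adjoint to S.\<close>

definition symbol_pair :: "('f => nat => 'k op) => ('f => 'k set) => 'k op => 'k op => bool" where
  "symbol_pair U A T S \<longleftrightarrow> limit_rel U A T S & (EX T' S'. limit_rel U A T' S' & is_adjoint T' T & is_adjoint S' S)"

definition symbol_algebra :: "('f => nat => 'k op) => ('f => 'k set) => 'k op set" where
  "symbol_algebra U A = {T. EX S. symbol_pair U A T S}"

definition symbol :: "('f => nat => 'k op) => ('f => 'k set) => 'k op => 'k op" where
  "symbol U A T = (THE S. limit_rel U A T S)"

lemma symbol_eq: "transfer_family U A ==> limit_rel U A T S ==> symbol U A T = S"
  unfolding symbol_def using limit_rel_unique by blast

lemma symbol_algebraD: "transfer_family U A ==> T \<in> symbol_algebra U A ==> symbol_pair U A T (symbol U A T)"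
  unfolding symbol_algebra_def symbol_pair_def using symbol_eq by fastforce

lemma symbol_algebra_cstar:
  assumes U: "transfer_family U A"
  shows "concrete_cstar_algebra (symbol_algebra U A)"
  unfolding concrete_cstar_algebra_def
proof (intro conjI ballI allI)
  let ?B = "symbol_algebra U A"
  show "T (cscale c x) = cscale c (T x)" if "T \<in> ?B" for T c x
    using that by (auto simp: symbol_algebra_def symbol_pair_def intro: clinear_apply limit_rel_D(1))
  show "0 \<in> ?B" unfolding symbol_algebra_def symbol_pair_def using limit_rel_0 is_adjoint_0 by blast
  have B: "T \<in> ?B \<longleftrightarrow> (EX S T' S'. limit_rel U A T S & limit_rel U A T' S' & is_adjoint T' T & is_adjoint S' S)" for T
    by (simp add: symbol_algebra_def symbol_pair_def)
  show "\<exists>S\<in>?B. is_adjoint S T" if "T \<in> ?B" for T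
    using that unfolding Bex_def B by (meson is_adjoint_sym)
  fix T assume "T \<in> ?B"
  then obtain T0 T' T0' where T: "limit_rel U A T T0" "limit_rel U A T' T0'" "is_adjoint T' T" "is_adjoint T0' T0"
    unfolding B by blast
  show "cscale_op c T \<in> ?B" for c
    unfolding B using limit_rel_cscale[OF U T(1)] limit_rel_cscale[OF U T(2)] is_adjoint_cscale[OF T(3)] is_adjoint_cscale[OF T(4)] by blast
  fix S assume "S \<in> ?B"
  then obtain S0 S' S0' where S: "limit_rel U A S S0" "limit_rel U A S' S0'" "is_adjoint S' S" "is_adjoint S0' S0"
    unfolding B by blast
  show "T + S \<in> ?B"
    unfolding B using limit_rel_add[OF T(1) S(1)] limit_rel_add[OF T(2) S(2)] is_adjoint_add[OF T(3) S(3)] is_adjoint_add[OF T(4) S(4)] by blast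
  show "T o\<^sub>L S \<in> ?B"
    unfolding B using limit_rel_compose[OF U T(1) S(1)] limit_rel_compose[OF U S(2) T(2)]
      is_adjoint_compose[OF T(3) S(3)] is_adjoint_compose[OF T(4) S(4)] by blast
next
  let ?B = "symbol_algebra U A"
  show "closed ?B"
    unfolding closed_sequential_limits
  proof (intro allI impI, elim conjE)
    fix T T0 assume T: "ALL n. T n \<in> ?B" and lim: "T ----> T0"
    define S where "S n = symbol U A (T n)" for n
    have "symbol_pair U A (T n) (S n)" for n unfolding S_def using T by (intro symbol_algebraD[OF U]) simp
    then have pair: "limit_rel U A (T n) (S n)"
      "EX p. limit_rel U A (fst p) (snd p) & is_adjoint (fst p) (T n) & is_adjoint (snd p) (S n)" for n
      unfolding symbol_pair_def by simp_all
    from choice[OF allI[OF pair(2)]] obtain p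
      where p: "ALL n. limit_rel U A (fst (p n)) (snd (p n)) & is_adjoint (fst (p n)) (T n) & is_adjoint (snd (p n)) (S n)" ..
    define T' S' where "T' n = fst (p n)" and "S' n = snd (p n)" for n
    have r: "limit_rel U A (T n) (S n)" "limit_rel U A (T' n) (S' n)" "is_adjoint (T' n) (T n)" "is_adjoint (S' n) (S n)" for n
      using p pair(1) by (simp_all add: T'_def S'_def)
    \<comment> \<open>Differences of the limits, of the adjoints and of the limits of adjoints are
      all bounded by those of T, so convergence of T carries them along.\<close>
    have conv: "convergent X" if "!!m n. norm (X m - X n) <= norm (T m - T n)" for X :: "nat => 'b op"
    proof (rule Cauchy_convergent, rule CauchyI)
      fix e :: real assume "e > 0"
      then obtain M where "\<forall>m\<ge>M. \<forall>n\<ge>M. norm (T m - T n) < e" using CauchyD[OF LIMSEQ_imp_Cauchy[OF lim]] by blast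
      then show "EX M. \<forall>m\<ge>M. \<forall>n\<ge>M. norm (X m - X n) < e" using that by (meson le_less_trans)
    qed
    have "norm (S m - S n) <= norm (T m - T n)" for m n by (rule limit_rel_norm[OF U limit_rel_diff[OF U r(1) r(1)]])
    then obtain S0 where S0: "S ----> S0" using conv convergent_def by blast
    have "norm (T' m - T' n) <= norm (T m - T n)" for m n by (rule is_adjoint_norm_le[OF is_adjoint_diff[OF r(3) r(3)]])
    then obtain T0' where T0': "T' ----> T0'" using conv convergent_def by blast
    have "norm (S' m - S' n) <= norm (T m - T n)" for m n
      using is_adjoint_norm_le[OF is_adjoint_diff[OF r(4)[of m] r(4)[of n]]] limit_rel_norm[OF U limit_rel_diff[OF U r(1)[of m] r(1)[of n]]] by linarith
    then obtain S0' where S0': "S' ----> S0'" using conv convergent_def by blast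
    show "T0 \<in> ?B"
      unfolding symbol_algebra_def symbol_pair_def
      using limit_rel_closed[OF U r(1) lim S0] limit_rel_closed[OF U r(2) T0' S0'] is_adjoint_lim[OF T0' lim r(3)] is_adjoint_lim[OF S0' S0 r(4)] by blast
  qed
qed

lemma symbol_star_hom:
  assumes U: "transfer_family U A"
  shows "star_hom (symbol_algebra U A) UNIV (symbol U A)"
  unfolding star_hom_def
proof (intro conjI ballI allI impI)
  let ?B = "symbol_algebra U A" and ?q = "symbol U A"
  have rel: "limit_rel U A T (?q T)" if "T \<in> ?B" for T using symbol_algebraD[OF U that] by (simp add: symbol_pair_def)
  show "?q (S + T) = ?q S + ?q T" if "S \<in> ?B" "T \<in> ?B" for S T by (rule symbol_eq[OF U limit_rel_add[OF rel[OF that(1)] rel[OF that(2)]]])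
  show "?q (cscale_op c T) = cscale_op c (?q T)" if "T \<in> ?B" for c T by (rule symbol_eq[OF U limit_rel_cscale[OF U rel[OF that]]])
  show "?q (S o\<^sub>L T) = ?q S o\<^sub>L ?q T" if "S \<in> ?B" "T \<in> ?B" for S T by (rule symbol_eq[OF U limit_rel_compose[OF U rel[OF that(1)] rel[OF that(2)]]])
  show "is_adjoint (?q S) (?q T)" if T: "S \<in> ?B" "T \<in> ?B" and adj: "is_adjoint S T" for S T
  proof -
    obtain T' S' where r: "limit_rel U A T' S'" "is_adjoint T' T" "is_adjoint S' (?q T)"
      using symbol_algebraD[OF U T(2)] unfolding symbol_pair_def by blast
    have "T' = S" by (rule is_adjoint_unique[OF r(2) adj])
    then show ?thesis using symbol_eq[OF U r(1)] r(3) by simp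
  qed
qed simp

lemma star_hom_image_cstar:
  assumes B: "concrete_cstar_algebra B" and q: "star_hom B UNIV q" and cl: "!!T. T \<in> B ==> clinear (q T)"
  shows "concrete_cstar_algebra (q ` B)" "star_hom B (q ` B) q"
proof -
  show "star_hom B (q ` B) q" using q by (simp add: star_hom_def)
  show "concrete_cstar_algebra (q ` B)"
    unfolding concrete_cstar_algebra_def
  proof (intro conjI ballI allI)
    show "closed (q ` B)" by (rule star_hom_image_closed[OF B q])
    show "0 \<in> q ` B" using star_hom_0[OF B q] cstar_0[OF B] by (metis imageI)
    fix T assume "T \<in> q ` B"
    then obtain T' where T: "T' \<in> B" "T = q T'" by blast
    show "T (cscale c x) = cscale c (T x)" for c x using cl[OF T(1)] by (simp add: T clinear_apply)
    show "cscale_op c T \<in> q ` B" for c using star_hom_cscale[OF q T(1)] cstar_cscale[OF B T(1)] T(2) by (metis imageI)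
    show "\<exists>S\<in>q ` B. is_adjoint S T" using cstar_adjoint[OF B T(1)] star_hom_adjoint[OF q _ T(1)] T(2) by blast
    fix S assume "S \<in> q ` B"
    then obtain S' where S: "S' \<in> B" "S = q S'" by blast
    show "T + S \<in> q ` B" using star_hom_add[OF q T(1) S(1)] cstar_add[OF B T(1) S(1)] T(2) S(2) by (metis imageI)
    show "T o\<^sub>L S \<in> q ` B" using star_hom_compose[OF q T(1) S(1)] cstar_compose[OF B T(1) S(1)] T(2) S(2) by (metis imageI)
  qed
qed

lemma limit_rel_ketI:
  assumes U: "transfer_family U A" and cl: "clinear T" "clinear S" and P: "coord_proj (\<Union>\<sigma>. A \<sigma>) o\<^sub>L S = S"
    and ket: "!!\<sigma> x. ((%i. T (U \<sigma> i (ket x)) - U \<sigma> i (S (ket x))) ---> 0) free_uf"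
  shows "limit_rel U A T S"
  unfolding limit_rel_def
proof (intro conjI allI cl P)
  fix \<sigma> w
  let ?R = "%w i. T (U \<sigma> i w) - U \<sigma> i (S w)"
  have diff: "?R (v - w) i = ?R v i - ?R w i" for v w i by (simp add: blinfun.diff_right)
  have bd: "norm (?R w i) <= (norm T + norm S) * norm w" for w i
  proof -
    have "norm (T (U \<sigma> i w)) <= norm T * norm w"
      by (rule order_trans[OF norm_blinfun]) (intro mult_left_mono transfer_norm_le[OF U] norm_ge_zero)
    moreover have "norm (U \<sigma> i (S w)) <= norm S * norm w"
      by (rule order_trans[OF transfer_norm_le[OF U]]) (rule norm_blinfun)
    ultimately show ?thesis using norm_triangle_ineq4[of "T (U \<sigma> i w)" "U \<sigma> i (S w)"] by (simp add: distrib_right)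
  qed
  show "(?R w ---> 0) free_uf"
  proof (rule ell2_dense_induct[where P = "%w. (?R w ---> 0) free_uf"])
    show "closed {w. (?R w ---> 0) free_uf}"
      unfolding closed_sequential_limits
    proof (intro allI impI, elim conjE)
      fix x l assume x: "ALL n. x n \<in> {w. (?R w ---> 0) free_uf}" and lim: "x ----> l"
      have "(?R l ---> 0) free_uf"
      proof (rule tendstoI)
        fix e :: real assume e: "e > 0"
        have "(%n. (norm T + norm S) * norm (l - x n)) ----> (norm T + norm S) * norm (l - l)"
          by (intro tendsto_intros lim)
        then have "\<forall>\<^sub>F n in sequentially. (norm T + norm S) * norm (l - x n) < e / 2"
          by (rule order_tendstoD(2)) (use e in simp)
        then obtain n where n: "(norm T + norm S) * norm (l - x n) < e / 2" by (meson eventually_happens trivial_limit_sequentially)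
        have "\<forall>\<^sub>F i in free_uf. norm (?R (x n) i) < e / 2"
          using x e by (auto dest!: spec[of _ n] tendstoD[of _ _ _ "e / 2"] simp: dist_norm)
        then show "\<forall>\<^sub>F i in free_uf. dist (?R l i) 0 < e"
        proof (rule eventually_mono)
          fix i assume "norm (?R (x n) i) < e / 2"
          moreover have "norm (?R l i) <= norm (?R (x n) i) + norm (?R (l - x n) i)"
            unfolding diff by (rule norm_triangle_sub)
          ultimately show "dist (?R l i) 0 < e" using bd[of i "l - x n"] n by (simp add: dist_norm)
        qed
      qed
      then show "l \<in> {w. (?R w ---> 0) free_uf}" by simp
    qed
    show "(?R (cscale c (ket p)) ---> 0) free_uf" for c p
    proof -
      have "?R (cscale c (ket p)) i = cscale c (?R (ket p) i)" for i
        by (simp add: clinear_apply cl transfer_clinear[OF U] cscale_simps)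
      then show ?thesis using bounded_linear.tendsto[OF bounded_linear_cscale ket[of \<sigma> p]] by (simp add: cscale_simps)
    qed
    show "(?R (x + y) ---> 0) free_uf" if "(?R x ---> 0) free_uf" "(?R y ---> 0) free_uf" for x y
      using tendsto_add[OF that] by (simp add: blinfun.add_right algebra_simps)
  qed
qed

text \<open>The unit of the quotient is the projection onto the blocks and not the identity
  operator, because limits live on the blocks only.\<close>

lemma symbol_pair_id:
  assumes U: "transfer_family U A"
  shows "symbol_pair U A id_blinfun (coord_proj (\<Union>\<sigma>. A \<sigma>))"
proof -
  let ?P = "coord_proj (\<Union>\<sigma>. A \<sigma>)"
  have "limit_rel U A id_blinfun ?P"
    unfolding limit_rel_def
  proof (intro conjI allI)
    show "clinear id_blinfun" by (simp add: clinear_def)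
    show "clinear ?P" by (rule coord_proj_clinear)
    show "?P o\<^sub>L ?P = ?P" by (simp add: coord_proj_compose)
    fix \<sigma> w
    have "norm (U \<sigma> i (w - ?P w)) = 0" for i
    proof -
      have "A \<sigma> \<inter> (\<Union>\<sigma>. A \<sigma>) = A \<sigma>" by blast
      then have "coord_proj (A \<sigma>) (?P w) = coord_proj (A \<sigma>) w"
        by (metis blinfun_apply_blinfun_compose coord_proj_compose)
      then have "coord_proj (A \<sigma>) (w - ?P w) = 0" by (simp only: blinfun.diff_right diff_self)
      then show ?thesis using transfer_norm[OF U, of \<sigma> i "w - ?P w"] by (simp only: norm_zero)
    qed
    then show "((%i. id_blinfun (U \<sigma> i w) - U \<sigma> i (?P w)) ---> 0) free_uf"
      by (simp add: blinfun.diff_right)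
  qed
  moreover have "is_adjoint (id_blinfun :: 'b op) id_blinfun" by (simp add: is_adjoint_def)
  ultimately show ?thesis unfolding symbol_pair_def using coord_proj_adjoint by blast
qed

section \<open>The concrete transfer operators and band operators\<close>

definition transfer_op :: "(nat => 'g::{group_add,countable}) => nat => ('u + nat set) op" where
  "transfer_op \<sigma> i = lift_op (%s. seq_index (i, s)) (%_. 1) (%s. - \<sigma> i + s) (%h. fam_index (\<sigma>, h))"

definition block :: "(nat => 'g::{group_add,countable}) => ('u + nat set) set" where
  "block \<sigma> = range (%h. fam_index (\<sigma>, h))"

lemma inj_indices: "inj (%s. seq_index (i, s))" "inj (%h. fam_index (\<sigma>, h))"
  by (auto intro!: injI simp: inj_eq[OF inj_seq_index] inj_eq[OF inj_fam_index])

lemma inj_shift: "inj_on (%s. g + s) B" for g :: "'g::group_add"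
  by (rule inj_onI) simp

lemma transfer_op_lift:
  fixes \<sigma> :: "nat => 'g::{group_add,countable}" and x :: "('u + nat set) ell2"
  shows transfer_op_apply: "ell2_apply (transfer_op \<sigma> i x) (seq_index (i, s)) = ell2_apply x (fam_index (\<sigma>, - \<sigma> i + s))"
    and transfer_op_outside: "k \<notin> range (%s. seq_index (i, s :: 'g)) ==> ell2_apply (transfer_op \<sigma> i x) k = 0"
    and transfer_op_clinear: "clinear (transfer_op \<sigma> i :: ('u + nat set) op)"
proof -
  note l = lift_op[OF inj_indices, where c = "%_. 1", OF _ inj_shift, simplified]
  show "ell2_apply (transfer_op \<sigma> i x) (seq_index (i, s)) = ell2_apply x (fam_index (\<sigma>, - \<sigma> i + s))"
    unfolding transfer_op_def by (rule l(1))
  show "k \<notin> range (%s. seq_index (i, s :: 'g)) ==> ell2_apply (transfer_op \<sigma> i x) k = 0"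
    unfolding transfer_op_def by (rule l(2))
  show "clinear (transfer_op \<sigma> i :: ('u + nat set) op)" unfolding transfer_op_def by (rule l(4))
qed

text \<open>The block of \<sigma> is a copy of l2(G), laid into layer i of the sequence space with
  its origin at the base point \<sigma> i.\<close>

lemma transfer_op_ket:
  fixes \<sigma> :: "nat => 'g::{group_add,countable}"
  shows "transfer_op \<sigma> i (ket (fam_index (\<sigma>, h))) = ket (seq_index (i, \<sigma> i + h))"
proof (rule ell2_eqI)
  fix k
  show "ell2_apply (transfer_op \<sigma> i (ket (fam_index (\<sigma>, h)))) k = ell2_apply (ket (seq_index (i, \<sigma> i + h))) k"
  proof (cases "k \<in> range (%s. seq_index (i, s :: 'g))")
    case True
    then obtain s :: 'g where k: "k = seq_index (i, s)" by blast
    have "- \<sigma> i + s = h \<longleftrightarrow> s = \<sigma> i + h" by (metis add.assoc add.left_neutral left_minus right_minus)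
    then show ?thesis unfolding k transfer_op_apply by (simp add: ket.rep_eq inj_eq[OF inj_seq_index] inj_eq[OF inj_fam_index])
  next
    case False
    then show ?thesis by (auto simp: transfer_op_outside ket.rep_eq)
  qed
qed

lemma transfer_op_ket_outside:
  fixes \<sigma> :: "nat => 'g::{group_add,countable}"
  assumes "x \<notin> block \<sigma>"
  shows "transfer_op \<sigma> i (ket x) = 0"
proof (rule ell2_eqI)
  fix k
  show "ell2_apply (transfer_op \<sigma> i (ket x)) k = ell2_apply 0 k"
  proof (cases "k \<in> range (%s. seq_index (i, s :: 'g))")
    case True
    then obtain s :: 'g where k: "k = seq_index (i, s)" by blast
    show ?thesis unfolding k transfer_op_apply using assms by (auto simp: ket.rep_eq zero_ell2.rep_eq block_def)
  qed (simp add: transfer_op_outside zero_ell2.rep_eq)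
qed

lemma transfer_op_family: "transfer_family transfer_op (block :: (nat => 'g::{group_add,countable}) => ('u + nat set) set)"
  unfolding transfer_family_def
proof (intro conjI allI)
  show "disjoint_family (block :: (nat => 'g) => ('u + nat set) set)"
    by (auto simp: disjoint_family_on_def block_def inj_eq[OF inj_fam_index])
  fix \<sigma> :: "nat => 'g" and i
  show "clinear (transfer_op \<sigma> i)" by (rule transfer_op_clinear)
  define U' :: "('u + nat set) op" where "U' = lift_op (%h. fam_index (\<sigma>, h)) (%_. 1) (%h. \<sigma> i + h) (%s. seq_index (i, s))"
  note l = lift_op[OF inj_indices(2,1), where c = "%_. 1", OF _ inj_shift, simplified]
  have eq: "- \<sigma> i + p = q \<longleftrightarrow> \<sigma> i + q = p" for p q by (metis add.assoc add.left_neutral left_minus right_minus)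
  have adj: "is_adjoint U' (transfer_op \<sigma> i)"
    unfolding U'_def transfer_op_def by (rule lift_op_adjoint[OF inj_indices]) (auto simp: eq intro: inj_shift)
  have comp: "U' o\<^sub>L transfer_op \<sigma> i = coord_proj (block \<sigma>)"
  proof (rule blinfun_eqI, rule ell2_eqI)
    fix x :: "('u + nat set) ell2" and k
    have "ell2_apply (U' (transfer_op \<sigma> i x)) k = indicator (block \<sigma>) k * ell2_apply x k"
    proof (cases "k \<in> block \<sigma>")
      case True
      then obtain h :: 'g where k: "k = fam_index (\<sigma>, h)" by (auto simp: block_def)
      have "- \<sigma> i + (\<sigma> i + h) = h" by (simp add: eq)
      then show ?thesis using True unfolding k U'_def l(1) transfer_op_apply by simp
    next
      case False
      then show ?thesis unfolding U'_def block_def by (simp add: l(2))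
    qed
    then show "ell2_apply ((U' o\<^sub>L transfer_op \<sigma> i) x) k = ell2_apply (coord_proj (block \<sigma>) x) k"
      by (simp add: coord_proj_apply)
  qed
  show "EX U'. is_adjoint U' (transfer_op \<sigma> i :: ('u + nat set) op) & U' o\<^sub>L transfer_op \<sigma> i = coord_proj (block \<sigma>)"
    by (intro exI[of _ U'] conjI adj comp)
qed

lemma Union_block: "(\<Union>\<sigma> :: nat => 'g::{group_add,countable}. block \<sigma>) = range (fam_index :: (nat => 'g) \<times> 'g => _)"
  by (auto simp: block_def)

text \<open>If smallness failed to be uniform, a bad base point in each bad layer would define a
  sequence \<sigma> along which the limit is not 0. This is why every sequence of base points has a
  block of its own.\<close>

lemma symbol_zero_uniform:
  fixes T :: "('u + nat set) op"
  assumes rel: "limit_rel transfer_op (block :: (nat => 'g::{group_add,countable}) => _) T 0" and e: "e > 0"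
  shows "\<forall>\<^sub>F n in free_uf. \<forall>s :: 'g. norm (T (ket (seq_index (n, s)))) < e"
proof (rule ccontr)
  let ?P = "%n. \<forall>s :: 'g. norm (T (ket (seq_index (n, s)))) < e"
  assume "\<not> eventually ?P free_uf"
  then have no: "\<forall>\<^sub>F n in free_uf. \<not> ?P n" by (rule iffD2[OF free_uf_not])
  define \<sigma> where "\<sigma> n = (SOME s :: 'g. \<not> norm (T (ket (seq_index (n, s)))) < e)" for n
  have \<sigma>: "\<not> norm (T (ket (seq_index (n, \<sigma> n)))) < e" if "\<not> ?P n" for n
    unfolding \<sigma>_def by (rule someI_ex[where P = "%s. \<not> norm (T (ket (seq_index (n, s)))) < e"]) (use that in simp)
  have "((%i. T (transfer_op \<sigma> i (ket (fam_index (\<sigma>, 0))))) ---> 0) free_uf"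
    using limit_rel_D(4)[OF rel, of \<sigma> "ket (fam_index (\<sigma>, 0))"] by simp
  then have "\<forall>\<^sub>F n in free_uf. norm (T (ket (seq_index (n, \<sigma> n)))) < e"
    using tendstoD[OF _ e] by (fastforce simp: transfer_op_ket dist_norm)
  with no have "\<forall>\<^sub>F n in free_uf. False"
    by eventually_elim (use \<sigma> in blast)
  then show False by simp
qed

text \<open>The f-th diagonals of the matrices \<open>\<beta> n\<close>, with all layers n assembled
  into one operator.\<close>

definition band_op :: "(nat => 'g => 'g => real) => 'g::{group_add,countable} => ('u + nat set) op" where
  "band_op \<beta> f = lift_op seq_index (%p. \<beta> (fst p) (snd p) (snd p + f)) (%p. (fst p, snd p + f)) seq_index"

definition band_limit :: "(nat => 'g => 'g => real) => 'g::{group_add,countable} => ('u + nat set) op" where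
  "band_limit \<beta> f = lift_op fam_index (%p. Lim free_uf (%i. \<beta> i (fst p i + snd p) (fst p i + snd p + f)))
     (%p. (fst p, snd p + f)) fam_index"

lemma inj_shift_right: "inj_on (%p. (fst p, snd p + f)) B" for f :: "'g::group_add"
  by (rule inj_onI) (auto intro: prod_eqI)

lemma band_op_lift:
  fixes \<beta> :: "nat => 'g::{group_add,countable} => 'g => real"
  assumes \<beta>: "!!n s t. \<bar>\<beta> n s t\<bar> <= 1"
  shows band_op_apply: "ell2_apply (band_op \<beta> f x) (seq_index (n, s)) = of_real (\<beta> n s (s + f)) * ell2_apply x (seq_index (n, s + f))"
    and band_op_outside: "k \<notin> range (seq_index :: nat \<times> 'g => _) ==> ell2_apply (band_op \<beta> f x) k = 0"
    and band_op_clinear: "clinear (band_op \<beta> f)"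
proof -
  note l = lift_op[OF inj_seq_index inj_seq_index, where c = "%p. \<beta> (fst p) (snd p) (snd p + f)", OF \<beta> inj_shift_right]
  show "ell2_apply (band_op \<beta> f x) (seq_index (n, s)) = of_real (\<beta> n s (s + f)) * ell2_apply x (seq_index (n, s + f))"
    unfolding band_op_def l(1) by simp
  show "k \<notin> range (seq_index :: nat \<times> 'g => _) ==> ell2_apply (band_op \<beta> f x) k = 0"
    unfolding band_op_def by (rule l(2))
  show "clinear (band_op \<beta> f)" unfolding band_op_def by (rule l(4))
qed

lemma free_uf_Lim:
  fixes X :: "nat => real"
  assumes "!!i. \<bar>X i\<bar> <= b"
  shows "(X ---> Lim free_uf X) free_uf" "\<bar>Lim free_uf X\<bar> <= b"
proof -
  have "bounded (range X)" using assms by (auto intro!: boundedI[of _ b])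
  then show *: "(X ---> Lim free_uf X) free_uf" by (rule free_uf_lim)
  show "\<bar>Lim free_uf X\<bar> <= b"
    by (rule tendsto_upperbound[OF tendsto_rabs[OF *]]) (simp_all add: assms)
qed

lemma band_limit_lift:
  fixes \<beta> :: "nat => 'g::{group_add,countable} => 'g => real"
  assumes \<beta>: "!!n s t. \<bar>\<beta> n s t\<bar> <= 1"
  shows band_limit_apply: "ell2_apply (band_limit \<beta> f x) (fam_index (\<sigma>, h)) =
      of_real (Lim free_uf (%i. \<beta> i (\<sigma> i + h) (\<sigma> i + h + f))) * ell2_apply x (fam_index (\<sigma>, h + f))"
    and band_limit_outside: "k \<notin> range (fam_index :: (nat => 'g) \<times> 'g => _) ==> ell2_apply (band_limit \<beta> f x) k = 0"
    and band_limit_clinear: "clinear (band_limit \<beta> f)"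
proof -
  note l = lift_op[OF inj_fam_index inj_fam_index, where c = "%p. Lim free_uf (%i. \<beta> i (fst p i + snd p) (fst p i + snd p + f))",
    OF free_uf_Lim(2)[OF \<beta>] inj_shift_right]
  show "ell2_apply (band_limit \<beta> f x) (fam_index (\<sigma>, h)) =
      of_real (Lim free_uf (%i. \<beta> i (\<sigma> i + h) (\<sigma> i + h + f))) * ell2_apply x (fam_index (\<sigma>, h + f))"
    unfolding band_limit_def l(1) by simp
  show "k \<notin> range (fam_index :: (nat => 'g) \<times> 'g => _) ==> ell2_apply (band_limit \<beta> f x) k = 0"
    unfolding band_limit_def by (rule l(2))
  show "clinear (band_limit \<beta> f)" unfolding band_limit_def by (rule l(4))
qed

text \<open>Seen from \<sigma> i, the f-th diagonal has at h the entry
  \<open>\<beta> i (\<sigma> i + h) (\<sigma> i + h + f)\<close>. This is bounded in i and converges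
  along the ultrafilter, and on a basis vector the whole difference is one such scalar minus its
  limit.\<close>

lemma band_limit_rel:
  fixes \<beta> :: "nat => 'g::{group_add,countable} => 'g => real"
  assumes \<beta>: "!!n s t. \<bar>\<beta> n s t\<bar> <= 1"
  shows "limit_rel transfer_op (block :: (nat => 'g) => ('u + nat set) set) (band_op \<beta> f) (band_limit \<beta> f)"
proof (rule limit_rel_ketI[OF transfer_op_family])
  show "clinear (band_op \<beta> f)" by (rule band_op_clinear[OF \<beta>])
  show "clinear (band_limit \<beta> f)" by (rule band_limit_clinear[OF \<beta>])
  show "coord_proj (\<Union>\<sigma> :: nat => 'g. block \<sigma>) o\<^sub>L band_limit \<beta> f = band_limit \<beta> f"
    unfolding Union_block
    by (rule blinfun_eqI, rule ell2_eqI) (auto simp: coord_proj_apply indicator_def band_limit_outside[OF \<beta>])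
  fix \<sigma> :: "nat => 'g" and x :: "'u + nat set"
  show "((%i. band_op \<beta> f (transfer_op \<sigma> i (ket x)) - transfer_op \<sigma> i (band_limit \<beta> f (ket x))) ---> 0) free_uf"
  proof (cases "x \<in> block \<sigma>")
    case True
    then obtain h :: 'g where x: "x = fam_index (\<sigma>, h)" by (auto simp: block_def)
    \<comment> \<open>\<open>band_op\<close> substitutes s + f for s, so it sends the basis vector
      at h to a multiple of the one at h + - f.\<close>
    define h' where "h' = h + - f"
    have hf: "h' + f = h" by (simp add: h'_def add.assoc)
    define L where "L = Lim free_uf (%i. \<beta> i (\<sigma> i + h') (\<sigma> i + h' + f))"
    have lim: "((%i. \<beta> i (\<sigma> i + h') (\<sigma> i + h' + f)) ---> L) free_uf"
      unfolding L_def by (rule free_uf_Lim(1)[OF \<beta>])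
    have tf: "t + f = h \<longleftrightarrow> t = h'" for t using hf by (metis add_right_cancel)
    have 1: "band_limit \<beta> f (ket x) = cscale (of_real L) (ket (fam_index (\<sigma>, h')))"
    proof (rule ell2_eqI)
      fix k
      show "ell2_apply (band_limit \<beta> f (ket x)) k = ell2_apply (cscale (of_real L) (ket (fam_index (\<sigma>, h')))) k"
      proof (cases "k \<in> range (fam_index :: (nat => 'g) \<times> 'g => _)")
        case True
        then obtain \<tau> and t :: 'g where k: "k = fam_index (\<tau>, t)" by auto
        show ?thesis
          unfolding k x band_limit_apply[OF \<beta>] cscale.rep_eq ket.rep_eq inj_eq[OF inj_fam_index] prod.inject tf
          by (auto simp: L_def)
      qed (auto simp: band_limit_outside[OF \<beta>] cscale.rep_eq ket.rep_eq)
    qed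
    have 2: "band_op \<beta> f (ket (seq_index (i, \<sigma> i + h))) = cscale (of_real (\<beta> i (\<sigma> i + h') (\<sigma> i + h' + f))) (ket (seq_index (i, \<sigma> i + h') :: 'u + nat set))" for i
    proof (rule ell2_eqI)
      fix k :: "'u + nat set"
      show "ell2_apply (band_op \<beta> f (ket (seq_index (i, \<sigma> i + h)))) k =
          ell2_apply (cscale (of_real (\<beta> i (\<sigma> i + h') (\<sigma> i + h' + f))) (ket (seq_index (i, \<sigma> i + h')))) k"
      proof (cases "k \<in> range (seq_index :: nat \<times> 'g => _)")
        case True
        then obtain n and t :: 'g where k: "k = seq_index (n, t)" by auto
        have tf': "t + f = \<sigma> i + h \<longleftrightarrow> t = \<sigma> i + h'" using hf by (metis add.assoc add_right_cancel)
        show ?thesis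
          unfolding k band_op_apply[OF \<beta>] cscale.rep_eq ket.rep_eq inj_eq[OF inj_seq_index] prod.inject tf'
          by auto
      qed (auto simp: band_op_outside[OF \<beta>] cscale.rep_eq ket.rep_eq)
    qed
    have 3: "band_op \<beta> f (transfer_op \<sigma> i (ket x)) - transfer_op \<sigma> i (band_limit \<beta> f (ket x))
        = (\<beta> i (\<sigma> i + h') (\<sigma> i + h' + f) - L) *\<^sub>R ket (seq_index (i, \<sigma> i + h'))" for i
      unfolding 1 unfolding x transfer_op_ket 2 clinear_apply[OF transfer_op_clinear] scaleR_cscale[symmetric]
      by (simp add: scaleR_left_diff_distrib blinfun.scaleR_right transfer_op_ket)
    have "((%i. \<bar>\<beta> i (\<sigma> i + h') (\<sigma> i + h' + f) - L\<bar>) ---> \<bar>L - L\<bar>) free_uf"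
      by (rule tendsto_rabs[OF tendsto_diff[OF lim tendsto_const]])
    then show ?thesis unfolding 3 by - (rule tendsto_norm_zero_cancel, simp)
  next
    case False
    have "transfer_op \<sigma> i (band_limit \<beta> f (ket x)) = 0" for i
    proof (rule ell2_eqI)
      fix k
      show "ell2_apply (transfer_op \<sigma> i (band_limit \<beta> f (ket x))) k = ell2_apply 0 k"
      proof (cases "k \<in> range (%s. seq_index (i, s :: 'g))")
        case True
        then obtain s :: 'g where k: "k = seq_index (i, s)" by blast
        have "ell2_apply (ket x) (fam_index (\<sigma>, - \<sigma> i + s + f)) = 0" using False by (auto simp: ket.rep_eq block_def)
        then show ?thesis unfolding k transfer_op_apply band_limit_apply[OF \<beta>] by (simp add: zero_ell2.rep_eq)
      qed (simp add: transfer_op_outside zero_ell2.rep_eq)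
    qed
    then show ?thesis by (simp add: transfer_op_ket_outside[OF False])
  qed
qed

lemma band_symbol_pair:
  fixes \<beta> :: "nat => 'g::{group_add,countable} => 'g => real"
  assumes \<beta>: "!!n s t. \<bar>\<beta> n s t\<bar> <= 1" and sym: "!!n s t. \<beta> n s t = \<beta> n t s"
  shows "symbol_pair transfer_op (block :: (nat => 'g) => ('u + nat set) set) (band_op \<beta> f) (band_limit \<beta> f)"
    "is_adjoint (band_op \<beta> (- f)) (band_op \<beta> f :: ('u + nat set) op)"
proof -
  have tf: "q + - f = p \<longleftrightarrow> p + f = q" for p q by (metis add.assoc add.right_neutral left_minus right_minus)
  show adj: "is_adjoint (band_op \<beta> (- f)) (band_op \<beta> f :: ('u + nat set) op)"
    unfolding band_op_def
    by (rule lift_op_adjoint[OF inj_seq_index inj_seq_index \<beta> \<beta> inj_shift_right inj_shift_right])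
      (auto simp: prod_eq_iff tf sym add.assoc simp del: add_uminus_conv_diff)
  have "is_adjoint (band_limit \<beta> (- f)) (band_limit \<beta> f :: ('u + nat set) op)"
    unfolding band_limit_def
  proof (rule lift_op_adjoint[OF inj_fam_index inj_fam_index free_uf_Lim(2)[OF \<beta>] free_uf_Lim(2)[OF \<beta>] inj_shift_right inj_shift_right])
    fix p q :: "(nat => 'g) \<times> 'g"
    let ?L = "%p f. Lim free_uf (%i. \<beta> i (fst p i + snd p) (fst p i + snd p + f))"
    have c: "((fst p, snd p + f) = q) = ((fst q, snd q + - f) = p)" using tf[of "snd q" "snd p"] by (auto simp: prod_eq_iff)
    show "(if (fst p, snd p + f) = q then ?L p f else 0) = (if (fst q, snd q + - f) = p then ?L q (- f) else 0)"
    proof (cases "(fst p, snd p + f) = q")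
      case True
      then have q: "fst q = fst p" "snd q = snd p + f" by auto
      have "fst q i + snd q + - f = fst p i + snd p" "fst q i + snd q = fst p i + snd p + f" for i
        by (simp_all add: q add.assoc[symmetric])
      then have "?L q (- f) = ?L p f" using sym by metis
      then show ?thesis unfolding c[symmetric] using True by simp
    next
      case False
      then show ?thesis unfolding c[symmetric] by simp
    qed
  qed
  then show "symbol_pair transfer_op (block :: (nat => 'g) => ('u + nat set) set) (band_op \<beta> f) (band_limit \<beta> f)"
    unfolding symbol_pair_def using band_limit_rel[where \<beta> = \<beta>, OF \<beta>] adj by blast
qed

section \<open>The assembled operator and the positivity of its limit\<close>

definition band_sum :: "('g::group_add => 'k op) => 'g set => ('g \<times> 'k) op" where
  "band_sum b F = (\<Sum>f\<in>F. tensor_op (left_regular f) (b f))"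

lemma blinfun_sum_apply: "(\<Sum>f\<in>F. T f) x = (\<Sum>f\<in>F. T f x)" for T :: "'c => 'a::real_normed_vector \<Rightarrow>\<^sub>L 'b::real_normed_vector"
  by (induction F rule: infinite_finite_induct) (simp_all add: blinfun.add_left)

lemma tensor_left_regular_apply:
  assumes "clinear b"
  shows "ell2_apply (tensor_op (left_regular f) b \<phi>) (g, x) = ell2_apply (b (row (- f + g) \<phi>)) x"
  by (simp add: tensor_op_eq left_regular_clinear assms op_tensor_id_apply left_regular_apply left_shift.rep_eq
      col.rep_eq id_tensor_op_apply)

text \<open>Vectors in layer n whose group coordinate is confined to E; positivity of the n-th
  matrix is available on these only.\<close>

definition seq_supported :: "nat => 'g set => ('g::{group_add,countable} \<times> ('u + nat set)) ell2 => bool" where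
  "seq_supported n E \<phi> \<longleftrightarrow> (ALL g x. ell2_apply \<phi> (g, x) ~= 0 --> g \<in> E & x \<in> range (%s :: 'g. seq_index (n, s)))"

text \<open>The substitution p = s + g absorbs the translations: the form splits over p into copies
  of the form of the matrix \<open>\<beta> n\<close>, evaluated on the values of \<phi> at group
  coordinate - s + p and position s.\<close>

lemma inner_band_sum:
  fixes \<beta> :: "nat => 'g::{group_add,countable} => 'g => real" and \<phi> :: "('g \<times> ('u + nat set)) ell2"
  assumes \<beta>: "!!n s t. \<bar>\<beta> n s t\<bar> <= 1" and supp: "!!s t. \<beta> n s t ~= 0 ==> s \<in> S & t \<in> S & - s + t \<in> F"
    and fin: "finite S" "finite F" "finite E" and \<phi>: "seq_supported n E \<phi>"
  shows "inner \<phi> (band_sum (band_op \<beta>) F \<phi>) = (\<Sum>p\<in>sum_set S E. \<Sum>s\<in>S. \<Sum>t\<in>S. \<beta> n s t *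
    Re (cnj (ell2_apply \<phi> (- s + p, seq_index (n, s))) * ell2_apply \<phi> (- t + p, seq_index (n, t))))"
proof -
  define y where "y s p = ell2_apply \<phi> (- s + p, seq_index (n, s))" for s p
  let ?T = "band_sum (band_op \<beta>) F"
  have T: "ell2_apply (?T \<phi>) (g, seq_index (n, s)) = (\<Sum>t\<in>S. of_real (\<beta> n s t) * y t (s + g))" for g s
  proof -
    have "ell2_apply (?T \<phi>) (g, seq_index (n, s)) = (\<Sum>f\<in>F. of_real (\<beta> n s (s + f)) * ell2_apply \<phi> (- f + g, seq_index (n, s + f)))"
      by (simp add: band_sum_def blinfun_sum_apply ell2_coord tensor_left_regular_apply band_op_clinear[OF \<beta>] band_op_apply[OF \<beta>] row_apply)
    also have "... = (\<Sum>f\<in>F. of_real (\<beta> n s (s + f)) * y (s + f) (s + g))"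
    proof (rule sum.cong[OF refl])
      fix f
      have "- (s + f) + (s + g) = - f + g" by (simp add: minus_add add.assoc del: add_uminus_conv_diff)
      then show "of_real (\<beta> n s (s + f)) * ell2_apply \<phi> (- f + g, seq_index (n, s + f)) = of_real (\<beta> n s (s + f)) * y (s + f) (s + g)"
        by (simp add: y_def)
    qed
    also have "... = (\<Sum>t\<in>(+) s ` F. of_real (\<beta> n s t) * y t (s + g))"
      by (subst sum.reindex[OF inj_shift]) simp
    also have "... = (\<Sum>t\<in>S. of_real (\<beta> n s t) * y t (s + g))"
    proof (rule sum.mono_neutral_cong)
      show "of_real (\<beta> n s t) * y t (s + g) = 0" if "t \<in> S - (+) s ` F" for t
      proof -
        have "- s + t \<notin> F"
        proof
          assume "- s + t \<in> F"
          then have "s + (- s + t) \<in> (+) s ` F" by (rule imageI)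
          then show False using that by (simp add: add.assoc[symmetric])
        qed
        then show ?thesis using supp[of s t] by auto
      qed
      show "of_real (\<beta> n s t) * y t (s + g) = 0" if "t \<in> (+) s ` F - S" for t using supp[of s t] that by auto
    qed (simp_all add: fin)
    finally show ?thesis .
  qed
  define A :: "('g \<times> ('u + nat set)) set" where "A = (%(g, s). (g, seq_index (n, s))) ` (E \<times> S)"
  have finA: "finite A" using fin by (simp add: A_def)
  have injA: "inj_on (%(g, s :: 'g). (g, seq_index (n, s) :: 'u + nat set)) (E \<times> S)"
    by (rule inj_onI) (auto simp: inj_eq[OF inj_seq_index])
  have "cinner \<phi> (?T \<phi>) = (\<Sum>\<^sub>\<infinity>i\<in>A. cnj (ell2_apply \<phi> i) * ell2_apply (?T \<phi>) i)"
    unfolding cinner_def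
  proof (rule infsum_cong_neutral)
    fix i assume i: "i \<in> UNIV - A"
    obtain g x where gx: "i = (g, x)" by fastforce
    show "cnj (ell2_apply \<phi> i) * ell2_apply (?T \<phi>) i = 0"
    proof (cases "ell2_apply \<phi> i = 0")
      case False
      then obtain s :: 'g where s: "g \<in> E" "x = seq_index (n, s)" using \<phi> unfolding seq_supported_def gx by blast
      then have "s \<notin> S" using i unfolding gx A_def by auto
      then have "\<beta> n s t = 0" for t using supp[of s t] by blast
      then show ?thesis unfolding gx s(2) T by simp
    qed simp
  qed simp_all
  also have "... = (\<Sum>i\<in>A. cnj (ell2_apply \<phi> i) * ell2_apply (?T \<phi>) i)" by (rule infsum_finite[OF finA])
  also have "... = (\<Sum>(g, s)\<in>E \<times> S. cnj (ell2_apply \<phi> (g, seq_index (n, s))) * (\<Sum>t\<in>S. of_real (\<beta> n s t) * y t (s + g)))"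
    unfolding A_def by (subst sum.reindex[OF injA]) (auto simp: T intro!: sum.cong)
  also have "... = (\<Sum>g\<in>E. \<Sum>s\<in>S. cnj (ell2_apply \<phi> (g, seq_index (n, s))) * (\<Sum>t\<in>S. of_real (\<beta> n s t) * y t (s + g)))"
    by (rule sum.cartesian_product[symmetric])
  also have "... = (\<Sum>s\<in>S. \<Sum>g\<in>E. cnj (ell2_apply \<phi> (g, seq_index (n, s))) * (\<Sum>t\<in>S. of_real (\<beta> n s t) * y t (s + g)))"
    by (rule sum.swap)
  also have "... = (\<Sum>s\<in>S. \<Sum>p\<in>sum_set S E. cnj (y s p) * (\<Sum>t\<in>S. of_real (\<beta> n s t) * y t p))"
  proof (rule sum.cong[OF refl])
    fix s assume s: "s \<in> S"
    have sg: "- s + (s + g) = g" for g by (simp add: add.assoc[symmetric])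
    have "(\<Sum>g\<in>E. cnj (ell2_apply \<phi> (g, seq_index (n, s))) * (\<Sum>t\<in>S. of_real (\<beta> n s t) * y t (s + g)))
        = (\<Sum>p\<in>(+) s ` E. cnj (y s p) * (\<Sum>t\<in>S. of_real (\<beta> n s t) * y t p))"
      by (subst sum.reindex[OF inj_shift]) (simp add: y_def sg)
    also have "... = (\<Sum>p\<in>sum_set S E. cnj (y s p) * (\<Sum>t\<in>S. of_real (\<beta> n s t) * y t p))"
    proof (rule sum.mono_neutral_left)
      show "finite (sum_set S E)" by (rule finite_sum_set[OF fin(1,3)])
      show "(+) s ` E \<subseteq> sum_set S E" using s by (auto simp: sum_set_def)
      show "\<forall>p\<in>sum_set S E - (+) s ` E. cnj (y s p) * (\<Sum>t\<in>S. of_real (\<beta> n s t) * y t p) = 0"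
      proof
        fix p assume p: "p \<in> sum_set S E - (+) s ` E"
        have "- s + p \<notin> E"
        proof
          assume "- s + p \<in> E"
          then have "s + (- s + p) \<in> (+) s ` E" by blast
          then show False using p by (simp add: add.assoc[symmetric])
        qed
        then have "y s p = 0" using \<phi> unfolding seq_supported_def y_def by blast
        then show "cnj (y s p) * (\<Sum>t\<in>S. of_real (\<beta> n s t) * y t p) = 0" by simp
      qed
    qed
    finally show "(\<Sum>g\<in>E. cnj (ell2_apply \<phi> (g, seq_index (n, s))) * (\<Sum>t\<in>S. of_real (\<beta> n s t) * y t (s + g)))
        = (\<Sum>p\<in>sum_set S E. cnj (y s p) * (\<Sum>t\<in>S. of_real (\<beta> n s t) * y t p))" .
  qed
  also have "... = (\<Sum>p\<in>sum_set S E. \<Sum>s\<in>S. cnj (y s p) * (\<Sum>t\<in>S. of_real (\<beta> n s t) * y t p))" by (rule sum.swap)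
  also have "... = (\<Sum>p\<in>sum_set S E. \<Sum>s\<in>S. \<Sum>t\<in>S. of_real (\<beta> n s t) * (cnj (y s p) * y t p))"
    by (simp only: sum_distrib_left mult.left_commute)
  finally have "cinner \<phi> (?T \<phi>) = (\<Sum>p\<in>sum_set S E. \<Sum>s\<in>S. \<Sum>t\<in>S. of_real (\<beta> n s t) * (cnj (y s p) * y t p))" .
  then show ?thesis by (simp add: inner_cinner y_def)
qed

text \<open>Real and imaginary parts of the values of \<phi>, divided by r, are Gram vectors of
  width E, and pairing their kernel with a gives the form of \<beta>. The division is legitimate
  because \<beta> vanishes wherever r does.\<close>

lemma inner_band_sum_nonneg:
  fixes a \<beta> :: "nat => 'g::{group_add,countable} => 'g => real" and \<phi> :: "('g \<times> ('u + nat set)) ell2"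
  assumes \<beta>: "!!n s t. \<bar>\<beta> n s t\<bar> <= 1" and supp: "!!s t. \<beta> n s t ~= 0 ==> s \<in> S & t \<in> S & - s + t \<in> F & r s ~= 0 & r t ~= 0"
    and fin: "finite S" "finite F" "finite E" and a: "!!s t. a n s t = \<beta> n s t * (r s * r t)"
    and pos: "!!k. k \<in> pos_kernels S E ==> (\<Sum>s\<in>S. \<Sum>t\<in>S. a n s t * k s t) >= 0"
    and \<phi>: "seq_supported n E \<phi>"
  shows "inner \<phi> (band_sum (band_op \<beta>) F \<phi>) >= 0"
proof -
  define y where "y s p = ell2_apply \<phi> (- s + p, seq_index (n, s))" for s p
  define \<xi> where "\<xi> j s p = (if s \<in> S then (if j = (0::nat) then Re (y s p) else Im (y s p)) / r s else 0)" for j s p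
  define k where "k s t = (\<Sum>j<2. \<Sum>p\<in>sum_set S E. \<xi> j s p * \<xi> j t p)" for s t
  have y0: "- s + p \<in> E" if "y s p ~= 0" for s p using that \<phi> unfolding seq_supported_def y_def by blast
  have "k \<in> pos_kernels S E"
    unfolding pos_kernels_def
  proof (intro CollectI exI conjI allI impI)
    show "k = (%s t. \<Sum>j<2. \<Sum>p\<in>sum_set S E. \<xi> j s p * \<xi> j t p)" by (simp add: k_def fun_eq_iff)
    show "s \<in> S" "- s + p \<in> E" if "\<xi> j s p ~= 0" for j s p
      using that y0[of s p] by (cases "y s p = 0"; simp add: \<xi>_def split: if_splits)+
  qed
  from pos[OF this] have "0 <= (\<Sum>s\<in>S. \<Sum>t\<in>S. a n s t * k s t)" .
  also have "... = (\<Sum>s\<in>S. \<Sum>t\<in>S. \<Sum>p\<in>sum_set S E. \<beta> n s t * Re (cnj (y s p) * y t p))"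
  proof (intro sum.cong refl)
    fix s t assume st: "s \<in> S" "t \<in> S"
    have "a n s t * k s t = (\<Sum>p\<in>sum_set S E. a n s t * (\<xi> 0 s p * \<xi> 0 t p + \<xi> 1 s p * \<xi> 1 t p))"
      by (simp add: k_def numeral_2_eq_2 sum.distrib sum_distrib_left distrib_left)
    also have "... = (\<Sum>p\<in>sum_set S E. \<beta> n s t * Re (cnj (y s p) * y t p))"
    proof (rule sum.cong[OF refl])
      fix p
      show "a n s t * (\<xi> 0 s p * \<xi> 0 t p + \<xi> 1 s p * \<xi> 1 t p) = \<beta> n s t * Re (cnj (y s p) * y t p)"
      proof (cases "\<beta> n s t = 0")
        case False
        then have "r s ~= 0" "r t ~= 0" using supp[of s t] by auto
        then show ?thesis using st by (simp add: a \<xi>_def field_simps)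
      qed (simp add: a)
    qed
    finally show "a n s t * k s t = (\<Sum>p\<in>sum_set S E. \<beta> n s t * Re (cnj (y s p) * y t p))" .
  qed
  also have "... = (\<Sum>s\<in>S. \<Sum>p\<in>sum_set S E. \<Sum>t\<in>S. \<beta> n s t * Re (cnj (y s p) * y t p))"
    by (intro sum.cong refl sum.swap)
  also have "... = (\<Sum>p\<in>sum_set S E. \<Sum>s\<in>S. \<Sum>t\<in>S. \<beta> n s t * Re (cnj (y s p) * y t p))"
    by (rule sum.swap)
  also have "... = inner \<phi> (band_sum (band_op \<beta>) F \<phi>)"
    unfolding y_def using supp by (intro inner_band_sum[OF \<beta> _ fin \<phi>, symmetric]) blast
  finally show ?thesis .
qed

lemma tensor_id_eq: "clinear U ==> tensor_op id_blinfun U = id_tensor_op U"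
  by (rule tensor_eqI) (simp add: tensor_op_tensor_vec id_tensor_op_tensor_vec clinear_def)

lemma id_tensor_coord_proj: "id_tensor_op (coord_proj A) = coord_proj (UNIV \<times> A)"
  by (rule blinfun_eqI, rule ell2_eqI_pair) (simp add: id_tensor_op_apply coord_proj_apply row_apply indicator_def)

lemma inner_id_tensor_transfer:
  fixes v w :: "('g \<times> 'k) ell2"
  assumes "transfer_family U A"
  shows "inner (id_tensor_op (U \<sigma> i) v) (id_tensor_op (U \<sigma> i) w) = inner (coord_proj (UNIV \<times> A \<sigma>) v) w"
proof -
  obtain U' where U': "is_adjoint U' (U \<sigma> i)" "U' o\<^sub>L U \<sigma> i = coord_proj (A \<sigma>)" and cl: "clinear (U \<sigma> i)"
    using assms by (meson transfer_family_def)
  have cl': "clinear U'" by (rule is_adjoint_clinear[OF U'(1)])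
  have cli: "clinear (id_blinfun :: 'g op)" by (simp add: clinear_def)
  have "is_adjoint (tensor_op id_blinfun U') (tensor_op id_blinfun (U \<sigma> i) :: ('g \<times> 'k) op)"
    by (rule tensor_op_adjoint[OF cli cl _ U'(1)]) (simp add: is_adjoint_def)
  then have "inner (id_tensor_op (U \<sigma> i) v) (id_tensor_op (U \<sigma> i) w) = inner v ((tensor_op id_blinfun U' o\<^sub>L tensor_op id_blinfun (U \<sigma> i)) w)"
    unfolding tensor_id_eq[OF cl, symmetric] by (simp add: is_adjoint_inner)
  also have "tensor_op id_blinfun U' o\<^sub>L tensor_op id_blinfun (U \<sigma> i) = (coord_proj (UNIV \<times> A \<sigma>) :: ('g \<times> 'k) op)"
    unfolding tensor_op_compose[OF cli cl' cli cl] U'(2) op_compose_id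
    by (simp add: tensor_id_eq coord_proj_clinear id_tensor_coord_proj)
  finally show ?thesis using is_adjoint_inner[OF coord_proj_adjoint, of "UNIV \<times> A \<sigma>" v w] by simp
qed

lemma band_sum_tensor_vec:
  "(!!f. clinear (b f)) ==> band_sum b F (tensor_vec x w) = (\<Sum>f\<in>F. tensor_vec (left_regular f x) (b f w))"
  by (simp add: band_sum_def blinfun_sum_apply tensor_op_tensor_vec left_regular_clinear)

lemma band_sum_clinear: "(!!f. clinear (b f)) ==> clinear (band_sum b F)"
  unfolding band_sum_def
  by (induction F rule: infinite_finite_induct)
    (auto simp: clinear_0 intro!: clinear_add tensor_op_clinear left_regular_clinear)

lemma id_tensor_op_clinear: "clinear T ==> clinear (id_tensor_op T :: ('i \<times> 'j) op)"
  using tensor_op_clinear[of "id_blinfun :: 'i op" T] by (simp add: tensor_id_eq) (simp add: clinear_def)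

lemma band_sum_transfer_lim:
  fixes u :: "('g::group_add \<times> 'k) ell2"
  assumes U: "transfer_family U A" and rel: "!!f. limit_rel U A (b f) (s f)"
  shows "((%i. band_sum b F (id_tensor_op (U \<sigma> i) (finite_part C u)) - id_tensor_op (U \<sigma> i) (band_sum s F (finite_part C u))) ---> 0) free_uf"
proof -
  note clU = transfer_clinear[OF U] and clb = limit_rel_D(1)[OF rel] and cls = limit_rel_D(2)[OF rel]
  define D where "D i = (band_sum b F o\<^sub>L id_tensor_op (U \<sigma> i)) - (id_tensor_op (U \<sigma> i) o\<^sub>L band_sum s F)" for i
  have clD: "clinear (D i)" for i
    unfolding D_def by (intro clinear_diff clinear_compose band_sum_clinear id_tensor_op_clinear clU clb cls)
  have ket: "((%i. D i (ket q)) ---> 0) free_uf" for q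
  proof -
    obtain g x where q: "q = (g, x)" by fastforce
    have "D i (ket q) = (\<Sum>f\<in>F. emb_op (f + g) (b f (U \<sigma> i (ket x)) - U \<sigma> i (s f (ket x))))" for i
      unfolding q tensor_vec_ket[symmetric] D_def
      by (simp add: blinfun.diff_left blinfun.diff_right id_tensor_op_tensor_vec clU band_sum_tensor_vec[OF clb] band_sum_tensor_vec[OF cls]
          blinfun.sum_right left_regular_ket emb_op_apply sum_subtractf)
    moreover have "((%i. \<Sum>f\<in>F. emb_op (f + g) (b f (U \<sigma> i (ket x)) - U \<sigma> i (s f (ket x)))) ---> 0) free_uf"
    proof (rule tendsto_null_sum)
      fix f
      show "((%i. emb_op (f + g) (b f (U \<sigma> i (ket x)) - U \<sigma> i (s f (ket x)))) ---> 0) free_uf"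
        using bounded_linear.tendsto[OF blinfun.bounded_linear_right limit_rel_D(4)[OF rel[of f], of \<sigma> "ket x"], of "emb_op (f + g)"] by simp
    qed
    ultimately show ?thesis by simp
  qed
  have "((%i. \<Sum>q\<in>C. cscale (ell2_apply u q) (D i (ket q))) ---> 0) free_uf"
  proof (rule tendsto_null_sum)
    fix q
    show "((%i. cscale (ell2_apply u q) (D i (ket q))) ---> 0) free_uf"
      using bounded_linear.tendsto[OF bounded_linear_cscale ket[of q]] by (simp add: cscale_simps)
  qed
  moreover have "band_sum b F (id_tensor_op (U \<sigma> i) (finite_part C u)) - id_tensor_op (U \<sigma> i) (band_sum s F (finite_part C u))
      = (\<Sum>q\<in>C. cscale (ell2_apply u q) (D i (ket q)))" for i
  proof -
    have "D i (finite_part C u) = (\<Sum>q\<in>C. cscale (ell2_apply u q) (D i (ket q)))"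
      unfolding finite_part_def blinfun.sum_right by (simp add: clinear_apply[OF clD])
    then show ?thesis by (simp add: D_def blinfun.diff_left)
  qed
  ultimately show ?thesis by simp
qed

text \<open>Up to an error tending to 0, the form of the limit operator on a block is the form of
  the band operator on the transferred vector.\<close>

lemma band_sum_limit_nonneg_block:
  fixes v :: "('g::group_add \<times> 'k) ell2"
  assumes U: "transfer_family U A" and rel: "!!f. limit_rel U A (b f) (s f)" and u: "u = finite_part C v"
    and pos: "\<forall>\<^sub>F i in free_uf. 0 <= inner (id_tensor_op (U \<sigma> i) u) (band_sum b F (id_tensor_op (U \<sigma> i) u))"
  shows "0 <= inner (coord_proj (UNIV \<times> A \<sigma>) u) (band_sum s F u)"
proof (rule tendsto_lowerbound[OF _ pos])
  let ?V = "%i. id_tensor_op (U \<sigma> i)"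
  let ?D = "%i. band_sum b F (?V i u) - ?V i (band_sum s F u)"
  have nV: "norm (?V i u) <= norm u" for i
  proof -
    have "norm (?V i u) <= norm (U \<sigma> i) * norm u" by (rule norm_id_tensor_op)
    also have "norm (U \<sigma> i) <= 1" by (rule norm_blinfun_bound) (simp_all add: transfer_norm_le[OF U])
    finally show ?thesis by (simp add: mult_right_mono)
  qed
  have lim: "(?D ---> 0) free_uf" unfolding u by (rule band_sum_transfer_lim[OF U rel])
  have "((%i. inner (?V i u) (?D i)) ---> 0) free_uf"
  proof (rule Lim_null_comparison)
    show "\<forall>\<^sub>F i in free_uf. norm (inner (?V i u) (?D i)) <= norm u * norm (?D i)"
    proof (intro always_eventually allI)
      fix i
      have "\<bar>inner (?V i u) (?D i)\<bar> <= norm (?V i u) * norm (?D i)" by (rule Cauchy_Schwarz_ineq2)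
      also have "... <= norm u * norm (?D i)" by (rule mult_right_mono[OF nV norm_ge_zero])
      finally show "norm (inner (?V i u) (?D i)) <= norm u * norm (?D i)" by simp
    qed
    show "((%i. norm u * norm (?D i)) ---> 0) free_uf"
      using tendsto_mult_left[OF tendsto_norm_zero[OF lim], of "norm u"] by simp
  qed
  moreover have "inner (?V i u) (band_sum b F (?V i u)) = inner (?V i u) (?D i) + inner (coord_proj (UNIV \<times> A \<sigma>) u) (band_sum s F u)" for i
    unfolding inner_id_tensor_transfer[OF U, of \<sigma> i, symmetric] by (simp add: inner_diff_right)
  ultimately show "((%i. inner (?V i u) (band_sum b F (?V i u))) ---> inner (coord_proj (UNIV \<times> A \<sigma>) u) (band_sum s F u)) free_uf"
    using tendsto_add[of "%i. inner (?V i u) (?D i)" 0 free_uf "%_. inner (coord_proj (UNIV \<times> A \<sigma>) u) (band_sum s F u)"] by simp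
qed simp

text \<open>Transfer to layer i keeps the group coordinates of a finitely supported vector, and
  these lie in \<open>E i\<close> for large i. So positivity restricted to width \<open>E i\<close>
  in layer i becomes unrestricted in the limit; summation over blocks and density give all
  v.\<close>

lemma band_limit_sum_nonneg:
  fixes \<beta> :: "nat => 'g::{group_add,countable} => 'g => real" and v :: "('g \<times> ('u + nat set)) ell2"
  assumes \<beta>: "!!n s t. \<bar>\<beta> n s t\<bar> <= 1"
    and pos: "!!n (\<phi> :: ('g \<times> ('u + nat set)) ell2). seq_supported n (E n) \<phi> ==> 0 <= inner \<phi> (band_sum (band_op \<beta>) F \<phi>)"
    and E: "!!g. \<forall>\<^sub>F n in sequentially. g \<in> E n"
  shows "0 <= inner v (band_sum (band_limit \<beta>) F v)"
proof -
  let ?R = "band_sum (band_limit \<beta>) F :: ('g \<times> ('u + nat set)) op"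
  let ?J = "range (fam_index :: (nat => 'g) \<times> 'g => 'u + nat set)"
  have R: "coord_proj (UNIV \<times> ?J) (?R w) = ?R w" for w
  proof (rule ell2_eqI_pair)
    fix g x
    have "ell2_apply (?R w) (g, x) = 0" if "x \<notin> ?J"
      using that by (simp add: band_sum_def blinfun_sum_apply ell2_coord tensor_left_regular_apply band_limit_clinear[OF \<beta>] band_limit_outside[OF \<beta>])
    then show "ell2_apply (coord_proj (UNIV \<times> ?J) (?R w)) (g, x) = ell2_apply (?R w) (g, x)"
      unfolding coord_proj_apply by (cases "x \<in> ?J") (simp_all add: indicator_def)
  qed
  have fin: "0 <= inner u (?R u)" if u: "u = finite_part C v" and C: "finite C" for u C
  proof -
    define \<Sigma> where "\<Sigma> = (%q. fst (inv (fam_index :: (nat => 'g) \<times> 'g => 'u + nat set) (snd q))) ` C"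
    have fin\<Sigma>: "finite \<Sigma>" using C by (simp add: \<Sigma>_def)
    have uC: "q \<in> C" if "ell2_apply u q ~= 0" for q using that C unfolding u by (simp add: finite_part_apply split: if_splits)
    have Pu: "coord_proj (UNIV \<times> ?J) u = (\<Sum>\<sigma>\<in>\<Sigma>. coord_proj (UNIV \<times> block \<sigma>) u)"
    proof (rule ell2_eqI_pair)
      fix g x
      show "ell2_apply (coord_proj (UNIV \<times> ?J) u) (g, x) = ell2_apply (\<Sum>\<sigma>\<in>\<Sigma>. coord_proj (UNIV \<times> block \<sigma>) u) (g, x)"
      proof (cases "ell2_apply u (g, x) ~= 0 & x \<in> ?J")
        case True
        then obtain \<sigma> and h :: 'g where x: "x = fam_index (\<sigma>, h)" by auto
        have "fst (inv fam_index x) = \<sigma>" unfolding x by (simp add: inv_f_f[OF inj_fam_index])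
        then have \<sigma>: "\<sigma> \<in> \<Sigma>" unfolding \<Sigma>_def using uC[of "(g, x)"] True by (intro image_eqI[of _ _ "(g, x)"]) auto
        have "indicator (UNIV \<times> block \<tau>) (g, x) = (if \<tau> = \<sigma> then 1 else 0 :: complex)" for \<tau> :: "nat => 'g"
          unfolding x by (auto simp: indicator_def block_def inj_eq[OF inj_fam_index])
        then have "ell2_apply (\<Sum>\<sigma>\<in>\<Sigma>. coord_proj (UNIV \<times> block \<sigma>) u) (g, x) = (\<Sum>\<tau>\<in>\<Sigma>. if \<tau> = \<sigma> then ell2_apply u (g, x) else 0)"
          by (simp add: ell2_coord coord_proj_apply if_distrib[of "%c. c * _"] cong: if_cong)
        also have "... = ell2_apply u (g, x)" using fin\<Sigma> \<sigma> by simp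
        also have "... = ell2_apply (coord_proj (UNIV \<times> ?J) u) (g, x)" using True by (simp add: coord_proj_apply indicator_def)
        finally show ?thesis by simp
      next
        case False
        then have "ell2_apply (coord_proj (UNIV \<times> block \<sigma>) u) (g, x) = 0" for \<sigma> :: "nat => 'g"
          by (auto simp: coord_proj_apply indicator_def block_def)
        then have "ell2_apply (\<Sum>\<sigma>\<in>\<Sigma>. coord_proj (UNIV \<times> block \<sigma>) u) (g, x) = 0" by (simp only: ell2_apply_sum sum.neutral_const)
        moreover have "ell2_apply (coord_proj (UNIV \<times> ?J) u) (g, x) = 0" using False by (auto simp: coord_proj_apply indicator_def)
        ultimately show ?thesis by simp
      qed
    qed
    have blk: "0 <= inner (coord_proj (UNIV \<times> block \<sigma>) u) (?R u)" for \<sigma> :: "nat => 'g"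
    proof (rule band_sum_limit_nonneg_block[OF transfer_op_family band_limit_rel[where \<beta> = \<beta>, OF \<beta>] u])
      have "\<forall>\<^sub>F n in sequentially. \<forall>g\<in>fst ` C. g \<in> E n" using C E by (intro eventually_ball_finite) auto
      then have "\<forall>\<^sub>F n in free_uf. \<forall>g\<in>fst ` C. g \<in> E n" by (rule eventually_free_uf)
      then show "\<forall>\<^sub>F i in free_uf. 0 <= inner (id_tensor_op (transfer_op \<sigma> i) u) (band_sum (band_op \<beta>) F (id_tensor_op (transfer_op \<sigma> i) u))"
      proof (rule eventually_mono)
        fix i assume i: "\<forall>g\<in>fst ` C. g \<in> E i"
        have "seq_supported i (E i) (id_tensor_op (transfer_op \<sigma> i) u)"
          unfolding seq_supported_def
        proof (intro allI impI)
          fix g x assume nz: "ell2_apply (id_tensor_op (transfer_op \<sigma> i) u) (g, x) ~= 0"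
          then have nz': "ell2_apply (transfer_op \<sigma> i (row g u)) x ~= 0" by (simp add: id_tensor_op_apply)
          have "EX y. ell2_apply u (g, y) ~= 0"
          proof (rule ccontr)
            assume "\<not> ?thesis"
            then have "row g u = 0" by (intro ell2_eqI) (simp add: row_apply zero_ell2.rep_eq)
            then show False using nz' by (simp add: zero_ell2.rep_eq)
          qed
          then have "g \<in> fst ` C" using uC by force
          moreover have "x \<in> range (%s :: 'g. seq_index (i, s))" using nz' transfer_op_outside[of x i \<sigma> "row g u"] by blast
          ultimately show "g \<in> E i & x \<in> range (%s :: 'g. seq_index (i, s))" using i by blast
        qed
        then show "0 <= inner (id_tensor_op (transfer_op \<sigma> i) u) (band_sum (band_op \<beta>) F (id_tensor_op (transfer_op \<sigma> i) u))"
          by (rule pos)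
      qed
    qed
    have "inner u (?R u) = inner u (coord_proj (UNIV \<times> ?J) (?R u))" by (simp only: R)
    also have "... = inner (coord_proj (UNIV \<times> ?J) u) (?R u)"
      by (rule is_adjoint_inner[OF coord_proj_adjoint, symmetric])
    also have "... = (\<Sum>\<sigma>\<in>\<Sigma>. inner (coord_proj (UNIV \<times> block \<sigma>) u) (?R u))" unfolding Pu by (rule inner_sum_left)
    finally show ?thesis using blk by (simp add: sum_nonneg)
  qed
  let ?K = "{w. 0 <= inner w (?R w)}"
  have "closed ?K"
    by (intro closed_Collect_le continuous_intros)
  moreover have "v \<in> closure ?K"
    unfolding closure_approachable
  proof (intro allI impI)
    fix e :: real assume "e > 0"
    then obtain A where A: "finite A" "!!B. finite B ==> A \<subseteq> B ==> norm (v - finite_part B v) < e" using finite_part_approx by blast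
    have "dist (finite_part A v) v < e" using A by (simp add: dist_norm norm_minus_commute)
    then show "\<exists>y\<in>?K. dist y v < e" using fin[OF refl A(1)] by blast
  qed
  ultimately have "v \<in> ?K" by (metis closure_closed)
  then show ?thesis by simp
qed

section \<open>Test vectors and the contradiction to exactness\<close>

lemma inner_tensor_ket: "inner (tensor_vec (ket i) u) (tensor_vec (ket k) w) = (if i = k then inner u w else 0)"
proof -
  have "inner (tensor_vec (ket i) u) (tensor_vec (ket k) w) = inner u ((row_op i o\<^sub>L emb_op k) w)"
    using inner_emb_op(1)[of i u "emb_op k w"] by (simp add: emb_op_apply)
  then show ?thesis by (simp add: row_op_emb_op)
qed

lemma norm_tensor_ket: "norm (tensor_vec (ket i) u) = norm u"
  by (simp add: norm_eq_sqrt_inner inner_tensor_ket)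

text \<open>The group coordinate - s is chosen so that only the copy p = s + - s = 0 contributes in
  \<open>inner_band_sum\<close>; the form then returns the matrix weighted by c.\<close>

definition diagonal_vec :: "('g::group_add => real) => 'g set => ('g => 'k ell2) => ('g \<times> 'k) ell2" where
  "diagonal_vec c S w = (\<Sum>s\<in>S. c s *\<^sub>R tensor_vec (ket (- s)) (w s))"

lemma norm_diagonal_vec:
  assumes "finite S"
  shows "(norm (diagonal_vec c S w))\<^sup>2 = (\<Sum>s\<in>S. (c s)\<^sup>2 * (norm (w s))\<^sup>2)"
proof -
  have "(norm (diagonal_vec c S w))\<^sup>2 = (\<Sum>s\<in>S. (norm (c s *\<^sub>R tensor_vec (ket (- s)) (w s)))\<^sup>2)"
    unfolding diagonal_vec_def
    by (rule norm_sum_Pythagorean[OF assms]) (auto simp: pairwise_def orthogonal_def inner_tensor_ket)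
  also have "... = (\<Sum>s\<in>S. (c s)\<^sup>2 * (norm (w s))\<^sup>2)"
    by (simp add: power_mult_distrib norm_tensor_ket)
  finally show ?thesis .
qed

text \<open>By \<open>symbol_zero_uniform\<close>, an element T of J is uniformly small on the basis
  vectors of layer n for almost all n; orthogonality of the first tensor factors makes 1 \<otimes> T
  equally small on the test vectors. Boundedness of the test vectors extends this from X \<otimes> T
  to the closed span.\<close>

lemma kernel_tensor_limit:
  fixes c :: "nat => 'g::{group_add,countable} => real" and A :: "'g op set" and J :: "('u + nat set) op set"
  assumes A: "!!X. X \<in> A ==> clinear X"
    and J: "!!T. T \<in> J ==> limit_rel transfer_op (block :: (nat => 'g) => _) T 0"
    and S: "!!n. finite (S n)" and c: "!!n. (\<Sum>s\<in>S n. (c n s)\<^sup>2) <= 1"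
    and \<eta>: "!!n. \<eta> n = diagonal_vec (c n) (S n) (%s. ket (seq_index (n, s) :: 'u + nat set))"
    and Z: "Z \<in> min_tensor A J"
  shows "((%n. inner (\<eta> n) (Z (\<eta> n))) ---> 0) free_uf"
proof -
  have n\<eta>: "norm (\<eta> n) <= 1" for n
  proof -
    have "(norm (\<eta> n))\<^sup>2 <= 1" unfolding \<eta> norm_diagonal_vec[OF S] using c[of n] by simp
    then show ?thesis by (simp add: abs_square_le_1)
  qed
  let ?P = "%Z. ((%n. inner (\<eta> n) (Z (\<eta> n))) ---> 0) free_uf"
  have gen: "?P (tensor_op X T)" if X: "X \<in> A" and T: "T \<in> J" for X T
  proof -
    have clT: "clinear T" by (rule limit_rel_D(1)[OF J[OF T]])
    have "((%n. id_tensor_op T (\<eta> n)) ---> 0) free_uf"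
    proof (rule tendstoI)
      fix e :: real assume e: "e > 0"
      have "\<forall>\<^sub>F n in free_uf. \<forall>s :: 'g. norm (T (ket (seq_index (n, s)))) < e / 2"
        by (rule symbol_zero_uniform[OF J[OF T]]) (use e in simp)
      then show "\<forall>\<^sub>F n in free_uf. dist (id_tensor_op T (\<eta> n)) 0 < e"
      proof (rule eventually_mono)
        fix n assume n: "\<forall>s :: 'g. norm (T (ket (seq_index (n, s)))) < e / 2"
        have "id_tensor_op T (\<eta> n) = diagonal_vec (c n) (S n) (%s. T (ket (seq_index (n, s))))"
          by (simp add: \<eta> diagonal_vec_def blinfun.sum_right blinfun.scaleR_right id_tensor_op_tensor_vec clT)
        then have "(norm (id_tensor_op T (\<eta> n)))\<^sup>2 = (\<Sum>s\<in>S n. (c n s)\<^sup>2 * (norm (T (ket (seq_index (n, s)))))\<^sup>2)"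
          by (simp add: norm_diagonal_vec S)
        also have "... <= (\<Sum>s\<in>S n. (c n s)\<^sup>2 * (e / 2)\<^sup>2)"
          using n by (intro sum_mono mult_left_mono power_mono) (auto simp: less_imp_le)
        also have "... <= 1 * (e / 2)\<^sup>2" unfolding sum_distrib_right[symmetric] by (intro mult_right_mono c) simp
        finally have "(norm (id_tensor_op T (\<eta> n)))\<^sup>2 <= (e / 2)\<^sup>2" by simp
        then have "norm (id_tensor_op T (\<eta> n)) <= e / 2" by (rule power2_le_imp_le) (use e in simp)
        then show "dist (id_tensor_op T (\<eta> n)) 0 < e" using e by simp
      qed
    qed
    from tendsto_mult_left[OF tendsto_norm_zero[OF this], of "norm X"]
    have lim: "((%n. norm X * norm (id_tensor_op T (\<eta> n))) ---> 0) free_uf" by simp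
    show ?thesis
    proof (rule Lim_null_comparison[OF always_eventually lim], rule allI)
      fix n
      have "\<bar>inner (\<eta> n) (tensor_op X T (\<eta> n))\<bar> <= norm (\<eta> n) * norm (tensor_op X T (\<eta> n))" by (rule Cauchy_Schwarz_ineq2)
      also have "... <= 1 * norm (tensor_op X T (\<eta> n))" by (rule mult_right_mono[OF n\<eta> norm_ge_zero])
      also have "norm (tensor_op X T (\<eta> n)) <= norm X * norm (id_tensor_op T (\<eta> n))"
        using norm_op_tensor_id[of X "id_tensor_op T (\<eta> n)"] by (simp add: tensor_op_eq A X clT)
      finally show "norm (inner (\<eta> n) (tensor_op X T (\<eta> n))) <= norm X * norm (id_tensor_op T (\<eta> n))" by simp
    qed
  qed
  have spn: "?P Z" if "Z \<in> span {tensor_op X T | X T. X \<in> A & T \<in> J}" for Z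
    using that
  proof (induction Z rule: span_induct_alt)
    case base
    then show ?case by simp
  next
    case (step r x y)
    then have "?P x" using gen by blast
    from tendsto_add[OF tendsto_mult_left[OF this, of r] step(2)]
    show ?case by (simp add: blinfun.add_left blinfun.scaleR_left inner_add_right)
  qed
  show ?thesis
  proof (rule tendstoI)
    fix e :: real assume e: "e > 0"
    then have "e / 2 > 0" by simp
    then obtain Z' where Z': "Z' \<in> span {tensor_op X T | X T. X \<in> A & T \<in> J}" "dist Z' Z < e / 2"
      using Z unfolding min_tensor_def closure_approachable by blast
    have "\<forall>\<^sub>F n in free_uf. dist (inner (\<eta> n) (Z' (\<eta> n))) 0 < e / 2"
      using e by (intro tendstoD[OF spn[OF Z'(1)]]) simp
    then show "\<forall>\<^sub>F n in free_uf. dist (inner (\<eta> n) (Z (\<eta> n))) 0 < e"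
    proof (rule eventually_mono)
      fix n assume n: "dist (inner (\<eta> n) (Z' (\<eta> n))) 0 < e / 2"
      have "\<bar>inner (\<eta> n) ((Z - Z') (\<eta> n))\<bar> <= norm (\<eta> n) * norm ((Z - Z') (\<eta> n))" by (rule Cauchy_Schwarz_ineq2)
      also have "... <= 1 * (norm (Z - Z') * 1)"
        by (intro mult_mono n\<eta> order_trans[OF norm_blinfun]) auto
      finally have "\<bar>inner (\<eta> n) ((Z - Z') (\<eta> n))\<bar> <= norm (Z - Z')" by simp
      also have "... < e / 2" using Z'(2) by (simp add: dist_norm norm_minus_commute)
      finally have "\<bar>inner (\<eta> n) (Z (\<eta> n)) - inner (\<eta> n) (Z' (\<eta> n))\<bar> < e / 2" by (simp add: blinfun.diff_left inner_diff_right)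
      then show "dist (inner (\<eta> n) (Z (\<eta> n))) 0 < e" using n unfolding dist_real_def by linarith
    qed
  qed
qed

text \<open>Since R is nonnegative, X = R + \<epsilon> p is bounded below by \<epsilon> p, so X / M
  = p - h with \<open>norm h < 1\<close> is the square of some p + y in A \<otimes> C. Lifting y
  gives w with T + \<epsilon> - M w' w in the kernel of Q, where w' is the adjoint of w. On the test
  vectors this element is at most - \<delta> + \<epsilon>, whereas exactness makes its values tend
  to 0.\<close>

lemma exact_band_sum_contradiction:
  fixes \<beta> :: "nat => 'g::{group_add,countable} => 'g => real" and c :: "nat => 'g => real"
  assumes exact: "exact_group TYPE('u + nat set) TYPE('g)"
    and \<beta>: "!!n s t. \<bar>\<beta> n s t\<bar> <= 1" and sym: "!!n s t. \<beta> n s t = \<beta> n t s"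
    and F: "finite F" "!!f. f \<in> F ==> - f \<in> F"
    and pos: "!!v :: ('g \<times> ('u + nat set)) ell2. 0 <= inner v (band_sum (band_limit \<beta>) F v)"
    and S: "!!n. finite (S n)" and c: "!!n. (\<Sum>s\<in>S n. (c n s)\<^sup>2) <= 1" and \<delta>: "\<delta> > 0"
    and \<eta>: "!!n. \<eta> n = diagonal_vec (c n) (S n) (%s. ket (seq_index (n, s) :: 'u + nat set))"
    and neg: "!!n. inner (\<eta> n) (band_sum (band_op \<beta>) F (\<eta> n)) <= - \<delta>"
  shows False
proof -
  let ?U = "transfer_op :: (nat => 'g) => nat => ('u + nat set) op" and ?D = "block :: (nat => 'g) => ('u + nat set) set"
  define A where "A = (reduced_group_cstar_algebra :: 'g op set)"
  define B where "B = symbol_algebra ?U ?D"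
  define q where "q = symbol ?U ?D"
  define C where "C = q ` B"
  note fam = transfer_op_family[where 'g = 'g and 'u = 'u]
  have A: "concrete_cstar_algebra A" unfolding A_def by (rule reduced_group_cstar)
  have B: "concrete_cstar_algebra B" unfolding B_def by (rule symbol_algebra_cstar[OF fam])
  have q0: "star_hom B UNIV q" unfolding B_def q_def by (rule symbol_star_hom[OF fam])
  have rel: "limit_rel ?U ?D T (q T)" if "T \<in> B" for T
    using symbol_algebraD[OF fam, of T] that unfolding B_def q_def symbol_pair_def by blast
  have C: "concrete_cstar_algebra C" and q: "star_hom B C q"
    unfolding C_def using star_hom_image_cstar[OF B q0 limit_rel_D(2)[OF rel]] by blast+
  have "EX Q. star_hom (min_tensor A B) (min_tensor A C) Q & (\<forall>S\<in>A. \<forall>T\<in>B. Q (tensor_op S T) = tensor_op S (q T)) &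
      Q ` min_tensor A B = min_tensor A C & {R \<in> min_tensor A B. Q R = 0} = min_tensor A {T \<in> B. q T = 0}"
    by (intro exact[unfolded exact_group_def exact_cstar_algebra_def, rule_format, folded A_def] conjI B C q) (simp add: C_def)
  then obtain Q where Q: "star_hom (min_tensor A B) (min_tensor A C) Q"
    and Qt0: "\<forall>S\<in>A. \<forall>T\<in>B. Q (tensor_op S T) = tensor_op S (q T)"
    and onto: "Q ` min_tensor A B = min_tensor A C"
    and ker: "{R \<in> min_tensor A B. Q R = 0} = min_tensor A {T \<in> B. q T = 0}"
    by (elim exE conjE) (rule that)
  note Qt = Qt0[rule_format]
  have AB: "concrete_cstar_algebra (min_tensor A B)" by (rule min_tensor_cstar[OF A B C q])
  have "star_hom C C (%T. T)" by (simp add: star_hom_def)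
  then have AC: "concrete_cstar_algebra (min_tensor A C)" by (rule min_tensor_cstar[OF A C C])
  have gen: "tensor_op X T \<in> min_tensor A B" if "X \<in> A" "T \<in> B" for X T
    unfolding min_tensor_def using that by (intro subsetD[OF closure_subset] span_base) blast
  have pairB: "T \<in> B" "q T = T'" if "symbol_pair ?U ?D T T'" for T T'
    using that symbol_eq[OF fam] unfolding B_def q_def symbol_algebra_def symbol_pair_def by blast+
  let ?P = "coord_proj (\<Union>\<sigma>. ?D \<sigma>)"
  note idB = pairB[OF symbol_pair_id[OF fam]]
  have bandB: "band_op \<beta> f \<in> B" "q (band_op \<beta> f) = band_limit \<beta> f" for f
    using pairB[OF band_symbol_pair(1)[where \<beta> = \<beta>, OF \<beta> sym]] by blast+
  have idA: "id_blinfun \<in> A" unfolding A_def left_regular_0[symmetric] by (rule left_regular_in)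
  have lrA: "left_regular f \<in> A" for f unfolding A_def by (rule left_regular_in)
  have cli: "clinear (id_blinfun :: 'x op)" by (simp add: clinear_def)

  define T where "T = (band_sum (band_op \<beta>) F :: ('g \<times> ('u + nat set)) op)"
  define R where "R = (band_sum (band_limit \<beta>) F :: ('g \<times> ('u + nat set)) op)"
  define e where "e = (tensor_op id_blinfun id_blinfun :: ('g \<times> ('u + nat set)) op)"
  define p where "p = (tensor_op id_blinfun ?P :: ('g \<times> ('u + nat set)) op)"
  have e_id: "e = id_blinfun" unfolding e_def by (rule tensor_eqI) (simp add: tensor_op_tensor_vec cli)
  have p_proj: "p = coord_proj (UNIV \<times> (\<Union>\<sigma>. ?D \<sigma>))"
    unfolding p_def by (simp add: tensor_id_eq coord_proj_clinear id_tensor_coord_proj)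
  have TAB: "T \<in> min_tensor A B" unfolding T_def band_sum_def by (intro cstar_sum[OF AB] gen lrA bandB)
  have eAB: "e \<in> min_tensor A B" unfolding e_def by (intro gen idA idB)
  have QT: "Q T = R"
    unfolding T_def R_def band_sum_def by (subst star_hom_sum[OF AB Q]) (simp_all add: gen lrA bandB Qt)
  have Qe: "Q e = p" unfolding e_def p_def by (simp add: Qt idA idB)
  have pAC: "p \<in> min_tensor A C" using star_hom_in[OF Q eAB] Qe by simp
  have RAC: "R \<in> min_tensor A C" using star_hom_in[OF Q TAB] QT by simp
  have Tsa: "is_adjoint T T"
  proof -
    have "is_adjoint (\<Sum>f\<in>F. tensor_op (left_regular (- f)) (band_op \<beta> (- f))) T"
      unfolding T_def band_sum_def
      by (intro is_adjoint_sum tensor_op_adjoint left_regular_clinear left_regular_adjoint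
          band_op_clinear[OF \<beta>] band_symbol_pair(2)[where \<beta> = \<beta>, OF \<beta> sym])
    moreover have "(\<Sum>f\<in>F. tensor_op (left_regular (- f)) (band_op \<beta> (- f))) = T"
      unfolding T_def band_sum_def by (rule sum.reindex_bij_witness[of _ uminus uminus]) (use F in auto)
    ultimately show ?thesis by simp
  qed
  have Rsa: "is_adjoint R R" using star_hom_adjoint[OF Q TAB TAB Tsa] QT by simp
  have psa: "is_adjoint p p" unfolding p_proj by (rule coord_proj_adjoint)
  have pp: "p o\<^sub>L p = p" unfolding p_proj by (simp add: coord_proj_compose)
  have pQ: "p o\<^sub>L Q X = Q X" "Q X o\<^sub>L p = Q X" if "X \<in> min_tensor A B" for X
  proof -
    have "e o\<^sub>L X = X" "X o\<^sub>L e = X" by (simp_all add: e_id op_compose_id)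
    then show "p o\<^sub>L Q X = Q X" "Q X o\<^sub>L p = Q X"
      using star_hom_compose[OF Q eAB that] star_hom_compose[OF Q that eAB] by (simp_all add: Qe)
  qed

  \<comment> \<open>Half of \<delta> is spent here, so that - \<delta> / 2 remains at the
    end.\<close>
  define \<epsilon> where "\<epsilon> = \<delta> / 2"
  have \<epsilon>: "\<epsilon> > 0" using \<delta> by (simp add: \<epsilon>_def)
  define X where "X = R + \<epsilon> *\<^sub>R p"
  \<comment> \<open>M exceeds \<open>norm X\<close> and \<epsilon>: the first gives X^2 <= M X, the
    second puts 1 - \<epsilon> / M strictly between 0 and 1.\<close>
  define M where "M = norm X + \<epsilon> + 1"
  have M: "M > 0" "norm X <= M" "\<epsilon> < M" using \<epsilon> norm_ge_zero[of X] unfolding M_def by linarith+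
  have XAC: "X \<in> min_tensor A C" unfolding X_def by (intro cstar_add[OF AC] cstar_scaleR[OF AC] RAC pAC)
  have Xsa: "is_adjoint X X" unfolding X_def by (intro is_adjoint_add is_adjoint_scaleR Rsa psa)
  have pX: "p (X v) = X v" for v
  proof -
    have "p o\<^sub>L X = X" unfolding X_def using pQ(1)[OF TAB] by (simp add: op_compose_simps pp QT)
    then show ?thesis by (metis blinfun_apply_blinfun_compose)
  qed
  have inner_p: "inner v (p v) = (norm (p v))\<^sup>2" for v
    using inner_coord_proj[of _ v v] is_adjoint_inner[OF psa, of v v] unfolding p_proj by (simp add: power2_norm_eq_inner)
  have Xlow: "inner v (X v) >= \<epsilon> * (norm (p v))\<^sup>2" for v
    using pos[of v] unfolding X_def R_def[symmetric] by (simp add: blinfun.add_left blinfun.scaleR_left inner_add_right inner_p)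
  have "positive_op X" unfolding positive_op_def using Xsa Xlow \<epsilon> by (meson mult_nonneg_nonneg less_imp_le order_trans zero_le_power2)
  note Xup = positive_op_norm_sq_le[OF this M(2,1)]
  define h where "h = p - (1 / M) *\<^sub>R X"
  have hAC: "h \<in> min_tensor A C" unfolding h_def by (intro cstar_diff[OF AC] cstar_scaleR[OF AC] pAC XAC)
  have hsa: "is_adjoint h h" unfolding h_def by (intro is_adjoint_diff is_adjoint_scaleR psa Xsa)
  have "norm h <= sqrt (1 - \<epsilon> / M)"
  proof (rule norm_blinfun_bound)
    fix v
    have "inner (p v) (X v) = inner v (X v)" using is_adjoint_inner[OF psa, of v "X v"] pX by simp
    moreover have "(norm (x - c *\<^sub>R y))\<^sup>2 = (norm x)\<^sup>2 - 2 * c * inner x y + c\<^sup>2 * (norm y)\<^sup>2" for x y :: "('g \<times> ('u + nat set)) ell2" and c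
      unfolding power2_norm_eq_inner by (simp add: inner_diff_left inner_diff_right inner_commute power2_eq_square algebra_simps)
    ultimately have "(norm (h v))\<^sup>2 = (norm (p v))\<^sup>2 - 2 / M * inner v (X v) + (norm (X v))\<^sup>2 / M\<^sup>2"
      by (simp add: h_def blinfun.diff_left blinfun.scaleR_left power_divide)
    also have "... <= (norm (p v))\<^sup>2 - 2 / M * inner v (X v) + (M * inner v (X v)) / M\<^sup>2"
      by (intro add_left_mono divide_right_mono Xup) simp
    also have "... = (norm (p v))\<^sup>2 - inner v (X v) / M" using M(1) by (simp add: power2_eq_square field_simps)
    also have "... <= (norm (p v))\<^sup>2 - \<epsilon> * (norm (p v))\<^sup>2 / M"
      using M(1) Xlow[of v] by (intro diff_left_mono divide_right_mono) auto
    also have "... = (1 - \<epsilon> / M) * (norm (p v))\<^sup>2" by (simp add: left_diff_distrib)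
    also have "... <= (1 - \<epsilon> / M) * (norm v)\<^sup>2"
      using M unfolding p_proj by (intro mult_left_mono power_mono norm_coord_proj_apply) auto
    finally have "norm (h v) <= sqrt ((1 - \<epsilon> / M) * (norm v)\<^sup>2)" by (rule real_le_rsqrt)
    then show "norm (h v) <= sqrt (1 - \<epsilon> / M) * norm v" by (simp add: real_sqrt_mult)
  qed (use M in simp)
  also have "... < 1" using M \<epsilon> by simp
  finally have nh: "norm h < 1" .
  obtain y where y: "y \<in> min_tensor A C" "is_adjoint y y" "2 *\<^sub>R y + (y o\<^sub>L y) = - h"
    by (rule cstar_sqrt[OF AC hAC hsa nh])
  obtain y' where y': "y' \<in> min_tensor A B" "Q y' = y" using y(1) onto by (metis imageE)
  obtain y'' where y'': "y'' \<in> min_tensor A B" "is_adjoint y'' y'" using cstar_adjoint[OF AB y'(1)] by blast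
  \<comment> \<open>y is self-adjoint, so the adjoint of a lift of y is again a lift of y.\<close>
  have Qy'': "Q y'' = y" using is_adjoint_unique[OF star_hom_adjoint[OF Q y''(1) y'(1) y''(2)]] y(2) y'(2) by blast
  define w where "w = e + y'"
  define w' where "w' = e + y''"
  have wAB: "w \<in> min_tensor A B" "w' \<in> min_tensor A B" unfolding w_def w'_def by (intro cstar_add[OF AB] eAB y' y'')+
  have adjw: "is_adjoint w' w" unfolding w_def w'_def e_id by (intro is_adjoint_add y'') (simp add: is_adjoint_def)
  define z where "z = (T + \<epsilon> *\<^sub>R e) - M *\<^sub>R (w' o\<^sub>L w)"
  have zAB: "z \<in> min_tensor A B"
    unfolding z_def by (intro cstar_diff[OF AB] cstar_add[OF AB] cstar_scaleR[OF AB] cstar_compose[OF AB] TAB eAB wAB)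
  have "Q z = 0"
  proof -
    have 1: "Q (T + \<epsilon> *\<^sub>R e) = X"
      unfolding X_def by (simp add: star_hom_add[OF Q] star_hom_scaleR[OF Q] cstar_scaleR[OF AB] TAB eAB QT Qe)
    have Qw: "Q w = p + y" "Q w' = p + y"
      unfolding w_def w'_def by (simp_all add: star_hom_add[OF Q] eAB y' y'' Qe Qy'')
    have "Q (w' o\<^sub>L w) = (p + y) o\<^sub>L (p + y)" by (simp add: star_hom_compose[OF Q] wAB Qw)
    also have "... = p + (2 *\<^sub>R y + (y o\<^sub>L y))"
      using pQ[OF y'(1)] unfolding y'(2) by (simp add: op_compose_simps pp scaleR_2)
    also have "... = (1 / M) *\<^sub>R X" unfolding y(3) h_def by simp
    finally have 2: "Q (M *\<^sub>R (w' o\<^sub>L w)) = X"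
      using M(1) by (simp add: star_hom_scaleR[OF Q] cstar_compose[OF AB] wAB)
    show ?thesis
      unfolding z_def
      by (subst star_hom_diff[OF AB Q]) (simp_all add: 1 2 cstar_add[OF AB] cstar_scaleR[OF AB] cstar_compose[OF AB] TAB eAB wAB)
  qed
  then have zJ: "z \<in> min_tensor A {T \<in> B. q T = 0}" using zAB ker by blast
  have lim: "((%n. inner (\<eta> n) (z (\<eta> n))) ---> 0) free_uf"
  proof (rule kernel_tensor_limit[OF _ _ S c \<eta> zJ])
    show "clinear Y" if "Y \<in> A" for Y by (rule cstar_clinear[OF A that])
    show "limit_rel ?U ?D Y 0" if "Y \<in> {T \<in> B. q T = 0}" for Y using rel[of Y] that by simp
  qed
  have "inner (\<eta> n) (z (\<eta> n)) <= - \<epsilon>" for n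
  proof -
    have "(norm (\<eta> n))\<^sup>2 <= 1" unfolding \<eta> norm_diagonal_vec[OF S] using c[of n] by simp
    then have 1: "\<epsilon> * inner (\<eta> n) (\<eta> n) <= \<epsilon>" using \<epsilon> by (simp add: power2_norm_eq_inner)
    have 2: "inner (\<eta> n) (w' (w (\<eta> n))) >= 0"
      using is_adjoint_inner[OF adjw, of "\<eta> n" "w (\<eta> n)"] by (metis inner_ge_zero)
    have "inner (\<eta> n) (z (\<eta> n)) = inner (\<eta> n) (T (\<eta> n)) + \<epsilon> * inner (\<eta> n) (\<eta> n) - M * inner (\<eta> n) (w' (w (\<eta> n)))"
      by (simp add: z_def e_id blinfun.diff_left blinfun.add_left blinfun.scaleR_left inner_add_right inner_diff_right)
    also have "... <= - \<delta> + \<epsilon> - 0"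
      using 1 2 neg[of n] M(1) unfolding T_def by (intro diff_mono add_mono) auto
    finally show ?thesis by (simp add: \<epsilon>_def)
  qed
  then have "0 <= - \<epsilon>" by (intro tendsto_upperbound[OF lim]) auto
  then show False using \<epsilon> by simp
qed

text \<open>Here r is the square root of the row sums of \<bar>a\<bar>, as in the Schur test.
  Dividing by r bounds all entries by 1, so that matrices of growing size fit into bounded band
  operators, and the squares of r sum to the l1 norm of a, so that r provides bounded test
  vectors.\<close>

lemma band_normalization:
  fixes a :: "'g::group_add => 'g => real"
  assumes S: "finite S" and supp: "!!s t. a s t ~= 0 ==> s \<in> S & t \<in> S" and sym: "!!s t. a s t = a t s"
  obtains r \<beta> where "!!s t. a s t = \<beta> s t * (r s * r t)" "!!s t. \<bar>\<beta> s t\<bar> <= 1" "!!s t. \<beta> s t = \<beta> t s"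
    "!!s t. \<beta> s t ~= 0 ==> a s t ~= 0 & r s ~= 0 & r t ~= 0" "(\<Sum>s\<in>S. (r s)\<^sup>2) = (\<Sum>s\<in>S. \<Sum>t\<in>S. \<bar>a s t\<bar>)"
proof -
  define d where "d s = (\<Sum>t\<in>S. \<bar>a s t\<bar>)" for s
  have d: "d s >= 0" for s by (simp add: d_def sum_nonneg)
  have le: "\<bar>a s t\<bar> <= d s" for s t
  proof (cases "a s t = 0")
    case False
    then show ?thesis unfolding d_def using S supp by (intro member_le_sum) auto
  qed (simp add: d)
  have le': "\<bar>a s t\<bar> <= sqrt (d s) * sqrt (d t)" for s t
  proof -
    have "\<bar>a s t\<bar> * \<bar>a s t\<bar> <= d s * d t" using le[of s t] le[of t s] sym[of s t] d by (intro mult_mono) auto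
    then show ?thesis unfolding real_sqrt_mult[symmetric] by (intro real_le_rsqrt) (simp add: power2_eq_square)
  qed
  define r where "r s = sqrt (d s)" for s
  define \<beta> where "\<beta> s t = a s t / (r s * r t)" for s t
  have r0: "r s >= 0" for s by (simp add: r_def d)
  show ?thesis
  proof (rule that[of \<beta> r])
    \<comment> \<open>Where r s or r t vanishes, a s t = 0 by \<open>le'\<close>, so the default
      value of the division is correct.\<close>
    show "a s t = \<beta> s t * (r s * r t)" for s t using le'[of s t] by (auto simp: \<beta>_def r_def)
    show "\<bar>\<beta> s t\<bar> <= 1" for s t
    proof (cases "r s * r t = 0")
      case False
      then have "r s * r t > 0" using r0[of s] r0[of t] by (simp add: less_le)
      then show ?thesis using le'[of s t] by (simp add: \<beta>_def r_def[symmetric])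
    qed (auto simp: \<beta>_def)
    show "\<beta> s t = \<beta> t s" for s t by (simp add: \<beta>_def sym[of s t] mult.commute)
    show "a s t ~= 0 & r s ~= 0 & r t ~= 0" if "\<beta> s t ~= 0" for s t using that by (auto simp: \<beta>_def)
    show "(\<Sum>s\<in>S. (r s)\<^sup>2) = (\<Sum>s\<in>S. \<Sum>t\<in>S. \<bar>a s t\<bar>)" by (simp add: r_def d) (simp add: d_def)
  qed
qed

lemma exact_imp_property_A:
  assumes exact: "exact_group TYPE('u + nat set) TYPE('g::{group_add,countable})"
  shows "property_A TYPE('g)"
proof (rule property_A_pos_kernels, rule ccontr)
  fix F0 :: "'g set" and \<delta> :: real assume F0: "finite F0" and \<delta>: "\<delta> > 0"
    and no: "\<nexists>E. finite E & (ALL S. finite S --> (\<exists>k\<in>pos_kernels S E. \<forall>s\<in>S. \<forall>t\<in>S. - s + t \<in> F0 --> \<bar>k s t - 1\<bar> <= \<delta>))"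
  \<comment> \<open>Symmetrised, so that the separating matrices can be symmetric and the assembled
    operator self-adjoint.\<close>
  define F where "F = F0 \<union> uminus ` F0"
  have F: "finite F" "!!f. f \<in> F ==> - f \<in> F" using F0 by (auto simp: F_def)
  \<comment> \<open>An exhaustion of the group: since no finite width works, each \<open>E n\<close>
    comes with a bad finite set \<open>S n\<close>.\<close>
  define E where "E n = (from_nat ` {..n} :: 'g set)" for n
  have finE: "finite (E n)" for n by (simp add: E_def)
  have E: "\<forall>\<^sub>F n in sequentially. g \<in> E n" for g
    unfolding E_def eventually_sequentially by (intro exI[of _ "to_nat g"]) (auto intro!: image_eqI[of _ _ "to_nat g"])
  have "EX S. finite S & (\<forall>k\<in>pos_kernels S (E n). \<exists>s\<in>S. \<exists>t\<in>S. - s + t \<in> F & \<bar>k s t - 1\<bar> > \<delta>)" for n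
  proof -
    obtain S where "finite S" "\<not> (\<exists>k\<in>pos_kernels S (E n). \<forall>s\<in>S. \<forall>t\<in>S. - s + t \<in> F0 --> \<bar>k s t - 1\<bar> <= \<delta>)"
      using no finE[of n] by blast
    then show ?thesis unfolding F_def by (intro exI[of _ S]) (simp add: not_le, blast)
  qed
  then obtain S where S: "!!n. finite (S n)"
    "!!n k. k \<in> pos_kernels (S n) (E n) ==> \<exists>s\<in>S n. \<exists>t\<in>S n. - s + t \<in> F & \<bar>k s t - 1\<bar> > \<delta>" by metis
  define good where "good n a r \<beta> \<longleftrightarrow> (ALL s t. a s t ~= 0 --> s \<in> S n & t \<in> S n & - s + t \<in> F) & (\<Sum>s\<in>S n. \<Sum>t\<in>S n. a s t) <= - \<delta> &
      (\<forall>k\<in>pos_kernels (S n) (E n). (\<Sum>s\<in>S n. \<Sum>t\<in>S n. a s t * k s t) >= 0) & (ALL s t. a s t = \<beta> s t * (r s * r t)) &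
      (ALL s t. \<bar>\<beta> s t\<bar> <= 1) & (ALL s t. \<beta> s t = \<beta> t s) & (ALL s t. \<beta> s t ~= 0 --> a s t ~= 0 & r s ~= 0 & r t ~= 0) &
      (\<Sum>s\<in>S n. (r s)\<^sup>2) <= 1" for n a r \<beta>
  have "\<exists>a r \<beta>. good n a r \<beta>" for n
  proof (rule kernel_separation[OF S(1)[of n] F(2) \<delta> S(2)[of _ n]])
    fix a :: "'g => 'g => real"
    assume a: "!!s t. a s t ~= 0 ==> s \<in> S n & t \<in> S n & - s + t \<in> F" "!!s t. a s t = a t s"
      "(\<Sum>s\<in>S n. \<Sum>t\<in>S n. \<bar>a s t\<bar>) <= 1"
      "!!k. k \<in> pos_kernels (S n) (E n) ==> (\<Sum>s\<in>S n. \<Sum>t\<in>S n. a s t * k s t) >= 0" "(\<Sum>s\<in>S n. \<Sum>t\<in>S n. a s t) <= - \<delta>"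
    have sup: "s \<in> S n & t \<in> S n" if "a s t ~= 0" for s t using a(1)[OF that] by blast
    show ?thesis
    proof (rule band_normalization[OF S(1)[of n] sup a(2)])
      fix r \<beta> assume b: "!!s t. a s t = \<beta> s t * (r s * r t)" "!!s t. \<bar>\<beta> s t\<bar> <= 1" "!!s t. \<beta> s t = \<beta> t s"
        "!!s t. \<beta> s t ~= 0 ==> a s t ~= 0 & r s ~= 0 & r t ~= 0" "(\<Sum>s\<in>S n. (r s)\<^sup>2) = (\<Sum>s\<in>S n. \<Sum>t\<in>S n. \<bar>a s t\<bar>)"
      have c: "ALL s t. a s t ~= 0 --> s \<in> S n & t \<in> S n & - s + t \<in> F" "\<forall>k\<in>pos_kernels (S n) (E n). (\<Sum>s\<in>S n. \<Sum>t\<in>S n. a s t * k s t) >= 0"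
        using a(1,4) by blast+
      have d: "ALL s t. a s t = \<beta> s t * (r s * r t)" "ALL s t. \<bar>\<beta> s t\<bar> <= 1" "ALL s t. \<beta> s t = \<beta> t s"
        "ALL s t. \<beta> s t ~= 0 --> a s t ~= 0 & r s ~= 0 & r t ~= 0"
        by (intro allI b(1), intro allI b(2), intro allI b(3), intro allI impI b(4))
      have "(\<Sum>s\<in>S n. (r s)\<^sup>2) <= 1" using a(3) b(5) by simp
      then show ?thesis unfolding good_def by (intro exI[of _ a] exI[of _ r] exI[of _ \<beta>] conjI c d a(5))
    qed
  qed
  then obtain a r \<beta> where good: "!!n. good n (a n) (r n) (\<beta> n)" by metis
  have a: "(\<Sum>s\<in>S n. \<Sum>t\<in>S n. a n s t) <= - \<delta>" "k \<in> pos_kernels (S n) (E n) ==> (\<Sum>s\<in>S n. \<Sum>t\<in>S n. a n s t * k s t) >= 0"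
    "a n s t = \<beta> n s t * (r n s * r n t)" and \<beta>: "\<bar>\<beta> n s t\<bar> <= 1" "\<beta> n s t = \<beta> n t s"
    "\<beta> n s t ~= 0 ==> s \<in> S n & t \<in> S n & - s + t \<in> F & r n s ~= 0 & r n t ~= 0" and r: "(\<Sum>s\<in>S n. (r n s)\<^sup>2) <= 1" for n s t k
    using good[of n] unfolding good_def by blast+
  have pos: "0 <= inner \<phi> (band_sum (band_op \<beta>) F \<phi>)" if "seq_supported n (E n) \<phi>" for n and \<phi> :: "('g \<times> ('u + nat set)) ell2"
    by (rule inner_band_sum_nonneg[where a = a and \<beta> = \<beta> and r = "r n", OF \<beta>(1) \<beta>(3) S(1) F(1) finE a(3) a(2) that])
  have R: "0 <= inner v (band_sum (band_limit \<beta>) F v)" for v :: "('g \<times> ('u + nat set)) ell2"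
    by (rule band_limit_sum_nonneg[where \<beta> = \<beta>, OF \<beta>(1) pos E])
  define \<eta> where "\<eta> n = diagonal_vec (r n) (S n) (%s. ket (seq_index (n, s) :: 'u + nat set))" for n
  have \<eta>a: "ell2_apply (\<eta> n) (g, seq_index (n, s)) = (if s \<in> S n & g = - s then of_real (r n s) else 0)" for n g s
  proof -
    have "ell2_apply (\<eta> n) (g, seq_index (n, s)) = (\<Sum>t\<in>S n. if t = s then (if g = - s then of_real (r n s) else 0) else 0)"
      unfolding \<eta>_def diagonal_vec_def ell2_apply_sum
      by (rule sum.cong[OF refl]) (auto simp: ell2_apply_scaleR tensor_vec_apply ket.rep_eq inj_eq[OF inj_seq_index])
    then show ?thesis using S(1)[of n] by simp
  qed
  have supp: "seq_supported n (uminus ` S n) (\<eta> n)" for n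
    unfolding seq_supported_def
  proof (intro allI impI)
    fix g x assume nz: "ell2_apply (\<eta> n) (g, x) ~= 0"
    have "\<exists>s\<in>S n. r n s * (ell2_apply (tensor_vec (ket (- s)) (ket (seq_index (n, s)))) (g, x)) ~= 0"
    proof (rule ccontr)
      assume "\<not> ?thesis"
      then have "ell2_apply (\<eta> n) (g, x) = 0"
        unfolding \<eta>_def diagonal_vec_def ell2_apply_sum by (intro sum.neutral) (auto simp: ell2_apply_scaleR)
      then show False using nz by simp
    qed
    then show "g \<in> uminus ` S n & x \<in> range (%s :: 'g. seq_index (n, s))"
      by (auto simp: tensor_vec_apply ket.rep_eq split: if_splits)
  qed
  have neg: "inner (\<eta> n) (band_sum (band_op \<beta>) F (\<eta> n)) <= - \<delta>" for n
  proof -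
    have fin: "finite (sum_set (S n) (uminus ` S n))" using S(1) by (intro finite_sum_set) auto
    have "inner (\<eta> n) (band_sum (band_op \<beta>) F (\<eta> n)) = (\<Sum>p\<in>sum_set (S n) (uminus ` S n). \<Sum>s\<in>S n. \<Sum>t\<in>S n. \<beta> n s t *
        Re (cnj (ell2_apply (\<eta> n) (- s + p, seq_index (n, s))) * ell2_apply (\<eta> n) (- t + p, seq_index (n, t))))"
      using \<beta>(3) S(1) by (intro inner_band_sum[where \<beta> = \<beta>, OF \<beta>(1) _ _ F(1) _ supp]) auto
    also have "... = (\<Sum>p\<in>sum_set (S n) (uminus ` S n). if p = 0 then (\<Sum>s\<in>S n. \<Sum>t\<in>S n. a n s t) else 0)"
    proof (rule sum.cong[OF refl])
      fix p
      have "- s + p = - s \<longleftrightarrow> p = 0" for s :: 'g using add_left_cancel[of "- s" p 0] by simp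
      then show "(\<Sum>s\<in>S n. \<Sum>t\<in>S n. \<beta> n s t * Re (cnj (ell2_apply (\<eta> n) (- s + p, seq_index (n, s))) * ell2_apply (\<eta> n) (- t + p, seq_index (n, t))))
          = (if p = 0 then (\<Sum>s\<in>S n. \<Sum>t\<in>S n. a n s t) else 0)"
        by (auto simp: \<eta>a a(3) intro!: sum.cong)
    qed
    also have "... = (\<Sum>s\<in>S n. \<Sum>t\<in>S n. a n s t)"
    proof -
      have "0 \<in> sum_set (S n) (uminus ` S n)" if "S n ~= {}"
      proof -
        obtain s where "s \<in> S n" using \<open>S n ~= {}\<close> by blast
        then show ?thesis unfolding sum_set_def by (intro image_eqI[of _ _ "(s, - s)"]) auto
      qed
      then show ?thesis using fin by (cases "S n = {}") auto
    qed
    finally show ?thesis using a(1)[of n] by simp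
  qed
  show False
    by (rule exact_band_sum_contradiction[where \<beta> = \<beta> and c = r and \<eta> = \<eta>, OF exact \<beta>(1,2) F R S(1) r \<delta> \<eta>_def neg])
qed

theorem mainTheorem3:
  shows "(exact_group TYPE('u + nat set) TYPE('g::{group_add, countable}) \<longleftrightarrow>
            johnson_class_trivial TYPE('g)) \<and>
         (johnson_class_trivial TYPE('g) \<longleftrightarrow>
            l1_geometric_vanishing TYPE('g) TYPE('e::banach) \<and>
            l1_geometric_vanishing TYPE('g) TYPE('g N0 \<Rightarrow>\<^sub>L real))"
proof -
  have "exact_group TYPE('u + nat set) TYPE('g) \<longleftrightarrow> property_A TYPE('g)"
    using exact_imp_property_A property_A_imp_exact by blast
  moreover have "\<exists>f :: nat \<Rightarrow> 'g V. amenable_seq f" if "property_A TYPE('g)"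
    by (rule property_A_imp_amenable_seq[OF that]) blast
  moreover have "\<exists>f :: nat \<Rightarrow> 'g V. amenable_seq f" if "johnson_class_trivial TYPE('g)"
    by (rule johnson_trivial_imp_amenable_seq[OF that]) blast
  \<comment> \<open>Once the sequence exists, vanishing holds over an arbitrary Banach space; its
    instance at the dual of \<open>N0\<close> closes the circle through the Johnson class.\<close>
  moreover have "property_A TYPE('g) \<and> l1_geometric_vanishing TYPE('g) TYPE('e) \<and>
      l1_geometric_vanishing TYPE('g) TYPE('g N0 \<Rightarrow>\<^sub>L real)" if "\<exists>f :: nat \<Rightarrow> 'g V. amenable_seq f"
    using that by (elim exE) (intro conjI amenable_seq_imp_property_A amenable_seq_vanishing)
  moreover note vanishing_imp_johnson_trivial[where 'g = 'g]
  ultimately show ?thesis by argo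
qed

end
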